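(* Let $F$ be a field with a (surjective) discrete valuation $v:F^\times\to\mathbb Z$ and residue field $k$. Suppose that there exists some $n\ge 1$ such that $U_n\subset U_1^2$. Then the homomorphism $$S_v:\overline{\mathcal{RP}}_1(F)[\tfrac12]\to \mathrm{Ind}^F_k\,\overline{\mathcal{RP}}_1(k)[\tfrac12]$$ induces an isomorphism $$\mathcal I_F\,\overline{\mathcal{RP}}_1(F)[\tfrac12]\;\cong\;\mathcal I_F\left(\mathrm{Ind}^F_k\,\overline{\mathcal{RP}}_1(k)[\tfrac12]\right).$$
   Context: For an abelian group $A$, $A[\frac12]=A\otimes\mathbb Z[\frac12]$. For a field $F$, $R_F=\mathbb Z[F^\times/(F^\times)^2]$; $\langle x\rangle\in R_F$ is the square class of $x\in F^\times$; $\langle\!\langle x\rangle\!\rangle=\langle x\rangle-1$; $\mathcal I_F\subset R_F$ is the augmentation ideal. Refined scissors congruence groups. If $F$ has at least $4$ elements, $\mathcal{RP}(F)$ is the $R_F$-module with generators $[x]$, $x\in F^\times$, and relations $[1]=0$ and, for all $x,y\in F^\times\setminus\{1\}$, $$0=[x]-[y]+\langle x\rangle\left[\tfrac yx\right]-\langle x^{-1}-1\rangle\left[\tfrac{1-x^{-1}}{1-y^{-1}}\right]+\langle 1-x\rangle\left[\tfrac{1-x}{1-y}\right].$$ $\lambda_1:\mathcal{RP}(F)\to\mathcal I_F^2$ is the (well-defined) $R_F$-homomorphism with $[x]\mapsto\langle\!\langle 1-x\rangle\!\rangle\langle\!\langle x\rangle\!\rangle$ for $x\neq1$. Put $\psi_1(x)=[x]+\langle-1\rangle[x^{-1}]$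 and let $\mathcal K^{(1)}_F$ be the $R_F$-submodule generated by all $\psi_1(x)$, $x\in F^\times$. The element $C_F=[x]+\langle-1\rangle[1-x]+\langle\!\langle1-x\rangle\!\rangle\psi_1(x)$ ($x\ne0,1$) is independent of $x$ and $6C_F=0$. Small fields: $\mathcal{RP}(\mathbb F_2)$ is a group of order $3$ with distinguished generator $C_{\mathbb F_2}$ (with $[1]=0$, $\lambda_1=0$, $\mathcal K^{(1)}_{\mathbb F_2}=0$). $\mathcal{RP}(\mathbb F_3)$ is the cyclic $R_{\mathbb F_3}$-module generated by $[-1]$ with the single relation $2([-1]+\langle-1\rangle[-1])=0$ (and $[1]=0$), $\lambda_1([-1])=\langle\!\langle-1\rangle\!\rangle^2$, $C_{\mathbb F_3}=\psi_1(-1)=(1+\langle-1\rangle)[-1]$. For every field $F$: $D_F=2C_F$, and $\mathcal D_F=R_F D_F$ (annihilated by $3$). $\widetilde{\mathcal{RP}}(F)=\mathcal{RP}(F)/\mathcal K^{(1)}_F$; $\widetilde{\mathcal{RP}}_1(F)$ is the kernel of the map $\widetilde{\mathcal{RP}}(F)\to\mathcal I_F^2/(1+\langle-1\rangle)\mathcal I_F$ induced by $\lambda_1$. The map $\mathcal D_F\to\widetilde{\mathcal{RP}}(F)$ is injective with image in $\widetilde{\mathcal{RP}}_1(F)$, and one sets $\overline{\mathcal{RP}}(F)=\widetilde{\mathcal{RP}}(F)/\mathcal D_F$, $\overline{\mathcal{RP}}_1(F)=\widetilde{\mathcal{RP}}_1(F)/\mathcal D_F$. Valuations. $U=\{x\in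 F^\times: v(x)=0\}$ and for $n\ge1$, $U_n=\{x\in F^\times: v(x)=0,\ v(1-x)\ge n\}$; $U_1^2=\{u^2:u\in U_1\}$. Reduction $U\to k^\times$, $a\mapsto\bar a$, makes any $R_k$-module $M$ a $\mathbb Z[U/U^2]$-module, and $\mathrm{Ind}^F_kM=R_F\otimes_{\mathbb Z[U/U^2]}M$. There is a well-defined $R_F$-homomorphism $S_v:\overline{\mathcal{RP}}(F)\to\mathrm{Ind}^F_k\overline{\mathcal{RP}}(k)$ with $S_v([a])=1\otimes[\bar a]$ if $v(a)=0$ and $S_v([a])=0$ if $v(a)\neq0$; after inverting $2$ it restricts to a map $\overline{\mathcal{RP}}_1(F)[\frac12]\to\mathrm{Ind}^F_k\overline{\mathcal{RP}}_1(k)[\frac12]$, also denoted $S_v$. *)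

theory Defs
  imports "HOL-Algebra.Algebra"
begin

section \<open>Modules\<close>

text \<open>The library record for modules extends the record for rings; the multiplicative fields
  are not used by modules and are left undefined.\<close>

abbreviation mk_module ::
    "'x set \<Rightarrow> ('x \<Rightarrow> 'x \<Rightarrow> 'x) \<Rightarrow> 'x \<Rightarrow> ('r \<Rightarrow> 'x \<Rightarrow> 'x) \<Rightarrow> ('r, 'x) module"
  where "mk_module A pl z sm \<equiv>
    \<lparr>carrier = A, monoid.mult = undefined, one = undefined, ring.zero = z, ring.add = pl, smult = sm\<rparr>"

text \<open>Homomorphisms are extensional (they are \<open>undefined\<close> off the carrier), so that
  a homomorphism is determined by its values on generators and definite descriptions make sense.\<close>

definition mod_hom ::
    "('r, 'k) ring_scheme \<Rightarrow> ('r, 'x, 'm) module_scheme \<Rightarrow> ('r, 'y, 'n) module_scheme \<Rightarrow> ('x \<Rightarrow> 'y) set"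
  where "mod_hom R M N = {h \<in> carrier M \<rightarrow>\<^sub>E carrier N.
      (\<forall>x\<in>carrier M. \<forall>y\<in>carrier M. h (x \<oplus>\<^bsub>M\<^esub> y) = h x \<oplus>\<^bsub>N\<^esub> h y) \<and>
      (\<forall>r\<in>carrier R. \<forall>x\<in>carrier M. h (r \<odot>\<^bsub>M\<^esub> x) = r \<odot>\<^bsub>N\<^esub> h x)}"

definition mod_iso ::
    "('r, 'k) ring_scheme \<Rightarrow> ('r, 'x, 'm) module_scheme \<Rightarrow> ('r, 'y, 'n) module_scheme \<Rightarrow> ('x \<Rightarrow> 'y) set"
  where "mod_iso R M N = {h \<in> mod_hom R M N. bij_betw h (carrier M) (carrier N)}"

definition submod_gen ::
    "('r, 'k) ring_scheme \<Rightarrow> ('r, 'x, 'm) module_scheme \<Rightarrow> 'x set \<Rightarrow> 'x set"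
  where "submod_gen R M S = \<Inter>{H. submodule H R M \<and> S \<subseteq> H}"

definition ideal_smult ::
    "('r, 'k) ring_scheme \<Rightarrow> 'r set \<Rightarrow> ('r, 'x) module \<Rightarrow> ('r, 'x) module"
  where "ideal_smult R I M =
    M\<lparr>carrier := submod_gen R M {a \<odot>\<^bsub>M\<^esub> m | a m. a \<in> I \<and> m \<in> carrier M}\<rparr>"

definition quotient_module :: "('r, 'x, 'm) module_scheme \<Rightarrow> 'x set \<Rightarrow> ('r, 'x set) module"
  where "quotient_module M N = mk_module (a_rcosets\<^bsub>M\<^esub> N) (set_add M) N
    (\<lambda>r T. \<Union>x\<in>T. N +>\<^bsub>M\<^esub> (r \<odot>\<^bsub>M\<^esub> x))"

definition regular_module :: "('r, 'k) ring_scheme \<Rightarrow> ('r, 'r) module"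
  where "regular_module R =
    mk_module (carrier R) (\<lambda>x y. x \<oplus>\<^bsub>R\<^esub> y) \<zero>\<^bsub>R\<^esub> (\<lambda>x y. x \<otimes>\<^bsub>R\<^esub> y)"

definition restrict_scalars ::
    "('s \<Rightarrow> 'r) \<Rightarrow> ('r, 'x, 'm) module_scheme \<Rightarrow> ('s, 'x) module"
  where "restrict_scalars \<phi> M =
    mk_module (carrier M) (\<lambda>x y. x \<oplus>\<^bsub>M\<^esub> y) \<zero>\<^bsub>M\<^esub> (\<lambda>s x. \<phi> s \<odot>\<^bsub>M\<^esub> x)"

definition free_module :: "('r, 'k) ring_scheme \<Rightarrow> 'b set \<Rightarrow> ('r, 'b \<Rightarrow> 'r) module"
  where "free_module R B = mk_module
    {f \<in> B \<rightarrow>\<^sub>E carrier R. finite {b \<in> B. f b \<noteq> \<zero>\<^bsub>R\<^esub>}}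
    (\<lambda>f g. \<lambda>b\<in>B. f b \<oplus>\<^bsub>R\<^esub> g b) (\<lambda>b\<in>B. \<zero>\<^bsub>R\<^esub>) (\<lambda>r f. \<lambda>b\<in>B. r \<otimes>\<^bsub>R\<^esub> f b)"

definition free_basis :: "('r, 'k) ring_scheme \<Rightarrow> 'b set \<Rightarrow> 'b \<Rightarrow> ('b \<Rightarrow> 'r)"
  where "free_basis R B b = (\<lambda>c\<in>B. if c = b then \<one>\<^bsub>R\<^esub> else \<zero>\<^bsub>R\<^esub>)"


section \<open>Tensor products\<close>

text \<open>
  Let \<open>T\<close> be a module over a ring \<open>S\<close> with a commuting right action \<open>\<rho>\<close> of a ring \<open>R\<close>,
  and let \<open>Y\<close> be an \<open>R\<close>-module.  The tensor product over \<open>R\<close> is the free abelian group on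
  pairs modulo the usual relations; \<open>S\<close> acts through the left factor.\<close>

definition pair_module ::
    "('s, 'x, 'm) module_scheme \<Rightarrow> ('r, 'y, 'n) module_scheme \<Rightarrow> ('s, ('x \<times> 'y) \<Rightarrow>\<^sub>0 int) module"
  where "pair_module T Y = mk_module {c. Poly_Mapping.keys c \<subseteq> carrier T \<times> carrier Y} (+) 0
    (\<lambda>s. frag_extend (\<lambda>(x, y). frag_of (s \<odot>\<^bsub>T\<^esub> x, y)))"

definition tensor_rels ::
    "('r, 'k) ring_scheme \<Rightarrow> ('s, 'x, 'm) module_scheme \<Rightarrow> ('x \<Rightarrow> 'r \<Rightarrow> 'x) \<Rightarrow>
     ('r, 'y, 'n) module_scheme \<Rightarrow> (('x \<times> 'y) \<Rightarrow>\<^sub>0 int) set"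
  where "tensor_rels R T \<rho> Y =
     {frag_of (x \<oplus>\<^bsub>T\<^esub> x', y) - frag_of (x, y) - frag_of (x', y) | x x' y.
        x \<in> carrier T \<and> x' \<in> carrier T \<and> y \<in> carrier Y}
   \<union> {frag_of (x, y \<oplus>\<^bsub>Y\<^esub> y') - frag_of (x, y) - frag_of (x, y') | x y y'.
        x \<in> carrier T \<and> y \<in> carrier Y \<and> y' \<in> carrier Y}
   \<union> {frag_of (\<rho> x r, y) - frag_of (x, r \<odot>\<^bsub>Y\<^esub> y) | x r y.
        x \<in> carrier T \<and> r \<in> carrier R \<and> y \<in> carrier Y}"

definition tensor_sub ::
    "('r, 'k) ring_scheme \<Rightarrow> ('s, 'x, 'm) module_scheme \<Rightarrow> ('x \<Rightarrow> 'r \<Rightarrow> 'x) \<Rightarrow>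
     ('r, 'y, 'n) module_scheme \<Rightarrow> (('x \<times> 'y) \<Rightarrow>\<^sub>0 int) set"
  where "tensor_sub R T \<rho> Y = generate (add_monoid (pair_module T Y)) (tensor_rels R T \<rho> Y)"

definition tensor ::
    "('r, 'k) ring_scheme \<Rightarrow> ('s, 'x, 'm) module_scheme \<Rightarrow> ('x \<Rightarrow> 'r \<Rightarrow> 'x) \<Rightarrow>
     ('r, 'y, 'n) module_scheme \<Rightarrow> ('s, (('x \<times> 'y) \<Rightarrow>\<^sub>0 int) set) module"
  where "tensor R T \<rho> Y = quotient_module (pair_module T Y) (tensor_sub R T \<rho> Y)"

definition pure_tensor ::
    "('r, 'k) ring_scheme \<Rightarrow> ('s, 'x, 'm) module_scheme \<Rightarrow> ('x \<Rightarrow> 'r \<Rightarrow> 'x) \<Rightarrow>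
     ('r, 'y, 'n) module_scheme \<Rightarrow> 'x \<Rightarrow> 'y \<Rightarrow> (('x \<times> 'y) \<Rightarrow>\<^sub>0 int) set"
  where "pure_tensor R T \<rho> Y x y = tensor_sub R T \<rho> Y +>\<^bsub>pair_module T Y\<^esub> frag_of (x, y)"


section \<open>Inverting 2\<close>

definition Z_half :: "(int, rat) module"
  where "Z_half = mk_module {q. \<exists>a n. q = of_int a / 2 ^ (n::nat)} (+) 0 (\<lambda>m q. of_int m * q)"

type_synonym 'x half = "(('x \<times> rat) \<Rightarrow>\<^sub>0 int) set"

definition half :: "('s, 'x) module \<Rightarrow> ('s, 'x half) module"
  where "half M = tensor \<Z> M (\<lambda>x n. add_pow M n x) Z_half"

definition half_tensor :: "('s, 'x) module \<Rightarrow> 'x \<Rightarrow> rat \<Rightarrow> 'x half"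
  where "half_tensor M x q = pure_tensor \<Z> M (\<lambda>x n. add_pow M n x) Z_half x q"

definition half_map ::
    "('s, 'k) ring_scheme \<Rightarrow> ('s, 'x) module \<Rightarrow> ('s, 'y) module \<Rightarrow> ('x \<Rightarrow> 'y) \<Rightarrow> 'x half \<Rightarrow> 'y half"
  where "half_map R M N f = (THE g. g \<in> mod_hom R (half M) (half N) \<and>
    (\<forall>x\<in>carrier M. \<forall>q\<in>carrier Z_half. g (half_tensor M x q) = half_tensor N (f x) q))"


section \<open>Group rings and square classes\<close>

definition group_ring :: "('g, 'm) monoid_scheme \<Rightarrow> ('g \<Rightarrow>\<^sub>0 int) ring"
  where "group_ring G =
    \<lparr>carrier = {c. Poly_Mapping.keys c \<subseteq> carrier G},
     monoid.mult = (\<lambda>c d. frag_extend (\<lambda>g. frag_extend (\<lambda>h. frag_of (g \<otimes>\<^bsub>G\<^esub> h)) d) c),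
     one = frag_of \<one>\<^bsub>G\<^esub>, ring.zero = 0, ring.add = (+)\<rparr>"

definition augmentation_ideal :: "('g, 'm) monoid_scheme \<Rightarrow> ('g \<Rightarrow>\<^sub>0 int) set"
  where "augmentation_ideal G =
    {c \<in> carrier (group_ring G). (\<Sum>g\<in>Poly_Mapping.keys c. Poly_Mapping.lookup c g) = 0}"

definition squares :: "('a, 'm) ring_scheme \<Rightarrow> 'a set"
  where "squares F = {x \<otimes>\<^bsub>F\<^esub> x | x. x \<in> carrier (mult_of F)}"

definition sq_class :: "('a, 'm) ring_scheme \<Rightarrow> 'a \<Rightarrow> 'a set"
  where "sq_class F x = squares F #>\<^bsub>mult_of F\<^esub> x"

definition sq_class_group :: "('a, 'm) ring_scheme \<Rightarrow> 'a set monoid"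
  where "sq_class_group F = mult_of F Mod squares F"

type_synonym 'a sqr = "'a set \<Rightarrow>\<^sub>0 int"

text \<open>\<open>RF F\<close>, \<open>IF F\<close>, \<open>sq F x\<close>, \<open>dsq F x\<close> stand for
  \<open>R\<^sub>F\<close>, its augmentation ideal, \<open>\<langle>x\<rangle>\<close> and \<open>\<langle>\<langle>x\<rangle>\<rangle>\<close>.\<close>

definition RF :: "('a, 'm) ring_scheme \<Rightarrow> 'a sqr ring"
  where "RF F = group_ring (sq_class_group F)"

definition IF :: "('a, 'm) ring_scheme \<Rightarrow> 'a sqr set"
  where "IF F = augmentation_ideal (sq_class_group F)"

definition sq :: "('a, 'm) ring_scheme \<Rightarrow> 'a \<Rightarrow> 'a sqr"
  where "sq F x = frag_of (sq_class F x)"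

definition dsq :: "('a, 'm) ring_scheme \<Rightarrow> 'a \<Rightarrow> 'a sqr"
  where "dsq F x = sq F x \<ominus>\<^bsub>RF F\<^esub> \<one>\<^bsub>RF F\<^esub>"

abbreviation m_one :: "('a, 'm) ring_scheme \<Rightarrow> 'a"
  where "m_one F \<equiv> \<ominus>\<^bsub>F\<^esub> \<one>\<^bsub>F\<^esub>"


section \<open>Refined scissors congruence groups\<close>

text \<open>\<open>Sym x\<close> is the generator \<open>[x]\<close>; the extra generator \<open>CGen\<close> is present only for the field
  with two elements, where it is the distinguished generator of order 3.\<close>

datatype 'a rp_gen = Sym 'a | CGen

definition rp_gens :: "('a, 'm) ring_scheme \<Rightarrow> 'a rp_gen set"
  where "rp_gens F =
    Sym ` (carrier F - {\<zero>\<^bsub>F\<^esub>}) \<union> (if card (carrier F) = 2 then {CGen} else {})"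

definition rp_free :: "('a, 'm) ring_scheme \<Rightarrow> ('a sqr, 'a rp_gen \<Rightarrow> 'a sqr) module"
  where "rp_free F = free_module (RF F) (rp_gens F)"

definition rp_basis :: "('a, 'm) ring_scheme \<Rightarrow> 'a rp_gen \<Rightarrow> ('a rp_gen \<Rightarrow> 'a sqr)"
  where "rp_basis F g = free_basis (RF F) (rp_gens F) g"

definition five_term :: "('a, 'm) ring_scheme \<Rightarrow> 'a \<Rightarrow> 'a \<Rightarrow> ('a rp_gen \<Rightarrow> 'a sqr)"
  where "five_term F x y = (let P = rp_free F; e = (\<lambda>z. rp_basis F (Sym z)) in
      e x \<ominus>\<^bsub>P\<^esub> e y
      \<oplus>\<^bsub>P\<^esub> sq F x \<odot>\<^bsub>P\<^esub> e (y \<otimes>\<^bsub>F\<^esub> inv\<^bsub>F\<^esub> x)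
      \<ominus>\<^bsub>P\<^esub> sq F (inv\<^bsub>F\<^esub> x \<ominus>\<^bsub>F\<^esub> \<one>\<^bsub>F\<^esub>) \<odot>\<^bsub>P\<^esub>
          e ((\<one>\<^bsub>F\<^esub> \<ominus>\<^bsub>F\<^esub> inv\<^bsub>F\<^esub> x) \<otimes>\<^bsub>F\<^esub> inv\<^bsub>F\<^esub> (\<one>\<^bsub>F\<^esub> \<ominus>\<^bsub>F\<^esub> inv\<^bsub>F\<^esub> y))
      \<oplus>\<^bsub>P\<^esub> sq F (\<one>\<^bsub>F\<^esub> \<ominus>\<^bsub>F\<^esub> x) \<odot>\<^bsub>P\<^esub>
          e ((\<one>\<^bsub>F\<^esub> \<ominus>\<^bsub>F\<^esub> x) \<otimes>\<^bsub>F\<^esub> inv\<^bsub>F\<^esub> (\<one>\<^bsub>F\<^esub> \<ominus>\<^bsub>F\<^esub> y)))"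

text \<open>\<open>card\<close> of an infinite set is 0, so the last case below is that of fields with at least
  4 elements, finite or infinite.\<close>

definition rp_rels :: "('a, 'm) ring_scheme \<Rightarrow> ('a rp_gen \<Rightarrow> 'a sqr) set"
  where "rp_rels F = {rp_basis F (Sym \<one>\<^bsub>F\<^esub>)} \<union>
    (if card (carrier F) = 2 then {add_pow (rp_free F) (3::nat) (rp_basis F CGen)}
     else if card (carrier F) = 3 then
       {add_pow (rp_free F) (2::nat) (rp_basis F (Sym (m_one F))
          \<oplus>\<^bsub>rp_free F\<^esub> sq F (m_one F) \<odot>\<^bsub>rp_free F\<^esub> rp_basis F (Sym (m_one F)))}
     else {five_term F x y | x y. x \<in> carrier F - {\<zero>\<^bsub>F\<^esub>, \<one>\<^bsub>F\<^esub>} \<and> y \<in> carrier F - {\<zero>\<^bsub>F\<^esub>, \<one>\<^bsub>F\<^esub>}})"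

definition rp_sub :: "('a, 'm) ring_scheme \<Rightarrow> ('a rp_gen \<Rightarrow> 'a sqr) set"
  where "rp_sub F = submod_gen (RF F) (rp_free F) (rp_rels F)"

type_synonym 'a rp = "('a rp_gen \<Rightarrow> 'a sqr) set"

definition RP :: "('a, 'm) ring_scheme \<Rightarrow> ('a sqr, 'a rp) module"
  where "RP F = quotient_module (rp_free F) (rp_sub F)"

definition rp_class :: "('a, 'm) ring_scheme \<Rightarrow> 'a rp_gen \<Rightarrow> 'a rp"
  where "rp_class F g = rp_sub F +>\<^bsub>rp_free F\<^esub> rp_basis F g"

definition rp_sym :: "('a, 'm) ring_scheme \<Rightarrow> 'a \<Rightarrow> 'a rp"
  where "rp_sym F x = rp_class F (Sym x)"

definition IF2 :: "('a, 'm) ring_scheme \<Rightarrow> ('a sqr, 'a sqr) module"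
  where "IF2 F = (regular_module (RF F))\<lparr>carrier := IF F \<cdot>\<^bsub>RF F\<^esub> IF F\<rparr>"

text \<open>For the field with three elements the formula reads
  \<open>\<lambda>\<^sub>1 [-1] = \<langle>\<langle>-1\<rangle>\<rangle>\<langle>\<langle>-1\<rangle>\<rangle>\<close>, since there \<open>1 - (-1) = -1\<close>.\<close>

definition lambda1 :: "('a, 'm) ring_scheme \<Rightarrow> 'a rp \<Rightarrow> 'a sqr"
  where "lambda1 F = (THE f. f \<in> mod_hom (RF F) (RP F) (IF2 F) \<and>
    (\<forall>x\<in>carrier F - {\<zero>\<^bsub>F\<^esub>, \<one>\<^bsub>F\<^esub>}.
        f (rp_sym F x) = dsq F (\<one>\<^bsub>F\<^esub> \<ominus>\<^bsub>F\<^esub> x) \<otimes>\<^bsub>RF F\<^esub> dsq F x) \<and>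
    (card (carrier F) = 2 \<longrightarrow> f (rp_class F CGen) = \<zero>\<^bsub>RF F\<^esub>))"

definition psi1 :: "('a, 'm) ring_scheme \<Rightarrow> 'a \<Rightarrow> 'a rp"
  where "psi1 F x = rp_sym F x \<oplus>\<^bsub>RP F\<^esub> sq F (m_one F) \<odot>\<^bsub>RP F\<^esub> rp_sym F (inv\<^bsub>F\<^esub> x)"

definition K1 :: "('a, 'm) ring_scheme \<Rightarrow> 'a rp set"
  where "K1 F = submod_gen (RF F) (RP F) (psi1 F ` (carrier F - {\<zero>\<^bsub>F\<^esub>}))"

definition C_elt :: "('a, 'm) ring_scheme \<Rightarrow> 'a rp"
  where "C_elt F =
    (if card (carrier F) = 2 then rp_class F CGen
     else if card (carrier F) = 3 then psi1 F (m_one F)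
     else (THE c. \<forall>x\<in>carrier F - {\<zero>\<^bsub>F\<^esub>, \<one>\<^bsub>F\<^esub>}. c =
       rp_sym F x \<oplus>\<^bsub>RP F\<^esub> sq F (m_one F) \<odot>\<^bsub>RP F\<^esub> rp_sym F (\<one>\<^bsub>F\<^esub> \<ominus>\<^bsub>F\<^esub> x)
       \<oplus>\<^bsub>RP F\<^esub> dsq F (\<one>\<^bsub>F\<^esub> \<ominus>\<^bsub>F\<^esub> x) \<odot>\<^bsub>RP F\<^esub> psi1 F x))"

definition D_elt :: "('a, 'm) ring_scheme \<Rightarrow> 'a rp"
  where "D_elt F = add_pow (RP F) (2::nat) (C_elt F)"

definition D_mod :: "('a, 'm) ring_scheme \<Rightarrow> 'a rp set"
  where "D_mod F = {r \<odot>\<^bsub>RP F\<^esub> D_elt F | r. r \<in> carrier (RF F)}"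

text \<open>In names, \<open>t\<close> refers to the quotient by \<open>K1\<close> (tilde) and \<open>b\<close> to the further quotient by
  \<open>D_mod\<close> (bar).\<close>

definition RPt :: "('a, 'm) ring_scheme \<Rightarrow> ('a sqr, 'a rp set) module"
  where "RPt F = quotient_module (RP F) (K1 F)"

definition to_RPt :: "('a, 'm) ring_scheme \<Rightarrow> 'a rp \<Rightarrow> 'a rp set"
  where "to_RPt F T = K1 F +>\<^bsub>RP F\<^esub> T"

definition lambda1_sub :: "('a, 'm) ring_scheme \<Rightarrow> 'a sqr set"
  where "lambda1_sub F = {(\<one>\<^bsub>RF F\<^esub> \<oplus>\<^bsub>RF F\<^esub> sq F (m_one F)) \<otimes>\<^bsub>RF F\<^esub> a | a. a \<in> IF F}"

definition lambda1t :: "('a, 'm) ring_scheme \<Rightarrow> 'a rp set \<Rightarrow> 'a sqr set"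
  where "lambda1t F = (THE f.
    f \<in> mod_hom (RF F) (RPt F) (quotient_module (IF2 F) (lambda1_sub F)) \<and>
    (\<forall>T\<in>carrier (RP F). f (to_RPt F T) = lambda1_sub F +>\<^bsub>IF2 F\<^esub> lambda1 F T))"

definition RPt1 :: "('a, 'm) ring_scheme \<Rightarrow> ('a sqr, 'a rp set) module"
  where "RPt1 F = (RPt F)\<lparr>carrier :=
    {T \<in> carrier (RPt F). lambda1t F T = \<zero>\<^bsub>quotient_module (IF2 F) (lambda1_sub F)\<^esub>}\<rparr>"

definition Dt_mod :: "('a, 'm) ring_scheme \<Rightarrow> 'a rp set set"
  where "Dt_mod F = to_RPt F ` D_mod F"

type_synonym 'a rpb = "'a rp set set"

definition RPb :: "('a, 'm) ring_scheme \<Rightarrow> ('a sqr, 'a rpb) module"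
  where "RPb F = quotient_module (RPt F) (Dt_mod F)"

text \<open>The carrier of \<open>RPb1 F\<close> is a subset of that of \<open>RPb F\<close>, since a coset depends only on
  the addition.\<close>

definition RPb1 :: "('a, 'm) ring_scheme \<Rightarrow> ('a sqr, 'a rpb) module"
  where "RPb1 F = quotient_module (RPt1 F) (Dt_mod F)"

definition symb :: "('a, 'm) ring_scheme \<Rightarrow> 'a \<Rightarrow> 'a rpb"
  where "symb F x = Dt_mod F +>\<^bsub>RPt F\<^esub> to_RPt F (rp_sym F x)"


section \<open>Discrete valuations\<close>

text \<open>The value of \<open>v\<close> at 0 is irrelevant; conditions such as \<open>v x \<ge> n\<close> are read with
  \<open>v 0 = \<infinity>\<close>.\<close>

definition discrete_valuation :: "('a, 'm) ring_scheme \<Rightarrow> ('a \<Rightarrow> int) \<Rightarrow> bool"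
  where "discrete_valuation F v \<longleftrightarrow>
    v ` (carrier F - {\<zero>\<^bsub>F\<^esub>}) = UNIV \<and>
    (\<forall>x\<in>carrier F - {\<zero>\<^bsub>F\<^esub>}. \<forall>y\<in>carrier F - {\<zero>\<^bsub>F\<^esub>}.
       v (x \<otimes>\<^bsub>F\<^esub> y) = v x + v y \<and>
       (x \<oplus>\<^bsub>F\<^esub> y \<noteq> \<zero>\<^bsub>F\<^esub> \<longrightarrow> min (v x) (v y) \<le> v (x \<oplus>\<^bsub>F\<^esub> y)))"

definition val_ring :: "('a, 'm) ring_scheme \<Rightarrow> ('a \<Rightarrow> int) \<Rightarrow> ('a, 'm) ring_scheme"
  where "val_ring F v = F\<lparr>carrier := {x \<in> carrier F. x = \<zero>\<^bsub>F\<^esub> \<or> 0 \<le> v x}\<rparr>"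

definition val_max_ideal :: "('a, 'm) ring_scheme \<Rightarrow> ('a \<Rightarrow> int) \<Rightarrow> 'a set"
  where "val_max_ideal F v = {x \<in> carrier F. x = \<zero>\<^bsub>F\<^esub> \<or> 0 < v x}"

definition residue_field :: "('a, 'm) ring_scheme \<Rightarrow> ('a \<Rightarrow> int) \<Rightarrow> 'a set ring"
  where "residue_field F v = val_ring F v Quot val_max_ideal F v"

definition red :: "('a, 'm) ring_scheme \<Rightarrow> ('a \<Rightarrow> int) \<Rightarrow> 'a \<Rightarrow> 'a set"
  where "red F v a = val_max_ideal F v +>\<^bsub>val_ring F v\<^esub> a"

definition val_units :: "('a, 'm) ring_scheme \<Rightarrow> ('a \<Rightarrow> int) \<Rightarrow> 'a set"
  where "val_units F v = {x \<in> carrier F - {\<zero>\<^bsub>F\<^esub>}. v x = 0}"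

definition higher_units :: "('a, 'm) ring_scheme \<Rightarrow> ('a \<Rightarrow> int) \<Rightarrow> nat \<Rightarrow> 'a set"
  where "higher_units F v n =
    {x \<in> val_units F v. \<one>\<^bsub>F\<^esub> \<ominus>\<^bsub>F\<^esub> x = \<zero>\<^bsub>F\<^esub> \<or> int n \<le> v (\<one>\<^bsub>F\<^esub> \<ominus>\<^bsub>F\<^esub> x)}"

definition unit_sq_group :: "('a, 'm) ring_scheme \<Rightarrow> ('a \<Rightarrow> int) \<Rightarrow> 'a set monoid"
  where "unit_sq_group F v =
    (mult_of F)\<lparr>carrier := val_units F v\<rparr> Mod {u \<otimes>\<^bsub>F\<^esub> u | u. u \<in> val_units F v}"

text \<open>The ring homomorphisms from \<open>\<int>[U/U\<^sup>2]\<close> to \<open>R\<^sub>F\<close> and \<open>R\<^sub>k\<close> induced by the inclusion and by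
  reduction.  The square class of \<open>u\<close> (or of its reduction) is the same for all \<open>u\<close> in a coset
  \<open>T\<close> of \<open>U\<^sup>2\<close>, so that each union is a single square class.\<close>

definition unit_sq_incl :: "('a, 'm) ring_scheme \<Rightarrow> ('a \<Rightarrow> int) \<Rightarrow> 'a sqr \<Rightarrow> 'a sqr"
  where "unit_sq_incl F v = frag_extend (\<lambda>T. frag_of (\<Union>u\<in>T. sq_class F u))"

definition unit_sq_red :: "('a, 'm) ring_scheme \<Rightarrow> ('a \<Rightarrow> int) \<Rightarrow> 'a sqr \<Rightarrow> 'a set sqr"
  where "unit_sq_red F v =
    frag_extend (\<lambda>T. frag_of (\<Union>u\<in>T. sq_class (residue_field F v) (red F v u)))"

type_synonym ('a, 'x) ind = "(('a sqr \<times> 'x) \<Rightarrow>\<^sub>0 int) set"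

definition Ind ::
    "('a, 'm) ring_scheme \<Rightarrow> ('a \<Rightarrow> int) \<Rightarrow> ('a set sqr, 'x) module \<Rightarrow> ('a sqr, ('a, 'x) ind) module"
  where "Ind F v M = tensor (group_ring (unit_sq_group F v))
    (regular_module (RF F)) (\<lambda>s r. s \<otimes>\<^bsub>RF F\<^esub> unit_sq_incl F v r)
    (restrict_scalars (unit_sq_red F v) M)"

definition ind_tensor ::
    "('a, 'm) ring_scheme \<Rightarrow> ('a \<Rightarrow> int) \<Rightarrow> ('a set sqr, 'x) module \<Rightarrow> 'a sqr \<Rightarrow> 'x \<Rightarrow> ('a, 'x) ind"
  where "ind_tensor F v M s m = pure_tensor (group_ring (unit_sq_group F v))
    (regular_module (RF F)) (\<lambda>s r. s \<otimes>\<^bsub>RF F\<^esub> unit_sq_incl F v r)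
    (restrict_scalars (unit_sq_red F v) M) s m"

definition ind_map ::
    "('a, 'm) ring_scheme \<Rightarrow> ('a \<Rightarrow> int) \<Rightarrow> ('a set sqr, 'x) module \<Rightarrow> ('a set sqr, 'y) module \<Rightarrow>
     ('x \<Rightarrow> 'y) \<Rightarrow> ('a, 'x) ind \<Rightarrow> ('a, 'y) ind"
  where "ind_map F v M N f = (THE g. g \<in> mod_hom (RF F) (Ind F v M) (Ind F v N) \<and>
    (\<forall>s\<in>carrier (RF F). \<forall>m\<in>carrier M. g (ind_tensor F v M s m) = ind_tensor F v N s (f m)))"


section \<open>The specialization homomorphism\<close>

definition S_map :: "('a, 'm) ring_scheme \<Rightarrow> ('a \<Rightarrow> int) \<Rightarrow> 'a rpb \<Rightarrow> ('a, 'a set rpb) ind"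
  where "S_map F v = (let k = residue_field F v in
    (THE f. f \<in> mod_hom (RF F) (RPb F) (Ind F v (RPb k)) \<and>
      (\<forall>a\<in>carrier F - {\<zero>\<^bsub>F\<^esub>}. f (symb F a) =
         (if v a = 0 then ind_tensor F v (RPb k) \<one>\<^bsub>RF F\<^esub> (symb k (red F v a))
          else \<zero>\<^bsub>Ind F v (RPb k)\<^esub>))))"

text \<open>The restriction of \<open>S_map[1/2]\<close> to \<open>RPb1 F[1/2]\<close>: the homomorphism which makes the square
  with the maps induced by the inclusions of \<open>RPb1\<close> in \<open>RPb\<close> (for \<open>F\<close> and for \<open>k\<close>) commute.
  These induced maps are injective, because \<open>\<int>[1/2]\<close> is flat over \<open>\<int>\<close> and \<open>R\<^sub>F\<close> is free over
  \<open>\<int>[U/U\<^sup>2]\<close>.\<close>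

definition S1_map ::
    "('a, 'm) ring_scheme \<Rightarrow> ('a \<Rightarrow> int) \<Rightarrow> 'a rpb half \<Rightarrow> ('a, 'a set rpb) ind half"
  where "S1_map F v = (let k = residue_field F v in
    (THE g. g \<in> mod_hom (RF F) (half (RPb1 F)) (half (Ind F v (RPb1 k))) \<and>
      (\<forall>z\<in>carrier (half (RPb1 F)).
         half_map (RF F) (Ind F v (RPb1 k)) (Ind F v (RPb k))
             (ind_map F v (RPb1 k) (RPb k) (\<lambda>x. x)) (g z) =
         half_map (RF F) (RPb F) (Ind F v (RPb k)) (S_map F v)
             (half_map (RF F) (RPb1 F) (RPb F) (\<lambda>x. x) z))))"

end

theory Submission
  imports Defs
begin

text \<open>After inverting 2, a module over the group ring of the square classes is detected by its
 quotients on which every square class acts by a sign \<open>\<chi>\<close>.  On \<open>RPb1\<close> the class of \<open>-1\<close> acts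
 trivially, and for an even nontrivial \<open>\<chi>\<close> the five term relation forces the symbols \<open>[a]\<close> with
 \<open>v a \<noteq> 0\<close> to vanish and makes \<open>[a]\<close> depend only on the residue of \<open>a\<close>; if \<open>\<chi>\<close> is nontrivial on
 \<open>U_1\<close>, then the hypothesis gives it a conductor, and all symbols vanish.  Hence
 \<open>\<langle>\<langle>g\<rangle>\<rangle>[a]\<close> is a function of the residue of \<open>a\<close>, which defines for every \<open>g\<close> a map in the
 opposite direction that is inverse to the specialization up to \<open>2\<langle>\<langle>g\<rangle>\<rangle>\<close>.\<close>

\<comment> \<open>The symbols \<open>[a]\<close> generate \<open>RPb\<close> but need not lie in
  \<open>RPb1\<close>, which is known only as a kernel. The operator \<open>1 + <-1>\<close> bridges
  this gap: it maps \<open>RPb\<close> into \<open>RPb1\<close>, and up to 2-primary torsion it acts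
  on \<open>RPb1\<close> as 2. The second fact is where the condition on \<open>lambda1\<close> is
  used: it makes z - <-1>z torsion for z in \<open>RPb1\<close>. So every map on
  \<open>RPb1[1/2]\<close> is described on symbols at the cost of factors 2. The obstruction to an
  isomorphism without the augmentation ideal is the trivial character. The vanishing arguments start
  from an element whose character is -1, so they say nothing when there is none; a factor
  \<open><<g>>\<close> removes every character with value 1 at g, in particular the trivial one. F
  is infinite, but the residue field may have two or three elements, where the five term relation is
  not imposed. The consequences of it that the character arguments use are therefore isolated in a
  locale and checked separately for these fields.\<close>
syntax "_index" :: "logic \<Rightarrow> index" ("\<^sub>_" [1000] 1000)

notation ring.add (infixl "+.\<index>" 65) and monoid.mult (infixl "*.\<index>" 70)
  and a_minus ("_ -.\<index> _" [65, 66] 65) and a_inv ("-.\<index> _" [81] 80)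

section \<open>Additive maps, submodules and quotients\<close>

text \<open>Plain additivity without extensionality, so that lambda abstractions compose directly;
  \<open>mod_hom_restrictI\<close> turns such a map into a homomorphism once it is known to be
  linear.\<close>

definition add_map :: "('x, 'm) ring_scheme => ('y, 'n) ring_scheme => ('x => 'y) => bool"
 where "add_map M N f \<longleftrightarrow> (\<forall>x\<in>carrier M. f x \<in> carrier N) \<and>
  (\<forall>x\<in>carrier M. \<forall>y\<in>carrier M. f (x +.\<^sub>M y) = f x +.\<^sub>N f y)"

lemma add_mapI:
 assumes "!!x. x \<in> carrier M ==> f x \<in> carrier N"
  and "!!x y. x \<in> carrier M ==> y \<in> carrier M ==> f (x +.\<^sub>M y) = f x +.\<^sub>N f y"
 shows "add_map M N f" using assms by (simp add: add_map_def)

lemma add_map_closed: "add_map M N f ==> x \<in> carrier M ==> f x \<in> carrier N" by (simp add: add_map_def)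

lemma add_map_add: "add_map M N f ==> x \<in> carrier M ==> y \<in> carrier M ==> f (x +.\<^sub>M y) = f x +.\<^sub>N f y" by (simp add: add_map_def)

lemma add_map_hom:
 assumes "abelian_group M" "abelian_group N" "add_map M N f"
 shows "abelian_group_hom M N f" using assms by (intro abelian_group_homI)
   (auto simp: group_hom_def group_hom_axioms_def hom_def add_map_def abelian_group.a_group)

lemma add_map_zero:
 assumes "abelian_group M" "abelian_group N" "add_map M N f"
 shows "f \<zero>\<^sub>M = \<zero>\<^sub>N" using abelian_group_hom.hom_zero[OF add_map_hom[OF assms]] .

lemma add_map_neg:
 assumes "abelian_group M" "abelian_group N" "add_map M N f" "x \<in> carrier M"
 shows "f (-.\<^sub>M x) = -.\<^sub>N f x" using abelian_group_hom.hom_a_inv[OF add_map_hom[OF assms(1-3)]] assms(4) .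

lemma add_map_minus:
 assumes "abelian_group M" "abelian_group N" "add_map M N f" "x \<in> carrier M" "y \<in> carrier M"
 shows "f (x -.\<^sub>M y) = f x -.\<^sub>N f y" using assms by (simp add: a_minus_def add_map_add add_map_neg abelian_group.a_inv_closed)

lemma add_map_comp: "add_map M N f ==> add_map N P g ==> add_map M P (\<lambda>x. g (f x))" by (simp add: add_map_def)

lemma add_map_plus:
 assumes "abelian_group N" "add_map M N f" "add_map M N g"
 shows "add_map M N (\<lambda>x. f x +.\<^sub>N g x)"
proof -
 interpret N: abelian_group N by fact
 show ?thesis using assms(2,3) by (intro add_mapI) (auto simp: add_map_def N.a_ac)
qed

lemma add_map_smult: "module R M ==> r \<in> carrier R ==> add_map M M (\<lambda>x. r \<odot>\<^sub>M x)"
 by (simp add: add_map_def module.smult_closed module.smult_r_distr)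

lemma module_abelian_group: "module R M ==> abelian_group M" by (simp add: module_def)

lemma mod_homI:
 assumes "f \<in> extensional (carrier M)" "add_map M N f"
  and "!!r x. r \<in> carrier R ==> x \<in> carrier M ==> f (r \<odot>\<^sub>M x) = r \<odot>\<^sub>N f x"
 shows "f \<in> mod_hom R M N" using assms by (auto simp: mod_hom_def add_map_def PiE_def)

lemma mod_hom_restrictI:
 assumes "module R M" "add_map M N f"
  and "!!r x. r \<in> carrier R ==> x \<in> carrier M ==> f (r \<odot>\<^sub>M x) = r \<odot>\<^sub>N f x"
 shows "restrict f (carrier M) \<in> mod_hom R M N"
proof -
 interpret module R M by fact
 show ?thesis using assms(2,3) by (intro mod_homI) (auto simp: add_map_def)
qed

lemma mod_hom_add_map: "f \<in> mod_hom R M N ==> add_map M N f" by (auto simp: mod_hom_def add_map_def)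

lemmas mod_hom_closed = add_map_closed[OF mod_hom_add_map]
lemmas mod_hom_add = add_map_add[OF mod_hom_add_map]

lemma mod_hom_smult: "f \<in> mod_hom R M N ==> r \<in> carrier R ==> x \<in> carrier M ==> f (r \<odot>\<^sub>M x) = r \<odot>\<^sub>N f x"
 by (auto simp: mod_hom_def)

lemma mod_hom_eqI:
 assumes "f \<in> mod_hom R M N" "g \<in> mod_hom R M N" "!!x. x \<in> carrier M ==> f x = g x"
 shows "f = g" using assms by (intro extensionalityI[of _ "carrier M"]) (auto simp: mod_hom_def PiE_def)

lemma mod_hom_comp:
 assumes "module R M" "f \<in> mod_hom R M N" "g \<in> mod_hom R N P"
 shows "restrict (\<lambda>x. g (f x)) (carrier M) \<in> mod_hom R M P" using assms by (intro mod_hom_restrictI add_map_comp[of M N f P g])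
   (auto simp: mod_hom_add_map mod_hom_smult mod_hom_closed)

lemma submod_gen_incl: "S \<subseteq> submod_gen R M S" by (auto simp: submod_gen_def)

lemma submod_gen_least: "submodule H R M ==> S \<subseteq> H ==> submod_gen R M S \<subseteq> H" by (auto simp: submod_gen_def)

lemma submodule_submod_gen:
 assumes "module R M" "S \<subseteq> carrier M"
 shows "submodule (submod_gen R M S) R M"
proof -
 interpret module R M by fact
 have c: "carrier M \<in> {H. submodule H R M \<and> S \<subseteq> H}" using carrier_is_submodule assms(2) by auto
 show ?thesis
 proof (rule submoduleI)
  show "submod_gen R M S \<subseteq> carrier M" using c by (auto simp: submod_gen_def)
 next
  show "\<zero>\<^sub>M \<in> submod_gen R M S" by (auto simp: submod_gen_def submodule_def dest: subgroup.one_closed)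
 qed (auto simp: submod_gen_def dest: submoduleE)
qed

lemma submodule_additive: "submodule H R M ==> additive_subgroup H M" by (simp add: submodule_def additive_subgroup_def)

lemma abelian_subgroup_of: "abelian_group M ==> additive_subgroup H M ==> abelian_subgroup H M" by (rule abelian_subgroupI3)

lemma additive_subgroupI':
 assumes "abelian_group M" "H \<subseteq> carrier M" "\<zero>\<^sub>M \<in> H"
  "!!x y. x \<in> H ==> y \<in> H ==> x +.\<^sub>M y \<in> H" "!!x. x \<in> H ==> -.\<^sub>M x \<in> H"
 shows "additive_subgroup H M" using assms by (auto simp: additive_subgroup_def subgroup_def a_inv_def)

lemma additive_subgroup_kernel:
 assumes "abelian_group M" "abelian_group N" "add_map M N f" "additive_subgroup K N"
 shows "additive_subgroup {x \<in> carrier M. f x \<in> K} M"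
proof -
 interpret M: abelian_group M by fact
 interpret N: abelian_group N by fact
 interpret K: additive_subgroup K N by fact
 show ?thesis using assms by (intro additive_subgroupI')
   (auto simp: add_map_add add_map_neg add_map_zero)
qed

lemma zero_additive_subgroup: "abelian_group N ==> additive_subgroup {\<zero>\<^sub>N} N"
proof -
 assume "abelian_group N"
 then interpret N: abelian_group N .
 show ?thesis by (intro additive_subgroupI') (auto simp: N.abelian_group_axioms)
qed

lemma submodule_preimage:
 assumes "module R M" "module R N" "f \<in> mod_hom R M N" "submodule K R N"
 shows "submodule {x \<in> carrier M. f x \<in> K} R M"
proof -
 interpret M: module R M by fact
 interpret N: module R N by fact
 have A: "additive_subgroup {x \<in> carrier M. f x \<in> K} M" by (rule additive_subgroup_kernel[OF M.abelian_group_axioms N.abelian_group_axioms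
    mod_hom_add_map[OF assms(3)] submodule_additive[OF assms(4)]])
 show ?thesis
 proof (rule M.submoduleI)
  fix r x assume "r \<in> carrier R" "x \<in> {x \<in> carrier M. f x \<in> K}"
  then show "r \<odot>\<^sub>M x \<in> {x \<in> carrier M. f x \<in> K}"
   by (simp add: mod_hom_smult[OF assms(3)] submodule.smult_closed[OF assms(4)])
 next
  fix x assume "x \<in> {x \<in> carrier M. f x \<in> K}"
  then show "-.\<^sub>M x \<in> {x \<in> carrier M. f x \<in> K}" by (rule additive_subgroup.a_inv_closed[OF A])
 next
  fix x y assume "x \<in> {x \<in> carrier M. f x \<in> K}" "y \<in> {x \<in> carrier M. f x \<in> K}"
  then show "x +.\<^sub>M y \<in> {x \<in> carrier M. f x \<in> K}" by (rule additive_subgroup.a_closed[OF A])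
 qed (rule additive_subgroup.a_subset[OF A] additive_subgroup.zero_closed[OF A])+
qed

lemma zero_submodule: "module R N ==> submodule {\<zero>\<^sub>N} R N"
proof -
 assume "module R N"
 then interpret N: module R N .
 show ?thesis by (intro N.submoduleI) auto
qed

lemma submod_gen_induct:
 assumes "module R M" "S \<subseteq> carrier M" "x \<in> submod_gen R M S"
  and "!!x. x \<in> S ==> P x" "P \<zero>\<^sub>M"
  and "!!x y. x \<in> carrier M ==> y \<in> carrier M ==> P x ==> P y ==> P (x +.\<^sub>M y)"
  and "!!r x. r \<in> carrier R ==> x \<in> carrier M ==> P x ==> P (r \<odot>\<^sub>M x)"
 shows "P x"
proof -
 interpret module R M by fact
 \<comment> \<open>The negative of x is (-1)x, so closure under scalars covers it.\<close>
 have neg: "P (-.\<^sub>M x)" if "x \<in> carrier M" "P x" for x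
 proof -
  have "-.\<^sub>M x = (-.\<^sub>R \<one>\<^sub>R) \<odot>\<^sub>M x" using that(1) by (simp add: smult_l_minus)
  then show ?thesis using assms(7)[of "-.\<^sub>R \<one>\<^sub>R" x] that by simp
 qed
 have "submodule {x \<in> carrier M. P x} R M" using assms(5-7) neg by (intro submoduleI) auto
 then have "submod_gen R M S \<subseteq> {x \<in> carrier M. P x}" using assms(2,4) by (intro submod_gen_least) auto
 then show ?thesis using assms(3) by auto
qed

lemma mod_hom_eq_gen:
 assumes "module R M" "module R N" "S \<subseteq> carrier M" "submod_gen R M S = carrier M"
  and "f \<in> mod_hom R M N" "g \<in> mod_hom R M N" "!!x. x \<in> S ==> f x = g x"
 shows "f = g"
proof (rule mod_hom_eqI[OF assms(5,6)])
 fix x assume "x \<in> carrier M"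
 then have "x \<in> submod_gen R M S" using assms(4) by simp
 then show "f x = g x" by (rule submod_gen_induct[OF assms(1,3)])
    (simp_all add: assms mod_hom_add[OF assms(5)] mod_hom_add[OF assms(6)]
     mod_hom_smult[OF assms(5)] mod_hom_smult[OF assms(6)]
     add_map_zero[OF module_abelian_group[OF assms(1)] module_abelian_group[OF assms(2)] mod_hom_add_map[OF assms(5)]]
     add_map_zero[OF module_abelian_group[OF assms(1)] module_abelian_group[OF assms(2)] mod_hom_add_map[OF assms(6)]])
qed

lemma (in abelian_subgroup) a_rcos_eq_iff:
 assumes "x \<in> carrier G" "y \<in> carrier G"
 shows "H +> x = H +> y \<longleftrightarrow> x -. y \<in> H"
proof
 assume "H +> x = H +> y"
 then have "x \<in> H +> y" using a_rcos_self assms by metis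
 then show "x -. y \<in> H" using a_rcos_module_imp assms by (simp add: a_minus_def)
next
 assume "x -. y \<in> H"
 then have "x \<in> H +> y" using a_rcos_module_rev assms by (simp add: a_minus_def)
 then show "H +> x = H +> y" using a_repr_independence' assms by metis
qed

lemma carrier_quotient_module: "carrier (quotient_module M H) = (\<lambda>x. H +>\<^sub>M x) ` carrier M"
 by (auto simp: quotient_module_def A_RCOSETS_def')

lemma zero_quotient_module: "\<zero>\<^sub>(quotient_module M H) = H" by (simp add: quotient_module_def)

lemma add_quotient_module:
 assumes "abelian_group M" "additive_subgroup H M" "x \<in> carrier M" "y \<in> carrier M"
 shows "(H +>\<^sub>M x) +.\<^sub>(quotient_module M H) (H +>\<^sub>M y) = H +>\<^sub>M (x +.\<^sub>M y)"
 using abelian_subgroup.a_rcos_sum[OF abelian_subgroup_of[OF assms(1,2)] assms(3,4)] by (simp add: quotient_module_def)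

lemma abelian_group_quotient_module:
 assumes "abelian_group M" "additive_subgroup H M"
 shows "abelian_group (quotient_module M H)"
proof -
 interpret abelian_subgroup H M by (rule abelian_subgroup_of[OF assms])
 note add = add_quotient_module[OF assms]
 have z: "\<zero>\<^sub>(quotient_module M H) = H +>\<^sub>M \<zero>\<^sub>M" by (simp add: zero_quotient_module a_subset)
 show ?thesis
 proof (rule abelian_groupI)
  fix x assume "x \<in> carrier (quotient_module M H)"
  then obtain a where a: "a \<in> carrier M" "x = H +>\<^sub>M a" by (auto simp: carrier_quotient_module)
  show "\<exists>y\<in>carrier (quotient_module M H). y +.\<^sub>(quotient_module M H) x = \<zero>\<^sub>(quotient_module M H)"
   by (rule bexI[of _ "H +>\<^sub>M (-.\<^sub>M a)"]) (auto simp: a z add l_neg carrier_quotient_module)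
 qed (auto simp: carrier_quotient_module z add a_ac)
qed

lemma proj_add_map:
 assumes "abelian_group M" "additive_subgroup H M"
 shows "add_map M (quotient_module M H) (\<lambda>x. H +>\<^sub>M x)"
 by (rule add_mapI) (auto simp: carrier_quotient_module add_quotient_module[OF assms])

lemma proj_eq_zero_iff:
 assumes "abelian_group M" "additive_subgroup H M" "x \<in> carrier M"
 shows "H +>\<^sub>M x = \<zero>\<^sub>(quotient_module M H) \<longleftrightarrow> x \<in> H"
proof -
 interpret abelian_subgroup H M by (rule abelian_subgroup_of[OF assms(1,2)])
 have "H +>\<^sub>M x = H \<longleftrightarrow> x \<in> H" using assms(3) a_rcos_self a_rcos_const by blast
 then show ?thesis by (simp add: zero_quotient_module)
qed

text \<open>Stated for a single scalar acting additively, because it will be applied to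
  \<open>pair_module\<close>, which is not a module: there (s + t)(x, y) and s(x, y) + t(x, y)
  differ until the tensor relations are imposed.\<close>

lemma smult_quotient_module:
 assumes "abelian_group M" "additive_subgroup H M"
  and "add_map M M (\<lambda>x. r \<odot>\<^sub>M x)" "!!h. h \<in> H ==> r \<odot>\<^sub>M h \<in> H" "x \<in> carrier M"
 shows "r \<odot>\<^sub>(quotient_module M H) (H +>\<^sub>M x) = H +>\<^sub>M (r \<odot>\<^sub>M x)"
proof -
 interpret abelian_subgroup H M by (rule abelian_subgroup_of[OF assms(1,2)])
 have "H +>\<^sub>M (r \<odot>\<^sub>M y) = H +>\<^sub>M (r \<odot>\<^sub>M x)" if "y \<in> H +>\<^sub>M x" for y
 proof -
  have y: "y \<in> carrier M" using that assms(5) a_elemrcos_carrier by blast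
  have "y -.\<^sub>M x \<in> H" using a_rcos_module_imp[OF assms(5) that] by (simp add: a_minus_def)
  then have "r \<odot>\<^sub>M y -.\<^sub>M r \<odot>\<^sub>M x \<in> H"
   using assms(4) add_map_minus[OF assms(1) assms(1) assms(3) y assms(5)] by metis
  then show ?thesis using a_rcos_eq_iff y assms(5) add_map_closed[OF assms(3)] by blast
 qed
 moreover have "x \<in> H +>\<^sub>M x" using a_rcos_self assms(5) by blast
 ultimately have "(\<Union>y\<in>H +>\<^sub>M x. H +>\<^sub>M (r \<odot>\<^sub>M y)) = H +>\<^sub>M (r \<odot>\<^sub>M x)" by blast
 then show ?thesis by (simp add: quotient_module_def)
qed

lemma quotient_lift:
 assumes "abelian_group M" "additive_subgroup H M" "abelian_group W" "add_map M W f"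
  and "!!x. x \<in> H ==> f x = \<zero>\<^sub>W"
 obtains g where "add_map (quotient_module M H) W g" "!!x. x \<in> carrier M ==> g (H +>\<^sub>M x) = f x"
proof
 interpret abelian_subgroup H M by (rule abelian_subgroup_of[OF assms(1,2)])
 interpret W: abelian_group W by fact
 define g where "g = (\<lambda>C. f (SOME x. x \<in> carrier M \<and> H +>\<^sub>M x = C))"
 show g: "g (H +>\<^sub>M x) = f x" if x: "x \<in> carrier M" for x
 proof -
  define y where "y = (SOME y. y \<in> carrier M \<and> H +>\<^sub>M y = H +>\<^sub>M x)"
  have y: "y \<in> carrier M" "H +>\<^sub>M y = H +>\<^sub>M x"
   using someI[of "\<lambda>y. y \<in> carrier M \<and> H +>\<^sub>M y = H +>\<^sub>M x" x] x unfolding y_def by auto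
  then have "y -.\<^sub>M x \<in> H" using a_rcos_eq_iff x by blast
  then have "f y -.\<^sub>W f x = \<zero>\<^sub>W" using assms(5) add_map_minus[OF assms(1,3,4) y(1) x] by metis
  then have "f y = f x" using add_map_closed[OF assms(4)] x y by (metis W.add.inv_solve_right W.l_zero W.zero_closed a_minus_def)
  then show ?thesis by (simp add: g_def y_def)
 qed
 show "add_map (quotient_module M H) W g" by (rule add_mapI)
   (auto simp: carrier_quotient_module add_quotient_module[OF assms(1,2)] g
    add_map_closed[OF assms(4)] add_map_add[OF assms(4)])
qed

lemma smult_quotient_module':
 assumes "module R M" "submodule H R M" "r \<in> carrier R" "x \<in> carrier M"
 shows "r \<odot>\<^sub>(quotient_module M H) (H +>\<^sub>M x) = H +>\<^sub>M (r \<odot>\<^sub>M x)" using assms by (intro smult_quotient_module)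
   (auto simp: module_abelian_group submodule_additive add_map_smult submodule.smult_closed)

lemma module_quotient_module:
 assumes "module R M" "submodule H R M"
 shows "module R (quotient_module M H)"
proof -
 interpret M: module R M by fact
 note ag = M.abelian_group_axioms submodule_additive[OF assms(2)]
 note s = smult_quotient_module'[OF assms] add_quotient_module[OF ag]
 show ?thesis
 proof (rule moduleI)
  show "abelian_group (quotient_module M H)" by (rule abelian_group_quotient_module[OF ag])
 qed (use M.is_cring in \<open>auto simp: carrier_quotient_module s M.smult_l_distr M.smult_r_distr M.smult_assoc1\<close>)
qed

lemma proj_mod_hom:
 assumes "module R M" "submodule H R M"
 shows "restrict (\<lambda>x. H +>\<^sub>M x) (carrier M) \<in> mod_hom R M (quotient_module M H)" using assms
 by (intro mod_hom_restrictI proj_add_map)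
   (auto simp: module_abelian_group submodule_additive smult_quotient_module')

lemma quotient_mod_lift:
 assumes "module R M" "submodule H R M" "module R W" "f \<in> mod_hom R M W"
  and "!!x. x \<in> H ==> f x = \<zero>\<^sub>W"
 obtains g where "g \<in> mod_hom R (quotient_module M H) W" "!!x. x \<in> carrier M ==> g (H +>\<^sub>M x) = f x"
proof -
 note ag = module_abelian_group[OF assms(1)] submodule_additive[OF assms(2)]
 obtain g where g: "add_map (quotient_module M H) W g" "!!x. x \<in> carrier M ==> g (H +>\<^sub>M x) = f x"
  using quotient_lift[OF ag module_abelian_group[OF assms(3)] mod_hom_add_map[OF assms(4)] assms(5)] by metis
 interpret M: module R M by fact
 interpret Q: module R "quotient_module M H" by (rule module_quotient_module[OF assms(1,2)])
 have "restrict g (carrier (quotient_module M H)) \<in> mod_hom R (quotient_module M H) W" by (rule mod_hom_restrictI[OF Q.module_axioms g(1)])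
   (auto simp: carrier_quotient_module smult_quotient_module'[OF assms(1,2)] g mod_hom_smult[OF assms(4)])
 then show ?thesis using that g(2) by (auto simp: carrier_quotient_module)
qed

lemma quotient_gen:
 assumes "module R M" "submodule H R M" "S \<subseteq> carrier M" "submod_gen R M S = carrier M"
 shows "submod_gen R (quotient_module M H) ((\<lambda>x. H +>\<^sub>M x) ` S) = carrier (quotient_module M H)"
proof -
 let ?Q = "quotient_module M H" and ?S = "(\<lambda>x. H +>\<^sub>M x) ` S"
 interpret M: module R M by fact
 interpret Q: module R ?Q by (rule module_quotient_module[OF assms(1,2)])
 have S: "?S \<subseteq> carrier ?Q" using assms(3) by (auto simp: carrier_quotient_module)
 have sub: "submodule (submod_gen R ?Q ?S) R ?Q" by (rule submodule_submod_gen[OF Q.module_axioms S])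
 let ?K = "{x \<in> carrier M. restrict (\<lambda>x. H +>\<^sub>M x) (carrier M) x \<in> submod_gen R ?Q ?S}"
 have K: "submodule ?K R M" by (rule submodule_preimage[OF assms(1) Q.module_axioms proj_mod_hom[OF assms(1,2)] sub])
 have "S \<subseteq> ?K"
 proof
  fix x assume x: "x \<in> S"
  then have "H +>\<^sub>M x \<in> submod_gen R ?Q ?S" using submod_gen_incl[of ?S R ?Q] by blast
  then show "x \<in> ?K" using x assms(3) by auto
 qed
 from submod_gen_least[OF K this] have sub': "carrier M \<subseteq> ?K" unfolding assms(4) .
 have "H +>\<^sub>M x \<in> submod_gen R ?Q ?S" if x: "x \<in> carrier M" for x
 proof -
  have "restrict (\<lambda>x. H +>\<^sub>M x) (carrier M) x \<in> submod_gen R ?Q ?S"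
   using subsetD[OF sub' x] unfolding mem_Collect_eq by (rule conjunct2)
  then show ?thesis using x by (simp only: restrict_apply if_True)
 qed
 then have "carrier ?Q \<subseteq> submod_gen R ?Q ?S" unfolding carrier_quotient_module by blast
 then show ?thesis using Q.submoduleE(1)[OF sub] by (rule subset_antisym[rotated])
qed

section \<open>Free modules\<close>

lemma free_module_simps:
 "carrier (free_module R B) = {f \<in> B \<rightarrow>\<^sub>E carrier R. finite {b \<in> B. f b ~= \<zero>\<^sub>R}}"
 "f +.\<^sub>(free_module R B) g = (\<lambda>b\<in>B. f b +.\<^sub>R g b)"
 "\<zero>\<^sub>(free_module R B) = (\<lambda>b\<in>B. \<zero>\<^sub>R)"
 "r \<odot>\<^sub>(free_module R B) f = (\<lambda>b\<in>B. r *.\<^sub>R f b)" by (simp_all add: free_module_def)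

lemma free_moduleI:
 assumes "finite {b \<in> B. f b ~= \<zero>\<^sub>R}" "!!b. b \<in> B ==> f b \<in> carrier R"
  and "!!b. b \<in> B ==> f b = \<zero>\<^sub>R ==> g b = \<zero>\<^sub>R" "!!b. b \<in> B ==> g b \<in> carrier R"
 shows "restrict g B \<in> carrier (free_module R B)"
proof -
 have "finite {b \<in> B. restrict g B b ~= \<zero>\<^sub>R}" by (rule finite_subset[OF _ assms(1)]) (use assms(3) in auto)
 then show ?thesis using assms(4) by (simp add: free_module_simps)
qed

lemma free_moduleD:
 assumes "f \<in> carrier (free_module R B)"
 shows "finite {b \<in> B. f b ~= \<zero>\<^sub>R}" "!!b. b \<in> B ==> f b \<in> carrier R" "f \<in> extensional B"
 using assms by (auto simp: free_module_simps PiE_def)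

lemma module_free_module:
 assumes "cring R"
 shows "module R (free_module R B)"
proof -
 interpret cring R by fact
 let ?M = "free_module R B"
 have add: "f +.\<^sub>?M g \<in> carrier ?M" if f: "f \<in> carrier ?M" and g: "g \<in> carrier ?M" for f g
 proof -
  have "finite {b \<in> B. f b +.\<^sub>R g b ~= \<zero>\<^sub>R}"
   by (rule finite_subset[OF _ finite_UnI[OF free_moduleD(1)[OF f] free_moduleD(1)[OF g]]]) auto
  then show ?thesis unfolding free_module_simps(2)
   by (intro free_moduleI[of B "\<lambda>b. f b +.\<^sub>R g b"]) (auto simp: free_moduleD(2)[OF f] free_moduleD(2)[OF g])
 qed
 have sm: "r \<odot>\<^sub>?M f \<in> carrier ?M" if "r \<in> carrier R" and f: "f \<in> carrier ?M" for r f unfolding free_module_simps(4)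
  by (rule free_moduleI[OF free_moduleD(1,2)[OF f]]) (use that free_moduleD(2)[OF f] in auto)
 have zero: "\<zero>\<^sub>?M \<in> carrier ?M" by (simp add: free_module_simps)
 note D = free_moduleD(2) free_moduleD(3)[THEN extensional_restrict]
 have z: "b \<in> B ==> \<zero>\<^sub>?M b = \<zero>\<^sub>R" for b by (simp add: free_module_simps(3))
 have ex: "f = g" if "f \<in> carrier ?M" "g \<in> carrier ?M" "!!b. b \<in> B ==> f b = g b" for f g
  using that free_moduleD(3) by (intro extensionalityI[of f B g]) auto
 have ap: "b \<in> B ==> (f +.\<^sub>?M g) b = f b +.\<^sub>R g b" for f g b by (simp add: free_module_simps(2))
 have sp: "b \<in> B ==> (r \<odot>\<^sub>?M g) b = r *.\<^sub>R g b" for r g b by (simp add: free_module_simps(4))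
 show ?thesis
 proof (rule moduleI[OF is_cring])
  show "abelian_group ?M"
  proof (rule abelian_groupI)
   fix f assume f: "f \<in> carrier ?M"
   have "-.\<^sub>R \<one>\<^sub>R \<odot>\<^sub>?M f +.\<^sub>?M f = \<zero>\<^sub>?M"
    by (rule ex) (auto simp: add sm f zero ap sp z free_moduleD(2)[OF f] l_minus l_neg)
   then show "\<exists>g\<in>carrier ?M. g +.\<^sub>?M f = \<zero>\<^sub>?M" using sm[OF _ f] by blast
  qed (auto intro!: ex simp: add zero ap z free_moduleD(2) a_ac)
 qed (auto intro!: ex simp: add sm ap sp free_moduleD(2) l_distr r_distr m_assoc)
qed

lemma free_basis_closed:
 assumes "cring R" "b \<in> B"
 shows "free_basis R B b \<in> carrier (free_module R B)"
proof -
 interpret cring R by fact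
 have "finite {c \<in> B. (\<lambda>c\<in>B. if c = b then \<one>\<^sub>R else \<zero>\<^sub>R) c ~= \<zero>\<^sub>R}"
  by (rule finite_subset[of _ "{b}"]) auto
 then show ?thesis by (auto simp: free_basis_def free_module_simps)
qed

lemma free_module_gen:
 assumes "cring R"
 shows "submod_gen R (free_module R B) (free_basis R B ` B) = carrier (free_module R B)"
proof -
 let ?M = "free_module R B" and ?S = "free_basis R B ` B"
 interpret cring R by fact
 interpret M: module R ?M by (rule module_free_module[OF assms])
 have S: "?S \<subseteq> carrier ?M" using free_basis_closed[OF assms] by auto
 have H: "submodule (submod_gen R ?M ?S) R ?M" by (rule submodule_submod_gen[OF M.module_axioms S])
 note HE = M.submoduleE[OF H]
 have "f \<in> submod_gen R ?M ?S"
  if "finite A" "A \<subseteq> B" "f \<in> carrier ?M" "{b \<in> B. f b ~= \<zero>\<^sub>R} \<subseteq> A" for A f using that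
 proof (induction A arbitrary: f rule: finite_induct)
  case empty
  then have "f = \<zero>\<^sub>?M" by (auto simp: free_module_simps fun_eq_iff PiE_def extensional_def)
  then show ?case using H by (auto simp: submodule_def dest: subgroup.one_closed)
 next
  case (insert a A)
  define g where "g = f(a := \<zero>\<^sub>R)"
  have a: "a \<in> B" and fa: "f a \<in> carrier R" using insert.prems by (auto simp: free_module_simps)
  have g: "g \<in> carrier ?M"
  proof -
   have "finite {b \<in> B. g b ~= \<zero>\<^sub>R}" by (rule finite_subset[of _ "{b \<in> B. f b ~= \<zero>\<^sub>R}"])
     (use insert.prems(2) in \<open>auto simp: g_def free_module_simps split: if_splits\<close>)
   then show ?thesis using insert.prems(2) a by (simp add: free_module_simps g_def PiE_def extensional_def Pi_def)
  qed
  have gA: "{b \<in> B. g b ~= \<zero>\<^sub>R} \<subseteq> A" using insert.prems(3) by (auto simp: g_def split: if_splits)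
  have "A \<subseteq> B" using insert.prems(1) by auto
  from insert.IH[OF this g gA] have "g \<in> submod_gen R ?M ?S" .
  moreover have feq: "f = g +.\<^sub>?M (f a \<odot>\<^sub>?M free_basis R B a)"
  proof
   fix b
   have "f b \<in> carrier R" if "b \<in> B" using free_moduleD(2)[OF insert.prems(2) that] .
   moreover have "f b = undefined" if "b \<notin> B" using free_moduleD(3)[OF insert.prems(2)] that by (rule extensional_arb)
   ultimately show "f b = (g +.\<^sub>?M (f a \<odot>\<^sub>?M free_basis R B a)) b"
    using fa by (simp add: free_module_simps(2,4) free_basis_def g_def)
  qed
  moreover have "f a \<odot>\<^sub>?M free_basis R B a \<in> submod_gen R ?M ?S" by (rule HE(4)) (use fa a submod_gen_incl[of ?S R ?M] in auto)
  ultimately have "g +.\<^sub>?M (f a \<odot>\<^sub>?M free_basis R B a) \<in> submod_gen R ?M ?S" by (intro HE(5))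
  then show ?case by (subst feq)
 qed
 note step = this
 have "carrier ?M \<subseteq> submod_gen R ?M ?S"
 proof
  fix f assume f: "f \<in> carrier ?M"
  show "f \<in> submod_gen R ?M ?S" by (rule step[OF free_moduleD(1)[OF f] _ f]) auto
 qed
 then show ?thesis using HE(1) by (rule subset_antisym[rotated])
qed

lemma free_module_lift:
 assumes "module R N" "m \<in> B \<rightarrow> carrier N"
 obtains h where "h \<in> mod_hom R (free_module R B) N" "!!b. b \<in> B ==> h (free_basis R B b) = m b"
proof -
 let ?M = "free_module R B"
 interpret N: module R N by fact
 interpret M: module R ?M by (rule module_free_module[OF N.is_cring])
 define h where "h = (\<lambda>f. finsum N (\<lambda>b. f b \<odot>\<^sub>N m b) {b \<in> B. f b ~= \<zero>\<^sub>R})"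
 have fm: "f b \<odot>\<^sub>N m b \<in> carrier N" if "f \<in> carrier ?M" "b \<in> B" for f b using that assms(2) by (auto simp: free_module_simps)
 have mb: "m b \<in> carrier N" if "b \<in> B" for b using assms(2) that by auto
 have fR: "f b \<in> carrier R" if "f \<in> carrier ?M" "b \<in> B" for f b using that by (auto simp: free_module_simps)
 \<comment> \<open>The support of a sum may be smaller than the union of the supports, so the
   defining sum is first extended to any finite set containing the support.\<close>
 have ext: "h f = finsum N (\<lambda>b. f b \<odot>\<^sub>N m b) A"
  if "f \<in> carrier ?M" "finite A" "A \<subseteq> B" "{b \<in> B. f b ~= \<zero>\<^sub>R} \<subseteq> A" for f A unfolding h_def
  by (rule N.add.finprod_mono_neutral_cong_left) (use that fm mb in auto)
 have hadd: "h (f +.\<^sub>?M g) = h f +.\<^sub>N h g" if f: "f \<in> carrier ?M" and g: "g \<in> carrier ?M" for f g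
 proof -
  let ?A = "{b \<in> B. f b ~= \<zero>\<^sub>R} \<union> {b \<in> B. g b ~= \<zero>\<^sub>R}"
  have A: "finite ?A" using f g by (auto simp: free_module_simps)
  have "h (f +.\<^sub>?M g) = finsum N (\<lambda>b. (f +.\<^sub>?M g) b \<odot>\<^sub>N m b) ?A"
  proof (rule ext[OF M.a_closed[OF f g] A])
   show "{b \<in> B. (f +.\<^sub>?M g) b ~= \<zero>\<^sub>R} \<subseteq> ?A" unfolding free_module_simps(2) by auto
  qed auto
  also have "\<dots> = finsum N (\<lambda>b. f b \<odot>\<^sub>N m b +.\<^sub>N g b \<odot>\<^sub>N m b) ?A"
   using fm[OF f] fm[OF g] fR[OF f] fR[OF g] mb by (intro N.add.finprod_cong') (auto simp: free_module_simps(2) N.smult_l_distr)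
  also have "\<dots> = finsum N (\<lambda>b. f b \<odot>\<^sub>N m b) ?A +.\<^sub>N finsum N (\<lambda>b. g b \<odot>\<^sub>N m b) ?A"
   by (rule N.finsum_addf) (use fm[OF f] fm[OF g] in auto)
  also have "\<dots> = h f +.\<^sub>N h g" using f g A ext[of f ?A] ext[of g ?A] by auto
  finally show ?thesis .
 qed
 have hcl: "h f \<in> carrier N" if "f \<in> carrier ?M" for f unfolding h_def by (rule N.finsum_closed) (use that fm in auto)
 have hsm: "h (r \<odot>\<^sub>?M f) = r \<odot>\<^sub>N h f" if r: "r \<in> carrier R" and f: "f \<in> carrier ?M" for r f
 proof -
  let ?A = "{b \<in> B. f b ~= \<zero>\<^sub>R}"
  have A: "finite ?A" using f by (auto simp: free_module_simps)
  have "h (r \<odot>\<^sub>?M f) = finsum N (\<lambda>b. (r \<odot>\<^sub>?M f) b \<odot>\<^sub>N m b) ?A"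
  proof (rule ext[OF M.smult_closed[OF r f] A])
   show "{b \<in> B. (r \<odot>\<^sub>?M f) b ~= \<zero>\<^sub>R} \<subseteq> ?A" unfolding free_module_simps(4) using r by auto
  qed auto
  also have "\<dots> = finsum N (\<lambda>b. r \<odot>\<^sub>N (f b \<odot>\<^sub>N m b)) ?A" using fm[OF f] fR[OF f] mb r
   by (intro N.add.finprod_cong') (auto simp: free_module_simps(4) N.smult_assoc1)
  also have "\<dots> = r \<odot>\<^sub>N h f" unfolding h_def by (rule N.finsum_smult_ldistr[symmetric]) (use r f fm A in auto)
  finally show ?thesis .
 qed
 have hb: "h (free_basis R B b) = m b" if b: "b \<in> B" for b
 proof -
  have "h (free_basis R B b) = finsum N (\<lambda>c. free_basis R B b c \<odot>\<^sub>N m c) {b}"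
   by (rule ext) (use b free_basis_closed[OF N.is_cring b] in \<open>auto simp: free_basis_def\<close>)
  also have "\<dots> = m b" using b assms(2) by (auto simp: free_basis_def Pi_def)
  finally show ?thesis .
 qed
 have "restrict h (carrier ?M) \<in> mod_hom R ?M N" by (rule mod_hom_restrictI[OF M.module_axioms]) (auto intro: add_mapI hcl hadd hsm)
 moreover have "restrict h (carrier ?M) (free_basis R B b) = m b" if "b \<in> B" for b
  using hb[OF that] free_basis_closed[OF N.is_cring that] by simp
 ultimately show ?thesis by (rule that)
qed

section \<open>Group rings\<close>

lemma frag_abelian_group:
 assumes "carrier M = {c :: 'c \<Rightarrow>\<^sub>0 int. Poly_Mapping.keys c \<subseteq> S}" "ring.add M = (+)" "ring.zero M = 0"
 shows "abelian_group M"
proof (rule abelian_groupI)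
 fix x assume x: "x \<in> carrier M"
 then show "\<exists>y\<in>carrier M. y +.\<^sub>M x = \<zero>\<^sub>M" by (intro bexI[of _ "- x"]) (use assms in auto)
qed (use assms keys_add in \<open>auto simp: ac_simps dest!: subsetD[OF keys_add]\<close>)

lemma frag_a_inv:
 assumes "carrier M = {c :: 'c \<Rightarrow>\<^sub>0 int. Poly_Mapping.keys c \<subseteq> S}" "ring.add M = (+)" "ring.zero M = 0"
  and "x \<in> carrier M"
 shows "-.\<^sub>M x = - x"
proof -
 interpret abelian_group M by (rule frag_abelian_group[OF assms(1-3)])
 show ?thesis by (rule minus_equality) (use assms in auto)
qed

lemma frag_induct_on [consumes 1, case_names zero gen diff]:
 assumes "Poly_Mapping.keys c \<subseteq> S" "P 0" "!!s. s \<in> S ==> P (frag_of s)"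
  "!!a b. Poly_Mapping.keys a \<subseteq> S ==> Poly_Mapping.keys b \<subseteq> S ==> P a ==> P b ==> P (a - b)"
 shows "P c" by (rule free_Abelian_group_induct[OF assms(1)]) (use assms in auto)

lemma frag_lift:
 assumes "abelian_group W" "!!s. s \<in> S ==> f s \<in> carrier W"
  and "carrier M = {c :: 'c \<Rightarrow>\<^sub>0 int. Poly_Mapping.keys c \<subseteq> S}" "ring.add M = (+)"
 obtains h where "add_map M W h" "!!s. s \<in> S ==> h (frag_of s) = f s"
proof -
 interpret W: abelian_group W by fact
 have "f ` S \<subseteq> carrier (add_monoid W)" using assms(2) by auto
 then obtain h where h: "h \<in> hom (free_Abelian_group S) (add_monoid W)" "!!s. s \<in> S ==> h (frag_of s) = f s"
  using comm_group.free_Abelian_group_universal[OF W.a_comm_group] by metis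
 have "add_map M W h" using h(1) assms(3,4) by (auto simp: add_map_def hom_def Pi_def)
 then show ?thesis using h(2) that by blast
qed

lemma frag_extend_plus:
 "frag_extend (\<lambda>x. f x + g x) c = frag_extend f c + frag_extend g c" by (simp add: frag_extend_def frag_cmul_distrib2 sum.distrib)

lemma group_ring_simps:
 "carrier (group_ring G) = {c. Poly_Mapping.keys c \<subseteq> carrier G}"
 "ring.add (group_ring G) = (+)"
 "\<zero>\<^sub>(group_ring G) = 0"
 "\<one>\<^sub>(group_ring G) = frag_of \<one>\<^sub>G"
 "c *.\<^sub>(group_ring G) d = frag_extend (\<lambda>g. frag_extend (\<lambda>h. frag_of (g *.\<^sub>G h)) d) c" by (simp_all add: group_ring_def)

lemma frag_of_group_ring: "g \<in> carrier G ==> frag_of g \<in> carrier (group_ring G)" by (simp add: group_ring_simps)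

lemma group_ring_mult_frag: "frag_of g *.\<^sub>(group_ring G) frag_of h = frag_of (g *.\<^sub>G h)" by (simp add: group_ring_simps)

lemma group_ring_mult_distrib:
 "(c + c') *.\<^sub>(group_ring G) d = c *.\<^sub>(group_ring G) d + c' *.\<^sub>(group_ring G) d"
 "c *.\<^sub>(group_ring G) (d + d') = c *.\<^sub>(group_ring G) d + c *.\<^sub>(group_ring G) d'"
 "(c - c') *.\<^sub>(group_ring G) d = c *.\<^sub>(group_ring G) d - c' *.\<^sub>(group_ring G) d"
 "0 *.\<^sub>(group_ring G) d = 0" "c *.\<^sub>(group_ring G) 0 = 0"
 by (simp_all add: group_ring_simps frag_extend_add frag_extend_diff frag_extend_plus frag_extend_eq_0)

lemma group_ring_mult_minus_right:
 "c *.\<^sub>(group_ring G) (d - d') = c *.\<^sub>(group_ring G) d - c *.\<^sub>(group_ring G) d'"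
proof -
 have "c *.\<^sub>(group_ring G) ((d - d') + d') = c *.\<^sub>(group_ring G) (d - d') + c *.\<^sub>(group_ring G) d'"
  by (rule group_ring_mult_distrib(2))
 then show ?thesis by (simp add: algebra_simps)
qed

lemma group_ring_mult_closed:
 assumes "monoid G" "c \<in> carrier (group_ring G)" "d \<in> carrier (group_ring G)"
 shows "c *.\<^sub>(group_ring G) d \<in> carrier (group_ring G)"
proof -
 interpret monoid G by fact
 have "Poly_Mapping.keys c \<subseteq> carrier G" "Poly_Mapping.keys d \<subseteq> carrier G" using assms by (auto simp: group_ring_simps)
 then show ?thesis using keys_frag_extend[of "\<lambda>g. frag_extend (\<lambda>h. frag_of (g *.\<^sub>G h)) d" c]
   keys_frag_extend[of "\<lambda>h. frag_of (_ *.\<^sub>G h)" d] by (fastforce simp: group_ring_simps)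
qed

lemma cring_group_ring:
 assumes "comm_group G"
 shows "cring (group_ring G)"
proof -
 interpret comm_group G by fact
 let ?R = "group_ring G"
 have ag: "abelian_group ?R" by (rule frag_abelian_group) (simp_all add: group_ring_simps)
 have assoc: "c *.\<^sub>?R d *.\<^sub>?R e = c *.\<^sub>?R (d *.\<^sub>?R e)"
  if "Poly_Mapping.keys c \<subseteq> carrier G" "Poly_Mapping.keys d \<subseteq> carrier G" "Poly_Mapping.keys e \<subseteq> carrier G" for c d e
  using that(1)
 proof (induction c rule: frag_induct_on)
  case (gen g)
  note g = gen
  show ?case using that(2)
  proof (induction d rule: frag_induct_on)
   case (gen h)
   show ?case using that(3) by (induction e rule: frag_induct_on)
     (use gen g in \<open>simp_all add: group_ring_mult_distrib group_ring_mult_minus_right group_ring_mult_frag m_assoc\<close>)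
  qed (simp_all add: group_ring_mult_distrib group_ring_mult_minus_right)
 qed (simp_all add: group_ring_mult_distrib group_ring_mult_minus_right)
 have comm: "c *.\<^sub>?R d = d *.\<^sub>?R c"
  if "Poly_Mapping.keys c \<subseteq> carrier G" "Poly_Mapping.keys d \<subseteq> carrier G" for c d using that(1)
 proof (induction c rule: frag_induct_on)
  case (gen g)
  show ?case using that(2) by (induction d rule: frag_induct_on)
    (use gen in \<open>simp_all add: group_ring_mult_distrib group_ring_mult_minus_right group_ring_mult_frag m_comm\<close>)
 qed (simp_all add: group_ring_mult_distrib group_ring_mult_minus_right)
 have one: "frag_of \<one>\<^sub>G *.\<^sub>?R c = c" if "Poly_Mapping.keys c \<subseteq> carrier G" for c using that
  by (induction c rule: frag_induct_on)
   (simp_all add: group_ring_mult_distrib group_ring_mult_minus_right group_ring_mult_frag)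
 show ?thesis
 proof (rule cringI[OF ag])
  show "comm_monoid ?R" by (rule comm_monoidI)
    (use assoc comm one group_ring_mult_closed[OF monoid_axioms] in \<open>auto simp: group_ring_simps(1,4)\<close>)
 qed (simp add: group_ring_simps(2) group_ring_mult_distrib)
qed

lemma group_ring_a_inv: "c \<in> carrier (group_ring G) ==> -.\<^sub>(group_ring G) c = - c" by (rule frag_a_inv) (simp_all add: group_ring_simps)

lemma group_ring_minus:
 "d \<in> carrier (group_ring G) ==> c -.\<^sub>(group_ring G) d = c - d" by (simp add: a_minus_def group_ring_a_inv) (simp add: group_ring_simps)

lemma group_ring_induct [consumes 1, case_names zero gen diff]:
 assumes "c \<in> carrier (group_ring G)" "P 0" "!!g. g \<in> carrier G ==> P (frag_of g)"
  "!!a b. a \<in> carrier (group_ring G) ==> b \<in> carrier (group_ring G) ==> P a ==> P b ==> P (a - b)"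
 shows "P c" using assms(1) unfolding group_ring_simps mem_Collect_eq
 by (rule frag_induct_on) (use assms in \<open>auto simp: group_ring_simps\<close>)

lemma group_ring_diff_smult:
 assumes "module (group_ring G) M" "a \<in> carrier (group_ring G)" "b \<in> carrier (group_ring G)" "x \<in> carrier M"
 shows "(a - b) \<odot>\<^sub>M x = a \<odot>\<^sub>M x -.\<^sub>M b \<odot>\<^sub>M x"
proof -
 interpret module "group_ring G" M by fact
 have "(a -.\<^sub>(group_ring G) b) \<odot>\<^sub>M x = a \<odot>\<^sub>M x -.\<^sub>M b \<odot>\<^sub>M x"
  using assms by (simp add: a_minus_def smult_l_distr smult_l_minus)
 then show ?thesis using assms by (simp add: group_ring_minus)
qed

lemma group_ring_zero_smult:
 assumes "module (group_ring G) M" "x \<in> carrier M"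
 shows "0 \<odot>\<^sub>M x = \<zero>\<^sub>M" using module.smult_l_null[OF assms] by (simp add: group_ring_simps)

lemma group_ring_submodule:
 assumes "module (group_ring G) M" "additive_subgroup H M"
  and "!!g x. g \<in> carrier G ==> x \<in> H ==> frag_of g \<odot>\<^sub>M x \<in> H"
 shows "submodule H (group_ring G) M"
proof -
 interpret M: module "group_ring G" M by fact
 interpret H: additive_subgroup H M by fact
 have "r \<odot>\<^sub>M x \<in> H" if "r \<in> carrier (group_ring G)" "x \<in> H" for r x using that(1)
 proof (induction r rule: group_ring_induct)
  case (diff a b)
  then show ?case using that(2) by (simp add: group_ring_diff_smult[OF assms(1)] a_minus_def)
 qed (use that assms(3) in \<open>simp_all add: group_ring_zero_smult[OF assms(1)]\<close>)
 then show ?thesis using H.a_subset by (intro M.submoduleI) auto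
qed

text \<open>By freeness of the group ring, \<open>h x\<close> extends g -> g x additively in the
  ring variable, and the module laws need checking on group elements only. The lemma later makes the
  part of \<open>half (RPb1 R)\<close> fixed by \<open>U1\<close> a module over the square classes
  of the residue field.\<close>

lemma group_action_module:
 assumes "comm_group G" "abelian_group W"
  and "!!g. g \<in> carrier G ==> add_map W W (act g)"
  and "!!x. x \<in> carrier W ==> act \<one>\<^sub>G x = x"
  and "!!g h x. g \<in> carrier G ==> h \<in> carrier G ==> x \<in> carrier W ==> act (g *.\<^sub>G h) x = act g (act h x)"
 obtains sm where "module (group_ring G) (mk_module (carrier W) (ring.add W) (ring.zero W) sm)"
  and "!!g x. g \<in> carrier G ==> x \<in> carrier W ==> sm (frag_of g) x = act g x"
proof -
 interpret G: comm_group G by fact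
 interpret W: abelian_group W by fact
 interpret R: cring "group_ring G" by (rule cring_group_ring[OF assms(1)])
 have "\<exists>h. add_map (group_ring G) W h \<and> (\<forall>g\<in>carrier G. h (frag_of g) = act g x)" if "x \<in> carrier W" for x
  using frag_lift[of W "carrier G" "\<lambda>g. act g x" "group_ring G"] that assms(2) add_map_closed[OF assms(3)] by (metis group_ring_simps(1,2))
 then obtain h where h: "!!x. x \<in> carrier W ==> add_map (group_ring G) W (h x)"
  "!!x g. x \<in> carrier W ==> g \<in> carrier G ==> h x (frag_of g) = act g x" by metis
 note h0 = add_map_zero[OF R.abelian_group_axioms assms(2) h(1), unfolded group_ring_simps(3)]
 have hm: "h x (a - b) = h x a -.\<^sub>W h x b"
  if "x \<in> carrier W" "a \<in> carrier (group_ring G)" "b \<in> carrier (group_ring G)" for x a b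
  using add_map_minus[OF R.abelian_group_axioms assms(2) h(1)[OF that(1)] that(2,3)] that(3) by (simp add: group_ring_minus)
 note hc = add_map_closed[OF h(1)]
 let ?M = "mk_module (carrier W) (ring.add W) (ring.zero W) (\<lambda>c x. h x c)"
 have ag: "abelian_group ?M" by (rule abelian_groupI) (auto simp: W.a_ac intro: bexI[of _ "-.\<^sub>W _"] W.l_neg)
 have dist: "h (x +.\<^sub>W y) c = h x c +.\<^sub>W h y c"
  if "c \<in> carrier (group_ring G)" "x \<in> carrier W" "y \<in> carrier W" for c x y using that(1)
 proof (induction c rule: group_ring_induct)
  case (diff a b)
  then show ?case using that(2,3) by (simp add: hm hc a_minus_def W.minus_add W.a_ac)
 qed (use that in \<open>simp_all add: h0 h(2) add_map_add[OF assms(3)]\<close>)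
 have h_zero: "h \<zero>\<^sub>W c = \<zero>\<^sub>W" if "c \<in> carrier (group_ring G)" for c
 proof -
  have "h \<zero>\<^sub>W c +.\<^sub>W h \<zero>\<^sub>W c = h \<zero>\<^sub>W c" using dist[OF that, of "\<zero>\<^sub>W" "\<zero>\<^sub>W"] by simp
  then show ?thesis using hc[OF W.zero_closed that] by (simp add: W.add.l_cancel_one)
 qed
 have neg: "h (-.\<^sub>W x) c = -.\<^sub>W h x c" if "c \<in> carrier (group_ring G)" "x \<in> carrier W" for c x
  using dist[OF that(1), of "-.\<^sub>W x" x] that h_zero hc by (metis W.a_inv_closed W.l_neg W.minus_equality)
 have assoc: "h x (c *.\<^sub>(group_ring G) d) = h (h x d) c"
  if "c \<in> carrier (group_ring G)" "d \<in> carrier (group_ring G)" "x \<in> carrier W" for c d x using that(1)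
 proof (induction c rule: group_ring_induct)
  case (gen g)
  note g = gen
  show ?case using that(2)
  proof (induction d rule: group_ring_induct)
   case (diff a b)
   then show ?case using g that(3) by (simp add: hm hc a_minus_def dist neg frag_of_group_ring group_ring_mult_minus_right)
  qed (use g that(3) in \<open>simp_all add: h0 h_zero group_ring_mult_distrib group_ring_mult_frag h(2) assms(5)
    add_map_closed[OF assms(3)] frag_of_group_ring add_map_zero[OF assms(2,2) assms(3)]\<close>)
 next
  case (diff a b)
  then show ?case using that(2,3) by (simp add: hm hc group_ring_mult_distrib group_ring_mult_closed[OF G.monoid_axioms])
 qed (use that in \<open>simp_all add: h0 hc group_ring_mult_distrib\<close>)
 have "module (group_ring G) ?M"
 proof (rule moduleI[OF R.is_cring ag])
  fix x assume "x \<in> carrier ?M"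
  then show "\<one>\<^sub>(group_ring G) \<odot>\<^sub>?M x = x" using h(2) assms(4) by (simp add: group_ring_simps(4))
 qed (auto simp: hc dist assoc add_map_add[OF h(1)])
 then show ?thesis using that[of "\<lambda>c x. h x c"] h(2) by simp
qed

section \<open>Modules over group rings of exponent two\<close>

definition dbl :: "('r, 'x, 'm) module_scheme => 'x => 'x"
 where "dbl M x = x +.\<^sub>M x"

text \<open>For a submodule N this says that M/N has no element of order 2.\<close>

definition saturated :: "('r, 'x, 'm) module_scheme => 'x set => bool"
 where "saturated M N \<longleftrightarrow> (\<forall>x\<in>carrier M. dbl M x \<in> N --> x \<in> N)"

lemma saturatedD_pow:
 assumes "module R M" "saturated M N" "x \<in> carrier M" "(dbl M ^^ n) x \<in> N"
 shows "x \<in> N" using assms(3,4)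
proof (induction n arbitrary: x)
 case (Suc n)
 interpret module R M by fact
 have "dbl M x \<in> carrier M" using Suc.prems by (simp add: dbl_def)
 moreover have "(dbl M ^^ n) (dbl M x) \<in> N" using Suc.prems(2) by (simp add: funpow_swap1)
 ultimately have "dbl M x \<in> N" by (rule Suc.IH)
 then show ?case using assms(2) Suc.prems(1) unfolding saturated_def by blast
qed simp

text \<open>The 2-primary torsion, that is the kernel of M -> M[1/2]. It is the smallest saturated
  submodule.\<close>

definition two_torsion :: "('r, 'x, 'm) module_scheme => 'x set"
 where "two_torsion M = {x \<in> carrier M. \<exists>n. (dbl M ^^ n) x = \<zero>\<^sub>M}"

lemma dbl_pow_facts:
 assumes "module R M"
 shows "x \<in> carrier M ==> (dbl M ^^ n) x \<in> carrier M"
  and "x \<in> carrier M ==> y \<in> carrier M ==> (dbl M ^^ n) (x +.\<^sub>M y) = (dbl M ^^ n) x +.\<^sub>M (dbl M ^^ n) y"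
  and "r \<in> carrier R ==> x \<in> carrier M ==> (dbl M ^^ n) (r \<odot>\<^sub>M x) = r \<odot>\<^sub>M (dbl M ^^ n) x"
  and "x \<in> carrier M ==> (dbl M ^^ n) (-.\<^sub>M x) = -.\<^sub>M (dbl M ^^ n) x"
  and "(dbl M ^^ n) \<zero>\<^sub>M = \<zero>\<^sub>M"
proof -
 interpret module R M by fact
 show cl: "(dbl M ^^ n) x \<in> carrier M" if "x \<in> carrier M" for x n using that by (induction n) (auto simp: dbl_def)
 show "(dbl M ^^ n) (x +.\<^sub>M y) = (dbl M ^^ n) x +.\<^sub>M (dbl M ^^ n) y" if "x \<in> carrier M" "y \<in> carrier M"
  using that by (induction n) (auto simp: dbl_def M.a_ac cl)
 show "(dbl M ^^ n) (r \<odot>\<^sub>M x) = r \<odot>\<^sub>M (dbl M ^^ n) x" if "r \<in> carrier R" "x \<in> carrier M"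
  using that by (induction n) (auto simp: dbl_def smult_r_distr cl)
 show "(dbl M ^^ n) (-.\<^sub>M x) = -.\<^sub>M (dbl M ^^ n) x" if "x \<in> carrier M"
  using that by (induction n) (auto simp: dbl_def M.minus_add cl)
 show "(dbl M ^^ n) \<zero>\<^sub>M = \<zero>\<^sub>M" by (induction n) (auto simp: dbl_def)
qed

lemma submodule_two_torsion:
 assumes "module R M"
 shows "submodule (two_torsion M) R M" "saturated M (two_torsion M)"
proof -
 interpret module R M by fact
 note d = dbl_pow_facts[OF assms]
 show "submodule (two_torsion M) R M"
 proof (rule submoduleI)
  fix x y assume "x \<in> two_torsion M" "y \<in> two_torsion M"
  then obtain m n where h: "x \<in> carrier M" "y \<in> carrier M" "(dbl M ^^ m) x = \<zero>\<^sub>M" "(dbl M ^^ n) y = \<zero>\<^sub>M"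
   by (auto simp: two_torsion_def)
  have "(dbl M ^^ (n + m)) x = \<zero>\<^sub>M" using h d by (simp add: funpow_add)
  moreover have "(dbl M ^^ (n + m)) y = \<zero>\<^sub>M" using h d by (subst add.commute) (simp add: funpow_add)
  ultimately have "(dbl M ^^ (n + m)) (x +.\<^sub>M y) = \<zero>\<^sub>M" using h by (simp add: d(2))
  then show "x +.\<^sub>M y \<in> two_torsion M" using h by (auto simp: two_torsion_def)
 next
  fix r x assume r: "r \<in> carrier R" and "x \<in> two_torsion M"
  then obtain n where "x \<in> carrier M" "(dbl M ^^ n) x = \<zero>\<^sub>M" by (auto simp: two_torsion_def)
  then have "r \<odot>\<^sub>M x \<in> carrier M" "(dbl M ^^ n) (r \<odot>\<^sub>M x) = \<zero>\<^sub>M" using r by (simp_all add: d(3))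
  then show "r \<odot>\<^sub>M x \<in> two_torsion M" unfolding two_torsion_def by blast
 next
  fix x assume "x \<in> two_torsion M"
  then obtain n where "x \<in> carrier M" "(dbl M ^^ n) x = \<zero>\<^sub>M" by (auto simp: two_torsion_def)
  then have "-.\<^sub>M x \<in> carrier M" "(dbl M ^^ n) (-.\<^sub>M x) = \<zero>\<^sub>M" by (simp_all add: d(4))
  then show "-.\<^sub>M x \<in> two_torsion M" unfolding two_torsion_def by blast
 next
  have "(dbl M ^^ 0) \<zero>\<^sub>M = \<zero>\<^sub>M" by simp
  then show "\<zero>\<^sub>M \<in> two_torsion M" unfolding two_torsion_def by blast
 qed (auto simp: two_torsion_def)
 show "saturated M (two_torsion M)" unfolding saturated_def
 proof (intro ballI impI)
  fix x assume x: "x \<in> carrier M" and "dbl M x \<in> two_torsion M"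
  then obtain n where "(dbl M ^^ n) (dbl M x) = \<zero>\<^sub>M" by (auto simp: two_torsion_def)
  then have "(dbl M ^^ Suc n) x = \<zero>\<^sub>M" by (simp add: funpow_swap1)
  then show "x \<in> two_torsion M" using x unfolding two_torsion_def by blast
 qed
qed

text \<open>Zorn gives N maximal among the saturated submodules that miss z;
  \<open>two_torsion M\<close> is one of them. Maximality forces every g to act on M/N by a sign.
  Consequently an element that vanishes in all such quotients is 2-primary torsion.\<close>

lemma character_submodule:
 assumes "comm_group G" "!!g. g \<in> carrier G ==> g *.\<^sub>G g = \<one>\<^sub>G"
  and "module (group_ring G) M" "z \<in> carrier M" "z \<notin> two_torsion M"
 obtains N where "submodule N (group_ring G) M" "saturated M N" "z \<notin> N"
  "!!g. g \<in> carrier G ==> (\<forall>x\<in>carrier M. frag_of g \<odot>\<^sub>M x -.\<^sub>M x \<in> N) \<or>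
             (\<forall>x\<in>carrier M. frag_of g \<odot>\<^sub>M x +.\<^sub>M x \<in> N)"
proof -
 interpret M: module "group_ring G" M by fact
 define \<A> where "\<A> = {N. submodule N (group_ring G) M \<and> saturated M N \<and> z \<notin> N}"
 have ne: "\<A> ~= {}" using submodule_two_torsion[OF assms(3)] assms(5) by (auto simp: \<A>_def)
 have "\<Union> \<C> \<in> \<A>" if "\<C> ~= {}" "subset.chain \<A> \<C>" for \<C>
 proof -
  have c: "!!N. N \<in> \<C> ==> N \<in> \<A>" "!!K L. K \<in> \<C> ==> L \<in> \<C> ==> K \<subseteq> L \<or> L \<subseteq> K"
   using that(2) by (auto simp: subset.chain_def)
  then have s: "!!N. N \<in> \<C> ==> submodule N (group_ring G) M" by (auto simp: \<A>_def)
  have "submodule (\<Union> \<C>) (group_ring G) M"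
  proof (rule M.submoduleI)
   show "\<zero>\<^sub>M \<in> \<Union> \<C>" using that(1) s additive_subgroup.zero_closed[OF submodule_additive] by blast
  next
   fix a b assume "a \<in> \<Union> \<C>" "b \<in> \<Union> \<C>"
   then obtain K where "K \<in> \<C>" "a \<in> K" "b \<in> K" using c(2) by blast
   then show "a +.\<^sub>M b \<in> \<Union> \<C>" using s M.submoduleE(5) by blast
  qed (use s M.submoduleE in blast)+
  then show ?thesis using c(1) by (auto simp: \<A>_def saturated_def)
 qed
 then obtain N where N: "N \<in> \<A>" "!!K. K \<in> \<A> ==> N \<subseteq> K ==> K = N" using subset_Zorn_nonempty[OF ne] by blast
 have sub: "submodule N (group_ring G) M" and sat: "saturated M N" and zN: "z \<notin> N" using N(1) by (auto simp: \<A>_def)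
 note NE = M.submoduleE[OF sub]
 have N0: "\<zero>\<^sub>M \<in> N" using additive_subgroup.zero_closed[OF submodule_additive[OF sub]] .
 have key: "(\<forall>x\<in>carrier M. frag_of g \<odot>\<^sub>M x -.\<^sub>M x \<in> N) \<or> (\<forall>x\<in>carrier M. frag_of g \<odot>\<^sub>M x +.\<^sub>M x \<in> N)"
  if g: "g \<in> carrier G" for g
 proof -
  define e where "e = frag_of g"
  have e: "e \<in> carrier (group_ring G)" using g by (simp add: e_def frag_of_group_ring)
  have ee: "e \<odot>\<^sub>M (e \<odot>\<^sub>M x) = x" if "x \<in> carrier M" for x
  proof -
   have "e *.\<^sub>(group_ring G) e = \<one>\<^sub>(group_ring G)"
    using assms(2) g by (simp add: e_def group_ring_mult_frag) (simp add: group_ring_simps)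
   then show ?thesis using M.smult_assoc1[OF e e that] that by simp
  qed
  \<comment> \<open>With \<alpha> = e - 1 and \<beta> = e + 1 one has \<alpha> \<beta> = 0, as e
    squares to one, and \<beta> - \<alpha> = 2.\<close>
  define \<alpha> where "\<alpha> x = e \<odot>\<^sub>M x -.\<^sub>M x" for x
  define \<beta> where "\<beta> x = e \<odot>\<^sub>M x +.\<^sub>M x" for x
  have com: "e \<odot>\<^sub>M (r \<odot>\<^sub>M x) = r \<odot>\<^sub>M (e \<odot>\<^sub>M x)" if "r \<in> carrier (group_ring G)" "x \<in> carrier M" for r x
   using that e by (metis M.smult_assoc1 M.R.m_comm)
  have \<alpha>: "restrict \<alpha> (carrier M) \<in> mod_hom (group_ring G) M M" by (rule mod_hom_restrictI[OF assms(3)])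
    (use e in \<open>auto simp: \<alpha>_def add_map_def a_minus_def M.smult_r_distr M.minus_add M.a_ac com M.smult_r_minus\<close>)
  have \<beta>: "restrict \<beta> (carrier M) \<in> mod_hom (group_ring G) M M" by (rule mod_hom_restrictI[OF assms(3)])
    (use e in \<open>auto simp: \<beta>_def add_map_def M.smult_r_distr M.a_ac com\<close>)
  \<comment> \<open>If f z is not in N, the preimage of N under f is saturated, contains N and
    misses z, so by maximality it is N. In other words, f is injective on M/N.\<close>
  have pre: "x \<in> N"
   if f: "restrict f (carrier M) \<in> mod_hom (group_ring G) M M" "!!x. x \<in> N ==> f x \<in> N" and z: "f z \<notin> N"
    and x: "x \<in> carrier M" "f x \<in> N" for f x
  proof -
   define K where K: "K = {x \<in> carrier M. restrict f (carrier M) x \<in> N}"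
   have subK: "submodule K (group_ring G) M" unfolding K by (rule submodule_preimage[OF assms(3,3) f(1) sub])
   have satK: "saturated M K" unfolding saturated_def
   proof (intro ballI impI)
    fix x assume x: "x \<in> carrier M" and "dbl M x \<in> K"
    then have "f (x +.\<^sub>M x) \<in> N" by (simp add: K dbl_def)
    then have "dbl M (f x) \<in> N" using mod_hom_add[OF f(1) x x] x by (simp add: dbl_def)
    moreover have "f x \<in> carrier M" using mod_hom_closed[OF f(1) x] x by simp
    ultimately have "f x \<in> N" using sat unfolding saturated_def by blast
    then show "x \<in> K" using x by (simp add: K)
   qed
   have "z \<notin> K" using z assms(4) by (simp add: K)
   with subK satK have "K \<in> \<A>" by (simp add: \<A>_def)
   moreover have "N \<subseteq> K"
   proof
    fix x assume "x \<in> N"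
    then show "x \<in> K" using f(2)[of x] subsetD[OF NE(1), of x] by (simp add: K)
   qed
   ultimately have "K = N" by (rule N(2))
   moreover have "x \<in> K" using x by (simp add: K)
   ultimately show "x \<in> N" by (simp only:)
  qed
  have \<alpha>N: "\<alpha> x \<in> N" and \<beta>N: "\<beta> x \<in> N" if "x \<in> N" for x
   using that NE e by (auto simp: \<alpha>_def \<beta>_def a_minus_def)
  have \<alpha>\<beta>: "\<alpha> (\<beta> x) = \<zero>\<^sub>M" "\<beta> (\<alpha> x) = \<zero>\<^sub>M" if "x \<in> carrier M" for x
   using that e ee[OF that] M.smult_closed[OF e that]
   by (simp_all add: \<alpha>_def \<beta>_def M.smult_r_distr a_minus_def M.smult_r_minus M.minus_add M.a_ac M.r_neg M.r_neg2 M.r_neg1)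
  have \<alpha>c: "\<alpha> x \<in> carrier M" and \<beta>c: "\<beta> x \<in> carrier M" if "x \<in> carrier M" for x
   using that e by (auto simp: \<alpha>_def \<beta>_def)
  show ?thesis
  proof (cases "\<alpha> z \<in> N")
   case False
   have "\<beta> x \<in> N" if "x \<in> carrier M" for x
    using pre[OF \<alpha> \<alpha>N False \<beta>c[OF that]] \<alpha>\<beta>(1)[OF that] N0 by simp
   then show ?thesis by (simp add: \<beta>_def e_def)
  next
   case True
   \<comment> \<open>If both \<alpha> z and \<beta> z were in N, then so would be 2z, hence
     z.\<close>
   have "dbl M z = \<beta> z -.\<^sub>M \<alpha> z" using assms(4) e M.smult_closed[OF e assms(4)]
    by (simp add: dbl_def \<alpha>_def \<beta>_def a_minus_def M.minus_add M.a_ac M.r_neg2 M.r_neg1 M.r_neg)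
   then have False if "\<beta> z \<in> N" using True that NE sat zN assms(4) by (auto simp: saturated_def a_minus_def)
   then have "\<beta> z \<notin> N" by blast
   have "\<alpha> x \<in> N" if "x \<in> carrier M" for x
    using pre[OF \<beta> \<beta>N \<open>\<beta> z \<notin> N\<close> \<alpha>c[OF that]] \<alpha>\<beta>(2)[OF that] N0 by simp
   then show ?thesis by (simp add: \<alpha>_def e_def)
  qed
 qed
 show ?thesis using that[OF sub sat zN] key by blast
qed

section \<open>Tensor products\<close>

lemma add_map_add_pow:
 assumes "abelian_group M" "abelian_group N" "add_map M N f" "x \<in> carrier M"
 shows "f (add_pow M (n::int) x) = add_pow N n (f x)"
proof -
 interpret h: group_hom "add_monoid M" "add_monoid N" f
  using add_map_hom[OF assms(1-3)] by (simp add: abelian_group_hom_def abelian_group_hom_axioms_def)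
 show ?thesis using h.hom_int_pow[of x n] assms(4) by (simp add: add_pow_def)
qed

text \<open>The assumptions are closure of the two actions of R and compatibility of the right
  action with S. These are the facts at hand for \<open>Z_half\<close> over the integers and for a
  module restricted along \<open>unit_sq_red\<close>.\<close>

locale tensor_product =
 fixes R :: "('r, 'k) ring_scheme" and S :: "('s, 'l) ring_scheme"
  and T :: "('s, 'x, 'm) module_scheme" and \<rho> :: "'x => 'r => 'x"
  and Y :: "('r, 'y, 'n) module_scheme"
 assumes T: "module S T" and Y: "abelian_group Y"
  and \<rho>_closed: "!!x r. x \<in> carrier T ==> r \<in> carrier R ==> \<rho> x r \<in> carrier T"
  and \<rho>_smult: "!!s x r. s \<in> carrier S ==> x \<in> carrier T ==> r \<in> carrier R ==> s \<odot>\<^sub>T \<rho> x r = \<rho> (s \<odot>\<^sub>T x) r"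
  and smult_Y: "!!r y. r \<in> carrier R ==> y \<in> carrier Y ==> r \<odot>\<^sub>Y y \<in> carrier Y"
begin

sublocale T: module S T by (rule T)
sublocale Y: abelian_group Y by (rule Y)

lemma pair_simps:
 "carrier (pair_module T Y) = {c. Poly_Mapping.keys c \<subseteq> carrier T \<times> carrier Y}"
 "ring.add (pair_module T Y) = (+)"
 "ring.zero (pair_module T Y) = 0"
 "s \<odot>\<^sub>(pair_module T Y) c = frag_extend (\<lambda>(x, y). frag_of (s \<odot>\<^sub>T x, y)) c" by (simp_all add: pair_module_def)

lemma pair_abelian: "abelian_group (pair_module T Y)" by (rule frag_abelian_group) (simp_all add: pair_simps)

lemma pair_minus: "b \<in> carrier (pair_module T Y) ==> a -.\<^sub>(pair_module T Y) b = a - b"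
 by (simp add: a_minus_def frag_a_inv[OF pair_simps(1-3)]) (simp add: pair_simps)

lemma pair_frag: "x \<in> carrier T ==> y \<in> carrier Y ==> frag_of (x, y) \<in> carrier (pair_module T Y)" by (simp add: pair_simps)

lemma pair_diff: "a \<in> carrier (pair_module T Y) ==> b \<in> carrier (pair_module T Y) ==> a - b \<in> carrier (pair_module T Y)"
 using keys_diff[of a b] by (auto simp: pair_simps)

lemma tensor_rels_closed: "tensor_rels R T \<rho> Y \<subseteq> carrier (pair_module T Y)" unfolding tensor_rels_def
 by (auto intro!: pair_diff pair_frag \<rho>_closed smult_Y)

lemma tensor_sub_additive: "additive_subgroup (tensor_sub R T \<rho> Y) (pair_module T Y)"
proof -
 interpret P: abelian_group "pair_module T Y" by (rule pair_abelian)
 show ?thesis unfolding tensor_sub_def additive_subgroup_def by (rule P.add.generate_is_subgroup) (use tensor_rels_closed in simp)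
qed

lemma tensor_sub_least:
 assumes "additive_subgroup H (pair_module T Y)" "tensor_rels R T \<rho> Y \<subseteq> H"
 shows "tensor_sub R T \<rho> Y \<subseteq> H"
proof -
 interpret P: abelian_group "pair_module T Y" by (rule pair_abelian)
 show ?thesis unfolding tensor_sub_def by (rule P.add.generate_subgroup_incl) (use assms additive_subgroup.a_subgroup in auto)
qed

lemma tensor_rels_sub: "tensor_rels R T \<rho> Y \<subseteq> tensor_sub R T \<rho> Y" unfolding tensor_sub_def by (auto intro: generate.incl)

lemma pair_smult_closed:
 assumes "s \<in> carrier S"
 shows "add_map (pair_module T Y) (pair_module T Y) (\<lambda>c. s \<odot>\<^sub>(pair_module T Y) c)"
proof (rule add_mapI)
 fix c assume c: "c \<in> carrier (pair_module T Y)"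
 then show "s \<odot>\<^sub>(pair_module T Y) c \<in> carrier (pair_module T Y)"
  using keys_frag_extend[of "\<lambda>(x, y). frag_of (s \<odot>\<^sub>T x, y)" c] assms by (fastforce simp: pair_simps)
qed (simp add: pair_simps frag_extend_add)

lemma pair_smult_diff: "s \<odot>\<^sub>(pair_module T Y) (a - b) = s \<odot>\<^sub>(pair_module T Y) a - s \<odot>\<^sub>(pair_module T Y) b"
 by (simp add: pair_simps frag_extend_diff)

lemma pair_smult_frag: "s \<odot>\<^sub>(pair_module T Y) frag_of (x, y) = frag_of (s \<odot>\<^sub>T x, y)" by (simp add: pair_simps)

text \<open>Multiplication by s maps each of the three families of relations into itself, so the
  preimage of the subgroup they generate contains them all.\<close>

lemma tensor_sub_smult:
 assumes "s \<in> carrier S" "h \<in> tensor_sub R T \<rho> Y"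
 shows "s \<odot>\<^sub>(pair_module T Y) h \<in> tensor_sub R T \<rho> Y"
proof -
 let ?H = "{c \<in> carrier (pair_module T Y). s \<odot>\<^sub>(pair_module T Y) c \<in> tensor_sub R T \<rho> Y}"
 have H: "additive_subgroup ?H (pair_module T Y)"
  by (rule additive_subgroup_kernel[OF pair_abelian pair_abelian pair_smult_closed[OF assms(1)] tensor_sub_additive])
 have "s \<odot>\<^sub>(pair_module T Y) c \<in> tensor_rels R T \<rho> Y" if "c \<in> tensor_rels R T \<rho> Y" for c
 proof -
  from that consider x x' y where "c = frag_of (x +.\<^sub>T x', y) - frag_of (x, y) - frag_of (x', y)"
    "x \<in> carrier T" "x' \<in> carrier T" "y \<in> carrier Y"
   | x y y' where "c = frag_of (x, y +.\<^sub>Y y') - frag_of (x, y) - frag_of (x, y')"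
    "x \<in> carrier T" "y \<in> carrier Y" "y' \<in> carrier Y"
   | x r y where "c = frag_of (\<rho> x r, y) - frag_of (x, r \<odot>\<^sub>Y y)"
    "x \<in> carrier T" "r \<in> carrier R" "y \<in> carrier Y" unfolding tensor_rels_def by blast
  then show ?thesis
  proof cases
   case 1
   then have "s \<odot>\<^sub>(pair_module T Y) c = frag_of (s \<odot>\<^sub>T x +.\<^sub>T s \<odot>\<^sub>T x', y) - frag_of (s \<odot>\<^sub>T x, y) - frag_of (s \<odot>\<^sub>T x', y)"
    using assms(1) by (simp add: pair_smult_diff pair_smult_frag T.smult_r_distr)
   then show ?thesis unfolding tensor_rels_def using 1 T.smult_closed[OF assms(1)] by blast
  next
   case 2
   then have "s \<odot>\<^sub>(pair_module T Y) c = frag_of (s \<odot>\<^sub>T x, y +.\<^sub>Y y') - frag_of (s \<odot>\<^sub>T x, y) - frag_of (s \<odot>\<^sub>T x, y')"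
    by (simp add: pair_smult_diff pair_smult_frag)
   then show ?thesis unfolding tensor_rels_def using 2 T.smult_closed[OF assms(1)] by blast
  next
   case 3
   then have "s \<odot>\<^sub>(pair_module T Y) c = frag_of (\<rho> (s \<odot>\<^sub>T x) r, y) - frag_of (s \<odot>\<^sub>T x, r \<odot>\<^sub>Y y)"
    using \<rho>_smult[OF assms(1)] by (simp add: pair_smult_diff pair_smult_frag)
   then show ?thesis unfolding tensor_rels_def using 3 T.smult_closed[OF assms(1)] by blast
  qed
 qed
 then have "tensor_rels R T \<rho> Y \<subseteq> ?H" using tensor_rels_closed tensor_rels_sub by (intro subsetI CollectI conjI) (blast+)
 from tensor_sub_least[OF H this] show ?thesis using assms(2) by blast
qed

abbreviation "TT \<equiv> tensor R T \<rho> Y"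
abbreviation "pt \<equiv> pure_tensor R T \<rho> Y"
abbreviation "tcos \<equiv> (\<lambda>c. tensor_sub R T \<rho> Y +>\<^sub>(pair_module T Y) c)"

lemma tensor_abelian: "abelian_group TT" unfolding tensor_def by (rule abelian_group_quotient_module[OF pair_abelian tensor_sub_additive])

lemma tensor_smult_coset:
 "s \<in> carrier S ==> c \<in> carrier (pair_module T Y) ==> s \<odot>\<^sub>TT tcos c = tcos (s \<odot>\<^sub>(pair_module T Y) c)"
 unfolding tensor_def by (rule smult_quotient_module[OF pair_abelian tensor_sub_additive pair_smult_closed tensor_sub_smult])

lemma tensor_add_coset:
 "c \<in> carrier (pair_module T Y) ==> d \<in> carrier (pair_module T Y) ==> tcos c +.\<^sub>TT tcos d = tcos (c + d)" unfolding tensor_def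
 using add_quotient_module[OF pair_abelian tensor_sub_additive] by (simp add: pair_simps(2))

lemma tensor_carrier: "carrier TT = tcos ` carrier (pair_module T Y)" unfolding tensor_def by (rule carrier_quotient_module)

lemma cos_eq_iff:
 "c \<in> carrier (pair_module T Y) ==> d \<in> carrier (pair_module T Y) ==> tcos c = tcos d \<longleftrightarrow> c - d \<in> tensor_sub R T \<rho> Y"
 using abelian_subgroup.a_rcos_eq_iff[OF abelian_subgroup_of[OF pair_abelian tensor_sub_additive]] by (simp add: pair_minus)

lemma pt_closed: "x \<in> carrier T ==> y \<in> carrier Y ==> pt x y \<in> carrier TT" by (auto simp: pure_tensor_def tensor_carrier pair_frag)

lemma pair_add: "a \<in> carrier (pair_module T Y) ==> b \<in> carrier (pair_module T Y) ==> a + b \<in> carrier (pair_module T Y)"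
 using keys_add[of a b] by (auto simp: pair_simps)

lemma pt_add_left:
 assumes "x \<in> carrier T" "x' \<in> carrier T" "y \<in> carrier Y"
 shows "pt (x +.\<^sub>T x') y = pt x y +.\<^sub>TT pt x' y"
proof -
 have "frag_of (x +.\<^sub>T x', y) - (frag_of (x, y) + frag_of (x', y)) \<in> tensor_rels R T \<rho> Y"
  unfolding tensor_rels_def diff_diff_eq[symmetric] using assms by blast
 then show ?thesis using assms tensor_rels_sub by (auto simp: pure_tensor_def tensor_add_coset cos_eq_iff pair_frag pair_add)
qed

lemma pt_add_right:
 assumes "x \<in> carrier T" "y \<in> carrier Y" "y' \<in> carrier Y"
 shows "pt x (y +.\<^sub>Y y') = pt x y +.\<^sub>TT pt x y'"
proof -
 have "frag_of (x, y +.\<^sub>Y y') - (frag_of (x, y) + frag_of (x, y')) \<in> tensor_rels R T \<rho> Y"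
  unfolding tensor_rels_def diff_diff_eq[symmetric] using assms by blast
 then show ?thesis using assms tensor_rels_sub by (auto simp: pure_tensor_def tensor_add_coset cos_eq_iff pair_frag pair_add)
qed

lemma pt_balanced:
 assumes "x \<in> carrier T" "r \<in> carrier R" "y \<in> carrier Y"
 shows "pt (\<rho> x r) y = pt x (r \<odot>\<^sub>Y y)"
proof -
 have "frag_of (\<rho> x r, y) - frag_of (x, r \<odot>\<^sub>Y y) \<in> tensor_rels R T \<rho> Y" unfolding tensor_rels_def using assms by blast
 then show ?thesis using assms tensor_rels_sub by (auto simp: pure_tensor_def cos_eq_iff pair_frag \<rho>_closed smult_Y)
qed

lemma pt_smult: "s \<in> carrier S ==> x \<in> carrier T ==> y \<in> carrier Y ==> s \<odot>\<^sub>TT pt x y = pt (s \<odot>\<^sub>T x) y"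
 by (simp add: pure_tensor_def tensor_smult_coset pair_frag pair_smult_frag)

lemma pt_add_maps:
 "y \<in> carrier Y ==> add_map T TT (\<lambda>x. pt x y)"
 "x \<in> carrier T ==> add_map Y TT (\<lambda>y. pt x y)" by (auto intro!: add_mapI pt_closed simp: pt_add_left pt_add_right)

lemma tensor_subgroup_full:
 assumes "additive_subgroup H TT" "!!x y. x \<in> carrier T ==> y \<in> carrier Y ==> pt x y \<in> H"
 shows "carrier TT \<subseteq> H"
proof
 interpret TT: abelian_group TT by (rule tensor_abelian)
 fix z assume "z \<in> carrier TT"
 then obtain c where c: "z = tcos c" "Poly_Mapping.keys c \<subseteq> carrier T \<times> carrier Y" by (auto simp: tensor_carrier pair_simps)
 have "tcos c \<in> H" using c(2)
 proof (induction c rule: frag_induct_on)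
  case zero
  have "tcos 0 = \<zero>\<^sub>TT" unfolding tensor_def by (subst proj_eq_zero_iff[OF pair_abelian tensor_sub_additive])
    (use additive_subgroup.zero_closed[OF tensor_sub_additive] in \<open>simp_all add: pair_simps\<close>)
  then show ?case using additive_subgroup.zero_closed[OF assms(1)] by simp
 next
  case (gen p)
  then show ?case using assms(2) by (cases p) (auto simp: pure_tensor_def)
 next
  case (diff a b)
  then have ab: "a \<in> carrier (pair_module T Y)" "b \<in> carrier (pair_module T Y)" by (auto simp: pair_simps)
  have "tcos (a - b) = tcos a -.\<^sub>TT tcos b" using add_map_minus[OF pair_abelian tensor_abelian _ ab]
    proj_add_map[OF pair_abelian tensor_sub_additive] ab by (simp add: tensor_def pair_minus)
  then show ?case using diff additive_subgroup.a_closed[OF assms(1)] additive_subgroup.a_inv_closed[OF assms(1)] by (simp add: a_minus_def)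
 qed
 then show "z \<in> H" using c by simp
qed

lemma tensor_induct [consumes 1, case_names zero tensor add]:
 assumes "z \<in> carrier TT" "P \<zero>\<^sub>TT" "!!x y. x \<in> carrier T ==> y \<in> carrier Y ==> P (pt x y)"
  and "!!a b. a \<in> carrier TT ==> b \<in> carrier TT ==> P a ==> P b ==> P (a +.\<^sub>TT b)"
 shows "P z"
proof -
 interpret TT: abelian_group TT by (rule tensor_abelian)
 have pneg: "-.\<^sub>TT pt x y = pt (-.\<^sub>T x) y" if "x \<in> carrier T" "y \<in> carrier Y" for x y
  using add_map_neg[OF T.abelian_group_axioms tensor_abelian pt_add_maps(1)[OF that(2)] that(1)] by simp
 have mz: "-.\<^sub>TT \<zero>\<^sub>TT = \<zero>\<^sub>TT" by (rule TT.minus_equality) simp_all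
 \<comment> \<open>The rule has no case for negatives. Carrying P(-a) along makes the set a
   subgroup, and the negative of a pure tensor is again pure.\<close>
 have "additive_subgroup {a \<in> carrier TT. P a \<and> P (-.\<^sub>TT a)} TT"
  by (rule additive_subgroupI'[OF tensor_abelian]) (use assms(2,4) in \<open>auto simp: TT.minus_add mz\<close>)
 from tensor_subgroup_full[OF this] have "carrier TT \<subseteq> {a \<in> carrier TT. P a \<and> P (-.\<^sub>TT a)}"
  using pt_closed assms(3) pneg by simp
 from subsetD[OF this assms(1)] show ?thesis by simp
qed

text \<open>Additivity in the scalar comes from the relation in the left factor, so it is checked on
  pure tensors. That the unit acts as the identity is already true on
  \<open>pair_module\<close>.\<close>

lemma tensor_module: "module S TT"
proof (rule moduleI[OF T.is_cring tensor_abelian])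
 have cl: "s \<odot>\<^sub>TT tcos c \<in> carrier TT" if "s \<in> carrier S" "c \<in> carrier (pair_module T Y)" for s c
  using that add_map_closed[OF pair_smult_closed[OF that(1)]] by (simp add: tensor_smult_coset) (simp add: tensor_carrier)
 show clo: "s \<odot>\<^sub>TT z \<in> carrier TT" if "s \<in> carrier S" "z \<in> carrier TT" for s z using that cl by (auto simp: tensor_carrier)
 show dist: "s \<odot>\<^sub>TT (z +.\<^sub>TT w) = s \<odot>\<^sub>TT z +.\<^sub>TT s \<odot>\<^sub>TT w"
  if "s \<in> carrier S" "z \<in> carrier TT" "w \<in> carrier TT" for s z w
 proof -
  from that obtain c d where *: "z = tcos c" "w = tcos d" "c \<in> carrier (pair_module T Y)" "d \<in> carrier (pair_module T Y)"
   by (auto simp: tensor_carrier)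
  then show ?thesis using that(1) add_map_closed[OF pair_smult_closed[OF that(1)]] pair_add
   by (simp add: tensor_add_coset tensor_smult_coset) (simp add: pair_simps frag_extend_add)
 qed
 interpret TT: abelian_group TT by (rule tensor_abelian)
 have z: "s \<odot>\<^sub>TT \<zero>\<^sub>TT = \<zero>\<^sub>TT" if "s \<in> carrier S" for s
 proof -
  have "s \<odot>\<^sub>TT \<zero>\<^sub>TT +.\<^sub>TT s \<odot>\<^sub>TT \<zero>\<^sub>TT = s \<odot>\<^sub>TT \<zero>\<^sub>TT"
   using dist[OF that, of "\<zero>\<^sub>TT" "\<zero>\<^sub>TT"] by simp
  then show ?thesis using clo[OF that TT.zero_closed] by (simp add: TT.add.l_cancel_one)
 qed
 fix s t z assume s: "s \<in> carrier S" and t: "t \<in> carrier S" and zz: "z \<in> carrier TT"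
 show "(s +.\<^sub>S t) \<odot>\<^sub>TT z = s \<odot>\<^sub>TT z +.\<^sub>TT t \<odot>\<^sub>TT z" using zz
 proof (induction z rule: tensor_induct)
  case (add a b)
  then show ?case using s t by (simp add: dist clo TT.a_ac)
 qed (use s t in \<open>simp_all add: z pt_smult T.smult_l_distr pt_add_left\<close>)
 show "s *.\<^sub>S t \<odot>\<^sub>TT z = s \<odot>\<^sub>TT (t \<odot>\<^sub>TT z)" using zz by (induction z rule: tensor_induct)
   (use s t in \<open>simp_all add: z pt_smult T.smult_assoc1 dist clo\<close>)
next
 interpret TT: abelian_group TT by (rule tensor_abelian)
 fix z assume "z \<in> carrier TT"
 then obtain c where c: "z = tcos c" "c \<in> carrier (pair_module T Y)" by (auto simp: tensor_carrier)
 have "\<one>\<^sub>S \<odot>\<^sub>(pair_module T Y) c = c" using c(2) unfolding pair_simps(1) mem_Collect_eq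
  by (induction c rule: frag_induct_on) (auto simp: pair_simps(4) frag_extend_diff)
 then show "\<one>\<^sub>S \<odot>\<^sub>TT z = z" using c by (simp add: tensor_smult_coset)
qed

lemma tensor_lift:
 assumes "abelian_group W" "!!y. y \<in> carrier Y ==> add_map T W (\<lambda>x. f x y)"
  and "!!x. x \<in> carrier T ==> add_map Y W (f x)"
  and "!!x r y. x \<in> carrier T ==> r \<in> carrier R ==> y \<in> carrier Y ==> f (\<rho> x r) y = f x (r \<odot>\<^sub>Y y)"
 obtains h where "add_map TT W h" "!!x y. x \<in> carrier T ==> y \<in> carrier Y ==> h (pt x y) = f x y"
proof -
 interpret W: abelian_group W by fact
 note fc = add_map_closed[OF assms(2)]
 obtain g where g: "add_map (pair_module T Y) W g"
  "!!p. p \<in> carrier T \<times> carrier Y ==> g (frag_of p) = (\<lambda>(x, y). f x y) p"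
  using frag_lift[of W "carrier T \<times> carrier Y" "\<lambda>(x, y). f x y" "pair_module T Y"] assms(1) fc by (auto simp: pair_simps)
 have gd: "g (a - b) = g a -.\<^sub>W g b" if "a \<in> carrier (pair_module T Y)" "b \<in> carrier (pair_module T Y)" for a b
  using add_map_minus[OF pair_abelian assms(1) g(1) that] that by (simp add: pair_minus)
 have "additive_subgroup {c \<in> carrier (pair_module T Y). g c \<in> {\<zero>\<^sub>W}} (pair_module T Y)"
  by (rule additive_subgroup_kernel[OF pair_abelian assms(1) g(1) zero_additive_subgroup[OF assms(1)]])
 moreover have "g c = \<zero>\<^sub>W" if c: "c \<in> tensor_rels R T \<rho> Y" for c
 proof -
  from that consider x x' y where "c = frag_of (x +.\<^sub>T x', y) - frag_of (x, y) - frag_of (x', y)"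
    "x \<in> carrier T" "x' \<in> carrier T" "y \<in> carrier Y"
   | x y y' where "c = frag_of (x, y +.\<^sub>Y y') - frag_of (x, y) - frag_of (x, y')"
    "x \<in> carrier T" "y \<in> carrier Y" "y' \<in> carrier Y"
   | x r y where "c = frag_of (\<rho> x r, y) - frag_of (x, r \<odot>\<^sub>Y y)"
    "x \<in> carrier T" "r \<in> carrier R" "y \<in> carrier Y" unfolding tensor_rels_def by blast
  then show ?thesis
  proof cases
   case 1
   then show ?thesis using fc add_map_add[OF assms(2)]
    by (simp add: gd pair_frag pair_diff g(2)) (simp add: a_minus_def W.a_ac W.r_neg W.r_neg1 W.r_neg2)
  next
   case 2
   then show ?thesis using fc add_map_add[OF assms(3)]
    by (simp add: gd pair_frag pair_diff g(2)) (simp add: a_minus_def W.a_ac W.r_neg W.r_neg1 W.r_neg2)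
  next
   case 3
   then show ?thesis using fc assms(4) by (simp add: gd pair_frag pair_diff g(2) \<rho>_closed smult_Y) (simp add: a_minus_def W.r_neg smult_Y)
  qed
 qed
 ultimately have ker: "tensor_sub R T \<rho> Y \<subseteq> {c \<in> carrier (pair_module T Y). g c \<in> {\<zero>\<^sub>W}}"
  by (intro tensor_sub_least) (use tensor_rels_closed in auto)
 have "g c = \<zero>\<^sub>W" if "c \<in> tensor_sub R T \<rho> Y" for c using subsetD[OF ker that] by simp
 from quotient_lift[OF pair_abelian tensor_sub_additive assms(1) g(1) this]
 obtain h where "add_map TT W h" "!!c. c \<in> carrier (pair_module T Y) ==> h (tcos c) = g c" unfolding tensor_def by blast
 then show ?thesis by (intro that[of h]) (auto simp: pure_tensor_def pair_frag g(2))
qed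

lemma tensor_eq:
 assumes "abelian_group W" "add_map TT W h" "add_map TT W h'"
  and "!!x y. x \<in> carrier T ==> y \<in> carrier Y ==> h (pt x y) = h' (pt x y)" "z \<in> carrier TT"
 shows "h z = h' z" using assms(5)
proof (induction z rule: tensor_induct)
 case zero
 then show ?case using add_map_zero[OF tensor_abelian assms(1,2)] add_map_zero[OF tensor_abelian assms(1,3)] by simp
qed (use assms(4) add_map_add[OF assms(2)] add_map_add[OF assms(3)] in auto)

lemma tensor_mod_lift:
 assumes "module S W" "!!y. y \<in> carrier Y ==> add_map T W (\<lambda>x. f x y)"
  and "!!x. x \<in> carrier T ==> add_map Y W (f x)"
  and "!!x r y. x \<in> carrier T ==> r \<in> carrier R ==> y \<in> carrier Y ==> f (\<rho> x r) y = f x (r \<odot>\<^sub>Y y)"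
  and "!!s x y. s \<in> carrier S ==> x \<in> carrier T ==> y \<in> carrier Y ==> f (s \<odot>\<^sub>T x) y = s \<odot>\<^sub>W f x y"
 obtains h where "h \<in> mod_hom S TT W" "!!x y. x \<in> carrier T ==> y \<in> carrier Y ==> h (pt x y) = f x y"
proof -
 interpret W: module S W by fact
 obtain h where h: "add_map TT W h" "!!x y. x \<in> carrier T ==> y \<in> carrier Y ==> h (pt x y) = f x y"
  using tensor_lift[OF W.abelian_group_axioms assms(2-4)] by blast
 have "h (s \<odot>\<^sub>TT z) = s \<odot>\<^sub>W h z" if "s \<in> carrier S" "z \<in> carrier TT" for s z
  by (rule tensor_eq[OF W.abelian_group_axioms, of "\<lambda>z. h (s \<odot>\<^sub>TT z)" "\<lambda>z. s \<odot>\<^sub>W h z"])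
   (use that in \<open>auto intro!: add_map_comp[OF add_map_smult[OF tensor_module] h(1)]
    add_map_comp[OF h(1) add_map_smult[OF assms(1)]] simp: h(2) pt_smult assms(5)\<close>)
 then have "restrict h (carrier TT) \<in> mod_hom S TT W" by (intro mod_hom_restrictI tensor_module h(1))
 then show ?thesis by (rule that) (simp add: h(2) pt_closed)
qed

lemma tensor_mod_hom_eq:
 assumes "module S W" "h \<in> mod_hom S TT W" "h' \<in> mod_hom S TT W"
  and "!!x y. x \<in> carrier T ==> y \<in> carrier Y ==> h (pt x y) = h' (pt x y)"
 shows "h = h'" by (rule mod_hom_eqI[OF assms(2,3)], rule tensor_eq[OF module_abelian_group[OF assms(1)]])
  (use assms in \<open>auto simp: mod_hom_add_map\<close>)

end

section \<open>Inverting two\<close>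

lemma Z_half_simps:
 "carrier Z_half = {q. \<exists>a n. q = of_int a / 2 ^ (n::nat)}" "p +.\<^sub>Z_half q = p + q" "\<zero>\<^sub>Z_half = 0"
 "m \<odot>\<^sub>Z_half q = of_int m * q" by (simp_all add: Z_half_def)

lemma Z_half_one: "1 \<in> carrier Z_half" unfolding Z_half_simps mem_Collect_eq by (rule exI[of _ 1], rule exI[of _ 0]) simp

lemma Z_half_add: "p \<in> carrier Z_half ==> q \<in> carrier Z_half ==> p + q \<in> carrier Z_half"
proof -
 assume "p \<in> carrier Z_half" "q \<in> carrier Z_half"
 then obtain a m b n where pq: "p = of_int a / 2 ^ (m::nat)" "q = of_int b / 2 ^ (n::nat)" by (auto simp: Z_half_simps)
 then have "p + q = of_int (a * 2 ^ n + b * 2 ^ m) / 2 ^ (m + n)" unfolding pq by (simp add: field_simps power_add)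
 then show ?thesis unfolding Z_half_simps by blast
qed

lemma Z_half_mult: "p \<in> carrier Z_half ==> q \<in> carrier Z_half ==> p * q \<in> carrier Z_half"
proof -
 assume "p \<in> carrier Z_half" "q \<in> carrier Z_half"
 then obtain a m b n where pq: "p = of_int a / 2 ^ (m::nat)" "q = of_int b / 2 ^ (n::nat)" by (auto simp: Z_half_simps)
 then have "p * q = of_int (a * b) / 2 ^ (m + n)" unfolding pq by (simp add: field_simps power_add)
 then show ?thesis unfolding Z_half_simps by blast
qed

lemma Z_half_int: "of_int m \<in> carrier Z_half" unfolding Z_half_simps mem_Collect_eq by (rule exI[of _ m], rule exI[of _ 0]) simp

lemma Z_half_half: "1 / 2 \<in> carrier Z_half" unfolding Z_half_simps mem_Collect_eq by (rule exI[of _ 1], rule exI[of _ 1]) simp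

lemma Z_half_abelian: "abelian_group Z_half"
proof (rule abelian_groupI)
 fix q assume q: "q \<in> carrier Z_half"
 then have "- q \<in> carrier Z_half" using Z_half_mult[OF Z_half_int[of "-1"] q] by simp
 then show "\<exists>p\<in>carrier Z_half. p +.\<^sub>Z_half q = \<zero>\<^sub>Z_half" by (rule bexI[rotated]) (simp add: Z_half_simps)
qed (use Z_half_add Z_half_int[of 0] in \<open>auto simp: Z_half_simps(2,3)\<close>)

lemma Z_half_add_pow: "q \<in> carrier Z_half ==> add_pow Z_half (m::int) q = of_int m * q"
proof -
 assume q: "q \<in> carrier Z_half"
 interpret Z: abelian_group Z_half by (rule Z_half_abelian)
 have one: "add_pow Z_half (1::int) q = q" using Z.add.int_pow_1[OF q] by simp
 have add: "add_pow Z_half (i + j) q = add_pow Z_half i q + add_pow Z_half j q" for i j :: int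
  using Z.add.int_pow_mult[OF q, of i j] by (simp add: Z_half_simps(2))
 show ?thesis
 proof (induction m rule: int_induct[of _ 0])
  case base
  then show ?case using add[of 0 0] by simp
 next
  case (step1 i)
  then show ?case using add[of i 1] one by (simp add: algebra_simps)
 next
  case (step2 i)
  then show ?case using add[of "i - 1" 1] one by (simp add: algebra_simps)
 qed
qed

lemma half_tensor_product:
 assumes "module R M"
 shows "tensor_product \<Z> R M (\<lambda>x n. add_pow M n x) Z_half"
proof -
 interpret module R M by fact
 show ?thesis
 proof (rule tensor_product.intro)
  show "s \<odot>\<^sub>M add_pow M r x = add_pow M r (s \<odot>\<^sub>M x)" if "s \<in> carrier R" "x \<in> carrier M" for s x and r :: int
   using add_map_add_pow[OF M.abelian_group_axioms M.abelian_group_axioms add_map_smult[OF assms that(1)] that(2)] .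
 qed (auto simp: assms Z_half_abelian Z_half_mult Z_half_int Z_half_simps(4) M.add.int_pow_closed)
qed

lemma half_module: "module R M ==> module R (half M)" unfolding half_def by (rule tensor_product.tensor_module[OF half_tensor_product])

lemma half_tensor_closed:
 "module R M ==> x \<in> carrier M ==> q \<in> carrier Z_half ==> half_tensor M x q \<in> carrier (half M)"
 unfolding half_def half_tensor_def by (rule tensor_product.pt_closed[OF half_tensor_product])

lemma half_tensor_add_left:
 "module R M ==> x \<in> carrier M ==> y \<in> carrier M ==> q \<in> carrier Z_half ==>
  half_tensor M (x +.\<^sub>M y) q = half_tensor M x q +.\<^sub>(half M) half_tensor M y q"
 unfolding half_def half_tensor_def by (rule tensor_product.pt_add_left[OF half_tensor_product])

lemma half_tensor_add_right:
 "module R M ==> x \<in> carrier M ==> p \<in> carrier Z_half ==> q \<in> carrier Z_half ==>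
  half_tensor M x (p + q) = half_tensor M x p +.\<^sub>(half M) half_tensor M x q" unfolding half_def half_tensor_def
 using tensor_product.pt_add_right[OF half_tensor_product] by (metis Z_half_simps(2))

lemma half_tensor_smult:
 "module R M ==> r \<in> carrier R ==> x \<in> carrier M ==> q \<in> carrier Z_half ==>
  r \<odot>\<^sub>(half M) half_tensor M x q = half_tensor M (r \<odot>\<^sub>M x) q"
 unfolding half_def half_tensor_def by (rule tensor_product.pt_smult[OF half_tensor_product])

lemma half_tensor_add_map:
 "module R M ==> q \<in> carrier Z_half ==> add_map M (half M) (\<lambda>x. half_tensor M x q)"
 "module R M ==> x \<in> carrier M ==> add_map Z_half (half M) (half_tensor M x)"
 by (auto intro!: add_mapI simp: half_tensor_closed half_tensor_add_left half_tensor_add_right Z_half_simps(2))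

lemma half_induct [consumes 2, case_names zero tensor add]:
 assumes "module R M" "z \<in> carrier (half M)" "P \<zero>\<^sub>(half M)"
  "!!x q. x \<in> carrier M ==> q \<in> carrier Z_half ==> P (half_tensor M x q)"
  "!!a b. a \<in> carrier (half M) ==> b \<in> carrier (half M) ==> P a ==> P b ==> P (a +.\<^sub>(half M) b)"
 shows "P z" using tensor_product.tensor_induct[OF half_tensor_product[OF assms(1)], of z P] assms(2-) unfolding half_def half_tensor_def by blast

lemma half_eq:
 assumes "module R M" "abelian_group W" "add_map (half M) W h" "add_map (half M) W h'"
  and "!!x q. x \<in> carrier M ==> q \<in> carrier Z_half ==> h (half_tensor M x q) = h' (half_tensor M x q)"
  and "z \<in> carrier (half M)"
 shows "h z = h' z" using tensor_product.tensor_eq[OF half_tensor_product[OF assms(1)] assms(2), of h h' z] assms(3-)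
 unfolding half_def half_tensor_def by blast

lemma half_mod_hom_eq:
 assumes "module R M" "module R W" "h \<in> mod_hom R (half M) W" "h' \<in> mod_hom R (half M) W"
  and "!!x q. x \<in> carrier M ==> q \<in> carrier Z_half ==> h (half_tensor M x q) = h' (half_tensor M x q)"
 shows "h = h'" by (rule mod_hom_eqI[OF assms(3,4)], rule half_eq[OF assms(1) module_abelian_group[OF assms(2)]])
  (use assms in \<open>auto simp: mod_hom_add_map\<close>)

lemma half_mod_lift:
 assumes "module R M" "module R W" "!!q. q \<in> carrier Z_half ==> add_map M W (\<lambda>x. f x q)"
  and "!!x. x \<in> carrier M ==> add_map Z_half W (f x)"
  and "!!s x q. s \<in> carrier R ==> x \<in> carrier M ==> q \<in> carrier Z_half ==> f (s \<odot>\<^sub>M x) q = s \<odot>\<^sub>W f x q"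
 obtains h where "h \<in> mod_hom R (half M) W"
  "!!x q. x \<in> carrier M ==> q \<in> carrier Z_half ==> h (half_tensor M x q) = f x q"
proof -
 interpret T: tensor_product \<Z> R M "\<lambda>x n. add_pow M n x" Z_half by (rule half_tensor_product[OF assms(1)])
 interpret W: module R W by fact
 have "f (add_pow M r x) q = f x (r \<odot>\<^sub>Z_half q)" if "x \<in> carrier M" "q \<in> carrier Z_half" for x q and r :: int
  using add_map_add_pow[OF T.T.M.abelian_group_axioms W.abelian_group_axioms assms(3)[OF that(2)] that(1)]
   add_map_add_pow[OF Z_half_abelian W.abelian_group_axioms assms(4)[OF that(1)] that(2)] that(2) by (simp add: Z_half_add_pow Z_half_simps(4))
 from T.tensor_mod_lift[OF assms(2), of f, OF assms(3,4) this assms(5)]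
 obtain h where "h \<in> mod_hom R T.TT W" "!!x q. x \<in> carrier M ==> q \<in> carrier Z_half ==> h (T.pt x q) = f x q" by blast
 then show ?thesis using that by (simp add: half_def half_tensor_def)
qed

lemma half_scale:
 assumes "module R M" "p \<in> carrier Z_half"
 obtains h where "h \<in> mod_hom R (half M) (half M)"
  "!!x q. x \<in> carrier M ==> q \<in> carrier Z_half ==> h (half_tensor M x q) = half_tensor M x (p * q)"
proof -
 have 1: "add_map M (half M) (\<lambda>x. half_tensor M x (p * q))" if "q \<in> carrier Z_half" for q
  by (rule half_tensor_add_map(1)[OF assms(1) Z_half_mult[OF assms(2) that]])
 have 2: "add_map Z_half (half M) (\<lambda>q. half_tensor M x (p * q))" if "x \<in> carrier M" for x using assms that
  by (intro add_mapI) (auto simp: half_tensor_closed Z_half_mult Z_half_simps(2) half_tensor_add_right distrib_left)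
 have 3: "half_tensor M (s \<odot>\<^sub>M x) (p * q) = s \<odot>\<^sub>(half M) half_tensor M x (p * q)"
  if "s \<in> carrier R" "x \<in> carrier M" "q \<in> carrier Z_half" for s x q using that assms by (simp add: half_tensor_smult Z_half_mult)
 from half_mod_lift[OF assms(1) half_module[OF assms(1)], of "\<lambda>x q. half_tensor M x (p * q)", OF 1 2 3] that
 show ?thesis by blast
qed

text \<open>Multiplication by 1/2 in the second factor is a two-sided inverse of doubling.\<close>

lemma half_halving:
 assumes "module R M"
 shows "\<exists>\<delta>\<in>mod_hom R (half M) (half M).
  (\<forall>z\<in>carrier (half M). dbl (half M) (\<delta> z) = z \<and> \<delta> (dbl (half M) z) = z)"
proof -
 interpret H: module R "half M" by (rule half_module[OF assms])
 obtain \<delta> where \<delta>: "\<delta> \<in> mod_hom R (half M) (half M)"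
  "!!x q. x \<in> carrier M ==> q \<in> carrier Z_half ==> \<delta> (half_tensor M x q) = half_tensor M x (1/2 * q)"
  using half_scale[OF assms Z_half_half] by blast
 note \<delta>a = mod_hom_add_map[OF \<delta>(1)]
 have 1: "\<delta> z +.\<^sub>(half M) \<delta> z = z" if "z \<in> carrier (half M)" for z
 proof (rule half_eq[OF assms H.abelian_group_axioms, of "\<lambda>z. \<delta> z +.\<^sub>(half M) \<delta> z" "\<lambda>z. z"])
  fix x q assume xq: "x \<in> carrier M" "q \<in> carrier Z_half"
  then have e1: "half_tensor M x (1/2 * q + 1/2 * q) = half_tensor M x (1/2 * q) +.\<^sub>(half M) half_tensor M x (1/2 * q)"
   using Z_half_mult[OF Z_half_half xq(2)] by (intro half_tensor_add_right[OF assms])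
  have e2: "1/2 * q + 1/2 * q = q" by simp
  show "\<delta> (half_tensor M x q) +.\<^sub>(half M) \<delta> (half_tensor M x q) = half_tensor M x q"
   unfolding \<delta>(2)[OF xq] e1[symmetric] e2 ..
 qed (use that \<delta>a add_map_plus[OF H.abelian_group_axioms \<delta>a \<delta>a] in \<open>auto simp: add_map_def\<close>)
 have "dbl (half M) (\<delta> z) = z \<and> \<delta> (dbl (half M) z) = z" if "z \<in> carrier (half M)" for z
  using 1[OF that] add_map_add[OF \<delta>a that that] by (simp add: dbl_def)
 then show ?thesis using \<delta>(1) by blast
qed

lemma half_dbl_inj:
 assumes "module R M" "z \<in> carrier (half M)" "w \<in> carrier (half M)" "dbl (half M) z = dbl (half M) w"
 shows "z = w"
proof -
 obtain \<delta> where "\<forall>z\<in>carrier (half M). dbl (half M) (\<delta> z) = z \<and> \<delta> (dbl (half M) z) = z"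
  using half_halving[OF assms(1)] by blast
 then have \<delta>: "!!z. z \<in> carrier (half M) ==> \<delta> (dbl (half M) z) = z" by blast
 have "z = \<delta> (dbl (half M) w)" using \<delta>[OF assms(2)] unfolding assms(4) by (rule sym)
 also have "\<dots> = w" by (rule \<delta>[OF assms(3)])
 finally show ?thesis .
qed

lemma half_two_torsion:
 assumes "module R M"
 shows "two_torsion (half M) = {\<zero>\<^sub>(half M)}"
proof -
 interpret H: module R "half M" by (rule half_module[OF assms])
 have "z = \<zero>\<^sub>(half M)" if "z \<in> carrier (half M)" "(dbl (half M) ^^ n) z = \<zero>\<^sub>(half M)" for n z using that
 proof (induction n arbitrary: z)
  case (Suc n)
  have "dbl (half M) z \<in> carrier (half M)" using Suc.prems by (simp add: dbl_def)
  then have "dbl (half M) z = \<zero>\<^sub>(half M)" using Suc by (simp add: funpow_swap1)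
  then have "dbl (half M) z = dbl (half M) \<zero>\<^sub>(half M)" by (simp add: dbl_def)
  then show ?case using half_dbl_inj[OF assms] Suc.prems by blast
 qed simp
 moreover have "(dbl (half M) ^^ 0) \<zero>\<^sub>(half M) = \<zero>\<^sub>(half M)" by simp
 ultimately show ?thesis unfolding two_torsion_def using H.M.zero_closed by blast
qed

text \<open>x (x) q equals 2x (x) q/2, so the factors 2 that kill x can be moved across one at a
  time.\<close>

lemma half_tensor_two_torsion:
 assumes "module R M" "x \<in> two_torsion M" "q \<in> carrier Z_half"
 shows "half_tensor M x q = \<zero>\<^sub>(half M)"
proof -
 interpret M: module R M by fact
 interpret H: module R "half M" by (rule half_module[OF assms(1)])
 have "half_tensor M x q = \<zero>\<^sub>(half M)"
  if "x \<in> carrier M" "(dbl M ^^ n) x = \<zero>\<^sub>M" "q \<in> carrier Z_half" for n x q using that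
 proof (induction n arbitrary: x q)
  case 0
  then show ?case using add_map_zero[OF M.abelian_group_axioms H.abelian_group_axioms half_tensor_add_map(1)[OF assms(1)]] by simp
 next
  case (Suc n)
  let ?q = "1/2 * q"
  have q: "?q \<in> carrier Z_half" using Z_half_mult[OF Z_half_half Suc.prems(3)] .
  have "dbl M x \<in> carrier M" using Suc.prems(1) by (simp add: dbl_def)
  then have "half_tensor M (dbl M x) ?q = \<zero>\<^sub>(half M)" using Suc.IH[OF _ _ q] Suc.prems(2) by (simp add: funpow_swap1)
  moreover have "half_tensor M (dbl M x) ?q = half_tensor M x (?q + ?q)"
   using half_tensor_add_left[OF assms(1) Suc.prems(1,1) q] half_tensor_add_right[OF assms(1) Suc.prems(1) q q] by (simp add: dbl_def)
  ultimately show ?case by simp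
 qed
 then show ?thesis using assms(2,3) by (auto simp: two_torsion_def)
qed

lemma half_map_spec:
 assumes "module R M" "module R N" "add_map M N f"
  and "!!r x. r \<in> carrier R ==> x \<in> carrier M ==> f (r \<odot>\<^sub>M x) = r \<odot>\<^sub>N f x"
 shows "half_map R M N f \<in> mod_hom R (half M) (half N)"
  and "!!x q. x \<in> carrier M ==> q \<in> carrier Z_half ==> half_map R M N f (half_tensor M x q) = half_tensor N (f x) q"
proof -
 have 1: "add_map M (half N) (\<lambda>x. half_tensor N (f x) q)" if "q \<in> carrier Z_half" for q
  by (rule add_map_comp[OF assms(3) half_tensor_add_map(1)[OF assms(2) that]])
 have 2: "add_map Z_half (half N) (half_tensor N (f x))" if "x \<in> carrier M" for x
  by (rule half_tensor_add_map(2)[OF assms(2) add_map_closed[OF assms(3) that]])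
 have 3: "half_tensor N (f (s \<odot>\<^sub>M x)) q = s \<odot>\<^sub>(half N) half_tensor N (f x) q"
  if "s \<in> carrier R" "x \<in> carrier M" "q \<in> carrier Z_half" for s x q
  using that assms(2,4) add_map_closed[OF assms(3)] by (simp add: half_tensor_smult)
 obtain h where h: "h \<in> mod_hom R (half M) (half N)"
  "!!x q. x \<in> carrier M ==> q \<in> carrier Z_half ==> h (half_tensor M x q) = half_tensor N (f x) q"
  using half_mod_lift[OF assms(1) half_module[OF assms(2)], of "\<lambda>x q. half_tensor N (f x) q", OF 1 2 3] by blast
 have "\<exists>!g. g \<in> mod_hom R (half M) (half N) \<and>
   (\<forall>x\<in>carrier M. \<forall>q\<in>carrier Z_half. g (half_tensor M x q) = half_tensor N (f x) q)"
  using h half_mod_hom_eq[OF assms(1) half_module[OF assms(2)]] by (intro ex1I[of _ h]) auto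
 from theI'[OF this] show "half_map R M N f \<in> mod_hom R (half M) (half N)"
  and "!!x q. x \<in> carrier M ==> q \<in> carrier Z_half ==> half_map R M N f (half_tensor M x q) = half_tensor N (f x) q"
  unfolding half_map_def[symmetric] by auto
qed

text \<open>\<open>half M\<close> carries a multiplication \<mu> p by every p in Z[1/2], so a linear
  map \<theta> on N extends by sending x (x) q to \<mu> q (\<theta> x).\<close>

lemma half_extend:
 assumes "module R N" "module R M" "add_map N (half M) \<theta>"
  and "!!r x. r \<in> carrier R ==> x \<in> carrier N ==> \<theta> (r \<odot>\<^sub>N x) = r \<odot>\<^sub>(half M) \<theta> x"
 obtains h where "h \<in> mod_hom R (half N) (half M)" "!!x. x \<in> carrier N ==> h (half_tensor N x 1) = \<theta> x"
proof -
 interpret H: module R "half M" by (rule half_module[OF assms(2)])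
 have "\<exists>h. h \<in> mod_hom R (half M) (half M) \<and>
  (\<forall>x\<in>carrier M. \<forall>q\<in>carrier Z_half. h (half_tensor M x q) = half_tensor M x (p * q))" if "p \<in> carrier Z_half" for p
  using half_scale[OF assms(2) that] by metis
 then obtain \<mu> where \<mu>: "!!p. p \<in> carrier Z_half ==> \<mu> p \<in> mod_hom R (half M) (half M)"
  "!!p x q. p \<in> carrier Z_half ==> x \<in> carrier M ==> q \<in> carrier Z_half ==> \<mu> p (half_tensor M x q) = half_tensor M x (p * q)"
  by metis
 have \<mu>add: "\<mu> (p + q) z = \<mu> p z +.\<^sub>(half M) \<mu> q z" if "p \<in> carrier Z_half" "q \<in> carrier Z_half" "z \<in> carrier (half M)" for p q z
 proof (rule half_eq[OF assms(2) H.abelian_group_axioms, of "\<mu> (p + q)" "\<lambda>z. \<mu> p z +.\<^sub>(half M) \<mu> q z"])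
  show "add_map (half M) (half M) (\<mu> (p + q))" by (rule mod_hom_add_map[OF \<mu>(1)[OF Z_half_add[OF that(1,2)]]])
  show "add_map (half M) (half M) (\<lambda>z. \<mu> p z +.\<^sub>(half M) \<mu> q z)"
   by (rule add_map_plus[OF H.abelian_group_axioms mod_hom_add_map[OF \<mu>(1)[OF that(1)]] mod_hom_add_map[OF \<mu>(1)[OF that(2)]]])
 qed (use that in \<open>auto simp: \<mu>(2) Z_half_add half_tensor_add_right[OF assms(2)] Z_half_mult distrib_right\<close>)
 have \<mu>1: "\<mu> 1 z = z" if "z \<in> carrier (half M)" for z by (rule half_eq[OF assms(2) H.abelian_group_axioms, of "\<mu> 1" "\<lambda>z. z"])
   (use that mod_hom_add_map[OF \<mu>(1)[OF Z_half_one]] in \<open>auto simp: \<mu>(2) Z_half_one add_map_def\<close>)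
 note \<theta>c = add_map_closed[OF assms(3)]
 have 1: "add_map N (half M) (\<lambda>x. \<mu> q (\<theta> x))" if "q \<in> carrier Z_half" for q
  by (rule add_map_comp[OF assms(3) mod_hom_add_map[OF \<mu>(1)[OF that]]])
 have 2: "add_map Z_half (half M) (\<lambda>q. \<mu> q (\<theta> x))" if "x \<in> carrier N" for x using that \<theta>c mod_hom_closed[OF \<mu>(1)]
  by (intro add_mapI) (auto simp: \<mu>add Z_half_simps(2))
 have 3: "\<mu> q (\<theta> (s \<odot>\<^sub>N x)) = s \<odot>\<^sub>(half M) \<mu> q (\<theta> x)"
  if "s \<in> carrier R" "x \<in> carrier N" "q \<in> carrier Z_half" for s x q
  using that \<theta>c assms(4) mod_hom_smult[OF \<mu>(1)[OF that(3)]] by simp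
 obtain h where "h \<in> mod_hom R (half N) (half M)"
  "!!x q. x \<in> carrier N ==> q \<in> carrier Z_half ==> h (half_tensor N x q) = \<mu> q (\<theta> x)"
  using half_mod_lift[OF assms(1) half_module[OF assms(2)], of "\<lambda>x q. \<mu> q (\<theta> x)", OF 1 2 3] by blast
 then show ?thesis using that[of h] Z_half_one \<mu>1 \<theta>c by simp
qed

text \<open>Since \<^term>\<open>half M\<close> is uniquely 2-divisible, only the elements \<^term>\<open>half_tensor N x 1\<close> matter.\<close>

lemma half_tensor_dbl_pow:
 assumes "module R N" "x \<in> carrier N" "q \<in> carrier Z_half"
 obtains n and m :: int where "(dbl (half N) ^^ n) (half_tensor N x q) = half_tensor N x (of_int m)"
proof -
 have "(dbl (half N) ^^ n) (half_tensor N x (of_int a / 2 ^ n)) = half_tensor N x (of_int a)" for n and a :: int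
 proof (induction n)
  case (Suc n)
  have c: "of_int a / 2 ^ Suc n \<in> carrier Z_half" unfolding Z_half_simps by blast
  have "dbl (half N) (half_tensor N x (of_int a / 2 ^ Suc n)) = half_tensor N x (of_int a / 2 ^ n)"
   using half_tensor_add_right[OF assms(1,2) c c] by (simp add: dbl_def field_simps)
  then show ?case using Suc by (simp add: funpow_swap1)
 qed simp
 moreover obtain a :: int and n where "q = of_int a / 2 ^ n" using assms(3) by (auto simp: Z_half_simps)
 ultimately show ?thesis by (intro that[of n a]) simp
qed

lemma half_mod_hom_eq1:
 assumes "module R N" "module R M" "h \<in> mod_hom R (half N) (half M)" "h' \<in> mod_hom R (half N) (half M)"
  and "!!x. x \<in> carrier N ==> h (half_tensor N x 1) = h' (half_tensor N x 1)"
 shows "h = h'"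
proof (rule half_mod_hom_eq[OF assms(1) half_module[OF assms(2)] assms(3,4)])
 fix x q assume xq: "x \<in> carrier N" "q \<in> carrier Z_half"
 interpret N: module R "half N" by (rule half_module[OF assms(1)])
 interpret M: module R "half M" by (rule half_module[OF assms(2)])
 have pow: "g ((dbl (half N) ^^ n) z) = (dbl (half M) ^^ n) (g z)"
  if "g \<in> mod_hom R (half N) (half M)" "z \<in> carrier (half N)" for g z n
 proof (induction n)
  case (Suc n)
  have "(dbl (half N) ^^ n) z \<in> carrier (half N)" using dbl_pow_facts(1)[OF N.module_axioms that(2)] .
  moreover have "g (dbl (half N) w) = dbl (half M) (g w)" if "w \<in> carrier (half N)" for w
   using mod_hom_add[OF \<open>g \<in> mod_hom R (half N) (half M)\<close> that that] by (simp add: dbl_def)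
  ultimately show ?case using Suc by simp
 qed simp
 have int: "g (half_tensor N x (of_int m)) = add_pow (half M) m (g (half_tensor N x 1))"
  if "g \<in> mod_hom R (half N) (half M)" for g and m :: int using add_map_add_pow[OF Z_half_abelian M.abelian_group_axioms
    add_map_comp[OF half_tensor_add_map(2)[OF assms(1) xq(1)] mod_hom_add_map[OF that]] Z_half_one, of m]
  by (simp add: Z_half_add_pow[OF Z_half_one])
 obtain n and m :: int where "(dbl (half N) ^^ n) (half_tensor N x q) = half_tensor N x (of_int m)"
  using half_tensor_dbl_pow[OF assms(1) xq] by blast
 note nm = this
 note c = half_tensor_closed[OF assms(1) xq]
 \<comment> \<open>Multiplied by 2^n, both sides become the same integer multiple of the common
   value at \<open>half_tensor N x 1\<close>; doubling in the target is injective and can be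
   cancelled.\<close>
 have eq: "(dbl (half M) ^^ n) (h (half_tensor N x q)) = (dbl (half M) ^^ n) (h' (half_tensor N x q))"
  unfolding pow[OF assms(3) c, symmetric] pow[OF assms(4) c, symmetric] nm int[OF assms(3)] int[OF assms(4)]
   assms(5)[OF xq(1)] ..
 have "z = w" if "z \<in> carrier (half M)" "w \<in> carrier (half M)" "(dbl (half M) ^^ n) z = (dbl (half M) ^^ n) w" for n z w using that
 proof (induction n arbitrary: z w)
  case (Suc n)
  have d: "dbl (half M) z \<in> carrier (half M)" "dbl (half M) w \<in> carrier (half M)" using Suc.prems(1,2) by (simp_all add: dbl_def)
  have "(dbl (half M) ^^ n) (dbl (half M) z) = (dbl (half M) ^^ n) (dbl (half M) w)" using Suc.prems(3) by (simp add: funpow_swap1)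
  from Suc.IH[OF d this] have "dbl (half M) z = dbl (half M) w" .
  then show ?case by (rule half_dbl_inj[OF assms(2) Suc.prems(1,2)])
 qed simp
 from this[OF mod_hom_closed[OF assms(3) c] mod_hom_closed[OF assms(4) c] eq]
 show "h (half_tensor N x q) = h' (half_tensor N x q)" .
qed

section \<open>Symbols over a field\<close>

definition nz :: "('a, 'm) ring_scheme => 'a set"
 where "nz F = carrier F - {\<zero>\<^sub>F}"

lemma nz_iff: "a \<in> nz F \<longleftrightarrow> a \<in> carrier F \<and> a ~= \<zero>\<^sub>F" by (simp add: nz_def)

lemma nz_closed [simp]: "a \<in> nz F ==> a \<in> carrier F" by (simp add: nz_iff)

context field
begin

lemma nz_one [simp]: "\<one> \<in> nz R" by (simp add: nz_iff)

lemma nz_mult [simp]: "a \<in> nz R ==> b \<in> nz R ==> a *. b \<in> nz R" by (simp add: nz_iff integral_iff)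

lemma nz_Units: "nz R = Units R" by (simp add: nz_def field_Units)

lemma nz_inv [simp]: "a \<in> nz R ==> inv a \<in> nz R" by (simp add: nz_Units)

lemma nz_r_inv: "a \<in> nz R ==> a *. inv a = \<one>" and nz_l_inv: "a \<in> nz R ==> inv a *. a = \<one>" by (simp_all add: nz_Units)

lemma nz_neg [simp]: "a \<in> nz R ==> -. a \<in> nz R" by (metis a_inv_closed add.inv_eq_1_iff nz_iff)

lemma nz_inv_unique: "a \<in> carrier R ==> b \<in> carrier R ==> a *. b = \<one> ==> inv a = b" by (rule comm_inv_char)

lemma nz_inv_inv: "a \<in> nz R ==> inv (inv a) = a" using nz_inv nz_l_inv by (intro nz_inv_unique) auto

lemma mult_cancel: "a \<in> carrier R ==> ai \<in> carrier R ==> z \<in> carrier R ==> a *. ai = \<one> ==> a *. (ai *. z) = z"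
 by (simp add: m_assoc[symmetric])

lemma nz_inv_mult: "a \<in> nz R ==> b \<in> nz R ==> inv (a *. b) = inv a *. inv b"
proof -
 assume a: "a \<in> nz R" and b: "b \<in> nz R"
 have "a *. b *. (inv a *. inv b) = (a *. inv a) *. (b *. inv b)" using a b nz_inv by (simp add: m_ac)
 then show ?thesis using a b nz_inv nz_r_inv by (intro nz_inv_unique) auto
qed

lemma nz_inv_neg: "a \<in> nz R ==> inv (-. a) = -. (inv a)" using nz_inv nz_r_inv by (intro nz_inv_unique) (auto simp: l_minus r_minus)

lemma inv_eq_one: "a \<in> nz R ==> inv a = \<one> \<longleftrightarrow> a = \<one>" using nz_inv_inv inv_one by metis

lemma one_minus_nz [simp]: "a \<in> carrier R ==> a ~= \<one> ==> \<one> -. a \<in> nz R"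
proof -
 assume a: "a \<in> carrier R" "a ~= \<one>"
 have "a = \<one>" if "\<one> -. a = \<zero>" using that a by (metis a_minus_def add.inv_closed minus_equality minus_minus one_closed)
 then show ?thesis using a by (auto simp: nz_iff)
qed

lemma one_minus_one_minus: "a \<in> carrier R ==> \<one> -. (\<one> -. a) = a" by algebra

lemma one_minus_inv:
 assumes "a \<in> nz R"
 shows "\<one> -. inv a = -. ((\<one> -. a) *. inv a)"
proof -
 have "(\<one> -. a) *. inv a = inv a -. a *. inv a" using assms nz_inv[OF assms] by (simp add: a_minus_def l_distr l_minus)
 then show ?thesis using assms nz_inv[OF assms] nz_r_inv[OF assms] by (simp add: a_minus_def minus_add a_comm)
qed

lemma one_minus_div:
 assumes "a \<in> carrier R" "c \<in> nz R"
 shows "\<one> -. a *. inv c = (c -. a) *. inv c" using assms nz_inv[OF assms(2)] nz_r_inv[OF assms(2)] by (simp add: a_minus_def l_distr l_minus)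

end

text \<open>\<open>b g x\<close> stands for \<open><g>[x]\<close>, and membership in N for
  vanishing. A type of class \<open>ab_group_add\<close> with a subgroup N takes the place of
  quotients of carriers, so that linear combinations are settled by \<open>algebra_simps\<close>.
  The five term relation is written with p = y/x and q = (1-x)/(1-y): then (1-1/x)/(1-1/y) = p q and
  \<open><1/x - 1> = <x(1-x)>\<close>, which removes all inverses.\<close>

locale symbol_system = field R for R (structure) +
 fixes b :: "'a => 'a => 't::ab_group_add" and N :: "'t set"
 assumes N0: "0 \<in> N" and Nadd: "!!s t. s \<in> N ==> t \<in> N ==> s + t \<in> N" and Nneg: "!!t. t \<in> N ==> - t \<in> N"
  and bsq: "!!g s x. g \<in> nz R ==> s \<in> nz R ==> b (g *. (s *. s)) x = b g x"
  and b1: "!!g. g \<in> nz R ==> b g \<one> \<in> N"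
  and ft: "!!g x p q. g \<in> nz R ==> x \<in> nz R ==> p \<in> nz R ==> q \<in> nz R ==> x ~= \<one> ==> x *. p ~= \<one> ==>
   \<one> -. x = q *. (\<one> -. x *. p) ==>
   b g x - b g (x *. p) + b (g *. x) p - b (g *. (x *. (\<one> -. x))) (p *. q) + b (g *. (\<one> -. x)) q \<in> N"
begin

lemma Ndiff: "s \<in> N ==> t \<in> N ==> s - t \<in> N" using Nadd[of s "- t"] Nneg by simp

lemma N_eq: "s \<in> N ==> s = t ==> t \<in> N" by simp

lemma bsqI: "g \<in> nz R ==> s \<in> nz R ==> g' = g *. (s *. s) ==> b g' x = b g x" by (simp add: bsq)

text \<open>This is \<open><g>\<close> times the element \<open>psi1\<close> at x.\<close>

definition psi :: "'a => 'a => 't"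
 where "psi g x = b g x + b (-. g) (inv x)"

lemma psi_sq: "g \<in> nz R ==> s \<in> nz R ==> g' = g *. (s *. s) ==> psi g' x = psi g x" unfolding psi_def
 using bsqI[of g s g'] bsqI[of "-. g" s "-. g'"] nz_neg[of g] by (simp add: l_minus)

lemma psi_one: "g \<in> nz R ==> psi g \<one> \<in> N" using Nadd b1 nz_neg by (simp add: psi_def)

text \<open>Add the five term relation at (x, p) with factor g to the one at (1/x, 1/p) with factor
  -g. In the second, q is replaced by p q and p q by q, and the square classes in front of them are
  exchanged too. So the last two terms cancel and the others pair up to values of
  \<open>psi\<close>.\<close>

lemma psi_cocycle0:
 assumes "g \<in> nz R" "x \<in> nz R" "p \<in> nz R" "x ~= \<one>" "x *. p ~= \<one>"
 shows "psi g x - psi g (x *. p) + psi (g *. x) p \<in> N"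
proof -
 define B where "B = \<one> -. x *. p"
 define A where "A = \<one> -. x"
 define xi where "xi = inv x"
 define pi where "pi = inv p"
 define Bi where "Bi = inv B"
 have U: "A \<in> nz R" "B \<in> nz R" "xi \<in> nz R" "pi \<in> nz R" "Bi \<in> nz R" "-. g \<in> nz R" "x *. p \<in> nz R" "g *. x \<in> nz R"
  unfolding A_def B_def xi_def pi_def Bi_def using assms by (auto intro!: one_minus_nz nz_inv nz_mult nz_neg)
 have C: "g \<in> carrier R" "x \<in> carrier R" "p \<in> carrier R" "A \<in> carrier R" "B \<in> carrier R" "xi \<in> carrier R"
  "pi \<in> carrier R" "Bi \<in> carrier R" using assms U by auto
 have I: "x *. xi = \<one>" "p *. pi = \<one>" "B *. Bi = \<one>" unfolding xi_def pi_def Bi_def using assms U by (auto intro: nz_r_inv)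
 note can = I mult_cancel[OF C(2,6) _ I(1)] mult_cancel[OF C(3,7) _ I(2)] mult_cancel[OF C(5,8) _ I(3)]
 define q where "q = A *. Bi"
 have q: "q \<in> nz R" "p *. q \<in> nz R" using U assms nz_mult by (auto simp: q_def)
 have f1: "b g x - b g (x *. p) + b (g *. x) p - b (g *. (x *. A)) (p *. q) + b (g *. A) q \<in> N" unfolding A_def
 proof (rule ft[OF assms(1-3) q(1) assms(4,5)])
  show "\<one> -. x = q *. (\<one> -. x *. p)" unfolding A_def[symmetric] B_def[symmetric] q_def using C by (simp add: m_ac can)
 qed
 have Ax: "\<one> -. xi = -. (A *. xi)" unfolding A_def xi_def by (rule one_minus_inv[OF assms(2)])
 have ixp: "inv (x *. p) = xi *. pi" unfolding xi_def pi_def by (rule nz_inv_mult[OF assms(2,3)])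
 have Bx: "\<one> -. xi *. pi = -. (B *. (xi *. pi))" using one_minus_inv[OF U(7)] by (simp add: ixp B_def)
 have f2: "b (-. g) xi - b (-. g) (xi *. pi) + b (-. g *. xi) pi - b (-. g *. (xi *. (\<one> -. xi))) (pi *. (p *. q))
   + b (-. g *. (\<one> -. xi)) (p *. q) \<in> N"
 proof (rule ft[OF U(6,3,4) q(2)])
  show "xi ~= \<one>" using assms(2,4) inv_eq_one by (simp add: xi_def)
  show "xi *. pi ~= \<one>" using assms(5) inv_eq_one[OF U(7)] by (simp add: ixp)
  show "\<one> -. xi = p *. q *. (\<one> -. xi *. pi)" unfolding Ax Bx q_def using C by (simp add: r_minus m_ac can)
 qed
 have e1: "b (-. g *. (xi *. (\<one> -. xi))) t = b (g *. A) t" for t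
  by (rule bsqI[of _ xi]) (use C U assms in \<open>auto simp: Ax l_minus r_minus m_ac nz_mult\<close>)
 have e2: "b (-. g *. (\<one> -. xi)) t = b (g *. (x *. A)) t" for t
  by (rule bsqI[of _ xi]) (use C U assms can in \<open>auto simp: Ax l_minus r_minus m_ac nz_mult\<close>)
 have e3: "b (-. g *. xi) t = b (-. (g *. x)) t" for t
  by (rule bsqI[of _ xi]) (use C U assms can in \<open>auto simp: l_minus r_minus m_ac nz_mult nz_neg\<close>)
 have e4: "pi *. (p *. q) = q" using C by (simp add: q_def m_ac can)
 show ?thesis using Nadd[OF f1 f2] by (rule N_eq) (simp add: psi_def e1 e2 e3 e4 ixp xi_def[symmetric] pi_def[symmetric] algebra_simps)
qed

end

locale big_symbol_system = symbol_system +
 assumes big: "!!c. \<exists>y\<in>nz R. y ~= \<one> \<and> y ~= c"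
begin

text \<open>This is the case x p = 1 left out of \<open>psi_cocycle0\<close>. With an auxiliary x,
  the relations leading from x to x t and from x t back to x add up to it, since g x times x is g up
  to squares.\<close>

lemma psi_inv:
 assumes "g \<in> nz R" "t \<in> nz R"
 shows "psi g t + psi (g *. t) (inv t) \<in> N"
proof -
 obtain x where x: "x \<in> nz R" "x ~= \<one>" "x ~= inv t" using big by blast
 define ti where "ti = inv t"
 have ti: "ti \<in> nz R" "t *. ti = \<one>" unfolding ti_def using assms nz_inv nz_r_inv by auto
 have xt: "x *. t ~= \<one>" using x assms nz_inv_unique[of t x] by (auto simp: m_comm)
 have C: "g \<in> carrier R" "x \<in> carrier R" "t \<in> carrier R" "ti \<in> carrier R" using assms x ti by auto
 have xtt: "x *. t *. ti = x" using C ti by (simp add: m_assoc)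
 have gx: "g *. x \<in> nz R" "x *. t \<in> nz R" "g *. t \<in> nz R" using assms x nz_mult by auto
 have 1: "psi (g *. x) x - psi (g *. x) (x *. t) + psi (g *. x *. x) t \<in> N" by (rule psi_cocycle0) (use gx x assms xt in auto)
 have 2: "psi (g *. x) (x *. t) - psi (g *. x) (x *. t *. ti) + psi (g *. x *. (x *. t)) ti \<in> N"
  by (rule psi_cocycle0) (use gx x assms xt ti xtt in auto)
 have e1: "psi (g *. x *. x) t = psi g t" by (rule psi_sq[of _ x]) (use assms x in \<open>auto simp: m_ac\<close>)
 have e2: "psi (g *. x *. (x *. t)) ti = psi (g *. t) ti" by (rule psi_sq[of _ x]) (use assms x gx in \<open>auto simp: m_ac\<close>)
 show ?thesis using Nadd[OF 1 2] by (rule N_eq) (simp add: e1 e2 xtt ti_def[symmetric])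
qed

lemma psi_cocycle:
 assumes "g \<in> nz R" "x \<in> nz R" "p \<in> nz R"
 shows "psi g x - psi g (x *. p) + psi (g *. x) p \<in> N"
proof -
 consider "x = \<one>" | "x ~= \<one>" "x *. p = \<one>" | "x ~= \<one>" "x *. p ~= \<one>" by blast
 then show ?thesis
 proof cases
  case 1
  then show ?thesis using assms psi_one by simp
 next
  case 2
  then have "p = inv x" using assms nz_inv_unique[of x p] by auto
  then show ?thesis using Ndiff[OF psi_inv[OF assms(1,2)] psi_one[OF assms(1)]] 2 by (simp add: algebra_simps)
 qed (use psi_cocycle0 assms in blast)
qed

text \<open>The cocycle relation at (a, 1/c) with factor g a; \<open>psi_inv\<close> turns its last
  term into one in c.\<close>

lemma psi_quot:
 assumes "g \<in> nz R" "a \<in> nz R" "c \<in> nz R"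
 shows "psi (g *. a) (a *. inv c) - psi (g *. a) a + psi (g *. c) c \<in> N"
proof -
 have U: "g *. a \<in> nz R" "inv c \<in> nz R" "g *. c \<in> nz R" using assms nz_mult nz_inv by auto
 have 1: "psi (g *. a) a - psi (g *. a) (a *. inv c) + psi (g *. a *. a) (inv c) \<in> N" by (rule psi_cocycle[OF U(1) assms(2) U(2)])
 have 2: "psi (g *. c) c + psi (g *. c *. c) (inv c) \<in> N" by (rule psi_inv[OF U(3) assms(3)])
 have e: "psi (g *. a *. a) (inv c) = psi g (inv c)" "psi (g *. c *. c) (inv c) = psi g (inv c)"
  by (rule psi_sq[of _ a] psi_sq[of _ c]; use assms in \<open>auto simp: m_ac\<close>)+
 show ?thesis using Ndiff[OF 2 1] by (rule N_eq) (simp add: e)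
qed

text \<open>\<open><g>\<close> times the expression that defines \<open>C_elt\<close>, with
  \<open><<1-x>>\<close> multiplied out.\<close>

definition "cel g x = b g x + b (-. g) (\<one> -. x) + (psi (g *. (\<one> -. x)) x - psi g x)"

text \<open>Replacing x, y by 1-x, 1-y turns p, q into 1/q, 1/p. Adding this second relation with
  factor -g to the first with factor g pairs the last three terms to values of \<open>psi\<close>.
  The cocycle relation expresses these through x, y, 1-x and 1-y, which separates the
  variables.\<close>

lemma cel_const:
 assumes "g \<in> nz R" "x \<in> nz R" "x ~= \<one>" "y \<in> nz R" "y ~= \<one>"
 shows "cel g x - cel g y \<in> N"
proof -
 define A where "A = \<one> -. x"
 define B where "B = \<one> -. y"
 define xi where "xi = inv x"
 define yi where "yi = inv y"
 define Ai where "Ai = inv A"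
 define Bi where "Bi = inv B"
 define p where "p = y *. xi"
 define q where "q = A *. Bi"
 have U: "A \<in> nz R" "B \<in> nz R" "xi \<in> nz R" "yi \<in> nz R" "Ai \<in> nz R" "Bi \<in> nz R" "-. g \<in> nz R"
  unfolding A_def B_def xi_def yi_def Ai_def Bi_def using assms by (auto intro!: one_minus_nz nz_inv nz_mult nz_neg)
 have C: "g \<in> carrier R" "x \<in> carrier R" "y \<in> carrier R" "A \<in> carrier R" "B \<in> carrier R" "xi \<in> carrier R"
  "yi \<in> carrier R" "Ai \<in> carrier R" "Bi \<in> carrier R" using assms U by auto
 have I: "x *. xi = \<one>" "y *. yi = \<one>" "A *. Ai = \<one>" "B *. Bi = \<one>"
  unfolding xi_def yi_def Ai_def Bi_def using assms U by (auto intro: nz_r_inv)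
 note can = I mult_cancel[OF C(2,6) _ I(1)] mult_cancel[OF C(3,7) _ I(2)] mult_cancel[OF C(4,8) _ I(3)]
  mult_cancel[OF C(5,9) _ I(4)]
 have pq: "p \<in> nz R" "q \<in> nz R" "p *. q \<in> nz R" "inv q \<in> nz R" "inv p \<in> nz R"
  using U assms nz_mult nz_inv by (auto simp: p_def q_def)
 have xp: "x *. p = y" using C by (simp add: p_def m_ac can)
 have ip: "inv p = x *. yi" using nz_inv_mult[OF assms(4) U(3)] nz_inv_inv[OF assms(2)] C by (simp add: p_def xi_def yi_def m_comm)
 have iq: "inv q = Ai *. B" using nz_inv_mult[OF U(1,6)] nz_inv_inv[OF U(2)] by (simp add: q_def Ai_def Bi_def)
 have f1: "b g x - b g (x *. p) + b (g *. x) p - b (g *. (x *. A)) (p *. q) + b (g *. A) q \<in> N" unfolding A_def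
 proof (rule ft[OF assms(1,2) pq(1,2) assms(3)])
  show "x *. p ~= \<one>" using assms xp by simp
  show "\<one> -. x = q *. (\<one> -. x *. p)" unfolding xp A_def[symmetric] B_def[symmetric] q_def using C by (simp add: m_ac can)
 qed
 have A1: "\<one> -. A = x" "\<one> -. B = y" unfolding A_def B_def using C one_minus_one_minus by auto
 have Aq: "A *. inv q = B" unfolding iq using C by (simp add: m_ac can)
 have ne: "A ~= \<one>" "B ~= \<one>" using A1 assms C by (auto simp: a_minus_def r_neg nz_iff[of \<zero>])
 have f2: "b (-. g) A - b (-. g) (A *. inv q) + b (-. g *. A) (inv q) - b (-. g *. (A *. (\<one> -. A))) (inv q *. inv p)
   + b (-. g *. (\<one> -. A)) (inv p) \<in> N"
 proof (rule ft[OF U(7,1) pq(4,5) ne(1)])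
  show "A *. inv q ~= \<one>" using Aq ne by simp
  show "\<one> -. A = inv p *. (\<one> -. A *. inv q)" unfolding Aq A1 ip using C by (simp add: m_ac can)
 qed
 have ipq: "inv (p *. q) = inv q *. inv p" using nz_inv_mult[OF pq(1,2)] pq by (simp add: m_comm)
 have s: "b g x + b (-. g) A - (b g y + b (-. g) B) + psi (g *. x) p - psi (g *. (x *. A)) (p *. q) + psi (g *. A) q \<in> N"
  using Nadd[OF f1 f2] C by (elim N_eq) (simp add: psi_def A1 Aq xp ipq l_minus m_comm[of A x] algebra_simps)
 have c1: "psi g x - psi g y + psi (g *. x) p \<in> N" using psi_cocycle[OF assms(1,2) pq(1)] by (simp add: xp)
 have c2: "psi (g *. A) q - psi (g *. A) A + psi (g *. B) B \<in> N" using psi_quot[OF assms(1) U(1,2)] by (simp add: q_def Bi_def)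
 \<comment> \<open>p q is the quotient of A/x by B/y, so this term splits into one that depends on x
   and one that depends on y.\<close>
 have c3: "psi (g *. (A *. xi)) (A *. xi *. inv (B *. yi)) - psi (g *. (A *. xi)) (A *. xi) + psi (g *. (B *. yi)) (B *. yi) \<in> N"
  by (rule psi_quot[OF assms(1)]) (use U nz_mult in auto)
 have e1: "A *. xi *. inv (B *. yi) = p *. q"
  using nz_inv_mult[OF U(2,4)] nz_inv_inv[OF assms(4)] C by (simp add: p_def q_def yi_def[symmetric] Bi_def[symmetric] m_ac)
 \<comment> \<open>Resolves the terms at A/x and B/y that \<open>c3\<close> leaves over.\<close>
 have quot: "psi (g *. (a *. inv z)) (a *. inv z) - (psi (g *. a) a - psi (g *. a) z) \<in> N"
  if a: "a \<in> nz R" and z: "z \<in> nz R" for a z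
 proof -
  define zi where "zi = inv z"
  have V: "zi \<in> nz R" "g *. a \<in> nz R" "g *. (a *. zi) \<in> nz R" using a z assms(1) nz_inv nz_mult by (auto simp: zi_def)
  have cz: "z *. zi = \<one>" using z nz_r_inv by (simp add: zi_def)
  have D: "a \<in> carrier R" "z \<in> carrier R" "zi \<in> carrier R" using a z V by auto
  note cn = cz mult_cancel[OF D(2,3) _ cz]
  have 1: "psi (g *. (a *. zi)) zi - psi (g *. (a *. zi)) (zi *. a) + psi (g *. (a *. zi) *. zi) a \<in> N" by (rule psi_cocycle[OF V(3,1) a])
  have 2: "psi (g *. a) z + psi (g *. a *. z) zi \<in> N" using psi_inv[OF V(2) z] by (simp add: zi_def)
  have e: "psi (g *. (a *. zi) *. zi) a = psi (g *. a) a" "psi (g *. (a *. zi)) zi = psi (g *. a *. z) zi"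
   by (rule psi_sq[of _ zi]; use C(1) D V nz_mult[OF V(2) z] cn in \<open>auto simp: m_ac\<close>)+
  show ?thesis using Ndiff[OF 2 1] D C(1) by (elim N_eq) (simp add: e zi_def[symmetric] m_comm[of zi a])
 qed
 have q1: "psi (g *. (A *. xi)) (A *. xi) - (psi (g *. A) A - psi (g *. A) x) \<in> N" using quot[OF U(1) assms(2)] by (simp add: xi_def)
 have q2: "psi (g *. (B *. yi)) (B *. yi) - (psi (g *. B) B - psi (g *. B) y) \<in> N" using quot[OF U(2) assms(4)] by (simp add: yi_def)
 have e2: "psi (g *. (A *. xi)) t = psi (g *. (x *. A)) t" for t
  by (rule psi_sq[of _ xi]) (use C U can assms nz_mult in \<open>auto simp: m_ac\<close>)
 have "b g x + b (-. g) A - (b g y + b (-. g) B) + psi (g *. x) p - psi (g *. (x *. A)) (p *. q) + psi (g *. A) q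
   - (psi g x - psi g y + psi (g *. x) p) - (psi (g *. A) q - psi (g *. A) A + psi (g *. B) B)
   + (psi (g *. (x *. A)) (p *. q) - psi (g *. (A *. xi)) (A *. xi) + psi (g *. (B *. yi)) (B *. yi))
   + (psi (g *. (A *. xi)) (A *. xi) - (psi (g *. A) A - psi (g *. A) x))
   - (psi (g *. (B *. yi)) (B *. yi) - (psi (g *. B) B - psi (g *. B) y)) \<in> N"
  using Ndiff[OF Nadd[OF Nadd[OF Ndiff[OF Ndiff[OF s c1] c2] c3[unfolded e1 e2[of "p *. q"]]] q1] q2] .
 then show ?thesis by (rule N_eq) (simp add: cel_def A_def[symmetric] B_def[symmetric] algebra_simps)
qed

end

text \<open>Refined scissors congruence classes modulo \<open>K1\<close> and \<open>D_mod\<close>: there \<open>2 C = 0\<close>, and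
 \<open>3 C = 0\<close> comes from the action of the permutations of order 3 of \<open>0, 1, \<infinity>\<close>.\<close>

locale big_bloch_system = big_symbol_system +
 assumes K: "!!g x. g \<in> nz R ==> x \<in> nz R ==> psi g x \<in> N"
  and D: "!!g x. g \<in> nz R ==> x \<in> nz R ==> x ~= \<one> ==>
   (b g x + b (-. g) (\<one> -. x)) + (b g x + b (-. g) (\<one> -. x)) \<in> N"
begin

text \<open>Let e(t) be \<open>[t] + <-1>[1-t]\<close>, with factor g. By \<open>cel_const\<close>
  it does not depend on t, and modulo \<open>psi\<close> it equals [t] - [1/(1-t)]. Along the cycle
  x, 1/(1-x), 1 - 1/x these differences add up to zero, so 3e = 0. Together with 2e = 0 this gives e
  = 0.\<close>

lemma b_one_minus:
 assumes "g \<in> nz R" "x \<in> nz R" "x ~= \<one>"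
 shows "b g x + b (-. g) (\<one> -. x) \<in> N"
proof -
 define ee where "ee t = b g t + b (-. g) (\<one> -. t)" for t
 have const: "ee s - ee t \<in> N" if s: "s \<in> nz R" "s ~= \<one>" and t: "t \<in> nz R" "t ~= \<one>" for s t
 proof -
  have "g *. (\<one> -. s) \<in> nz R" "g *. (\<one> -. t) \<in> nz R" using assms(1) one_minus_nz s t nz_mult by auto
  then have "cel g s - cel g t - (psi (g *. (\<one> -. s)) s - psi g s) + (psi (g *. (\<one> -. t)) t - psi g t) \<in> N"
   using s t assms(1) by (intro Nadd Ndiff cel_const K)
  then show ?thesis by (rule N_eq) (simp add: ee_def cel_def)
 qed
 have ee: "ee t - (b g t - b g (inv (\<one> -. t))) \<in> N" if t: "t \<in> nz R" "t ~= \<one>" for t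
 proof -
  have "psi g (inv (\<one> -. t)) \<in> N" using K assms(1) nz_inv[OF one_minus_nz] t by auto
  moreover have "inv (inv (\<one> -. t)) = \<one> -. t" using nz_inv_inv[OF one_minus_nz] t by auto
  ultimately show ?thesis by (elim N_eq) (simp add: ee_def psi_def)
 qed
 define A where "A = \<one> -. x"
 define xi where "xi = inv x"
 define Ai where "Ai = inv A"
 define w where "w = -. (A *. xi)"
 have U: "A \<in> nz R" "xi \<in> nz R" "Ai \<in> nz R" "w \<in> nz R"
  unfolding A_def xi_def Ai_def w_def using assms by (auto intro!: one_minus_nz nz_inv nz_mult nz_neg)
 have C: "x \<in> carrier R" "A \<in> carrier R" "xi \<in> carrier R" "Ai \<in> carrier R" "w \<in> carrier R" using U assms by auto
 have I: "x *. xi = \<one>" "A *. Ai = \<one>" unfolding xi_def Ai_def using assms U by (auto intro: nz_r_inv)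
 have w1: "w = \<one> -. xi" unfolding w_def A_def xi_def by (rule one_minus_inv[OF assms(2), symmetric])
 have "\<one> -. w = xi" unfolding w1 using C one_minus_one_minus by auto
 then have w2: "inv (\<one> -. w) = x" unfolding xi_def using nz_inv_inv[OF assms(2)] by simp
 have A1: "\<one> -. A = x" unfolding A_def using C one_minus_one_minus by auto
 have "\<one> -. Ai = -. (x *. Ai)" unfolding Ai_def using one_minus_inv[OF U(1)] A1 by simp
 moreover have "-. (x *. Ai) *. w = \<one>"
 proof -
  have "-. (x *. Ai) *. w = (x *. xi) *. (A *. Ai)" unfolding w_def using C by (simp add: l_minus r_minus m_ac)
  then show ?thesis using I by simp
 qed
 ultimately have z2: "inv (\<one> -. Ai) = w" using C by (intro nz_inv_unique) auto
 have ne: "Ai ~= \<one>" "w ~= \<one>"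
 proof -
  show "Ai ~= \<one>" unfolding Ai_def using inv_eq_one[OF U(1)] A1 assms C by (auto simp: a_minus_def r_neg nz_iff[of \<zero>])
  show "w ~= \<one>" using \<open>\<one> -. w = xi\<close> U by (auto simp: a_minus_def r_neg nz_iff[of \<zero>])
 qed
 have e1: "ee x - (b g x - b g Ai) \<in> N" using ee[OF assms(2,3)] by (simp add: A_def Ai_def)
 have e2: "ee Ai - (b g Ai - b g w) \<in> N" using ee[OF U(3) ne(1)] by (simp add: z2)
 have e3: "ee w - (b g w - b g x) \<in> N" using ee[OF U(4) ne(2)] by (simp add: w2)
 have e4: "ee x + ee x \<in> N" using D[OF assms] by (simp add: ee_def)
 have "(ee x - (b g x - b g Ai)) + (ee Ai - (b g Ai - b g w)) + (ee w - (b g w - b g x))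
   + (ee x - ee Ai) + (ee x - ee w) - (ee x + ee x) \<in> N" by (intro Nadd[OF _ const] Nadd[OF _ e2] Nadd[OF _ e3] Ndiff[OF _ e4] e1 assms U ne)
 then have "ee x \<in> N" by (rule N_eq) (simp add: algebra_simps)
 then show ?thesis by (simp add: ee_def)
qed

text \<open>Add the relation for (x, y) with factor g and the one for (1/x, y/x) with factor g x.
  The terms in y and y/x cancel. The other terms, besides the two in the claim, form pairs [s],
  <-1>[t] with t = s/(s-1), and such a pair vanishes by \<open>flip\<close>.\<close>

lemma b_inv_twist0:
 assumes "g \<in> nz R" "x \<in> nz R" "x ~= \<one>"
 shows "b g x + b (g *. x) (inv x) \<in> N"
proof -
 obtain y where y: "y \<in> nz R" "y ~= \<one>" "y ~= x" using big by blast
 define A where "A = \<one> -. x"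
 define B where "B = \<one> -. y"
 define xi where "xi = inv x"
 define p where "p = y *. xi"
 define P where "P = \<one> -. p"
 define Bi where "Bi = inv B"
 define Pi where "Pi = inv P"
 have xix: "x *. xi = \<one>" "xi \<in> carrier R" "xi \<in> nz R" unfolding xi_def using assms nz_r_inv nz_inv by auto
 have p1: "p ~= \<one>"
 proof
  assume "p = \<one>"
  then have "y *. (xi *. x) = x" using y assms xix by (simp add: p_def m_assoc[symmetric])
  then show False using y assms xix by (simp add: m_comm)
 qed
 have U: "A \<in> nz R" "B \<in> nz R" "p \<in> nz R" "P \<in> nz R" "Bi \<in> nz R" "Pi \<in> nz R" "-. g \<in> nz R" "g *. x \<in> nz R"
  unfolding A_def B_def P_def Bi_def Pi_def p_def using assms y xix p1[unfolded p_def] by (auto intro!: one_minus_nz nz_inv nz_mult nz_neg)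
 have C: "g \<in> carrier R" "x \<in> carrier R" "y \<in> carrier R" "A \<in> carrier R" "B \<in> carrier R" "xi \<in> carrier R"
  "p \<in> carrier R" "P \<in> carrier R" "Bi \<in> carrier R" "Pi \<in> carrier R" using assms y U xix by auto
 have I: "x *. xi = \<one>" "B *. Bi = \<one>" "P *. Pi = \<one>" unfolding xi_def Bi_def Pi_def using assms U by (auto intro: nz_r_inv)
 note can = I mult_cancel[OF C(2,6) _ I(1)] mult_cancel[OF C(5,9) _ I(2)] mult_cancel[OF C(8,10) _ I(3)]
 have xp: "x *. p = y" using C by (simp add: p_def m_ac can)
 define q where "q = A *. Bi"
 define r where "r = (\<one> -. xi) *. Pi"
 have xi1: "xi ~= \<one>" using inv_eq_one[OF assms(2)] assms(3) by (simp add: xi_def)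
 have qr: "q \<in> nz R" "r \<in> nz R" "p *. q \<in> nz R" "y *. r \<in> nz R"
  using U y one_minus_nz[OF C(6) xi1] nz_mult by (auto simp: q_def r_def)
 have f1: "b g x - b g (x *. p) + b (g *. x) p - b (g *. (x *. A)) (p *. q) + b (g *. A) q \<in> N" unfolding A_def
 proof (rule ft[OF assms(1,2) U(3) qr(1) assms(3)])
  show "x *. p ~= \<one>" using y xp by simp
  show "\<one> -. x = q *. (\<one> -. x *. p)" unfolding xp A_def[symmetric] B_def[symmetric] q_def using C by (simp add: m_ac can)
 qed
 have xiy: "xi *. y = p" using C by (simp add: p_def m_comm)
 have f2: "b (g *. x) xi - b (g *. x) (xi *. y) + b (g *. x *. xi) y - b (g *. x *. (xi *. (\<one> -. xi))) (y *. r)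
   + b (g *. x *. (\<one> -. xi)) r \<in> N"
 proof (rule ft[OF U(8) xix(3) y(1) qr(2) xi1])
  show "xi *. y ~= \<one>" using xiy p1 by simp
  show "\<one> -. xi = r *. (\<one> -. xi *. y)" unfolding xiy P_def[symmetric] r_def using C by (simp add: m_ac can)
 qed
 have Ax: "\<one> -. xi = -. (A *. xi)" unfolding A_def xi_def by (rule one_minus_inv[OF assms(2)])
 have g1: "b (g *. x *. xi) t = b g t" for t using C by (simp add: m_assoc can)
 have g2: "b (g *. x *. (xi *. (\<one> -. xi))) t = b (-. (g *. (x *. A))) t" for t
  by (rule bsqI[of _ xi]) (use C U can assms xix nz_mult in \<open>auto simp: Ax l_minus r_minus m_ac intro!: nz_neg nz_mult\<close>)
 have g3: "g *. x *. (\<one> -. xi) = -. (g *. A)" using C by (simp add: Ax r_minus m_ac can)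
 have xip: "x -. x *. p = x *. P" unfolding P_def using C by algebra
 have BA: "B -. A = x *. P"
 proof -
  have "B -. A = x -. x *. p" unfolding A_def B_def xp[symmetric] using C by algebra
  then show ?thesis using xip by simp
 qed
 have q1: "\<one> -. q = x *. P *. Bi" unfolding q_def Bi_def one_minus_div[OF C(4) U(2)] BA ..
 have r1: "\<one> -. r = xi *. B *. Pi"
 proof -
  have "P -. (\<one> -. xi) = xi *. B"
  proof -
   have "P -. (\<one> -. xi) = xi -. y *. xi" unfolding P_def p_def using C by algebra
   also have "\<dots> = xi *. B" unfolding B_def using C by algebra
   finally show ?thesis .
  qed
  then show ?thesis unfolding r_def Pi_def using one_minus_div[of "\<one> -. xi", OF _ U(4)] C by simp
 qed
 have "(\<one> -. q) *. (\<one> -. r) = \<one>" unfolding q1 r1 using C by (simp add: m_ac can)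
 then have iq: "inv (\<one> -. q) = \<one> -. r" using qr by (intro nz_inv_unique) auto
 have pq1: "\<one> -. p *. q = P *. Bi"
 proof -
  have "B -. p *. A = P" unfolding A_def B_def P_def xp[symmetric] using C by algebra
  moreover have "p *. q = p *. A *. inv B" unfolding q_def Bi_def using C U nz_inv by (simp add: m_assoc)
  ultimately show ?thesis using one_minus_div[of "p *. A", OF _ U(2)] C by (simp add: Bi_def)
 qed
 have yr1: "\<one> -. y *. r = B *. Pi"
 proof -
  have "P -. y *. (\<one> -. xi) = B" unfolding P_def p_def B_def using C by algebra
  moreover have "y *. r = y *. (\<one> -. xi) *. inv P" unfolding r_def Pi_def using C U nz_inv by (simp add: m_assoc)
  ultimately show ?thesis using one_minus_div[of "y *. (\<one> -. xi)", OF _ U(4)] C by (simp add: Pi_def)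
 qed
 have "(\<one> -. p *. q) *. (\<one> -. y *. r) = \<one>" unfolding pq1 yr1 using C by (simp add: m_ac can)
 then have ipq: "inv (\<one> -. p *. q) = \<one> -. y *. r" using qr C by (intro nz_inv_unique) auto
 \<comment> \<open>From s pass to its complement, invert, and pass to the complement again: two uses
   of \<open>b_one_minus\<close> and one of \<open>psi\<close>.\<close>
 have flip: "b h s + b (-. h) t \<in> N"
  if h: "h \<in> nz R" and s: "s \<in> nz R" "s ~= \<one>" and t: "t \<in> nz R" "t ~= \<one>" and st: "inv (\<one> -. s) = \<one> -. t" for h s t
 proof -
  have "\<one> -. s \<in> nz R" using one_minus_nz s by auto
  then have k: "psi (-. h) (\<one> -. s) \<in> N" using K h by simp
  have t1: "\<one> -. t ~= \<one>" using one_minus_one_minus[of t] t by (auto simp: a_minus_def r_neg nz_iff[of \<zero>])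
  have "b h (\<one> -. t) + b (-. h) (\<one> -. (\<one> -. t)) \<in> N" by (rule b_one_minus[OF h _ t1]) (use t in simp)
  from Nadd[OF Ndiff[OF b_one_minus[OF h s] k] this]
  have "b h s + b (-. h) (\<one> -. s) - psi (-. h) (\<one> -. s) + (b h (\<one> -. t) + b (-. h) (\<one> -. (\<one> -. t))) \<in> N" .
  then show ?thesis using h t by (elim N_eq) (simp add: psi_def st one_minus_one_minus)
 qed
 have ne1: "s ~= \<one>" if "\<one> -. s \<in> nz R" "s \<in> carrier R" for s using that by (auto simp: a_minus_def r_neg nz_iff[of \<zero>])
 have h1: "b (g *. A) q + b (-. (g *. A)) r \<in> N"
 proof (rule flip[OF _ qr(1) _ qr(2) _ iq])
  show "q ~= \<one>" by (rule ne1) (use q1 U xix assms qr nz_mult in auto)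
  show "r ~= \<one>" by (rule ne1) (use r1 U xix assms qr nz_mult in auto)
 qed (use assms U nz_mult in auto)
 have h2: "b (g *. (x *. A)) (p *. q) + b (-. (g *. (x *. A))) (y *. r) \<in> N"
 proof (rule flip[OF _ qr(3) _ qr(4) _ ipq])
  show "p *. q ~= \<one>" by (rule ne1) (use pq1 U qr nz_mult in auto)
  show "y *. r ~= \<one>" by (rule ne1) (use yr1 U qr nz_mult in auto)
 qed (use assms U nz_mult in auto)
 show ?thesis using Nadd[OF Ndiff[OF Nadd[OF f1 f2] h1] h2] by (rule N_eq) (simp add: xp xiy g1 g2 g3 xi_def[symmetric] algebra_simps)
qed

text \<open>By \<open>psi\<close>, <x>[x] is -<-x>[1/x], and by \<open>b_inv_twist0\<close> this is
  <-1>[x].\<close>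

lemma b_twist:
 assumes "g \<in> nz R" "x \<in> nz R"
 shows "b (g *. x) x - b (-. g) x \<in> N"
proof (cases "x = \<one>")
 case True
 then show ?thesis using assms by (simp add: Ndiff b1 nz_neg)
next
 case False
 have U: "-. g \<in> nz R" "g *. x \<in> nz R" using assms nz_neg nz_mult by auto
 have "psi (g *. x) x - (b (-. g) x + b (-. g *. x) (inv x)) \<in> N" by (intro Ndiff K b_inv_twist0 U assms False)
 then show ?thesis using assms by (elim N_eq) (simp add: psi_def l_minus)
qed

end

text \<open>These three consequences hold in \<open>RPb\<close> of every field and are what the
  arguments with characters use. Fields with at least four elements obtain them from the five term
  relation, the two smaller ones by inspection in \<open>bloch_system_RPb\<close>.\<close>

locale bloch_system = symbol_system +
 assumes b_inv_neg: "!!g x. g \<in> nz R ==> x \<in> nz R ==> b g x + b (-. g) (inv x) \<in> N"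
  and b_compl: "!!g x. g \<in> nz R ==> x \<in> nz R ==> x ~= \<one> ==> b g x + b (-. g) (\<one> -. x) \<in> N"
  and b_twist: "!!g x. g \<in> nz R ==> x \<in> nz R ==> b (g *. x) x - b (-. g) x \<in> N"
begin

lemma compl_ne_one: "x \<in> nz R ==> \<one> -. x ~= \<one>" using one_minus_one_minus[of x] by (auto simp: a_minus_def r_neg nz_iff[of \<zero>])

text \<open>Pass to 1-x by the complement relation, apply \<open>b_twist\<close> there, and
  return.\<close>

lemma b_twist_compl:
 assumes "g \<in> nz R" "x \<in> nz R" "x ~= \<one>"
 shows "b (g *. (\<one> -. x)) x - b (-. g) x \<in> N"
proof -
 have U: "\<one> -. x \<in> nz R" using assms by simp
 have "b (g *. (\<one> -. x)) x + b (-. (g *. (\<one> -. x))) (\<one> -. x) - (b (-. g *. (\<one> -. x)) (\<one> -. x) - b (-. (-. g)) (\<one> -. x))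
   - (b (-. g) x + b (-. (-. g)) (\<one> -. x)) \<in> N" by (rule Ndiff[OF Ndiff]; (rule b_compl b_twist)?) (use assms U in simp_all)
 then show ?thesis using assms by (elim N_eq) (simp add: l_minus)
qed

end

lemma (in big_bloch_system) bloch: "bloch_system R b N" using K b_one_minus b_twist by unfold_locales (simp_all add: psi_def)

text \<open>P is the kernel of a character \<chi> with values 1 and -1, and \<open>P_mult\<close> is
  its multiplicativity. Modulo N the class of g acts on symbols as \<chi>(g).\<close>

locale character_system = bloch_system +
 fixes P :: "'a => bool"
 assumes sat: "!!t. t + t \<in> N ==> t \<in> N"
  and P_mult: "!!a c. a \<in> nz R ==> c \<in> nz R ==> P (a *. c) \<longleftrightarrow> P a = P c"
  and b_pos: "!!g x. g \<in> nz R ==> x \<in> nz R ==> P g ==> b g x - b \<one> x \<in> N"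
  and b_neg: "!!g x. g \<in> nz R ==> x \<in> nz R ==> \<not> P g ==> b g x + b \<one> x \<in> N"
begin

abbreviation "c \<equiv> b \<one>"

lemma P_one: "P \<one>" using P_mult[of \<one> \<one>] by simp

lemma P_inv: "a \<in> nz R ==> P (inv a) = P a" using P_mult[of a "inv a"] P_one by (simp add: nz_r_inv)

lemma N_cancel: "s + t \<in> N ==> s \<in> N ==> t \<in> N" "s + t \<in> N ==> t \<in> N ==> s \<in> N"
 "s - t \<in> N ==> s \<in> N ==> t \<in> N" "s - t \<in> N ==> t \<in> N ==> s \<in> N"
 using Ndiff[of "s + t" s] Ndiff[of "s + t" t] Ndiff[of s "s - t"] Nadd[of "s - t" t] by simp_all

lemma b_in_N: "g \<in> nz R ==> x \<in> nz R ==> c x \<in> N ==> b g x \<in> N" using b_pos[of g x] b_neg[of g x] N_cancel by (cases "P g") blast+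

lemma c_in_N: "g \<in> nz R ==> x \<in> nz R ==> b g x \<in> N ==> c x \<in> N" using b_pos[of g x] b_neg[of g x] N_cancel by (cases "P g") blast+

text \<open>If \<open><g>\<close> and \<open><-1>\<close> have the same effect on [x] while
  \<chi>(g) and \<chi>(-1) differ, then [x] = -[x], so [x] = 0 by saturation. With the twist
  relations, a symbol survives only if \<chi>(x) = \<chi>(1-x) = \<chi>(-1).\<close>

lemma c_zero:
 assumes "g \<in> nz R" "x \<in> nz R" "b g x - b (-. \<one>) x \<in> N" "P g ~= P (-. \<one>)"
 shows "c x \<in> N"
proof (rule sat)
 show "c x + c x \<in> N"
 proof (cases "P g")
  case True
  then have "b (-. \<one>) x + c x - (b g x - c x) + (b g x - b (-. \<one>) x) \<in> N"
   using Nadd[OF Ndiff[OF b_neg[of "-. \<one>" x] b_pos[of g x]] assms(3)] assms by simp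
  then show ?thesis by (simp add: algebra_simps)
 next
  case False
  then have "b g x + c x - (b (-. \<one>) x - c x) - (b g x - b (-. \<one>) x) \<in> N"
   using Ndiff[OF Ndiff[OF b_neg[of g x] b_pos[of "-. \<one>" x]] assms(3)] assms by simp
  then show ?thesis by (simp add: algebra_simps)
 qed
qed

lemma c_zero_twist: "x \<in> nz R ==> P x ~= P (-. \<one>) ==> c x \<in> N" using c_zero[of x x] b_twist[of \<one> x] by simp

lemma c_zero_compl: "x \<in> nz R ==> x ~= \<one> ==> P (\<one> -. x) ~= P (-. \<one>) ==> c x \<in> N"
 using c_zero[of "\<one> -. x" x] b_twist_compl[of \<one> x] by simp

lemma five_term_c:
 assumes "x \<in> nz R" "p \<in> nz R" "x ~= \<one>" "x *. p ~= \<one>"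
 shows "c x - c (x *. p) + b x p - b (x *. (\<one> -. x)) (p *. ((\<one> -. x) *. inv (\<one> -. x *. p)))
  + b (\<one> -. x) ((\<one> -. x) *. inv (\<one> -. x *. p)) \<in> N"
proof -
 have B: "\<one> -. x *. p \<in> nz R" using assms by simp
 then have "\<one> -. x = (\<one> -. x) *. inv (\<one> -. x *. p) *. (\<one> -. x *. p)"
  using assms nz_l_inv[OF B] nz_closed[OF nz_inv[OF B]] by (simp add: m_assoc)
 from ft[OF nz_one assms(1,2) _ assms(3,4) this] show ?thesis using assms B by simp
qed

text \<open>The part on which \<open>-1\<close> acts as \<open>-1\<close> is detected by \<^const>\<open>lambda1\<close>, since there all the
 symbols that survive agree.\<close>

lemma minus_part:
 assumes "\<not> P (-. \<one>)"
 obtains \<kappa> where "!!x. x \<in> nz R ==> c x - (if x ~= \<one> \<and> \<not> P x \<and> \<not> P (\<one> -. x) then \<kappa> else 0) \<in> N"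
proof -
 have eq: "c x - c y \<in> N"
  if x: "x \<in> nz R" "x ~= \<one>" "\<not> P x" "\<not> P (\<one> -. x)" and y: "y \<in> nz R" "y ~= \<one>" "\<not> P y" "\<not> P (\<one> -. y)" for x y
 proof -
  define p where "p = y *. inv x"
  have p: "p \<in> nz R" "x *. p = y" "P p"
  proof -
   have C: "x \<in> carrier R" "y \<in> carrier R" "inv x \<in> carrier R" using x y by simp_all
   show "p \<in> nz R" using x y by (simp add: p_def)
   have "x *. p = y *. (x *. inv x)" using C by (simp add: p_def m_ac)
   then show "x *. p = y" using C x by (simp add: nz_r_inv)
   show "P p" using x y P_mult[of y "inv x"] by (simp add: p_def P_inv)
  qed
  define q where "q = (\<one> -. x) *. inv (\<one> -. y)"
  have q: "q \<in> nz R" "P q" "p *. q \<in> nz R" "P (p *. q)" using x y p P_mult by (simp_all add: q_def P_inv)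
  have "c x - c y + b x p - b (x *. (\<one> -. x)) (p *. q) + b (\<one> -. x) q \<in> N"
   using five_term_c[OF x(1) p(1) x(2)] y p by (simp add: q_def)
  \<comment> \<open>p, q and p q have character 1, which is not \<chi>(-1). So only [x] - [y] is
    left of the relation.\<close>
  moreover have "b x p \<in> N" "b (x *. (\<one> -. x)) (p *. q) \<in> N" "b (\<one> -. x) q \<in> N"
   using x p q assms by (auto intro!: b_in_N c_zero_twist)
  ultimately show ?thesis using N_cancel by blast
 qed
 show ?thesis
 proof (cases "\<exists>y\<in>nz R. y ~= \<one> \<and> \<not> P y \<and> \<not> P (\<one> -. y)")
  case True
  then obtain y where y: "y \<in> nz R" "y ~= \<one>" "\<not> P y" "\<not> P (\<one> -. y)" by blast
  show ?thesis
  proof (rule that[of "c y"])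
   fix x assume x: "x \<in> nz R"
   show "c x - (if x ~= \<one> \<and> \<not> P x \<and> \<not> P (\<one> -. x) then c y else 0) \<in> N"
    using eq[OF x _ _ _ y] c_zero_twist[OF x] c_zero_compl[OF x] b1[OF nz_one] assms by (cases "x = \<one>") auto
  qed
 next
  case False
  show ?thesis
  proof (rule that[of 0])
   fix x assume x: "x \<in> nz R"
   show "c x - (if x ~= \<one> \<and> \<not> P x \<and> \<not> P (\<one> -. x) then 0 else 0) \<in> N"
    using False x c_zero_twist[OF x] c_zero_compl[OF x] b1[OF nz_one] assms by (cases "x = \<one>") auto
  qed
 qed
qed

end

locale even_character_system = character_system +
 assumes P_minus_one: "P (-. \<one>)"
begin

lemma P_neg: "a \<in> nz R ==> P (-. a) = P a" using P_mult[of "-. \<one>" a] P_minus_one by (simp add: l_minus)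

lemma c_inv: "x \<in> nz R ==> c x + c (inv x) \<in> N" using Ndiff[OF b_inv_neg[of \<one> x] b_pos[of "-. \<one>" "inv x"]] P_minus_one by simp

lemma c_compl: "x \<in> nz R ==> x ~= \<one> ==> c x + c (\<one> -. x) \<in> N"
 using Ndiff[OF b_compl[of \<one> x] b_pos[of "-. \<one>" "\<one> -. x"]] P_minus_one by simp

text \<open>If \<chi>(p) = -1, then [p] vanishes by the twist relation. Otherwise x, x p, q and p q
  all have character -1, and the five term relation shrinks to <x>[p]. The vanishing of symbols of
  positive valuation is proved by finding such an x.\<close>

lemma c_translate:
 assumes "p \<in> nz R" "x \<in> nz R" "\<not> P x" "x ~= \<one>" "x *. p ~= \<one>" "P (\<one> -. x) ~= P (\<one> -. x *. p)"
 shows "c p \<in> N"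
proof (cases "P p")
 case False
 then show ?thesis using c_zero_twist assms P_minus_one by simp
next
 case True
 define q where "q = (\<one> -. x) *. inv (\<one> -. x *. p)"
 have q: "q \<in> nz R" "\<not> P q" "p *. q \<in> nz R" "\<not> P (p *. q)" using assms True P_mult by (auto simp: q_def P_inv)
 have z: "c x \<in> N" "c (x *. p) \<in> N" "b (x *. (\<one> -. x)) (p *. q) \<in> N" "b (\<one> -. x) q \<in> N"
  using q assms True P_mult P_minus_one by (auto intro!: b_in_N c_zero_twist)
 have "c x - c (x *. p) + b x p - b (x *. (\<one> -. x)) (p *. q) + b (\<one> -. x) q \<in> N"
  using five_term_c[OF assms(2,1,4,5)] by (simp add: q_def)
 then have "b x p \<in> N" using z N_cancel by (metis Ndiff)
 then show ?thesis using c_in_N assms by blast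
qed

end

section \<open>Discrete valuations\<close>

locale valued_field = field R for R (structure) +
 fixes v :: "'a => int"
 assumes v: "discrete_valuation R v"
begin

abbreviation "UU \<equiv> val_units R v"
abbreviation "U1 \<equiv> higher_units R v 1"

lemma v_surj: "\<exists>x\<in>nz R. v x = n" using v unfolding discrete_valuation_def nz_def by (metis UNIV_I imageE)

lemma v_mult: "a \<in> nz R ==> b \<in> nz R ==> v (a *. b) = v a + v b" using v unfolding discrete_valuation_def nz_def by simp

lemma v_add: "a \<in> nz R ==> b \<in> nz R ==> a +. b \<in> nz R ==> min (v a) (v b) \<le> v (a +. b)"
 using v unfolding discrete_valuation_def nz_def by simp

lemma v_one: "v \<one> = 0" using v_mult[of \<one> \<one>] by simp

lemma v_inv: "a \<in> nz R ==> v (inv a) = - v a" using v_mult[of a "inv a"] by (simp add: nz_r_inv v_one)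

lemma v_minus_one: "v (-. \<one>) = 0" using v_mult[of "-. \<one>" "-. \<one>"] by (simp add: l_minus r_minus v_one)

lemma v_neg: "a \<in> nz R ==> v (-. a) = v a" using v_mult[of "-. \<one>" a] by (simp add: l_minus v_minus_one)

lemma v_diff: "a \<in> nz R ==> b \<in> nz R ==> a -. b \<in> nz R ==> min (v a) (v b) \<le> v (a -. b)"
 using v_add[of a "-. b"] by (simp add: a_minus_def v_neg)

lemma v_compl_ge:
 assumes "x \<in> nz R" "x ~= \<one>"
 shows "min 0 (v x) \<le> v (\<one> -. x)" using v_diff[of \<one> x] assms by (simp add: v_one)

lemma v_compl_pos:
 assumes "x \<in> nz R" "v x > 0"
 shows "x ~= \<one>" "v (\<one> -. x) = 0"
proof -
 show ne: "x ~= \<one>" using assms v_one by auto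
 have "\<one> = (\<one> -. x) +. x" using assms by (simp add: a_minus_def a_assoc l_neg)
 then have "min (v (\<one> -. x)) (v x) \<le> v \<one>" using v_add[of "\<one> -. x" x] assms ne by (metis nz_closed nz_one one_minus_nz)
 then show "v (\<one> -. x) = 0" using v_compl_ge[OF assms(1) ne] assms v_one by (auto simp: min_def split: if_splits)
qed

lemma v_compl_neg:
 assumes "x \<in> nz R" "v x < 0"
 shows "x ~= \<one>" "v (\<one> -. x) = v x"
proof -
 show ne: "x ~= \<one>" using assms v_one by auto
 have "\<one> -. inv x = -. ((\<one> -. x) *. inv x)" by (rule one_minus_inv[OF assms(1)])
 moreover have "v (\<one> -. inv x) = 0" using v_compl_pos(2)[of "inv x"] assms by (simp add: v_inv)
 ultimately show "v (\<one> -. x) = v x" using assms ne by (simp add: v_neg v_mult v_inv)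
qed

lemma higher_units_iff: "x \<in> higher_units R v n \<longleftrightarrow> x \<in> nz R \<and> v x = 0 \<and> (x = \<one> \<or> int n \<le> v (\<one> -. x))"
proof -
 have "\<one> -. x = \<zero> \<longleftrightarrow> x = \<one>" if "x \<in> carrier R"
  using that one_minus_nz[of x] by (auto simp: nz_iff a_minus_def r_neg)
 then show ?thesis by (auto simp: higher_units_def val_units_def nz_def)
qed

lemma one_higher: "\<one> \<in> higher_units R v n" by (simp add: higher_units_iff v_one)

lemma compl_higher: "x \<in> nz R ==> int n \<le> v x ==> n \<ge> 1 ==> \<one> -. x \<in> higher_units R v n"
 using v_compl_pos[of x] by (simp add: higher_units_iff one_minus_one_minus)

lemma higher_mult:
 assumes "x \<in> higher_units R v n" "y \<in> higher_units R v n"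
 shows "x *. y \<in> higher_units R v n"
proof (cases "x = \<one> \<or> y = \<one> \<or> x *. y = \<one>")
 case True
 then show ?thesis using assms one_higher by (auto simp: higher_units_iff)
next
 case False
 then have xy: "x \<in> nz R" "y \<in> nz R" "v x = 0" "v y = 0" "int n \<le> v (\<one> -. x)" "int n \<le> v (\<one> -. y)"
  using assms by (auto simp: higher_units_iff)
 have "\<one> -. x *. y = (\<one> -. x) +. x *. (\<one> -. y)" using xy(1,2)[THEN nz_closed] by algebra
 moreover have "\<one> -. x *. y \<in> nz R" using False xy by simp
 ultimately have "int n \<le> v (\<one> -. x *. y)" using v_add[of "\<one> -. x" "x *. (\<one> -. y)"] False xy by (simp add: v_mult)
 then show ?thesis using xy by (simp add: higher_units_iff v_mult)
qed

lemma higher_inv: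
 assumes "x \<in> higher_units R v n"
 shows "inv x \<in> higher_units R v n"
proof (cases "x = \<one>")
 case True
 then show ?thesis using one_higher by simp
next
 case False
 then have x: "x \<in> nz R" "v x = 0" "int n \<le> v (\<one> -. x)" using assms by (auto simp: higher_units_iff)
 then show ?thesis using False by (simp add: higher_units_iff v_inv one_minus_inv v_neg v_mult)
qed

lemma not_higher_one: "x \<in> nz R ==> v x = 0 ==> x \<notin> U1 \<longleftrightarrow> x ~= \<one> \<and> v (\<one> -. x) = 0"
 using v_compl_ge[of x] by (auto simp: higher_units_iff)

lemma quot_mult: "a \<in> nz R ==> b \<in> nz R ==> a *. inv b *. b = a" "a \<in> nz R ==> b \<in> nz R ==> b *. (a *. inv b) = a"
proof -
 assume a: "a \<in> nz R" and b: "b \<in> nz R"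
 have C: "a \<in> carrier R" "b \<in> carrier R" "inv b \<in> carrier R" using a b by simp_all
 show "a *. inv b *. b = a" using C b by (simp add: m_assoc nz_l_inv)
 then show "b *. (a *. inv b) = a" using C by (simp add: m_comm)
qed

text \<open>The quotient is 1 - t with t = (x-y)/(1-y), and the hypothesis bounds the valuation of
  t.\<close>

lemma compl_quot_higher:
 assumes "x \<in> nz R" "x ~= \<one>" "y \<in> nz R" "y ~= \<one>" "x -. y \<in> nz R" "v (x -. y) \<ge> v (\<one> -. y) + int n" "n \<ge> 1"
 shows "(\<one> -. x) *. inv (\<one> -. y) \<in> higher_units R v n"
proof -
 have B: "\<one> -. y \<in> nz R" using assms by simp
 have C: "x \<in> carrier R" "y \<in> carrier R" using assms by simp_all
 have "\<one> -. (\<one> -. x) *. inv (\<one> -. y) = ((\<one> -. y) -. (\<one> -. x)) *. inv (\<one> -. y)"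
  using one_minus_div[OF _ B, of "\<one> -. x"] C by simp
 also have "(\<one> -. y) -. (\<one> -. x) = x -. y" using C by algebra
 finally have e: "\<one> -. (\<one> -. x) *. inv (\<one> -. y) = (x -. y) *. inv (\<one> -. y)" .
 define t where "t = (x -. y) *. inv (\<one> -. y)"
 have t: "t \<in> nz R" "v t \<ge> int n" using assms B by (simp_all add: t_def v_mult v_inv)
 have "(\<one> -. x) *. inv (\<one> -. y) = \<one> -. t"
  using e B assms(1,2) one_minus_one_minus[of "(\<one> -. x) *. inv (\<one> -. y)"] by (simp add: t_def)
 then show ?thesis using compl_higher[OF t assms(7)] by simp
qed

end

section \<open>Symbols modulo an even nontrivial character of a valued field\<close>

locale valued_character_system = valued_field R v + even_character_system R b N P
 for R (structure) and v b and N :: "'t::ab_group_add set" and P +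
 assumes P_nontrivial: "\<exists>z\<in>nz R. \<not> P z"
begin

text \<open>Inversion exchanges positive and negative valuations, and u -> 1-u takes
  \<open>U1\<close> without 1 to positive valuations.\<close>

lemma c_valuation_sym:
 assumes "!!a. a \<in> nz R ==> v a > 0 ==> c a \<in> N"
 shows "a \<in> nz R ==> v a ~= 0 ==> c a \<in> N" "u \<in> U1 ==> c u \<in> N"
proof -
 show a: "c a \<in> N" if "a \<in> nz R" "v a ~= 0" for a
 proof (cases "v a > 0")
  case False
  then have "c (inv a) \<in> N" using assms[of "inv a"] that by (simp add: v_inv)
  then show ?thesis using c_inv[OF that(1)] by (rule N_cancel(2)[rotated])
 qed (use assms that in blast)
 show "c u \<in> N" if "u \<in> U1"
 proof (cases "u = \<one>")
  case True
  then show ?thesis by (simp add: b1)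
 next
  case False
  then have "u \<in> nz R" "v (\<one> -. u) ~= 0" using that by (auto simp: higher_units_iff)
  then show ?thesis using a[of "\<one> -. u"] c_compl[of u] False N_cancel(2)[of "c u" "c (\<one> -. u)"] by simp
 qed
qed

text \<open>In the five term relation for a and a u both q and u q lie in \<open>U1\<close>, so only
  [a] - [a u] survives. If a lies in \<open>U1\<close>, the two symbols vanish separately.\<close>

lemma c_unit_mult:
 assumes "!!u. u \<in> U1 ==> c u \<in> N"
  and "a \<in> nz R" "v a = 0" "u \<in> U1"
 shows "c (a *. u) - c a \<in> N"
proof (cases "a \<in> U1")
 case True
 then show ?thesis using Ndiff assms higher_mult by blast
next
 case False
 have u: "u \<in> nz R" "v u = 0" using assms(4) by (auto simp: higher_units_iff)
 have au: "a *. u \<notin> U1"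
 proof
  assume "a *. u \<in> U1"
  then have "a *. u *. inv u \<in> U1" using higher_mult higher_inv assms(4) by blast
  moreover have "a *. u *. inv u = a" using assms(2) u nz_closed[OF nz_inv[OF u(1)]] by (simp add: m_assoc nz_r_inv)
  ultimately show False using False by simp
 qed
 have a1: "a ~= \<one>" "v (\<one> -. a) = 0" using False not_higher_one assms(2,3) by blast+
 have au1: "a *. u ~= \<one>" "v (\<one> -. a *. u) = 0" using au not_higher_one[of "a *. u"] assms(2,3) u by (auto simp: v_mult)
 define q where "q = (\<one> -. a) *. inv (\<one> -. a *. u)"
 have q: "q \<in> U1"
 proof (cases "u = \<one>")
  case True
  then show ?thesis using a1 assms(2) one_higher by (simp add: q_def nz_r_inv)
 next
  case False
  have e: "a -. a *. u = a *. (\<one> -. u)" using assms(2)[THEN nz_closed] u(1)[THEN nz_closed] by algebra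
  show ?thesis unfolding q_def by (rule compl_quot_higher)
    (use a1 au1 assms u e False in \<open>auto simp: higher_units_iff v_mult\<close>)
 qed
 then have uq: "u *. q \<in> U1" using higher_mult assms(4) by blast
 have "c a - c (a *. u) + b a u - b (a *. (\<one> -. a)) (u *. q) + b (\<one> -. a) q \<in> N"
  using five_term_c[OF assms(2) u(1) a1(1) au1(1)] by (simp add: q_def)
 moreover have "b a u \<in> N" "b (a *. (\<one> -. a)) (u *. q) \<in> N" "b (\<one> -. a) q \<in> N"
  using assms(1)[OF assms(4)] assms(1)[OF uq] assms(1)[OF q] assms(2) u a1 q uq by (auto intro!: b_in_N simp: higher_units_iff)
 ultimately have "c a - c (a *. u) \<in> N" using N_cancel(2) N_cancel(4) by metis
 from Nneg[OF this] show ?thesis by simp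
qed

text \<open>The hypothesis \<open>U_n \<subseteq> U_1^2\<close> enters here: a character that is nontrivial on
 \<open>U_1\<close> has a conductor.\<close>

lemma c_zero_wild:
 assumes "u \<in> U1" "\<not> P u" "n \<ge> 1" "!!u. u \<in> higher_units R v n ==> P u" "a \<in> nz R"
 shows "c a \<in> N"
proof -
 \<comment> \<open>The conductor of \<chi>: the least m with \<chi> trivial on \<open>U_m\<close>.
   It is at least 2 because \<chi>(u) = -1 for an element u of \<open>U1\<close>.\<close>
 define m where "m = (LEAST m. m \<ge> 1 \<and> (\<forall>u\<in>higher_units R v m. P u))"
 have "m \<ge> 1 \<and> (\<forall>u\<in>higher_units R v m. P u)" unfolding m_def by (rule LeastI[of _ n]) (use assms(3,4) in blast)
 then have m: "m \<ge> 1" "!!u. u \<in> higher_units R v m ==> P u" by blast+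
 have m2: "m \<ge> 2"
 proof (rule ccontr)
  assume "\<not> m \<ge> 2"
  then have "m = 1" using m(1) by simp
  then show False using m(2)[of u] assms(1,2) by simp
 qed
 have "\<not> (m - 1 \<ge> 1 \<and> (\<forall>u\<in>higher_units R v (m - 1). P u))"
  using not_less_Least[of "m - 1" "\<lambda>m. m \<ge> 1 \<and> (\<forall>u\<in>higher_units R v m. P u)"] m2 unfolding m_def[symmetric] by simp
 then obtain w where w: "w \<in> higher_units R v (m - 1)" "\<not> P w" using m2 by auto
 have w1: "w \<in> nz R" "v w = 0" "w ~= \<one>" "int (m - 1) \<le> v (\<one> -. w)" using w P_one by (auto simp: higher_units_iff)
 then have vw: "v (\<one> -. w) = int (m - 1)" using w m(2)[of w] by (force simp: higher_units_iff)
 have u: "u \<in> nz R" "v u = 0" "u ~= \<one>" "1 \<le> v (\<one> -. u)" using assms(1,2) P_one by (auto simp: higher_units_iff)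
 \<comment> \<open>An x of valuation m - 1 with \<chi>(x) = \<chi>(1-x) = -1 suffices for positive
   valuations: if v a > 0, then 1 - x a lies in \<open>U_m\<close>, so \<chi>(1-x) and \<chi>(1-xa)
   differ and \<open>c_translate\<close> applies.\<close>
 have "\<exists>x. x \<in> nz R \<and> \<not> P x \<and> v x = int (m - 1) \<and> \<not> P (\<one> -. x)"
 proof (cases "P (\<one> -. w)")
  case False
  then show ?thesis using w1 vw w(2) by (intro exI[of _ "\<one> -. w"]) (simp add: one_minus_one_minus)
 next
  case True
  \<comment> \<open>The factor u changes the sign of \<chi>(1-w), whereas 1 - (1-w)u differs from w
    only by a factor in \<open>U_m\<close>, so its character is still -1.\<close>
  define x where "x = (\<one> -. w) *. u"
  have W: "\<one> -. w \<in> nz R" using w1 by simp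
  have x: "x \<in> nz R" "v x = int (m - 1)" "\<not> P x" "x ~= \<one>"
   using W u True P_mult[OF W u(1)] assms(2) vw v_compl_pos(1)[of x] m2 by (auto simp: x_def v_mult)
  have e: "x -. (\<one> -. w) = -. ((\<one> -. w) *. (\<one> -. u))" unfolding x_def using w1(1)[THEN nz_closed] u(1)[THEN nz_closed] by algebra
  have "(\<one> -. x) *. inv (\<one> -. (\<one> -. w)) \<in> higher_units R v m"
  proof (rule compl_quot_higher)
   show "\<one> -. w ~= \<one>" using compl_ne_one w1 by blast
   show "x -. (\<one> -. w) \<in> nz R" unfolding e using W u by simp
   show "v (\<one> -. (\<one> -. w)) + int m \<le> v (x -. (\<one> -. w))"
    unfolding e using W u w1 vw m2 by (simp add: v_neg v_mult one_minus_one_minus)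
  qed (use W x m in auto)
  then have "P ((\<one> -. x) *. inv w)" using m(2) w1 by (simp add: one_minus_one_minus)
  then have "\<not> P (\<one> -. x)" using P_mult[of "\<one> -. x" "inv w"] P_inv w w1 x by simp
  then show ?thesis using x by blast
 qed
 then obtain x where x: "x \<in> nz R" "\<not> P x" "v x = int (m - 1)" "\<not> P (\<one> -. x)" by blast
 have x1: "x ~= \<one>" using x P_one by auto
 have pos: "c a \<in> N" if a: "a \<in> nz R" "v a > 0" for a
 proof (rule c_translate[OF a(1) x(1,2) x1])
  have "\<one> -. x *. a \<in> higher_units R v m" using a x m m2 by (intro compl_higher) (auto simp: v_mult)
  then show "P (\<one> -. x) ~= P (\<one> -. x *. a)" using m(2) x by blast
  show "x *. a ~= \<one>" using a x v_compl_pos(1)[of "x *. a"] by (simp add: v_mult)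
 qed
 note sym = c_valuation_sym[OF pos]
 show ?thesis
 proof (cases "v a = 0")
  case True
  have "c (a *. u) - c a \<in> N" by (rule c_unit_mult[OF sym(2) assms(5) True assms(1)])
  \<comment> \<open>Since \<chi>(u) = -1, one of a and a u has character -1, and its symbol vanishes
    by the twist relation.\<close>
  moreover have "c a \<in> N \<or> c (a *. u) \<in> N"
   using c_zero_twist[of a] c_zero_twist[of "a *. u"] P_mult[OF assms(5) u(1)] assms(2,5) u P_minus_one by auto
  ultimately show ?thesis using N_cancel by blast
 qed (use sym(1) assms(5) in blast)
qed

text \<open>As \<chi> is trivial on \<open>U1\<close>, 1 - x a has character 1 whenever x a has
  positive valuation, so \<open>c_translate\<close> asks for an x with \<chi>(x) = \<chi>(1-x) = -1.
  A unit provides it if \<chi> is nontrivial on units; otherwise the inverse of a uniformizer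
  does.\<close>

lemma c_valuation_pos:
 assumes "!!u. u \<in> U1 ==> P u" "a \<in> nz R" "v a > 0"
 shows "c a \<in> N"
proof (cases "\<exists>u\<in>nz R. v u = 0 \<and> \<not> P u")
 case True
 then obtain u where u: "u \<in> nz R" "v u = 0" "\<not> P u" by blast
 have "u \<notin> U1" using u assms(1) by blast
 then have u1: "u ~= \<one>" "v (\<one> -. u) = 0" using not_higher_one u by blast+
 \<comment> \<open>As \<chi>(1 - 1/u) = \<chi>(1-u) \<chi>(u) and \<chi>(u) = -1, exactly one of u
   and 1/u has a complement of character -1.\<close>
 define x where "x = (if P (\<one> -. u) then inv u else u)"
 have "\<not> P (\<one> -. inv u)" if "P (\<one> -. u)"
  using that u u1 P_mult[of "\<one> -. u" "inv u"] P_inv[of u] P_neg[of "(\<one> -. u) *. inv u"] by (simp add: one_minus_inv)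
 then have x: "x \<in> nz R" "v x = 0" "\<not> P x" "\<not> P (\<one> -. x)" using u P_inv by (auto simp: x_def v_inv)
 have "\<one> -. x *. a \<in> U1" using assms x by (intro compl_higher) (auto simp: v_mult)
 then have "P (\<one> -. x *. a)" using assms(1) by blast
 moreover have "x *. a ~= \<one>" using assms x v_compl_pos(1)[of "x *. a"] by (simp add: v_mult)
 moreover have "x ~= \<one>" using x P_one by auto
 ultimately show ?thesis using c_translate[OF assms(2) x(1,3)] x by blast
next
 case False
 then have unit: "!!u. u \<in> nz R ==> v u = 0 ==> P u" by blast
 obtain \<pi> where \<pi>: "\<pi> \<in> nz R" "v \<pi> = 1" using v_surj by blast
 have P\<pi>: "\<not> P \<pi>"
 proof
  assume p: "P \<pi>"
  have nat: "P z" if "z \<in> nz R" "v z = int n" for z n using that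
  proof (induction n arbitrary: z)
   case (Suc n)
   have "P (z *. inv \<pi>)" using Suc.prems \<pi> by (intro Suc.IH) (auto simp: v_mult v_inv)
   then show ?case using P_mult[of z "inv \<pi>"] P_inv p \<pi> Suc.prems by simp
  qed (use unit in simp)
  have "P z" if z: "z \<in> nz R" for z
  proof (cases "v z \<ge> 0")
   case True
   then show ?thesis using nat[OF z, of "nat (v z)"] by simp
  next
   case False
   then show ?thesis using nat[of "inv z" "nat (- v z)"] P_inv z by (simp add: v_inv)
  qed
  then show False using P_nontrivial by blast
 qed
 show ?thesis
 \<comment> \<open>With x = 1/\<pi> the product x a has positive valuation only from v a = 2 on. For
   v a = 1 the character of a itself is -1.\<close>
 proof (cases "v a = 1")
  case True
  have "P (a *. inv \<pi>)" by (rule unit) (use True assms \<pi> in \<open>auto simp: v_mult v_inv\<close>)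
  then have "\<not> P a" using P_mult[of a "inv \<pi>"] P_inv \<pi> P\<pi> assms by simp
  then show ?thesis using c_zero_twist assms P_minus_one by simp
 next
  case False
  define x where "x = inv \<pi>"
  have "x \<in> nz R" "v x = -1" "\<not> P x" using \<pi> P\<pi> P_inv by (auto simp: x_def v_inv)
  then have x: "x \<in> nz R" "v x = -1" "\<not> P x" "x ~= \<one>" using P_one by auto
  have "\<one> -. \<pi> \<in> U1" using \<pi> by (intro compl_higher) auto
  then have "P (\<one> -. \<pi>)" by (rule assms(1))
  moreover have "\<pi> ~= \<one>" using \<pi> v_one by auto
  then have "\<one> -. \<pi> \<in> nz R" using \<pi> by simp
  ultimately have "\<not> P (\<one> -. x)"
   using \<pi> P\<pi> P_mult[of "\<one> -. \<pi>" "inv \<pi>"] P_inv[of \<pi>] P_neg[of "(\<one> -. \<pi>) *. inv \<pi>"]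
   by (simp add: x_def one_minus_inv)
  moreover have "\<one> -. x *. a \<in> U1" using assms x False by (intro compl_higher) (auto simp: v_mult)
  then have "P (\<one> -. x *. a)" by (rule assms(1))
  moreover have "x *. a ~= \<one>" using assms x False v_compl_pos(1)[of "x *. a"] by (simp add: v_mult)
  ultimately show ?thesis using c_translate[OF assms(2) x(1,3,4)] by blast
 qed
qed

end

section \<open>Square classes\<close>

context field
begin

lemma mult_of_eq: "Ring_Divisibility.mult_of R = Multiplicative_Group.mult_of R"
 by (simp add: Ring_Divisibility.mult_of_def Multiplicative_Group.mult_of_def)

lemma mult_of_group: "group (mult_of R)" using field_mult_group by (simp add: mult_of_eq)

lemma mult_of_comm_group: "comm_group (mult_of R)" by (rule group.group_comm_groupI[OF mult_of_group]) (simp add: m_comm)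

lemma carrier_mult_of_nz: "carrier (mult_of R) = nz R" by (simp add: nz_def)

lemma m_inv_mult_of_nz: "x \<in> nz R ==> inv\<^bsub>mult_of R\<^esub> x = inv x" unfolding mult_of_eq by (rule m_inv_mult_of) (simp add: nz_def)

lemma squares_iff: "y \<in> squares R \<longleftrightarrow> (\<exists>s\<in>nz R. y = s *. s)" by (auto simp: squares_def nz_def)

lemma squares_subgroup: "subgroup (squares R) (mult_of R)"
proof (rule group.subgroupI[OF mult_of_group])
 show "squares R \<subseteq> carrier (mult_of R)" by (auto simp: squares_iff carrier_mult_of_nz simp del: carrier_mult_of)
 show "squares R ~= {}" using squares_iff nz_one by blast
next
 fix a assume "a \<in> squares R"
 then obtain s where "s \<in> nz R" "a = s *. s" by (auto simp: squares_iff)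
 then have "inv\<^bsub>mult_of R\<^esub> a = inv s *. inv s" "inv s \<in> nz R" by (simp_all add: m_inv_mult_of_nz nz_inv_mult)
 then show "inv\<^bsub>mult_of R\<^esub> a \<in> squares R" by (auto simp: squares_iff)
next
 fix a c assume "a \<in> squares R" "c \<in> squares R"
 then obtain s t where st: "s \<in> nz R" "a = s *. s" "t \<in> nz R" "c = t *. t" by (auto simp: squares_iff)
 then have "a *. c = (s *. t) *. (s *. t)" by (simp add: m_ac)
 then show "a *.\<^sub>(mult_of R) c \<in> squares R" using st nz_mult by (auto simp: squares_iff)
qed

lemma squares_normal: "normal (squares R) (mult_of R)"
 by (rule comm_group.normal_iff_subgroup[OF mult_of_comm_group, THEN iffD2, OF squares_subgroup])

lemma sq_class_eq_iff:
 assumes "a \<in> nz R" "c \<in> nz R"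
 shows "sq_class R a = sq_class R c \<longleftrightarrow> (\<exists>s\<in>nz R. a = c *. (s *. s))"
proof -
 interpret G: group "mult_of R" by (rule mult_of_group)
 have "sq_class R a = sq_class R c \<longleftrightarrow> a \<in> squares R #>\<^sub>(mult_of R) c" unfolding sq_class_def
  using G.repr_independence[OF _ _ squares_subgroup, of a c] G.rcos_self[OF _ squares_subgroup, of a] assms by (auto simp: nz_def)
 also have "\<dots> \<longleftrightarrow> (\<exists>s\<in>nz R. a = c *. (s *. s))"
 proof
  assume "a \<in> squares R #>\<^sub>(mult_of R) c"
  then obtain s where "s \<in> nz R" "a = (s *. s) *. c" by (auto simp: r_coset_def squares_iff)
  then show "\<exists>s\<in>nz R. a = c *. (s *. s)" using assms by (intro bexI[of _ s]) (simp_all add: m_comm)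
 next
  assume "\<exists>s\<in>nz R. a = c *. (s *. s)"
  then obtain s where s: "s \<in> nz R" "a = c *. (s *. s)" by blast
  then have "s *. s \<in> squares R" "a = (s *. s) *. c" using assms by (auto simp: squares_iff m_comm)
  then show "a \<in> squares R #>\<^sub>(mult_of R) c" by (auto simp: r_coset_def)
 qed
 finally show ?thesis .
qed

lemma sq_class_sq: "g \<in> nz R ==> s \<in> nz R ==> sq_class R (g *. (s *. s)) = sq_class R g" by (subst sq_class_eq_iff) auto

lemma sq_class_group_comm: "comm_group (sq_class_group R)" unfolding sq_class_group_def
 by (rule comm_group.abelian_FactGroup[OF mult_of_comm_group squares_subgroup])

lemma sq_class_group_carrier: "carrier (sq_class_group R) = sq_class R ` nz R"
 by (auto simp: sq_class_group_def FactGroup_def RCOSETS_def sq_class_def nz_def)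

lemma sq_class_group_mult:
 "a \<in> nz R ==> c \<in> nz R ==> sq_class R a *.\<^sub>(sq_class_group R) sq_class R c = sq_class R (a *. c)"
 unfolding sq_class_group_def sq_class_def using normal.rcos_sum[OF squares_normal, of a c] by (simp add: nz_def)

lemma sq_class_group_one: "\<one>\<^sub>(sq_class_group R) = sq_class R \<one>"
proof -
 interpret G: group "mult_of R" by (rule mult_of_group)
 have "squares R #>\<^sub>(mult_of R) \<one> = squares R" using G.coset_mult_one[of "squares R"] subgroup.subset[OF squares_subgroup] by simp
 then show ?thesis by (simp add: sq_class_group_def sq_class_def)
qed

lemma sq_class_group_exp: "c \<in> carrier (sq_class_group R) ==> c *.\<^sub>(sq_class_group R) c = \<one>\<^sub>(sq_class_group R)"
proof -
 assume "c \<in> carrier (sq_class_group R)"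
 then obtain a where a: "a \<in> nz R" "c = sq_class R a" by (auto simp: sq_class_group_carrier)
 then show ?thesis using sq_class_sq[OF nz_one a(1)] by (simp add: sq_class_group_mult sq_class_group_one)
qed

lemma RF_cring: "cring (RF R)" unfolding RF_def by (rule cring_group_ring[OF sq_class_group_comm])

lemma RF_simps: "ring.add (RF R) = (+)" "\<zero>\<^sub>(RF R) = 0" by (simp_all add: RF_def group_ring_simps)

lemma sq_closed [simp]: "a \<in> nz R ==> sq R a \<in> carrier (RF R)"
 unfolding RF_def sq_def by (rule frag_of_group_ring) (simp add: sq_class_group_carrier)

lemma sq_mult: "a \<in> nz R ==> c \<in> nz R ==> sq R a *.\<^sub>(RF R) sq R c = sq R (a *. c)"
 unfolding RF_def sq_def by (simp add: group_ring_mult_frag sq_class_group_mult)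

lemma sq_one: "sq R \<one> = \<one>\<^sub>(RF R)" by (simp add: RF_def sq_def group_ring_simps(4) sq_class_group_one)

lemma sq_sq: "g \<in> nz R ==> s \<in> nz R ==> sq R (g *. (s *. s)) = sq R g" by (simp add: sq_def sq_class_sq)

lemma RF_diff: "b \<in> carrier (RF R) ==> a -.\<^sub>(RF R) b = a - b" unfolding RF_def by (rule group_ring_minus)

lemma RF_diff_closed: "a \<in> carrier (RF R) ==> b \<in> carrier (RF R) ==> a - b \<in> carrier (RF R)"
 using RF_diff[of b a] ring.ring_simprules(4)[OF cring.axioms(1)[OF RF_cring], of a b] by simp

lemma dsq_eq: "dsq R a = sq R a - sq R \<one>" using RF_diff[of "\<one>\<^sub>(RF R)" "sq R a"] cring.axioms(1)[OF RF_cring]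
 by (simp add: dsq_def sq_one ring.ring_simprules(6))

lemma dsq_closed [simp]: "a \<in> nz R ==> dsq R a \<in> carrier (RF R)" by (simp add: dsq_eq RF_diff_closed)

lemma RF_mult_simps:
 "(c + c') *.\<^sub>(RF R) d = c *.\<^sub>(RF R) d + c' *.\<^sub>(RF R) d"
 "c *.\<^sub>(RF R) (d + d') = c *.\<^sub>(RF R) d + c *.\<^sub>(RF R) d'"
 "(c - c') *.\<^sub>(RF R) d = c *.\<^sub>(RF R) d - c' *.\<^sub>(RF R) d"
 "c *.\<^sub>(RF R) (d - d') = c *.\<^sub>(RF R) d - c *.\<^sub>(RF R) d'"
 "0 *.\<^sub>(RF R) d = 0" "c *.\<^sub>(RF R) 0 = 0" by (simp_all add: RF_def group_ring_mult_distrib group_ring_mult_minus_right)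

lemma dsq_mult: "a \<in> nz R ==> c \<in> nz R ==> dsq R a *.\<^sub>(RF R) dsq R c = sq R (a *. c) - sq R a - sq R c + sq R \<one>"
 by (simp add: dsq_eq RF_mult_simps sq_mult)

lemma RF_induct [consumes 1, case_names zero gen diff]:
 assumes "r \<in> carrier (RF R)" "P 0" "!!g. g \<in> nz R ==> P (sq R g)"
  "!!a b. a \<in> carrier (RF R) ==> b \<in> carrier (RF R) ==> P a ==> P b ==> P (a - b)"
 shows "P r"
proof -
 have "r \<in> carrier (group_ring (sq_class_group R))" using assms(1) by (simp add: RF_def)
 then show ?thesis
 proof (induction r rule: group_ring_induct)
  case (gen g)
  then obtain a where "a \<in> nz R" "g = sq_class R a" by (auto simp: sq_class_group_carrier)
  then show ?case using assms(3)[of a] by (simp add: sq_def)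
 next
  case (diff a b)
  then show ?case using assms(4)[of a b] by (simp add: RF_def)
 qed (rule assms(2))
qed

lemma RF_submodule:
 assumes "module (RF R) M" "additive_subgroup H M" "!!g x. g \<in> nz R ==> x \<in> H ==> sq R g \<odot>\<^sub>M x \<in> H"
 shows "submodule H (RF R) M" unfolding RF_def by (rule group_ring_submodule[OF assms(1)[unfolded RF_def] assms(2)])
  (use assms(3) in \<open>auto simp: sq_def sq_class_group_carrier\<close>)

lemma sq_smult_sq:
 assumes "module (RF R) M" "a \<in> nz R" "c \<in> nz R" "m \<in> carrier M"
 shows "sq R a \<odot>\<^sub>M (sq R c \<odot>\<^sub>M m) = sq R (a *. c) \<odot>\<^sub>M m"
 using module.smult_assoc1[OF assms(1), of "sq R a" "sq R c" m] assms(2-) by (simp add: sq_mult)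

lemma sq_one_smult: "module (RF R) M ==> m \<in> carrier M ==> sq R \<one> \<odot>\<^sub>M m = m"
 using module.smult_one[of "RF R" M m] by (simp add: sq_one)

lemma dsq_smult:
 assumes "module (RF R) M" "a \<in> nz R" "m \<in> carrier M"
 shows "dsq R a \<odot>\<^sub>M m = sq R a \<odot>\<^sub>M m -.\<^sub>M m"
 using group_ring_diff_smult[OF assms(1)[unfolded RF_def], of "sq R a" "sq R \<one>" m] assms by (simp add: dsq_eq RF_def[symmetric] sq_one_smult)

section \<open>The augmentation ideal\<close>

lemma IF_iff: "c \<in> IF R \<longleftrightarrow> c \<in> carrier (RF R) \<and> (\<Sum>g\<in>Poly_Mapping.keys c. Poly_Mapping.lookup c g) = 0"
 by (simp add: IF_def augmentation_ideal_def RF_def)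

lemma aug_diff:
 "(\<Sum>g\<in>Poly_Mapping.keys (a - b). Poly_Mapping.lookup (a - b) g) =
  (\<Sum>g\<in>Poly_Mapping.keys a. Poly_Mapping.lookup a g) - (\<Sum>g\<in>Poly_Mapping.keys b. Poly_Mapping.lookup (b :: 'c \<Rightarrow>\<^sub>0 int) g)"
proof -
 let ?K = "Poly_Mapping.keys a \<union> Poly_Mapping.keys b"
 have "(\<Sum>g\<in>Poly_Mapping.keys c. Poly_Mapping.lookup c g) = (\<Sum>g\<in>?K. Poly_Mapping.lookup c g)"
  if "Poly_Mapping.keys c \<subseteq> ?K" for c :: "'c \<Rightarrow>\<^sub>0 int"
  by (rule sum.mono_neutral_left) (use that in \<open>auto simp: in_keys_iff\<close>)
 note s = this[of "a - b"] this[of a] this[of b]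
 show ?thesis using s keys_diff[of a b] by (simp add: lookup_minus sum_subtractf)
qed

lemma dsq_IF: "a \<in> nz R ==> dsq R a \<in> IF R" by (simp add: IF_iff) (simp add: dsq_eq aug_diff sq_def)

lemma IF_diff: "a \<in> IF R ==> b \<in> IF R ==> a - b \<in> IF R" by (simp add: IF_iff RF_diff_closed aug_diff)

lemma IF_zero: "0 \<in> IF R" using ring.ring_simprules(2)[OF cring.axioms(1)[OF RF_cring]] by (simp add: IF_iff RF_simps)

lemma IF_closed: "c \<in> IF R ==> c \<in> carrier (RF R)" by (simp add: IF_iff)

text \<open>Subtracting from c its augmentation times <1> leaves a combination of elements
  \<open><<a>>\<close>; on the augmentation ideal nothing is subtracted.\<close>

lemma IF_induct [consumes 1, case_names zero gen diff]:
 assumes "c \<in> IF R" "P 0" "!!a. a \<in> nz R ==> P (dsq R a)"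
  "!!a b. a \<in> IF R ==> b \<in> IF R ==> P a ==> P b ==> P (a - b)"
 shows "P c"
proof -
 define aug where "aug c = (\<Sum>g\<in>Poly_Mapping.keys c. Poly_Mapping.lookup c g)" for c :: "'a set \<Rightarrow>\<^sub>0 int"
 have "c - frag_cmul (aug c) (sq R \<one>) \<in> IF R \<and> P (c - frag_cmul (aug c) (sq R \<one>))"
  if "c \<in> carrier (RF R)" for c using that
 proof (induction c rule: RF_induct)
  case zero
  then show ?case using assms(2) IF_zero by (simp add: aug_def)
 next
  case (gen g)
  then show ?case using assms(3) dsq_IF by (simp add: aug_def sq_def dsq_eq)
 next
  case (diff a b)
  have "a - b - frag_cmul (aug (a - b)) (sq R \<one>) =
   (a - frag_cmul (aug a) (sq R \<one>)) - (b - frag_cmul (aug b) (sq R \<one>))" by (simp add: aug_def aug_diff frag_cmul_diff_distrib)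
  then show ?case using diff assms(4) IF_diff by metis
 qed
 from this[OF IF_closed[OF assms(1)]] show ?thesis using assms(1) by (simp add: aug_def IF_iff)
qed

lemma IF_ideal: "ideal (IF R) (RF R)"
proof -
 interpret RF: cring "RF R" by (rule RF_cring)
 have sub: "additive_subgroup (IF R) (RF R)"
 proof (rule additive_subgroupI'[OF RF.abelian_group_axioms])
  have neg: "-.\<^sub>(RF R) c = 0 - c" if "c \<in> IF R" for c using RF_diff[OF IF_closed[OF that], of 0] IF_closed[OF that] RF_simps
   by (metis RF.l_zero RF.a_inv_closed a_minus_def)
  show "-.\<^sub>(RF R) c \<in> IF R" if "c \<in> IF R" for c using that IF_diff[OF IF_zero that] neg by simp
  show "c +.\<^sub>(RF R) d \<in> IF R" if "c \<in> IF R" "d \<in> IF R" for c d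
  proof -
   have "c +.\<^sub>(RF R) d = c - (0 - d)" by (simp add: RF_simps)
   then show ?thesis using IF_diff[OF that(1) IF_diff[OF IF_zero that(2)]] by simp
  qed
 qed (auto simp: IF_closed IF_zero RF_simps)
 have mult: "r *.\<^sub>(RF R) c \<in> IF R" if "c \<in> IF R" "r \<in> carrier (RF R)" for r c using that(2)
 proof (induction r rule: RF_induct)
  case (gen g)
  show ?case using that(1)
  proof (induction c rule: IF_induct)
   case (gen a)
   have "sq R g *.\<^sub>(RF R) dsq R a = dsq R (g *. a) - dsq R g"
    using gen \<open>g \<in> nz R\<close> by (simp add: dsq_eq RF_mult_simps sq_mult)
   then show ?case using gen \<open>g \<in> nz R\<close> IF_diff dsq_IF by simp
  qed (simp_all add: RF_mult_simps IF_zero IF_diff)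
 qed (simp_all add: RF_mult_simps IF_zero IF_diff)
 show ?thesis
 proof (rule idealI[OF RF.ring_axioms additive_subgroup.a_subgroup[OF sub]])
  show "r *.\<^sub>(RF R) c \<in> IF R" if "c \<in> IF R" "r \<in> carrier (RF R)" for c r using mult that .
  show "c *.\<^sub>(RF R) r \<in> IF R" if "c \<in> IF R" "r \<in> carrier (RF R)" for c r using mult[OF that] that IF_closed RF.m_comm by metis
 qed
qed

text \<open>Both sides expand to \<open><a> + <-a> - <-1> - 1\<close>, because
  \<open><a><-a> = <-1>\<close>. Hence \<open>(1 + <-1>) IF\<close> is contained in the square of
  \<open>IF\<close>.\<close>

lemma minus_one_eq_IF2: "a \<in> nz R ==>
 (\<one>\<^sub>(RF R) +.\<^sub>(RF R) sq R (-. \<one>)) *.\<^sub>(RF R) dsq R a = 0 - dsq R a *.\<^sub>(RF R) dsq R (-. a)"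
proof -
 assume a: "a \<in> nz R"
 have "sq R (a *. -. a) = sq R (-. \<one>)" using sq_sq[of "-. \<one>" a] a by (simp add: l_minus r_minus)
 then show ?thesis using a by (simp add: RF_simps(1) sq_one[symmetric] dsq_mult) (simp add: dsq_eq RF_mult_simps sq_mult l_minus)
qed

section \<open>Evaluating symbols in a module\<close>

text \<open>A module is a record over a carrier and not an instance of \<open>ab_group_add\<close>.
  Symbol systems therefore live in the free abelian group on pairs of a square class and an
  argument. A module enters through an evaluation map h, and N is the preimage under h of a
  subgroup.\<close>

definition bsym :: "'a => 'a => ('a set \<times> 'a) \<Rightarrow>\<^sub>0 int"
 where "bsym g x = frag_of (sq_class R g, x)"

lemma bsym_eval:
 assumes "module (RF R) M" "!!x. x \<in> nz R ==> e x \<in> carrier M"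
 obtains h where "!!t. h t \<in> carrier M" "!!s t. h (s + t) = h s +.\<^sub>M h t" "!!s t. h (s - t) = h s -.\<^sub>M h t"
  "!!t. h (- t) = -.\<^sub>M h t" "h 0 = \<zero>\<^sub>M"
  "!!g x. g \<in> nz R ==> x \<in> nz R ==> h (bsym g x) = sq R g \<odot>\<^sub>M e x"
proof -
 interpret M: module "RF R" M by fact
 let ?T = "mk_module (UNIV :: (('a set \<times> 'a) \<Rightarrow>\<^sub>0 int) set) (+) 0 undefined"
 have T: "abelian_group ?T" by (rule frag_abelian_group[of _ UNIV]) simp_all
 \<comment> \<open>Pairs other than a square class with a nonzero argument go to zero, so that h is
   defined on the whole type.\<close>
 define f where "f = (\<lambda>(k, x). if k \<in> carrier (sq_class_group R) \<and> x \<in> nz R then frag_of k \<odot>\<^sub>M e x else \<zero>\<^sub>M)"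
 have fc: "f p \<in> carrier M" for p
  using assms(2) frag_of_group_ring[of _ "sq_class_group R", folded RF_def] by (auto simp: f_def split: prod.split)
 obtain h where h: "add_map ?T M h" "!!p. h (frag_of p) = f p" using frag_lift[of M UNIV f ?T] fc M.abelian_group_axioms by auto
 have neg: "-.\<^sub>?T t = - t" for t by (rule frag_a_inv[of _ UNIV]) simp_all
 have m: "s -.\<^sub>?T t = s - t" for s t by (simp add: a_minus_def neg)
 show ?thesis
 proof (rule that[of h])
  show "h t \<in> carrier M" for t using add_map_closed[OF h(1)] by simp
  show "h (s + t) = h s +.\<^sub>M h t" for s t using add_map_add[OF h(1), of s t] by simp
  show "h (s - t) = h s -.\<^sub>M h t" for s t using add_map_minus[OF T M.abelian_group_axioms h(1), of s t] by (simp add: m)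
  show "h (- t) = -.\<^sub>M h t" for t using add_map_neg[OF T M.abelian_group_axioms h(1), of t] by (simp add: neg)
  show "h 0 = \<zero>\<^sub>M" using add_map_zero[OF T M.abelian_group_axioms h(1)] by simp
  show "h (bsym g x) = sq R g \<odot>\<^sub>M e x" if "g \<in> nz R" "x \<in> nz R" for g x
   using that by (simp add: bsym_def h(2) f_def sq_class_group_carrier sq_def)
 qed
qed

lemma bsym_sq: "g \<in> nz R ==> s \<in> nz R ==> bsym (g *. (s *. s)) x = bsym g x" by (simp add: bsym_def sq_class_sq)

text \<open>Written in the variables x, p, q of \<open>symbol_system\<close>;
  \<open>five_rel_iff\<close> returns to x and y.\<close>

definition five_rel :: "('a sqr, 'x, 'n) module_scheme => ('a => 'x) => bool"
 where "five_rel M m \<longleftrightarrow> (\<forall>x\<in>nz R. \<forall>p\<in>nz R. \<forall>q\<in>nz R. x ~= \<one> --> x *. p ~= \<one> --> \<one> -. x = q *. (\<one> -. x *. p) -->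
   m x -.\<^sub>M m (x *. p) +.\<^sub>M sq R x \<odot>\<^sub>M m p -.\<^sub>M sq R (x *. (\<one> -. x)) \<odot>\<^sub>M m (p *. q)
    +.\<^sub>M sq R (\<one> -. x) \<odot>\<^sub>M m q = \<zero>\<^sub>M)"

lemma symbol_system_module:
 assumes "module (RF R) M" "!!x. x \<in> nz R ==> e x \<in> carrier M" "e \<one> = \<zero>\<^sub>M" "five_rel M e"
  and h: "!!t. h t \<in> carrier M" "!!s t. h (s + t) = h s +.\<^sub>M h t" "!!s t. h (s - t) = h s -.\<^sub>M h t"
  "!!t. h (- t) = -.\<^sub>M h t" "h 0 = \<zero>\<^sub>M"
  "!!g x. g \<in> nz R ==> x \<in> nz R ==> h (bsym g x) = sq R g \<odot>\<^sub>M e x"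
  and H: "additive_subgroup H M"
 shows "symbol_system R bsym {t. h t \<in> H}"
proof -
 interpret M: module "RF R" M by fact
 interpret H: additive_subgroup H M by fact
 show ?thesis
 proof (unfold_locales, goal_cases)
  case (6 g x p q)
  let ?A = "\<one> -. x"
  have U: "?A \<in> nz R" "x *. p \<in> nz R" "p *. q \<in> nz R" "x *. ?A \<in> nz R" using 6 by simp_all
  have "sq R g \<odot>\<^sub>M (e x -.\<^sub>M e (x *. p) +.\<^sub>M sq R x \<odot>\<^sub>M e p -.\<^sub>M sq R (x *. ?A) \<odot>\<^sub>M e (p *. q)
    +.\<^sub>M sq R ?A \<odot>\<^sub>M e q) = \<zero>\<^sub>M" using assms(4) 6 by (simp add: five_rel_def)
  moreover have "sq R g \<odot>\<^sub>M (e x -.\<^sub>M e (x *. p) +.\<^sub>M sq R x \<odot>\<^sub>M e p -.\<^sub>M sq R (x *. ?A) \<odot>\<^sub>M e (p *. q)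
    +.\<^sub>M sq R ?A \<odot>\<^sub>M e q) = h (bsym g x - bsym g (x *. p) + bsym (g *. x) p - bsym (g *. (x *. ?A)) (p *. q) + bsym (g *. ?A) q)"
   using 6 U assms(2) by (simp add: h(2,3,6) a_minus_def M.smult_r_distr M.smult_r_minus sq_smult_sq[OF assms(1)])
  ultimately show ?case by simp
 qed (use assms(3) in \<open>simp_all add: h(2,4,5,6) bsym_sq\<close>)
qed

lemma five_term_args:
 assumes "x \<in> nz R" "y \<in> nz R" "x ~= \<one>" "y ~= \<one>"
 shows "(\<one> -. inv x) *. inv (\<one> -. inv y) = (y *. inv x) *. ((\<one> -. x) *. inv (\<one> -. y))"
  and "sq R (inv x -. \<one>) = sq R (x *. (\<one> -. x))"
  and "x *. (y *. inv x) = y" and "\<one> -. x = (\<one> -. x) *. inv (\<one> -. y) *. (\<one> -. y)"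
proof -
 define A where "A = \<one> -. x"
 define B where "B = \<one> -. y"
 have U: "A \<in> nz R" "B \<in> nz R" using assms by (simp_all add: A_def B_def)
 have C: "x \<in> carrier R" "y \<in> carrier R" "inv x \<in> carrier R" "inv y \<in> carrier R" "A \<in> carrier R" "inv B \<in> carrier R" "B \<in> carrier R"
  using U assms by simp_all
 have "inv (\<one> -. inv y) = -. (inv B *. y)"
  unfolding one_minus_inv[OF assms(2)] B_def[symmetric] using assms U by (simp add: nz_inv_neg nz_inv_mult nz_inv_inv)
 then show "(\<one> -. inv x) *. inv (\<one> -. inv y) = (y *. inv x) *. ((\<one> -. x) *. inv (\<one> -. y))"
  unfolding one_minus_inv[OF assms(1)] A_def[symmetric] B_def[symmetric] using C by (simp add: l_minus r_minus m_ac)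
 have "inv x -. \<one> = -. (\<one> -. inv x)" using C by algebra
 then have "inv x -. \<one> = A *. inv x" using C one_minus_inv[OF assms(1)] by (simp add: A_def)
 also have "\<dots> = (x *. inv x) *. (A *. inv x)" using assms C by (simp add: nz_r_inv)
 also have "\<dots> = (x *. A) *. (inv x *. inv x)" using C by (simp add: m_ac)
 finally show "sq R (inv x -. \<one>) = sq R (x *. (\<one> -. x))" using U assms by (simp add: sq_sq A_def)
 have "x *. (y *. inv x) = y *. (x *. inv x)" using C by (simp add: m_ac)
 then show "x *. (y *. inv x) = y" using C assms by (simp add: nz_r_inv)
 show "\<one> -. x = (\<one> -. x) *. inv (\<one> -. y) *. (\<one> -. y)"
  unfolding A_def[symmetric] B_def[symmetric] using C U by (simp add: m_assoc nz_l_inv)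
qed

lemma five_rel_iff:
 "five_rel M m \<longleftrightarrow> (\<forall>x\<in>nz R. \<forall>y\<in>nz R. x ~= \<one> --> y ~= \<one> -->
   m x -.\<^sub>M m y +.\<^sub>M sq R x \<odot>\<^sub>M m (y *. inv x)
   -.\<^sub>M sq R (inv x -. \<one>) \<odot>\<^sub>M m ((\<one> -. inv x) *. inv (\<one> -. inv y))
   +.\<^sub>M sq R (\<one> -. x) \<odot>\<^sub>M m ((\<one> -. x) *. inv (\<one> -. y)) = \<zero>\<^sub>M)" (is "_ \<longleftrightarrow> ?R")
proof
 assume five: "five_rel M m"
 show ?R
 proof (intro ballI impI)
  fix x y assume xy: "x \<in> nz R" "y \<in> nz R" "x ~= \<one>" "y ~= \<one>"
  note args = five_term_args[OF xy]
  show "m x -.\<^sub>M m y +.\<^sub>M sq R x \<odot>\<^sub>M m (y *. inv x)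
   -.\<^sub>M sq R (inv x -. \<one>) \<odot>\<^sub>M m ((\<one> -. inv x) *. inv (\<one> -. inv y))
   +.\<^sub>M sq R (\<one> -. x) \<odot>\<^sub>M m ((\<one> -. x) *. inv (\<one> -. y)) = \<zero>\<^sub>M"
   using five[unfolded five_rel_def, rule_format, of x "y *. inv x" "(\<one> -. x) *. inv (\<one> -. y)"] xy args by simp
 qed
next
 assume r: ?R
 show "five_rel M m" unfolding five_rel_def
 proof (intro ballI impI)
  fix x p q assume h: "x \<in> nz R" "p \<in> nz R" "q \<in> nz R" "x ~= \<one>" "x *. p ~= \<one>" "\<one> -. x = q *. (\<one> -. x *. p)"
  have y: "x *. p \<in> nz R" using h by simp
  note args = five_term_args[OF h(1) y h(4,5)]
  have C: "x \<in> carrier R" "p \<in> carrier R" "q \<in> carrier R" "inv x \<in> carrier R" using h by simp_all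
  have "x *. p *. inv x = p *. (x *. inv x)" using C by (simp add: m_ac)
  then have e1: "x *. p *. inv x = p" using h C by (simp add: nz_r_inv)
  have e2: "(\<one> -. x) *. inv (\<one> -. x *. p) = q"
  proof -
   have "\<one> -. x *. p \<in> nz R" using h by simp
   then show ?thesis using C unfolding h(6) by (simp add: m_assoc nz_r_inv)
  qed
  show "m x -.\<^sub>M m (x *. p) +.\<^sub>M sq R x \<odot>\<^sub>M m p -.\<^sub>M sq R (x *. (\<one> -. x)) \<odot>\<^sub>M m (p *. q)
    +.\<^sub>M sq R (\<one> -. x) \<odot>\<^sub>M m q = \<zero>\<^sub>M" using r[rule_format, OF h(1) y h(4,5)] unfolding args(1,2) e1 e2 .
 qed
qed

end

lemma add_map_add_pow_nat:
 assumes "abelian_group M" "abelian_group N" "add_map M N f" "x \<in> carrier M"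
 shows "f (add_pow M (n::nat) x) = add_pow N n (f x)" using add_map_add_pow[OF assms, of "int n"] by (simp add: add_pow_def int_pow_int)

lemma add_pow_2: "abelian_group M ==> x \<in> carrier M ==> add_pow M (2::nat) x = x +.\<^sub>M x"
proof -
 assume "abelian_group M" and x: "x \<in> carrier M"
 then interpret M: abelian_group M by simp
 show ?thesis using x by (simp add: add_pow_def numeral_2_eq_2)
qed

lemma mod_hom_minus:
 assumes "module R M" "module R N" "h \<in> mod_hom R M N" "x \<in> carrier M" "y \<in> carrier M"
 shows "h (x -.\<^sub>M y) = h x -.\<^sub>N h y" using add_map_minus[OF module_abelian_group[OF assms(1)] module_abelian_group[OF assms(2)]
  mod_hom_add_map[OF assms(3)] assms(4,5)] .

lemma mod_hom_zero:
 assumes "module R M" "module R N" "h \<in> mod_hom R M N"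
 shows "h \<zero>\<^sub>M = \<zero>\<^sub>N" using add_map_zero[OF module_abelian_group[OF assms(1)] module_abelian_group[OF assms(2)]
  mod_hom_add_map[OF assms(3)]] .

lemma mod_hom_kills_gen:
 assumes "module R M" "module R N" "h \<in> mod_hom R M N" "S \<subseteq> carrier M" "!!x. x \<in> S ==> h x = \<zero>\<^sub>N"
  and "x \<in> submod_gen R M S"
 shows "h x = \<zero>\<^sub>N"
proof -
 have "submodule {x \<in> carrier M. h x \<in> {\<zero>\<^sub>N}} R M" by (rule submodule_preimage[OF assms(1-3) zero_submodule[OF assms(2)]])
 then have "submod_gen R M S \<subseteq> {x \<in> carrier M. h x \<in> {\<zero>\<^sub>N}}" by (rule submod_gen_least) (use assms(4,5) in auto)
 then show ?thesis using assms(6) by auto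
qed

lemma abelian_minus_eq_zero:
 assumes "abelian_group M" "x \<in> carrier M" "y \<in> carrier M" "x -.\<^sub>M y = \<zero>\<^sub>M"
 shows "x = y"
proof -
 interpret abelian_group M by fact
 have "x = x -.\<^sub>M y +.\<^sub>M y" using assms(2,3) by (simp add: a_minus_def a_assoc l_neg)
 then show ?thesis using assms by simp
qed

section \<open>Refined scissors congruence groups\<close>

context field
begin

lemma m_one_nz [simp]: "-. \<one> \<in> nz R" by simp

lemma rp_free_module: "module (RF R) (rp_free R)" unfolding rp_free_def by (rule module_free_module[OF RF_cring])

lemma Sym_gens: "x \<in> nz R ==> Sym x \<in> rp_gens R" by (simp add: rp_gens_def nz_def)

lemma rp_gens_cases:
 assumes "g \<in> rp_gens R"
 obtains x where "x \<in> nz R" "g = Sym x" | "card (carrier R) = 2" "g = CGen" using assms by (auto simp: rp_gens_def nz_def split: if_splits)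

lemma rp_basis_closed: "g \<in> rp_gens R ==> rp_basis R g \<in> carrier (rp_free R)"
 unfolding rp_basis_def rp_free_def by (rule free_basis_closed[OF RF_cring])

lemma rp_basis_Sym: "x \<in> nz R ==> rp_basis R (Sym x) \<in> carrier (rp_free R)" by (rule rp_basis_closed[OF Sym_gens])

lemma rp_free_gen: "submod_gen (RF R) (rp_free R) (rp_basis R ` rp_gens R) = carrier (rp_free R)"
 unfolding rp_basis_def rp_free_def by (rule free_module_gen[OF RF_cring])

lemma card_2_D: "card (carrier R) = 2 ==> x \<in> nz R ==> x = \<one>"
 by (metis card_2_iff empty_iff insert_iff nz_iff one_closed zero_closed one_not_zero)

lemma card_3_D:
 assumes "card (carrier R) = 3"
 shows "-. \<one> ~= \<one>" "x \<in> nz R ==> x = \<one> \<or> x = -. \<one>" "\<one> -. (-. \<one>) = -. \<one>" "inv (-. \<one>) = -. \<one>"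
proof -
 have fin: "finite (carrier R)" using assms by (metis card.infinite zero_neq_numeral)
 have card1: "card (carrier R - {\<zero>, \<one>}) = 1" using assms fin by (simp add: card_Diff_subset)
 then obtain t where t: "carrier R - {\<zero>, \<one>} = {t}" using card_1_singletonE by metis
 then have tc: "t \<in> carrier R" "t ~= \<zero>" "t ~= \<one>" by auto
 have D: "y = \<zero> \<or> y = \<one> \<or> y = t" if "y \<in> carrier R" for y using t that by blast
 \<comment> \<open>If -1 = 1, then t + 1 would be a fourth element.\<close>
 show ne: "-. \<one> ~= \<one>"
 proof
  assume e: "-. \<one> = \<one>"
  have "t +. \<one> \<in> carrier R" using tc by simp
  moreover have "t +. \<one> ~= \<zero>" using e tc by (metis minus_equality one_closed)
  moreover have "t +. \<one> ~= \<one>" using tc by (metis add.r_cancel_one one_closed)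
  moreover have "t +. \<one> ~= t" using tc by (metis add.l_cancel_one one_closed one_not_zero)
  ultimately show False using D by blast
 qed
 then have m: "-. \<one> = t" using D[of "-. \<one>"] by (metis a_inv_closed add.inv_eq_1_iff one_closed one_not_zero)
 show "x \<in> nz R ==> x = \<one> \<or> x = -. \<one>" using D m by (auto simp: nz_iff)
 have "\<one> -. (-. \<one>) \<in> nz R" using ne by simp
 moreover have "\<one> -. (-. \<one>) ~= \<one>" by (simp add: a_minus_def)
 ultimately show "\<one> -. (-. \<one>) = -. \<one>" using D m by (auto simp: nz_iff)
 show "inv (-. \<one>) = -. \<one>" by (simp add: nz_inv_neg)
qed

lemma five_term_closed:
 assumes "x \<in> nz R" "y \<in> nz R" "x ~= \<one>" "y ~= \<one>"
 shows "five_term R x y \<in> carrier (rp_free R)"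
  and "module (RF R) M ==> h \<in> mod_hom (RF R) (rp_free R) M ==> (!!z. z \<in> nz R ==> h (rp_basis R (Sym z)) = m z) ==>
   h (five_term R x y) = m x -.\<^sub>M m y +.\<^sub>M sq R x \<odot>\<^sub>M m (y *. inv x)
   -.\<^sub>M sq R (inv x -. \<one>) \<odot>\<^sub>M m ((\<one> -. inv x) *. inv (\<one> -. inv y))
   +.\<^sub>M sq R (\<one> -. x) \<odot>\<^sub>M m ((\<one> -. x) *. inv (\<one> -. y))"
proof -
 interpret P: module "RF R" "rp_free R" by (rule rp_free_module)
 have i: "inv x ~= \<one>" "inv y ~= \<one>" using assms inv_eq_one by auto
 have "inv x -. \<one> = -. (\<one> -. inv x)" using nz_inv[OF assms(1), THEN nz_closed] by algebra
 then have U: "inv x -. \<one> \<in> nz R" using i assms by simp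
 have V: "y *. inv x \<in> nz R" "\<one> -. x \<in> nz R" "(\<one> -. inv x) *. inv (\<one> -. inv y) \<in> nz R"
  "(\<one> -. x) *. inv (\<one> -. y) \<in> nz R" using assms i by simp_all
 note b = rp_basis_Sym[OF assms(1)] rp_basis_Sym[OF assms(2)] rp_basis_Sym[OF V(1)] rp_basis_Sym[OF V(3)] rp_basis_Sym[OF V(4)]
 note s = sq_closed[OF assms(1)] sq_closed[OF U] sq_closed[OF V(2)]
 show "five_term R x y \<in> carrier (rp_free R)" using b s by (simp add: five_term_def Let_def)
 show "h (five_term R x y) = m x -.\<^sub>M m y +.\<^sub>M sq R x \<odot>\<^sub>M m (y *. inv x)
   -.\<^sub>M sq R (inv x -. \<one>) \<odot>\<^sub>M m ((\<one> -. inv x) *. inv (\<one> -. inv y))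
   +.\<^sub>M sq R (\<one> -. x) \<odot>\<^sub>M m ((\<one> -. x) *. inv (\<one> -. y))"
  if M: "module (RF R) M" and h: "h \<in> mod_hom (RF R) (rp_free R) M" and hb: "!!z. z \<in> nz R ==> h (rp_basis R (Sym z)) = m z"
  using b s assms V by (simp add: five_term_def Let_def mod_hom_add[OF h] mod_hom_minus[OF P.module_axioms M h] mod_hom_smult[OF h] hb)
qed

lemma rp_rels_closed: "rp_rels R \<subseteq> carrier (rp_free R)"
proof -
 interpret P: module "RF R" "rp_free R" by (rule rp_free_module)
 have "add_pow (rp_free R) (3::nat) (rp_basis R CGen) \<in> carrier (rp_free R)" if "card (carrier R) = 2"
  using rp_basis_closed[of CGen] that by (simp add: rp_gens_def)
 moreover have "add_pow (rp_free R) (2::nat) (rp_basis R (Sym (-. \<one>)) +.\<^sub>(rp_free R) sq R (-. \<one>) \<odot>\<^sub>(rp_free R) rp_basis R (Sym (-. \<one>)))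
  \<in> carrier (rp_free R)" using rp_basis_Sym[OF m_one_nz] by simp
 moreover have "five_term R x y \<in> carrier (rp_free R)"
  if "x \<in> carrier R - {\<zero>, \<one>}" "y \<in> carrier R - {\<zero>, \<one>}" for x y
  using five_term_closed(1)[of x y] that by (simp add: nz_iff)
 ultimately show ?thesis using rp_basis_Sym[OF nz_one] unfolding rp_rels_def by (cases "card (carrier R) = 2"; cases "card (carrier R) = 3") auto
qed

lemma rp_sub_submodule: "submodule (rp_sub R) (RF R) (rp_free R)"
 unfolding rp_sub_def by (rule submodule_submod_gen[OF rp_free_module rp_rels_closed])

lemma RP_module: "module (RF R) (RP R)" unfolding RP_def by (rule module_quotient_module[OF rp_free_module rp_sub_submodule])

lemma rp_class_closed: "g \<in> rp_gens R ==> rp_class R g \<in> carrier (RP R)"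
 by (simp add: rp_class_def RP_def carrier_quotient_module rp_basis_closed)

lemma rp_sym_closed [simp]: "x \<in> nz R ==> rp_sym R x \<in> carrier (RP R)" by (simp add: rp_sym_def rp_class_closed Sym_gens)

lemma RP_gen: "submod_gen (RF R) (RP R) (rp_class R ` rp_gens R) = carrier (RP R)"
proof -
 have "rp_basis R ` rp_gens R \<subseteq> carrier (rp_free R)" using rp_basis_closed by auto
 from quotient_gen[OF rp_free_module rp_sub_submodule this rp_free_gen]
 show ?thesis by (simp add: RP_def rp_class_def[abs_def] image_image)
qed

lemma rp_class_rel:
 assumes "t \<in> rp_rels R"
 shows "rp_sub R +>\<^sub>(rp_free R) t = \<zero>\<^sub>(RP R)"
 using proj_eq_zero_iff[OF module_abelian_group[OF rp_free_module] submodule_additive[OF rp_sub_submodule], of t]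
  assms rp_rels_closed submod_gen_incl[of "rp_rels R" "RF R" "rp_free R"] by (auto simp: RP_def rp_sub_def)

lemma rp_sym_one: "rp_sym R \<one> = \<zero>\<^sub>(RP R)" unfolding rp_sym_def rp_class_def by (rule rp_class_rel) (simp add: rp_rels_def)

lemma five_rel_RP:
 assumes "card (carrier R) ~= 2" "card (carrier R) ~= 3"
 shows "five_rel (RP R) (rp_sym R)" unfolding five_rel_iff
proof (intro ballI impI)
 fix x y assume xy: "x \<in> nz R" "y \<in> nz R" "x ~= \<one>" "y ~= \<one>"
 have h: "restrict (\<lambda>t. rp_sub R +>\<^sub>(rp_free R) t) (carrier (rp_free R)) \<in> mod_hom (RF R) (rp_free R) (RP R)"
  unfolding RP_def by (rule proj_mod_hom[OF rp_free_module rp_sub_submodule])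
 have "five_term R x y \<in> rp_rels R" using assms xy by (auto simp: rp_rels_def nz_iff)
 then have "rp_sub R +>\<^sub>(rp_free R) five_term R x y = \<zero>\<^sub>(RP R)" by (rule rp_class_rel)
 moreover have "restrict (\<lambda>t. rp_sub R +>\<^sub>(rp_free R) t) (carrier (rp_free R)) (rp_basis R (Sym z)) = rp_sym R z"
  if "z \<in> nz R" for z using rp_basis_Sym[OF that] by (simp add: rp_sym_def rp_class_def)
 ultimately show "rp_sym R x -.\<^sub>(RP R) rp_sym R y +.\<^sub>(RP R) sq R x \<odot>\<^sub>(RP R) rp_sym R (y *. inv x)
   -.\<^sub>(RP R) sq R (inv x -. \<one>) \<odot>\<^sub>(RP R) rp_sym R ((\<one> -. inv x) *. inv (\<one> -. inv y))
   +.\<^sub>(RP R) sq R (\<one> -. x) \<odot>\<^sub>(RP R) rp_sym R ((\<one> -. x) *. inv (\<one> -. y)) = \<zero>\<^sub>(RP R)"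
  using five_term_closed(2)[OF xy RP_module h, of "rp_sym R"] five_term_closed(1)[OF xy] by simp
qed

text \<open>The universal property of \<open>RP\<close>. The extra generator over two elements is
  sent to zero, which is its image in all targets used below.\<close>

lemma RP_lift:
 assumes "module (RF R) M" "!!x. x \<in> nz R ==> m x \<in> carrier M" "m \<one> = \<zero>\<^sub>M" "five_rel M m"
  and "card (carrier R) = 3 ==>
   (m (-. \<one>) +.\<^sub>M sq R (-. \<one>) \<odot>\<^sub>M m (-. \<one>)) +.\<^sub>M (m (-. \<one>) +.\<^sub>M sq R (-. \<one>) \<odot>\<^sub>M m (-. \<one>)) = \<zero>\<^sub>M"
 obtains h where "h \<in> mod_hom (RF R) (RP R) M" "!!x. x \<in> nz R ==> h (rp_sym R x) = m x"
  "card (carrier R) = 2 ==> h (rp_class R CGen) = \<zero>\<^sub>M"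
proof -
 interpret M: module "RF R" M by fact
 interpret P: module "RF R" "rp_free R" by (rule rp_free_module)
 define m' where "m' g = (case g of Sym x => m x | CGen => \<zero>\<^sub>M)" for g
 have "m' \<in> rp_gens R \<rightarrow> carrier M" using assms(2) by (auto simp: m'_def elim!: rp_gens_cases)
 then obtain h where h: "h \<in> mod_hom (RF R) (rp_free R) M" "!!g. g \<in> rp_gens R ==> h (rp_basis R g) = m' g"
  using free_module_lift[OF assms(1)] unfolding rp_free_def rp_basis_def by metis
 have hs: "h (rp_basis R (Sym z)) = m z" if "z \<in> nz R" for z using h(2)[OF Sym_gens[OF that]] by (simp add: m'_def)
 have rel: "h t = \<zero>\<^sub>M" if t: "t \<in> rp_rels R" for t
 proof -
  consider "t = rp_basis R (Sym \<one>)"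
   | "card (carrier R) = 2" "t = add_pow (rp_free R) (3::nat) (rp_basis R CGen)"
   | "card (carrier R) = 3" "t = add_pow (rp_free R) (2::nat) (rp_basis R (Sym (-. \<one>))
     +.\<^sub>(rp_free R) sq R (-. \<one>) \<odot>\<^sub>(rp_free R) rp_basis R (Sym (-. \<one>)))"
   | x y where "x \<in> nz R" "y \<in> nz R" "x ~= \<one>" "y ~= \<one>" "t = five_term R x y"
   using t by (auto simp: rp_rels_def nz_iff split: if_splits)
  then show ?thesis
  proof cases
   case 1
   then show ?thesis using hs[OF nz_one] assms(3) by simp
  next
   case 2
   then have g: "CGen \<in> rp_gens R" by (simp add: rp_gens_def)
   then have "h (rp_basis R CGen) = \<zero>\<^sub>M" using h(2) by (simp add: m'_def)
   then show ?thesis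
    using 2 add_map_add_pow_nat[OF P.abelian_group_axioms M.abelian_group_axioms mod_hom_add_map[OF h(1)] rp_basis_closed[OF g], of 3]
     M.add.nat_pow_one[of 3] by simp
  next
   case 3
   let ?u = "rp_basis R (Sym (-. \<one>)) +.\<^sub>(rp_free R) sq R (-. \<one>) \<odot>\<^sub>(rp_free R) rp_basis R (Sym (-. \<one>))"
   have b: "rp_basis R (Sym (-. \<one>)) \<in> carrier (rp_free R)" by (rule rp_basis_Sym) simp
   then have u: "?u \<in> carrier (rp_free R)" by simp
   have "h ?u = m (-. \<one>) +.\<^sub>M sq R (-. \<one>) \<odot>\<^sub>M m (-. \<one>)"
    using b by (simp add: mod_hom_add[OF h(1)] mod_hom_smult[OF h(1)] hs)
   then show ?thesis using 3 assms(5) u by (simp add: add_pow_2[OF P.abelian_group_axioms] mod_hom_add[OF h(1)])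
  next
   case 4
   then show ?thesis using five_term_closed(2)[OF 4(1-4) assms(1) h(1) hs] assms(4) by (simp add: five_rel_iff)
  qed
 qed
 have "h t = \<zero>\<^sub>M" if "t \<in> rp_sub R" for t
  using mod_hom_kills_gen[OF rp_free_module assms(1) h(1) rp_rels_closed rel] that by (simp add: rp_sub_def)
 then obtain g where g: "g \<in> mod_hom (RF R) (RP R) M" "!!t. t \<in> carrier (rp_free R) ==> g (rp_sub R +>\<^sub>(rp_free R) t) = h t"
  using quotient_mod_lift[OF rp_free_module rp_sub_submodule assms(1) h(1)] unfolding RP_def by metis
 show ?thesis
 proof (rule that[OF g(1)])
  show "g (rp_sym R x) = m x" if "x \<in> nz R" for x using that by (simp add: rp_sym_def rp_class_def g(2) rp_basis_Sym hs)
  show "g (rp_class R CGen) = \<zero>\<^sub>M" if "card (carrier R) = 2"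
  proof -
   have "CGen \<in> rp_gens R" using that by (simp add: rp_gens_def)
   then show ?thesis by (simp add: rp_class_def g(2) rp_basis_closed h(2) m'_def)
  qed
 qed
qed

lemma RP_hom_eq:
 assumes "module (RF R) M" "h \<in> mod_hom (RF R) (RP R) M" "h' \<in> mod_hom (RF R) (RP R) M"
  and "!!x. x \<in> nz R ==> h (rp_sym R x) = h' (rp_sym R x)"
  and "card (carrier R) = 2 ==> h (rp_class R CGen) = h' (rp_class R CGen)"
 shows "h = h'"
proof (rule mod_hom_eq_gen[OF RP_module assms(1) _ RP_gen assms(2,3)])
 show "rp_class R ` rp_gens R \<subseteq> carrier (RP R)" using rp_class_closed by auto
 fix x assume "x \<in> rp_class R ` rp_gens R"
 then obtain g where "g \<in> rp_gens R" "x = rp_class R g" by auto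
 then show "h x = h' x" using assms(4,5) by (elim rp_gens_cases) (auto simp: rp_sym_def)
qed

subsection \<open>The homomorphism \<open>\<lambda>\<^sub>1\<close>\<close>

lemma IF2_module: "module (RF R) (IF2 R)"
proof -
 interpret RF: cring "RF R" by (rule RF_cring)
 interpret I2: ideal "IF R \<cdot>\<^sub>(RF R) IF R" "RF R" by (rule RF.ideal_prod_is_ideal[OF IF_ideal IF_ideal])
 have reg: "module (RF R) (regular_module (RF R))" by (rule moduleI)
    (use RF.l_neg in \<open>auto simp: regular_module_def RF.is_cring RF.m_assoc RF.l_distr RF.r_distr RF.a_ac
     intro!: abelian_groupI bexI[of _ "-.\<^sub>(RF R) _"]\<close>)
 then interpret Rg: module "RF R" "regular_module (RF R)" .
 have "submodule (IF R \<cdot>\<^sub>(RF R) IF R) (RF R) (regular_module (RF R))"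
 proof (rule Rg.submoduleI)
  have "-.\<^sub>(regular_module (RF R)) a = -.\<^sub>(RF R) a" if "a \<in> carrier (RF R)" for a
   by (rule Rg.M.minus_equality) (use that RF.l_neg in \<open>auto simp: regular_module_def\<close>)
  then show "-.\<^sub>(regular_module (RF R)) a \<in> IF R \<cdot>\<^sub>(RF R) IF R" if "a \<in> IF R \<cdot>\<^sub>(RF R) IF R" for a
   using that I2.a_inv_closed I2.Icarr by simp
 qed (use I2.a_subset I2.I_l_closed in \<open>auto simp: regular_module_def\<close>)
 from submodule.submodule_is_module[OF this reg] show ?thesis by (simp add: IF2_def)
qed

lemma IF2_simps:
 "carrier (IF2 R) = IF R \<cdot>\<^sub>(RF R) IF R" "ring.add (IF2 R) = (+)" "\<zero>\<^sub>(IF2 R) = 0" "r \<odot>\<^sub>(IF2 R) c = r *.\<^sub>(RF R) c"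
 by (simp_all add: IF2_def regular_module_def RF_simps)

lemma IF2_carrier_RF: "c \<in> carrier (IF2 R) ==> c \<in> carrier (RF R)"
 using ring.ideal_prod_in_carrier[OF cring.axioms(1)[OF RF_cring] IF_ideal IF_ideal] by (auto simp: IF2_simps)

lemma IF2_diff: "a \<in> carrier (IF2 R) ==> b \<in> carrier (IF2 R) ==> a -.\<^sub>(IF2 R) b = a - b"
proof -
 assume a: "a \<in> carrier (IF2 R)" and b: "b \<in> carrier (IF2 R)"
 interpret module "RF R" "IF2 R" by (rule IF2_module)
 have "-.\<^sub>(IF2 R) b + b = 0" using M.l_neg[OF b] by (simp add: IF2_simps)
 then show ?thesis by (simp add: a_minus_def IF2_simps eq_neg_iff_add_eq_0[symmetric])
qed

definition lam :: "'a => 'a sqr"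
 where "lam x = (if x = \<one> then 0 else dsq R (\<one> -. x) *.\<^sub>(RF R) dsq R x)"

lemma lam_closed: "x \<in> nz R ==> lam x \<in> carrier (IF2 R)"
proof -
 assume x: "x \<in> nz R"
 interpret module "RF R" "IF2 R" by (rule IF2_module)
 have "0 \<in> carrier (IF2 R)" using M.zero_closed by (simp add: IF2_simps)
 then show ?thesis using x by (auto simp: lam_def IF2_simps intro!: ideal_prod.prod dsq_IF)
qed

lemma lam_eq: "x \<in> nz R ==> x ~= \<one> ==> lam x = sq R ((\<one> -. x) *. x) - sq R (\<one> -. x) - sq R x + sq R \<one>"
 by (simp add: lam_def dsq_mult)

lemma sq_eqI: "g \<in> nz R ==> s \<in> nz R ==> g' = g *. (s *. s) ==> sq R g' = sq R g" by (simp add: sq_sq)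

lemma sq_inv: "a \<in> nz R ==> g \<in> nz R ==> sq R (g *. inv a) = sq R (g *. a)"
proof -
 assume a: "a \<in> nz R" and g: "g \<in> nz R"
 have "g *. a *. (inv a *. inv a) = g *. ((a *. inv a) *. inv a)" using a g by (simp add: m_ac)
 then show ?thesis using sq_sq[of "g *. a" "inv a"] a g by (simp add: nz_r_inv)
qed

lemma five_rel_lam: "five_rel (IF2 R) lam" unfolding five_rel_def
proof (intro ballI impI)
 fix x p q assume h: "x \<in> nz R" "p \<in> nz R" "q \<in> nz R" "x ~= \<one>" "x *. p ~= \<one>" "\<one> -. x = q *. (\<one> -. x *. p)"
 interpret I2: module "RF R" "IF2 R" by (rule IF2_module)
 define A where "A = \<one> -. x"
 define B where "B = \<one> -. x *. p"
 have U: "A \<in> nz R" "B \<in> nz R" "x *. p \<in> nz R" "p *. q \<in> nz R" "x *. A \<in> nz R" using h by (simp_all add: A_def B_def)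
 have C: "x \<in> carrier R" "p \<in> carrier R" "q \<in> carrier R" "A \<in> carrier R" "B \<in> carrier R" using h U by simp_all
 have A: "A = q *. B" using h(6) by (simp add: A_def B_def)
 have cl: "lam x \<in> carrier (IF2 R)" "lam (x *. p) \<in> carrier (IF2 R)" "lam p \<in> carrier (IF2 R)" "lam q \<in> carrier (IF2 R)"
  "lam (p *. q) \<in> carrier (IF2 R)" using lam_closed h U by simp_all
 have rc: "sq R x \<in> carrier (RF R)" "sq R (x *. A) \<in> carrier (RF R)" "sq R A \<in> carrier (RF R)" using h U by simp_all
 have red: "lam x -.\<^sub>(IF2 R) lam (x *. p) +.\<^sub>(IF2 R) sq R x \<odot>\<^sub>(IF2 R) lam p -.\<^sub>(IF2 R) sq R (x *. A) \<odot>\<^sub>(IF2 R) lam (p *. q)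
    +.\<^sub>(IF2 R) sq R A \<odot>\<^sub>(IF2 R) lam q =
   lam x - lam (x *. p) + sq R x *.\<^sub>(RF R) lam p - sq R (x *. A) *.\<^sub>(RF R) lam (p *. q) + sq R A *.\<^sub>(RF R) lam q"
  using IF2_diff[OF cl(1,2)] IF2_diff[OF _ I2.smult_closed[OF rc(2) cl(5)], of "lam x - lam (x *. p) + sq R x *.\<^sub>(RF R) lam p"]
   I2.M.minus_closed[OF cl(1,2)] I2.M.a_closed[OF I2.M.minus_closed[OF cl(1,2)] I2.smult_closed[OF rc(1) cl(3)]] by (simp add: IF2_simps(2,4))
 have "lam x - lam (x *. p) + sq R x *.\<^sub>(RF R) lam p - sq R (x *. A) *.\<^sub>(RF R) lam (p *. q) + sq R A *.\<^sub>(RF R) lam q = 0"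
 \<comment> \<open>If p = 1 then q = 1 too, and \<open>lam\<close> is zero there by definition; the
   expansion \<open>lam_eq\<close> is valid only away from 1.\<close>
 proof (cases "p = \<one>")
  case True
  then have "B = A" using C by (simp add: A_def B_def)
  then have "q *. B *. inv B = B *. inv B" using A C by simp
  moreover have "q *. B *. inv B = q *. (B *. inv B)" by (rule m_assoc) (use U C nz_closed[OF nz_inv[OF U(2)]] in simp_all)
  ultimately have "q = \<one>" using U C nz_r_inv[OF U(2)] by simp
  then show ?thesis using True C by (simp add: lam_def RF_mult_simps)
 next
  case False
  \<comment> \<open>E = x - y satisfies E = x(1-p) = B(1-q) = x B(1-pq). Written through E, x, p, q,
    A and B, all square classes cancel.\<close>
  define E where "E = x -. x *. p"
  have EP: "E = x *. (\<one> -. p)" unfolding E_def using C by algebra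
  have Enz: "E \<in> nz R" using False h unfolding EP by simp
  have EC: "E \<in> carrier R" using Enz by simp
  have BA: "B -. A = E" unfolding E_def A_def B_def using C by algebra
  have q1: "B *. (\<one> -. q) = E"
  proof -
   have "B *. (\<one> -. q) = B -. q *. B" using C by (simp add: a_minus_def r_distr r_minus m_comm[of q B])
   then show ?thesis using BA A by simp
  qed
  have pq1: "(x *. B) *. (\<one> -. p *. q) = E"
  proof -
   have "(x *. B) *. (\<one> -. p *. q) = x *. B -. x *. p *. (q *. B)" using C by algebra
   also have "\<dots> = x *. B -. x *. p *. A" using A by simp
   also have "\<dots> = E" unfolding A_def B_def E_def using C by algebra
   finally show ?thesis .
  qed
  have qn: "q ~= \<one>" using q1 Enz C by (auto simp: a_minus_def r_neg nz_iff)
  have pqn: "p *. q ~= \<one>" using pq1 Enz C by (auto simp: a_minus_def r_neg nz_iff)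
  have V: "\<one> -. p \<in> nz R" "\<one> -. q \<in> nz R" "\<one> -. p *. q \<in> nz R" using h U False qn pqn by simp_all
  have VC: "\<one> -. p \<in> carrier R" "\<one> -. q \<in> carrier R" "\<one> -. p *. q \<in> carrier R" using V by simp_all
  have sA: "sq R (g *. A) = sq R (g *. (q *. B))" for g using A by simp
  have e1: "sq R (x *. ((\<one> -. p) *. p)) = sq R (E *. p)" using EP C VC by (simp add: m_ac)
  have e2: "sq R (x *. (\<one> -. p)) = sq R E" using EP by simp
  have e3: "sq R ((x *. A) *. ((\<one> -. p *. q) *. (p *. q))) = sq R (E *. p)"
  proof (rule sq_eqI[of _ q])
   have "(x *. A) *. ((\<one> -. p *. q) *. (p *. q)) = ((x *. B) *. (\<one> -. p *. q)) *. (p *. (q *. q))" using C VC by (simp add: A m_ac)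
   then show "(x *. A) *. ((\<one> -. p *. q) *. (p *. q)) = E *. p *. (q *. q)" using pq1 C EC by (simp add: m_assoc)
  qed (use h Enz in simp_all)
  have e4: "sq R ((x *. A) *. (\<one> -. p *. q)) = sq R (E *. q)"
  proof -
   have "(x *. A) *. (\<one> -. p *. q) = ((x *. B) *. (\<one> -. p *. q)) *. q" using C VC by (simp add: A m_ac)
   then show ?thesis using pq1 by simp
  qed
  have e5: "sq R ((x *. A) *. (p *. q)) = sq R (B *. (x *. p))" by (rule sq_eqI[of _ q]) (use h U C in \<open>simp_all add: A m_ac\<close>)
  have e6: "sq R (A *. ((\<one> -. q) *. q)) = sq R E"
  proof (rule sq_eqI[of _ q])
   have "A *. ((\<one> -. q) *. q) = (B *. (\<one> -. q)) *. (q *. q)" using C VC by (simp add: A m_ac)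
   then show "A *. ((\<one> -. q) *. q) = E *. (q *. q)" using q1 by simp
  qed (use h Enz in simp_all)
  have e7: "sq R (A *. (\<one> -. q)) = sq R (E *. q)"
  proof -
   have "A *. (\<one> -. q) = (B *. (\<one> -. q)) *. q" using C VC by (simp add: A m_ac)
   then show ?thesis using q1 by simp
  qed
  have e8: "sq R (A *. q) = sq R B" by (rule sq_eqI[of _ q]) (use h U C in \<open>simp_all add: A m_ac\<close>)
  have l: "lam x = sq R (x *. A) - sq R A - sq R x + sq R \<one>" using lam_eq[OF h(1,4), folded A_def] m_comm[OF C(4) C(1)] by simp
  have l2: "lam (x *. p) = sq R (B *. (x *. p)) - sq R B - sq R (x *. p) + sq R \<one>" using lam_eq[OF U(3) h(5), folded B_def] .
  have l3: "sq R x *.\<^sub>(RF R) lam p = sq R (E *. p) - sq R E - sq R (x *. p) + sq R x"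
   using h V False by (simp add: lam_eq RF_mult_simps sq_mult e1 e2)
  have l4: "sq R (x *. A) *.\<^sub>(RF R) lam (p *. q) = sq R (E *. p) - sq R (E *. q) - sq R (B *. (x *. p)) + sq R (x *. A)"
   using h U V pqn C by (simp add: lam_eq RF_mult_simps sq_mult e3 e4 e5)
  have l5: "sq R A *.\<^sub>(RF R) lam q = sq R E - sq R (E *. q) - sq R B + sq R A"
   using h U V qn C by (simp add: lam_eq RF_mult_simps sq_mult e6 e7 e8)
  show ?thesis by (simp add: l l2 l3 l4 l5)
 qed
 then show "lam x -.\<^sub>(IF2 R) lam (x *. p) +.\<^sub>(IF2 R) sq R x \<odot>\<^sub>(IF2 R) lam p -.\<^sub>(IF2 R) sq R (x *. (\<one> -. x)) \<odot>\<^sub>(IF2 R) lam (p *. q)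
    +.\<^sub>(IF2 R) sq R (\<one> -. x) \<odot>\<^sub>(IF2 R) lam q = \<zero>\<^sub>(IF2 R)" using red by (simp add: A_def IF2_simps(3))
qed

text \<open>It shows that \<open>lambda1\<close> sends \<open>psi1\<close> into
  \<open>(1 + <-1>) IF\<close> and hence descends to \<open>RPt\<close>. At x = -1 it also yields
  the defining relation over three elements.\<close>

lemma lam_inv:
 assumes "x \<in> nz R"
 shows "lam x + sq R (-. \<one>) *.\<^sub>(RF R) lam (inv x) = 0 - (\<one>\<^sub>(RF R) +.\<^sub>(RF R) sq R (-. \<one>)) *.\<^sub>(RF R) (if x = \<one> then 0 else dsq R x)"
proof (cases "x = \<one>")
 case True
 then show ?thesis by (simp add: lam_def RF_mult_simps)
next
 case False
 define A where "A = \<one> -. x"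
 have U: "A \<in> nz R" "inv x \<in> nz R" "inv x ~= \<one>" using assms False inv_eq_one by (auto simp: A_def)
 have C: "A \<in> carrier R" "x \<in> carrier R" "inv x \<in> carrier R" using U assms by simp_all
 have i: "\<one> -. inv x = -. (A *. inv x)" unfolding A_def by (rule one_minus_inv[OF assms])
 have l1: "lam x = sq R (A *. x) - sq R A - sq R x + sq R \<one>" using lam_eq[OF assms False] by (simp add: A_def)
 have 1: "sq R (-. \<one> *. (-. (A *. inv x) *. inv x)) = sq R A"
  by (rule sq_eqI[of _ "inv x"]) (use U C in \<open>simp_all add: l_minus r_minus m_ac\<close>)
 have 2: "sq R (-. \<one> *. (-. (A *. inv x))) = sq R (A *. x)" using sq_inv[OF assms U(1)] C by (simp add: l_minus r_minus)
 have 3: "sq R (-. \<one> *. inv x) = sq R (-. \<one> *. x)" using sq_inv[OF assms m_one_nz] by simp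
 have l2: "sq R (-. \<one>) *.\<^sub>(RF R) lam (inv x) = sq R A - sq R (A *. x) - sq R (-. \<one> *. x) + sq R (-. \<one>)"
  using U assms C 1 2 3 by (simp add: lam_eq i RF_mult_simps sq_mult)
 have r: "(\<one>\<^sub>(RF R) +.\<^sub>(RF R) sq R (-. \<one>)) *.\<^sub>(RF R) dsq R x = sq R x - sq R \<one> + (sq R (-. \<one> *. x) - sq R (-. \<one>))"
  using assms by (simp add: RF_simps(1) sq_one[symmetric] dsq_eq RF_mult_simps sq_mult)
 show ?thesis using False by (simp add: l1 l2 r)
qed

lemma minus_one_three: "card (carrier R) = 3 ==> (\<one>\<^sub>(RF R) +.\<^sub>(RF R) sq R (-. \<one>)) *.\<^sub>(RF R) dsq R (-. \<one>) = 0"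
 by (simp add: RF_simps(1) sq_one[symmetric] dsq_eq RF_mult_simps sq_mult r_minus)

lemma lambda1_spec:
 shows "lambda1 R \<in> mod_hom (RF R) (RP R) (IF2 R)"
  and "!!x. x \<in> nz R ==> lambda1 R (rp_sym R x) = lam x"
  and "card (carrier R) = 2 ==> lambda1 R (rp_class R CGen) = 0"
proof -
 interpret module "RF R" "IF2 R" by (rule IF2_module)
 \<comment> \<open>By \<open>lam_inv\<close> at -1 the bracket is a multiple of
   \<open>(1 + <-1>)<<-1>>\<close>, which is zero.\<close>
 have three: "(lam (-. \<one>) +.\<^sub>(IF2 R) sq R (-. \<one>) \<odot>\<^sub>(IF2 R) lam (-. \<one>)) +.\<^sub>(IF2 R) (lam (-. \<one>) +.\<^sub>(IF2 R) sq R (-. \<one>) \<odot>\<^sub>(IF2 R) lam (-. \<one>)) = \<zero>\<^sub>(IF2 R)"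
  if "card (carrier R) = 3" using lam_inv[OF m_one_nz] minus_one_three[OF that] card_3_D[OF that] by (simp add: IF2_simps)
 obtain h where h: "h \<in> mod_hom (RF R) (RP R) (IF2 R)" "!!x. x \<in> nz R ==> h (rp_sym R x) = lam x"
  "card (carrier R) = 2 ==> h (rp_class R CGen) = \<zero>\<^sub>(IF2 R)"
  by (rule RP_lift[OF IF2_module lam_closed _ five_rel_lam three]) (auto simp: lam_def IF2_simps)
 have "\<exists>!f. f \<in> mod_hom (RF R) (RP R) (IF2 R) \<and>
  (\<forall>x\<in>carrier R - {\<zero>, \<one>}. f (rp_sym R x) = dsq R (\<one> -. x) *.\<^sub>(RF R) dsq R x) \<and>
  (card (carrier R) = 2 --> f (rp_class R CGen) = \<zero>\<^sub>(RF R))"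
 proof (rule ex1I[of _ h])
  show "h \<in> mod_hom (RF R) (RP R) (IF2 R) \<and>
  (\<forall>x\<in>carrier R - {\<zero>, \<one>}. h (rp_sym R x) = dsq R (\<one> -. x) *.\<^sub>(RF R) dsq R x) \<and>
  (card (carrier R) = 2 --> h (rp_class R CGen) = \<zero>\<^sub>(RF R))" using h by (auto simp: lam_def nz_iff IF2_simps RF_simps)
 next
  fix f assume f: "f \<in> mod_hom (RF R) (RP R) (IF2 R) \<and>
  (\<forall>x\<in>carrier R - {\<zero>, \<one>}. f (rp_sym R x) = dsq R (\<one> -. x) *.\<^sub>(RF R) dsq R x) \<and>
  (card (carrier R) = 2 --> f (rp_class R CGen) = \<zero>\<^sub>(RF R))"
  show "f = h"
  proof (rule RP_hom_eq[OF IF2_module])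
   fix x assume x: "x \<in> nz R"
   show "f (rp_sym R x) = h (rp_sym R x)"
   proof (cases "x = \<one>")
    case True
    then show ?thesis using mod_hom_zero[OF RP_module IF2_module h(1)] mod_hom_zero[OF RP_module IF2_module conjunct1[OF f]] by (simp add: rp_sym_one)
   next
    case False
    then show ?thesis using f h(2)[OF x] x by (simp add: lam_def nz_iff)
   qed
  qed (use f h in \<open>auto simp: IF2_simps RF_simps\<close>)
 qed
 from theI'[OF this, folded lambda1_def]
 have l: "lambda1 R \<in> mod_hom (RF R) (RP R) (IF2 R)"
  "\<forall>x\<in>carrier R - {\<zero>, \<one>}. lambda1 R (rp_sym R x) = dsq R (\<one> -. x) *.\<^sub>(RF R) dsq R x"
  "card (carrier R) = 2 --> lambda1 R (rp_class R CGen) = \<zero>\<^sub>(RF R)" by auto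
 show "lambda1 R \<in> mod_hom (RF R) (RP R) (IF2 R)" by (rule l(1))
 show "lambda1 R (rp_sym R x) = lam x" if "x \<in> nz R" for x
 proof (cases "x = \<one>")
  case True
  then show ?thesis using mod_hom_zero[OF RP_module IF2_module l(1)] by (simp add: rp_sym_one lam_def IF2_simps)
 next
  case False
  then show ?thesis using l(2) that by (simp add: lam_def nz_iff)
 qed
 show "card (carrier R) = 2 ==> lambda1 R (rp_class R CGen) = 0" using l(3) by (simp add: RF_simps)
qed

end

lemma cyclic_submodule:
 assumes "module R M" "d \<in> carrier M"
 shows "submodule {r \<odot>\<^sub>M d | r. r \<in> carrier R} R M"
proof -
 interpret module R M by fact
 let ?H = "{r \<odot>\<^sub>M d | r. r \<in> carrier R}"
 have I: "r \<odot>\<^sub>M d \<in> ?H" if "r \<in> carrier R" for r using that by blast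
 show ?thesis
 proof (rule submoduleI)
  show "\<zero>\<^sub>M \<in> ?H" using I[OF R.zero_closed] assms(2) by simp
 next
  fix a assume "a \<in> ?H"
  then obtain r where "r \<in> carrier R" "a = r \<odot>\<^sub>M d" by blast
  then show "-.\<^sub>M a \<in> ?H" using I[of "-.\<^sub>R r"] smult_l_minus[of r d] assms(2) by simp
 next
  fix a c assume "a \<in> ?H" "c \<in> ?H"
  then obtain r s where "r \<in> carrier R" "a = r \<odot>\<^sub>M d" "s \<in> carrier R" "c = s \<odot>\<^sub>M d" by blast
  then show "a +.\<^sub>M c \<in> ?H" using I[of "r +.\<^sub>R s"] smult_l_distr[of r s d] assms(2) by simp
 next
  fix s a assume s: "s \<in> carrier R" and "a \<in> ?H"
  then obtain r where "r \<in> carrier R" "a = r \<odot>\<^sub>M d" by blast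
  then show "s \<odot>\<^sub>M a \<in> ?H" using I[of "s *.\<^sub>R r"] smult_assoc1[of s r d] assms(2) s by simp
 qed (use assms(2) in auto)
qed

lemma submodule_image:
 assumes "module R M" "module R N" "f \<in> mod_hom R M N" "submodule H R M"
 shows "submodule (f ` H) R N"
proof -
 interpret M: module R M by fact
 interpret N: module R N by fact
 note E = M.submoduleE[OF assms(4)]
 have H: "x \<in> carrier M" if "x \<in> H" for x using that E(1) by blast
 show ?thesis
 proof (rule N.submoduleI)
  show "f ` H \<subseteq> carrier N" using H mod_hom_closed[OF assms(3)] by blast
  have "\<zero>\<^sub>M \<in> H" using additive_subgroup.zero_closed[OF submodule_additive[OF assms(4)]] .
  then show "\<zero>\<^sub>N \<in> f ` H" using mod_hom_zero[OF assms(1-3)] by force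
 next
  fix a assume "a \<in> f ` H"
  then obtain x where x: "x \<in> H" "a = f x" by blast
  then have "-.\<^sub>N a = f (-.\<^sub>M x)"
   using add_map_neg[OF M.abelian_group_axioms N.abelian_group_axioms mod_hom_add_map[OF assms(3)] H] by simp
  then show "-.\<^sub>N a \<in> f ` H" using E(3)[OF x(1)] by blast
 next
  fix a c assume "a \<in> f ` H" "c \<in> f ` H"
  then obtain x y where x: "x \<in> H" "a = f x" "y \<in> H" "c = f y" by blast
  then have "a +.\<^sub>N c = f (x +.\<^sub>M y)" using mod_hom_add[OF assms(3)] H by simp
  then show "a +.\<^sub>N c \<in> f ` H" using E(5) x by blast
 next
  fix r a assume r: "r \<in> carrier R" and "a \<in> f ` H"
  then obtain x where x: "x \<in> H" "a = f x" by blast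
  then have "r \<odot>\<^sub>N a = f (r \<odot>\<^sub>M x)" using mod_hom_smult[OF assms(3) r] H by simp
  then show "r \<odot>\<^sub>N a \<in> f ` H" using E(4)[OF r x(1)] by blast
 qed
qed

context field
begin

definition sym_eval :: "('a sqr, 'x, 'n) module_scheme => ('a => 'x) => ((('a set \<times> 'a) \<Rightarrow>\<^sub>0 int) => 'x) => bool"
 where "sym_eval M e h \<longleftrightarrow> (\<forall>t. h t \<in> carrier M) \<and> (\<forall>s t. h (s + t) = h s +.\<^sub>M h t) \<and>
  (\<forall>s t. h (s - t) = h s -.\<^sub>M h t) \<and> (\<forall>t. h (- t) = -.\<^sub>M h t) \<and> h 0 = \<zero>\<^sub>M \<and>
  (\<forall>g\<in>nz R. \<forall>x\<in>nz R. h (bsym g x) = sq R g \<odot>\<^sub>M e x)"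

lemma sym_evalD:
 assumes "sym_eval M e h"
 shows "!!t. h t \<in> carrier M" "!!s t. h (s + t) = h s +.\<^sub>M h t" "!!s t. h (s - t) = h s -.\<^sub>M h t"
  "!!t. h (- t) = -.\<^sub>M h t" "h 0 = \<zero>\<^sub>M"
  "!!g x. g \<in> nz R ==> x \<in> nz R ==> h (bsym g x) = sq R g \<odot>\<^sub>M e x" using assms by (simp_all add: sym_eval_def)

lemma sym_eval_ex:
 assumes "module (RF R) M" "!!x. x \<in> nz R ==> e x \<in> carrier M"
 shows "\<exists>h. sym_eval M e h"
proof (rule bsym_eval[of M e])
 fix h assume "!!t. h t \<in> carrier M" "!!s t. h (s + t) = h s +.\<^sub>M h t" "!!s t. h (s - t) = h s -.\<^sub>M h t"
  "!!t. h (- t) = -.\<^sub>M h t" "h 0 = \<zero>\<^sub>M"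
  "!!g x. g \<in> nz R ==> x \<in> nz R ==> h (bsym g x) = sq R g \<odot>\<^sub>M e x"
 then have "sym_eval M e h" by (simp add: sym_eval_def)
 then show "\<exists>h. sym_eval M e h" by blast
qed (use assms in auto)

lemma five_rel_hom:
 assumes M: "module (RF R) M" and N: "module (RF R) N" and f: "f \<in> mod_hom (RF R) M N"
  and m: "!!x. x \<in> nz R ==> m x \<in> carrier M" "five_rel M m"
 shows "five_rel N (\<lambda>x. f (m x))" unfolding five_rel_def
proof (intro ballI impI)
 interpret M: module "RF R" M by fact
 interpret N: module "RF R" N by fact
 fix x p q assume h: "x \<in> nz R" "p \<in> nz R" "q \<in> nz R" "x ~= \<one>" "x *. p ~= \<one>" "\<one> -. x = q *. (\<one> -. x *. p)"
 have A: "\<one> -. x \<in> nz R" using h by simp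
 have "f (m x -.\<^sub>M m (x *. p) +.\<^sub>M sq R x \<odot>\<^sub>M m p -.\<^sub>M sq R (x *. (\<one> -. x)) \<odot>\<^sub>M m (p *. q)
    +.\<^sub>M sq R (\<one> -. x) \<odot>\<^sub>M m q) = \<zero>\<^sub>N" using m(2) h mod_hom_zero[OF M N f] unfolding five_rel_def by metis
 then show "f (m x) -.\<^sub>N f (m (x *. p)) +.\<^sub>N sq R x \<odot>\<^sub>N f (m p) -.\<^sub>N sq R (x *. (\<one> -. x)) \<odot>\<^sub>N f (m (p *. q))
    +.\<^sub>N sq R (\<one> -. x) \<odot>\<^sub>N f (m q) = \<zero>\<^sub>N" using h(1-3) A m(1)
  by (simp add: mod_hom_add[OF f] mod_hom_minus[OF M N f] mod_hom_smult[OF f])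
qed

lemma psi1_closed [simp]: "x \<in> nz R ==> psi1 R x \<in> carrier (RP R)"
proof -
 assume "x \<in> nz R"
 interpret module "RF R" "RP R" by (rule RP_module)
 show ?thesis using \<open>x \<in> nz R\<close> by (simp add: psi1_def)
qed

lemma K1_gens: "psi1 R ` (carrier R - {\<zero>}) = psi1 R ` nz R" "psi1 R ` nz R \<subseteq> carrier (RP R)"
 by (simp_all add: nz_def[symmetric] image_subsetI)

lemma K1_submodule: "submodule (K1 R) (RF R) (RP R)" unfolding K1_def K1_gens(1) by (rule submodule_submod_gen[OF RP_module K1_gens(2)])

lemma psi1_K1: "x \<in> nz R ==> psi1 R x \<in> K1 R" unfolding K1_def K1_gens(1) by (rule subsetD[OF submod_gen_incl imageI])

lemma big_nz:
 assumes "card (carrier R) ~= 2" "card (carrier R) ~= 3"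
 shows "\<exists>y\<in>nz R. y ~= \<one> \<and> y ~= c"
proof (rule ccontr)
 assume "\<not> (\<exists>y\<in>nz R. y ~= \<one> \<and> y ~= c)"
 then have s: "carrier R \<subseteq> {\<zero>, \<one>, c}" by (auto simp: nz_iff)
 then have fin: "finite (carrier R)" by (rule finite_subset) simp
 have "card {\<zero>, \<one>, c} \<le> 3" by (simp add: card_insert_if)
 then have "card (carrier R) \<le> 3" using card_mono[OF _ s] by simp
 moreover have "card {\<zero>, \<one>} \<le> card (carrier R)" by (rule card_mono[OF fin]) auto
 then have "2 \<le> card (carrier R)" by simp
 ultimately show False using assms by linarith
qed

text \<open>With N the preimage of zero, \<open>cel_const\<close> becomes an equation in
  \<open>RP\<close> itself, which makes the definite description in \<open>C_elt\<close>
  proper.\<close>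

lemma C_elt_big:
 assumes "card (carrier R) ~= 2" "card (carrier R) ~= 3" "x \<in> nz R" "x ~= \<one>"
 shows "C_elt R = rp_sym R x +.\<^sub>(RP R) sq R (-. \<one>) \<odot>\<^sub>(RP R) rp_sym R (\<one> -. x) +.\<^sub>(RP R) dsq R (\<one> -. x) \<odot>\<^sub>(RP R) psi1 R x"
proof -
 interpret M: module "RF R" "RP R" by (rule RP_module)
 define E where "E x = rp_sym R x +.\<^sub>(RP R) sq R (-. \<one>) \<odot>\<^sub>(RP R) rp_sym R (\<one> -. x) +.\<^sub>(RP R) dsq R (\<one> -. x) \<odot>\<^sub>(RP R) psi1 R x" for x
 obtain h where "sym_eval (RP R) (rp_sym R) h" using sym_eval_ex[of "RP R" "rp_sym R", OF RP_module rp_sym_closed] by blast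
 note h = sym_evalD[OF this]
 interpret S: symbol_system R bsym "{t. h t \<in> {\<zero>\<^sub>(RP R)}}"
  by (rule symbol_system_module[OF RP_module rp_sym_closed rp_sym_one five_rel_RP[OF assms(1,2)] h
    zero_additive_subgroup[OF M.abelian_group_axioms]])
 interpret B: big_symbol_system R bsym "{t. h t \<in> {\<zero>\<^sub>(RP R)}}" by unfold_locales (rule big_nz[OF assms(1,2)])
 have hpsi: "h (S.psi g x) = sq R g \<odot>\<^sub>(RP R) psi1 R x" if "g \<in> nz R" "x \<in> nz R" for g x
  using that sq_smult_sq[OF RP_module that(1) m_one_nz, of "rp_sym R (inv x)"] by (simp add: S.psi_def h(2,6) psi1_def M.smult_r_distr r_minus)
 have hE: "h (B.cel \<one> x) = E x" if x: "x \<in> nz R" "x ~= \<one>" for x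
 proof -
  have "h (B.cel \<one> x) = rp_sym R x +.\<^sub>(RP R) sq R (-. \<one>) \<odot>\<^sub>(RP R) rp_sym R (\<one> -. x) +.\<^sub>(RP R)
    (sq R (\<one> -. x) \<odot>\<^sub>(RP R) psi1 R x -.\<^sub>(RP R) psi1 R x)"
   using x by (simp add: B.cel_def h(2,3,6) hpsi sq_one_smult[OF RP_module])
  then show ?thesis using x by (simp add: E_def dsq_smult[OF RP_module])
 qed
 have Ec: "E x \<in> carrier (RP R)" if "x \<in> nz R" "x ~= \<one>" for x using that by (simp add: E_def)
 have const: "E y = E x" if "y \<in> nz R" "y ~= \<one>" for y
 proof (rule abelian_minus_eq_zero[OF M.abelian_group_axioms])
  show "E y -.\<^sub>(RP R) E x = \<zero>\<^sub>(RP R)"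
   using B.cel_const[OF nz_one that assms(3,4)] hE[OF that] hE[OF assms(3,4)] by (simp add: h(3))
 qed (use that assms Ec in auto)
 have "C_elt R = (THE c. \<forall>x\<in>carrier R - {\<zero>, \<one>}. c = E x)" using assms by (simp add: C_elt_def E_def)
 also have "\<dots> = E x"
 proof (rule the_equality)
  show "\<forall>y\<in>carrier R - {\<zero>, \<one>}. E x = E y" using const by (auto simp: nz_iff)
  show "c = E x" if "\<forall>y\<in>carrier R - {\<zero>, \<one>}. c = E y" for c using that assms by (simp add: nz_iff)
 qed
 finally show ?thesis by (simp add: E_def)
qed

lemma C_elt_closed: "C_elt R \<in> carrier (RP R)"
proof -
 interpret M: module "RF R" "RP R" by (rule RP_module)
 consider "card (carrier R) = 2" | "card (carrier R) = 3" | "card (carrier R) ~= 2" "card (carrier R) ~= 3" by blast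
 then show ?thesis
 proof cases
  case 1
  then show ?thesis by (simp add: C_elt_def rp_class_closed rp_gens_def)
 next
  case 2
  then show ?thesis by (simp add: C_elt_def)
 next
  case 3
  then obtain x where "x \<in> nz R" "x ~= \<one>" using big_nz by blast
  then show ?thesis using C_elt_big[OF 3] by simp
 qed
qed

lemma D_elt_eq: "D_elt R = C_elt R +.\<^sub>(RP R) C_elt R"
 unfolding D_elt_def by (rule add_pow_2[OF module_abelian_group[OF RP_module] C_elt_closed])

lemma D_elt_closed: "D_elt R \<in> carrier (RP R)" using C_elt_closed module_abelian_group[OF RP_module] by (simp add: D_elt_eq abelian_groupE(1))

lemma RPt_module: "module (RF R) (RPt R)" unfolding RPt_def by (rule module_quotient_module[OF RP_module K1_submodule])

lemma to_RPt_hom: "restrict (to_RPt R) (carrier (RP R)) \<in> mod_hom (RF R) (RP R) (RPt R)"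
 using proj_mod_hom[OF RP_module K1_submodule] by (simp add: RPt_def to_RPt_def[abs_def])

lemma RPt_carrier: "carrier (RPt R) = to_RPt R ` carrier (RP R)" by (simp add: RPt_def carrier_quotient_module to_RPt_def[abs_def])

lemma Dt_submodule: "submodule (Dt_mod R) (RF R) (RPt R)"
proof -
 have D: "submodule (D_mod R) (RF R) (RP R)" unfolding D_mod_def by (rule cyclic_submodule[OF RP_module D_elt_closed])
 have "Dt_mod R = restrict (to_RPt R) (carrier (RP R)) ` D_mod R"
  unfolding Dt_mod_def using module.submoduleE(1)[OF RP_module D] by (intro image_cong) auto
 then show ?thesis using submodule_image[OF RP_module RPt_module to_RPt_hom D] by simp
qed

lemma RPb_module: "module (RF R) (RPb R)" unfolding RPb_def by (rule module_quotient_module[OF RPt_module Dt_submodule])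

definition to_RPb :: "'a rp => 'a rpb"
 where "to_RPb T = Dt_mod R +>\<^sub>(RPt R) to_RPt R T"

lemma to_RPb_hom: "restrict to_RPb (carrier (RP R)) \<in> mod_hom (RF R) (RP R) (RPb R)"
proof -
 have p: "restrict (\<lambda>T. Dt_mod R +>\<^sub>(RPt R) T) (carrier (RPt R)) \<in> mod_hom (RF R) (RPt R) (RPb R)"
  using proj_mod_hom[OF RPt_module Dt_submodule] by (simp add: RPb_def)
 have "restrict to_RPb (carrier (RP R)) = restrict (\<lambda>T. restrict (\<lambda>T. Dt_mod R +>\<^sub>(RPt R) T) (carrier (RPt R))
   (restrict (to_RPt R) (carrier (RP R)) T)) (carrier (RP R))" by (rule restrict_ext) (simp add: to_RPb_def RPt_carrier)
 then show ?thesis using mod_hom_comp[OF RP_module to_RPt_hom p] by simp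
qed

lemma to_RPb_simps:
 "T \<in> carrier (RP R) ==> to_RPb T \<in> carrier (RPb R)"
 "S \<in> carrier (RP R) ==> T \<in> carrier (RP R) ==> to_RPb (S +.\<^sub>(RP R) T) = to_RPb S +.\<^sub>(RPb R) to_RPb T"
 "r \<in> carrier (RF R) ==> T \<in> carrier (RP R) ==> to_RPb (r \<odot>\<^sub>(RP R) T) = r \<odot>\<^sub>(RPb R) to_RPb T"
proof -
 interpret M: module "RF R" "RP R" by (rule RP_module)
 show "T \<in> carrier (RP R) ==> to_RPb T \<in> carrier (RPb R)" using mod_hom_closed[OF to_RPb_hom, of T] by simp
 show "S \<in> carrier (RP R) ==> T \<in> carrier (RP R) ==> to_RPb (S +.\<^sub>(RP R) T) = to_RPb S +.\<^sub>(RPb R) to_RPb T"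
  using mod_hom_add[OF to_RPb_hom, of S T] by simp
 show "r \<in> carrier (RF R) ==> T \<in> carrier (RP R) ==> to_RPb (r \<odot>\<^sub>(RP R) T) = r \<odot>\<^sub>(RPb R) to_RPb T"
  using mod_hom_smult[OF to_RPb_hom, of r T] by simp
qed

lemma RPb_carrier: "carrier (RPb R) = to_RPb ` carrier (RP R)"
 by (simp add: RPb_def carrier_quotient_module RPt_carrier image_image to_RPb_def[abs_def])

lemma symb_eq: "symb R x = to_RPb (rp_sym R x)" by (simp add: symb_def to_RPb_def)

lemma symb_closed [simp]: "x \<in> nz R ==> symb R x \<in> carrier (RPb R)" by (simp add: symb_eq to_RPb_simps(1))

lemma to_RPb_zero: "to_RPb \<zero>\<^sub>(RP R) = \<zero>\<^sub>(RPb R)"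
proof -
 interpret M: module "RF R" "RP R" by (rule RP_module)
 show ?thesis using mod_hom_zero[OF RP_module RPb_module to_RPb_hom] by simp
qed

lemma symb_one: "symb R \<one> = \<zero>\<^sub>(RPb R)" by (simp add: symb_eq rp_sym_one to_RPb_zero)

lemma to_RPb_psi1: "x \<in> nz R ==> to_RPb (psi1 R x) = \<zero>\<^sub>(RPb R)"
proof -
 assume x: "x \<in> nz R"
 have "to_RPt R (psi1 R x) = \<zero>\<^sub>(RPt R)" unfolding to_RPt_def RPt_def
  using proj_eq_zero_iff[OF module_abelian_group[OF RP_module] submodule_additive[OF K1_submodule]] x psi1_K1 by simp
 moreover have "Dt_mod R +>\<^sub>(RPt R) \<zero>\<^sub>(RPt R) = \<zero>\<^sub>(RPb R)" unfolding RPb_def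
  using proj_eq_zero_iff[OF module_abelian_group[OF RPt_module] submodule_additive[OF Dt_submodule]]
   additive_subgroup.zero_closed[OF submodule_additive[OF Dt_submodule]]
   abelian_groupE(2)[OF module_abelian_group[OF RPt_module]] by simp
 ultimately show ?thesis by (simp add: to_RPb_def)
qed

lemma to_RPb_D: "to_RPb (D_elt R) = \<zero>\<^sub>(RPb R)"
proof -
 interpret M: module "RF R" "RP R" by (rule RP_module)
 have "D_elt R \<in> D_mod R" unfolding D_mod_def using D_elt_closed M.smult_one[OF D_elt_closed] M.R.one_closed by force
 then have "to_RPt R (D_elt R) \<in> Dt_mod R" by (simp add: Dt_mod_def)
 then show ?thesis unfolding to_RPb_def RPb_def using proj_eq_zero_iff[OF module_abelian_group[OF RPt_module] submodule_additive[OF Dt_submodule]]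
   D_elt_closed by (simp add: RPt_carrier)
qed

text \<open>Over three elements the only instance is x = y = -1 with p = q = 1, which reads [x] -
  [x] = 0 because [1] = 0. Over two elements there is no instance.\<close>

lemma five_rel_RPb: "five_rel (RPb R) (symb R)"
proof (cases "card (carrier R) = 2 \<or> card (carrier R) = 3")
 case False
 interpret M: module "RF R" "RP R" by (rule RP_module)
 interpret B: module "RF R" "RPb R" by (rule RPb_module)
 have "five_rel (RPb R) (\<lambda>x. restrict to_RPb (carrier (RP R)) (rp_sym R x))"
  using False by (intro five_rel_hom[OF RP_module RPb_module to_RPb_hom rp_sym_closed five_rel_RP]) auto
 then show ?thesis by (simp add: five_rel_def symb_eq)
next
 case True
 interpret B: module "RF R" "RPb R" by (rule RPb_module)
 show ?thesis unfolding five_rel_def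
 proof (intro ballI impI)
  fix x p q assume h: "x \<in> nz R" "p \<in> nz R" "q \<in> nz R" "x ~= \<one>" "x *. p ~= \<one>" "\<one> -. x = q *. (\<one> -. x *. p)"
  then have c3: "card (carrier R) = 3" using True card_2_D by blast
  have xp: "x = -. \<one>" "x *. p = -. \<one>" using card_3_D(2)[OF c3] h nz_mult by metis+
  then have "p = \<one>" using h by (simp add: l_minus) (metis minus_minus nz_closed one_closed)
  moreover have "q = \<one>"
  proof -
   have "-. \<one> = q *. (-. \<one>)" using h(6) unfolding xp(2) unfolding xp(1) card_3_D(3)[OF c3] .
   then show ?thesis using h(3) by (simp add: r_minus) (metis minus_minus nz_closed one_closed)
  qed
  ultimately have pq: "p = \<one>" "q = \<one>" .
  show "symb R x -.\<^sub>(RPb R) symb R (x *. p) +.\<^sub>(RPb R) sq R x \<odot>\<^sub>(RPb R) symb R p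
    -.\<^sub>(RPb R) sq R (x *. (\<one> -. x)) \<odot>\<^sub>(RPb R) symb R (p *. q) +.\<^sub>(RPb R) sq R (\<one> -. x) \<odot>\<^sub>(RPb R) symb R q = \<zero>\<^sub>(RPb R)"
   using h(1,4) unfolding pq by (simp add: symb_one a_minus_def[of _ "_ :: 'a rpb"] B.M.r_neg)
 qed
qed

lemma bloch_system_RPb:
 assumes h: "!!t. h t \<in> carrier (RPb R)" "!!s t. h (s + t) = h s +.\<^sub>(RPb R) h t" "!!s t. h (s - t) = h s -.\<^sub>(RPb R) h t"
  "!!t. h (- t) = -.\<^sub>(RPb R) h t" "h 0 = \<zero>\<^sub>(RPb R)"
  "!!g x. g \<in> nz R ==> x \<in> nz R ==> h (bsym g x) = sq R g \<odot>\<^sub>(RPb R) symb R x"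
  and H: "additive_subgroup H (RPb R)"
 shows "bloch_system R bsym {t. h t \<in> H}"
proof -
 interpret M: module "RF R" "RP R" by (rule RP_module)
 interpret B: module "RF R" "RPb R" by (rule RPb_module)
 interpret S: symbol_system R bsym "{t. h t \<in> H}" by (rule symbol_system_module[OF RPb_module symb_closed symb_one five_rel_RPb h H])
 note H0 = additive_subgroup.zero_closed[OF H]
 have psi: "h (bsym g x + bsym (-. g) (inv x)) = \<zero>\<^sub>(RPb R)" if g: "g \<in> nz R" and x: "x \<in> nz R" for g x
 proof -
  have "h (bsym g x + bsym (-. g) (inv x)) = sq R g \<odot>\<^sub>(RPb R) to_RPb (psi1 R x)"
   using g x sq_smult_sq[OF RPb_module g m_one_nz, of "symb R (inv x)"]
   by (simp add: h(2,6) psi1_def to_RPb_simps symb_eq[symmetric] B.smult_r_distr r_minus)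
  then show ?thesis using to_RPb_psi1[OF x] g by simp
 qed
 show ?thesis
 proof (cases "card (carrier R) = 2 \<or> card (carrier R) = 3")
  case False
  then have big: "card (carrier R) ~= 2" "card (carrier R) ~= 3" by auto
  interpret BS: big_symbol_system R bsym "{t. h t \<in> H}" by unfold_locales (rule big_nz[OF big])
  interpret BB: big_bloch_system R bsym "{t. h t \<in> H}"
  proof
   show "S.psi g x \<in> {t. h t \<in> H}" if "g \<in> nz R" "x \<in> nz R" for g x using psi[OF that] H0 by (simp add: S.psi_def)
   fix g x assume g: "g \<in> nz R" and x: "x \<in> nz R" "x ~= \<one>"
   let ?e = "symb R x +.\<^sub>(RPb R) sq R (-. \<one>) \<odot>\<^sub>(RPb R) symb R (\<one> -. x)"
   have "to_RPb (C_elt R) = ?e +.\<^sub>(RPb R) dsq R (\<one> -. x) \<odot>\<^sub>(RPb R) to_RPb (psi1 R x)"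
    using x by (simp add: C_elt_big[OF big x] to_RPb_simps symb_eq[symmetric])
   then have C: "to_RPb (C_elt R) = ?e" using x by (simp add: to_RPb_psi1)
   have "?e +.\<^sub>(RPb R) ?e = \<zero>\<^sub>(RPb R)" using to_RPb_D C_elt_closed by (simp add: D_elt_eq to_RPb_simps C)
   then have "sq R g \<odot>\<^sub>(RPb R) (?e +.\<^sub>(RPb R) ?e) = \<zero>\<^sub>(RPb R)" using g by simp
   moreover have "h (bsym g x + bsym (-. g) (\<one> -. x)) = sq R g \<odot>\<^sub>(RPb R) ?e"
    using g x sq_smult_sq[OF RPb_module g m_one_nz, of "symb R (\<one> -. x)"] by (simp add: h(2,6) B.smult_r_distr r_minus)
   ultimately have "h ((bsym g x + bsym (-. g) (\<one> -. x)) + (bsym g x + bsym (-. g) (\<one> -. x))) = \<zero>\<^sub>(RPb R)"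
    using g x by (simp add: h(2)[of "bsym g x + bsym (-. g) (\<one> -. x)"] B.smult_r_distr)
   then show "(bsym g x + bsym (-. g) (\<one> -. x)) + (bsym g x + bsym (-. g) (\<one> -. x)) \<in> {t. h t \<in> H}" using H0 by simp
  qed
  show ?thesis by (rule BB.bloch)
 next
  case True
  \<comment> \<open>Besides 1 there is at most -1, over three elements. There -1 is its own inverse
    and its own complement, so the complement relation is the inversion relation, and g x is
    literally -g in the twist relation.\<close>
  have small: "x = \<one> \<or> card (carrier R) = 3 \<and> x = -. \<one>" if "x \<in> nz R" for x using True that card_2_D card_3_D(2) by blast
  show ?thesis
  proof
   fix g x assume g: "g \<in> nz R" and x: "x \<in> nz R"
   show "bsym g x + bsym (-. g) (inv x) \<in> {t. h t \<in> H}" using psi[OF g x] H0 by simp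
   show "bsym g x + bsym (-. g) (\<one> -. x) \<in> {t. h t \<in> H}" if "x ~= \<one>" using small[OF x] that psi[OF g x] H0 card_3_D(3,4) by auto
   show "bsym (g *. x) x - bsym (-. g) x \<in> {t. h t \<in> H}"
   proof (cases "x = \<one>")
    case True
    then show ?thesis using g S.Ndiff[OF S.b1 S.b1] by simp
   next
    case False
    then have "x = -. \<one>" using small[OF x] by blast
    then show ?thesis using g H0 by (simp add: r_minus h(5))
   qed
  qed
 qed
qed

lemma symb_rel:
 shows "x \<in> nz R ==> symb R x +.\<^sub>(RPb R) sq R (-. \<one>) \<odot>\<^sub>(RPb R) symb R (inv x) = \<zero>\<^sub>(RPb R)"
  and "x \<in> nz R ==> x ~= \<one> ==> symb R x +.\<^sub>(RPb R) sq R (-. \<one>) \<odot>\<^sub>(RPb R) symb R (\<one> -. x) = \<zero>\<^sub>(RPb R)"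
  and "x \<in> nz R ==> sq R x \<odot>\<^sub>(RPb R) symb R x = sq R (-. \<one>) \<odot>\<^sub>(RPb R) symb R x"
proof -
 interpret B: module "RF R" "RPb R" by (rule RPb_module)
 obtain h where "sym_eval (RPb R) (symb R) h" using sym_eval_ex[of "RPb R" "symb R", OF RPb_module symb_closed] by blast
 note h = sym_evalD[OF this]
 interpret S: bloch_system R bsym "{t. h t \<in> {\<zero>\<^sub>(RPb R)}}"
  by (rule bloch_system_RPb[OF h zero_additive_subgroup[OF B.abelian_group_axioms]])
 have one: "sq R \<one> \<odot>\<^sub>(RPb R) symb R x = symb R x" if "x \<in> nz R" for x using sq_one_smult[OF RPb_module] that by simp
 show "symb R x +.\<^sub>(RPb R) sq R (-. \<one>) \<odot>\<^sub>(RPb R) symb R (inv x) = \<zero>\<^sub>(RPb R)" if "x \<in> nz R"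
  using S.b_inv_neg[of \<one> x] that by (simp add: h(2,6) one)
 show "symb R x +.\<^sub>(RPb R) sq R (-. \<one>) \<odot>\<^sub>(RPb R) symb R (\<one> -. x) = \<zero>\<^sub>(RPb R)" if "x \<in> nz R" "x ~= \<one>"
  using S.b_compl[of \<one> x] that by (simp add: h(2,6) one)
 show "sq R x \<odot>\<^sub>(RPb R) symb R x = sq R (-. \<one>) \<odot>\<^sub>(RPb R) symb R x" if "x \<in> nz R"
  by (rule abelian_minus_eq_zero[OF B.abelian_group_axioms])
   (use S.b_twist[of \<one> x] that in \<open>simp_all add: h(3,6)\<close>)
qed

text \<open>In \<open>RPb\<close> twice the generator is \<open>D_elt\<close>, hence zero, and three
  times it is a defining relation. So symbols alone generate \<open>RPb\<close>, also over two
  elements.\<close>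

lemma to_RPb_CGen:
 assumes c2: "card (carrier R) = 2"
 shows "to_RPb (rp_class R CGen) = \<zero>\<^sub>(RPb R)"
proof -
  interpret M: module "RF R" "RP R" by (rule RP_module)
  interpret B: module "RF R" "RPb R" by (rule RPb_module)
  have g: "CGen \<in> rp_gens R" using c2 by (simp add: rp_gens_def)
  let ?C = "rp_class R CGen"
  have C: "?C \<in> carrier (RP R)" "C_elt R = ?C" using g c2 by (simp_all add: rp_class_closed C_elt_def)
  have "to_RPb ?C +.\<^sub>(RPb R) to_RPb ?C = \<zero>\<^sub>(RPb R)" using to_RPb_D C by (simp add: D_elt_eq to_RPb_simps)
  moreover have "to_RPb ?C +.\<^sub>(RPb R) to_RPb ?C +.\<^sub>(RPb R) to_RPb ?C = \<zero>\<^sub>(RPb R)"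
  proof -
   have "add_map (rp_free R) (RP R) (\<lambda>t. rp_sub R +>\<^sub>(rp_free R) t)"
    unfolding RP_def by (rule proj_add_map[OF module_abelian_group[OF rp_free_module] submodule_additive[OF rp_sub_submodule]])
   from add_map_add_pow_nat[OF module_abelian_group[OF rp_free_module] M.abelian_group_axioms this rp_basis_closed[OF g], of 3]
   have "rp_sub R +>\<^sub>(rp_free R) (add_pow (rp_free R) (3::nat) (rp_basis R CGen)) = add_pow (RP R) (3::nat) ?C" by (simp add: rp_class_def)
   moreover have "rp_sub R +>\<^sub>(rp_free R) (add_pow (rp_free R) (3::nat) (rp_basis R CGen)) = \<zero>\<^sub>(RP R)"
    by (rule rp_class_rel) (simp add: rp_rels_def c2)
   ultimately have "?C +.\<^sub>(RP R) ?C +.\<^sub>(RP R) ?C = \<zero>\<^sub>(RP R)" using C by (simp add: add_pow_def numeral_3_eq_3 M.M.a_assoc)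
   then have "to_RPb (?C +.\<^sub>(RP R) ?C +.\<^sub>(RP R) ?C) = \<zero>\<^sub>(RPb R)" by (simp add: to_RPb_zero)
   then show ?thesis using C by (simp add: to_RPb_simps)
  qed
  ultimately show ?thesis using C by (simp add: to_RPb_simps(1))
qed

lemma RPb_gen: "submod_gen (RF R) (RPb R) (symb R ` nz R) = carrier (RPb R)"
proof -
 interpret M: module "RF R" "RP R" by (rule RP_module)
 interpret B: module "RF R" "RPb R" by (rule RPb_module)
 have S: "symb R ` nz R \<subseteq> carrier (RPb R)" by auto
 have H: "submodule (submod_gen (RF R) (RPb R) (symb R ` nz R)) (RF R) (RPb R)" by (rule submodule_submod_gen[OF RPb_module S])
 note CG = to_RPb_CGen
 have "submodule {T \<in> carrier (RP R). restrict to_RPb (carrier (RP R)) T \<in> submod_gen (RF R) (RPb R) (symb R ` nz R)} (RF R) (RP R)"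
  by (rule submodule_preimage[OF RP_module RPb_module to_RPb_hom H])
 moreover have "rp_class R ` rp_gens R \<subseteq>
  {T \<in> carrier (RP R). restrict to_RPb (carrier (RP R)) T \<in> submod_gen (RF R) (RPb R) (symb R ` nz R)}"
 proof
  fix T assume "T \<in> rp_class R ` rp_gens R"
  then obtain g where g: "g \<in> rp_gens R" "T = rp_class R g" by blast
  from g(1) have "to_RPb T \<in> submod_gen (RF R) (RPb R) (symb R ` nz R)"
  proof (cases rule: rp_gens_cases)
   case (1 x)
   then have "to_RPb T = symb R x" using g(2) by (simp add: symb_eq rp_sym_def)
   then show ?thesis using 1 submod_gen_incl[of "symb R ` nz R" "RF R" "RPb R"] by auto
  next
   case 2
   then have "to_RPb T = \<zero>\<^sub>(RPb R)" using g(2) CG by simp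
   then show ?thesis using additive_subgroup.zero_closed[OF submodule_additive[OF H]] by simp
  qed
  then show "T \<in> {T \<in> carrier (RP R). restrict to_RPb (carrier (RP R)) T \<in> submod_gen (RF R) (RPb R) (symb R ` nz R)}"
   using g rp_class_closed by simp
 qed
 ultimately have "submod_gen (RF R) (RP R) (rp_class R ` rp_gens R) \<subseteq>
  {T \<in> carrier (RP R). restrict to_RPb (carrier (RP R)) T \<in> submod_gen (RF R) (RPb R) (symb R ` nz R)}" by (rule submod_gen_least)
 then have c: "carrier (RP R) \<subseteq> {T \<in> carrier (RP R). restrict to_RPb (carrier (RP R)) T \<in> submod_gen (RF R) (RPb R) (symb R ` nz R)}"
  unfolding RP_gen .
 have "carrier (RPb R) \<subseteq> submod_gen (RF R) (RPb R) (symb R ` nz R)"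
 proof
  fix z assume "z \<in> carrier (RPb R)"
  then obtain T where T: "T \<in> carrier (RP R)" "z = to_RPb T" unfolding RPb_carrier by blast
  then show "z \<in> submod_gen (RF R) (RPb R) (symb R ` nz R)" using subsetD[OF c T(1)] by simp
 qed
 then show ?thesis using B.submoduleE(1)[OF H] by (rule subset_antisym[rotated])
qed

lemma RPb_induct [consumes 1, case_names gen zero add smult]:
 assumes "z \<in> carrier (RPb R)" "!!x. x \<in> nz R ==> P (symb R x)" "P \<zero>\<^sub>(RPb R)"
  and "!!x y. x \<in> carrier (RPb R) ==> y \<in> carrier (RPb R) ==> P x ==> P y ==> P (x +.\<^sub>(RPb R) y)"
  and "!!r x. r \<in> carrier (RF R) ==> x \<in> carrier (RPb R) ==> P x ==> P (r \<odot>\<^sub>(RPb R) x)"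
 shows "P z"
proof -
 have S: "symb R ` nz R \<subseteq> carrier (RPb R)" by auto
 have "z \<in> submod_gen (RF R) (RPb R) (symb R ` nz R)" using assms(1) by (simp add: RPb_gen)
 then show ?thesis by (rule submod_gen_induct[OF RPb_module S, of z P]) (use assms(2-) in auto)
qed

lemma RPb_hom_eq:
 assumes "module (RF R) M" "h \<in> mod_hom (RF R) (RPb R) M" "h' \<in> mod_hom (RF R) (RPb R) M"
  and "!!x. x \<in> nz R ==> h (symb R x) = h' (symb R x)"
 shows "h = h'" by (rule mod_hom_eq_gen[OF RPb_module assms(1) _ RPb_gen assms(2,3)]) (use assms(4) in auto)

text \<open>The universal property of \<open>RPb\<close>. The last condition makes
  \<open>C_elt\<close> vanish and not only its double \<open>D_elt\<close>, but by
  \<open>symb_rel\<close> it is satisfied in \<open>RPb\<close>.\<close>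

theorem RPb_lift:
 assumes M: "module (RF R) M" and m: "!!x. x \<in> nz R ==> m x \<in> carrier M" "m \<one> = \<zero>\<^sub>M" "five_rel M m"
  and K: "!!x. x \<in> nz R ==> m x +.\<^sub>M sq R (-. \<one>) \<odot>\<^sub>M m (inv x) = \<zero>\<^sub>M"
  and E: "!!x. x \<in> nz R ==> x ~= \<one> ==> m x +.\<^sub>M sq R (-. \<one>) \<odot>\<^sub>M m (\<one> -. x) = \<zero>\<^sub>M"
 obtains h where "h \<in> mod_hom (RF R) (RPb R) M" "!!x. x \<in> nz R ==> h (symb R x) = m x"
proof -
 interpret M: module "RF R" M by fact
 interpret RP: module "RF R" "RP R" by (rule RP_module)
 \<comment> \<open>Over three elements -1 is its own inverse, so the relation follows from K at
   -1.\<close>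
 have three: "(m (-. \<one>) +.\<^sub>M sq R (-. \<one>) \<odot>\<^sub>M m (-. \<one>)) +.\<^sub>M (m (-. \<one>) +.\<^sub>M sq R (-. \<one>) \<odot>\<^sub>M m (-. \<one>)) = \<zero>\<^sub>M"
  if "card (carrier R) = 3" using K[OF m_one_nz] card_3_D(4)[OF that] by simp
 obtain h1 where h1: "h1 \<in> mod_hom (RF R) (RP R) M" "!!x. x \<in> nz R ==> h1 (rp_sym R x) = m x"
  "card (carrier R) = 2 ==> h1 (rp_class R CGen) = \<zero>\<^sub>M"
  by (rule RP_lift[OF M m three]) (assumption+, rule that, assumption, blast, blast)
 have psi: "h1 (psi1 R x) = \<zero>\<^sub>M" if "x \<in> nz R" for x
  using that K by (simp add: psi1_def mod_hom_add[OF h1(1)] mod_hom_smult[OF h1(1)] h1(2))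
 have C: "h1 (C_elt R) = \<zero>\<^sub>M"
 proof -
  consider "card (carrier R) = 2" | "card (carrier R) = 3" | "card (carrier R) ~= 2" "card (carrier R) ~= 3" by blast
  then show ?thesis
  proof cases
   case 1
   then show ?thesis by (simp add: C_elt_def h1(3))
  next
   case 2
   then show ?thesis by (simp add: C_elt_def psi)
  next
   case 3
   then obtain x where x: "x \<in> nz R" "x ~= \<one>" using big_nz by blast
   then show ?thesis using C_elt_big[OF 3 x] E[OF x] m(1) by (simp add: mod_hom_add[OF h1(1)] mod_hom_smult[OF h1(1)] h1(2) psi)
  qed
 qed
 have "h1 T = \<zero>\<^sub>M" if "T \<in> K1 R" for T
  using mod_hom_kills_gen[OF RP_module M h1(1) K1_gens(2) _ that[unfolded K1_def K1_gens(1)]] psi by auto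
 then obtain h2 where h2: "h2 \<in> mod_hom (RF R) (RPt R) M" "!!T. T \<in> carrier (RP R) ==> h2 (to_RPt R T) = h1 T"
  using quotient_mod_lift[OF RP_module K1_submodule M h1(1)] unfolding RPt_def to_RPt_def by metis
 have "h2 S = \<zero>\<^sub>M" if S: "S \<in> Dt_mod R" for S
 proof -
  obtain r where r: "r \<in> carrier (RF R)" "S = to_RPt R (r \<odot>\<^sub>(RP R) D_elt R)" using S by (auto simp: Dt_mod_def D_mod_def)
  then have "h2 S = r \<odot>\<^sub>M h1 (D_elt R)" using h2(2) D_elt_closed by (simp add: mod_hom_smult[OF h1(1)])
  then show ?thesis using C C_elt_closed r by (simp add: D_elt_eq mod_hom_add[OF h1(1)])
 qed
 then obtain h3 where h3: "h3 \<in> mod_hom (RF R) (RPb R) M" "!!S. S \<in> carrier (RPt R) ==> h3 (Dt_mod R +>\<^sub>(RPt R) S) = h2 S"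
  using quotient_mod_lift[OF RPt_module Dt_submodule M h2(1)] unfolding RPb_def by metis
 show ?thesis by (rule that[OF h3(1)]) (simp add: symb_def h3(2) RPt_carrier h2(2) h1(2))
qed

subsection \<open>The submodule \<^const>\<open>RPb1\<close>\<close>

lemma IF2_IF: "c \<in> carrier (IF2 R) ==> c \<in> IF R"
 using ring.ideal_prod_inter[OF cring.axioms(1)[OF RF_cring] IF_ideal IF_ideal] by (auto simp: IF2_simps)

lemma IF_mult: "r \<in> carrier (RF R) ==> a \<in> IF R ==> r *.\<^sub>(RF R) a \<in> IF R" using ideal.I_l_closed[OF IF_ideal] by blast

lemma IF_add: "a \<in> IF R ==> b \<in> IF R ==> a + b \<in> IF R"
 using additive_subgroup.a_closed[OF ideal.axioms(1)[OF IF_ideal], of a b] by (simp add: RF_simps)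

lemma lambda1_sub_submodule: "submodule (lambda1_sub R) (RF R) (IF2 R)"
proof -
 interpret RF: cring "RF R" by (rule RF_cring)
 interpret M: module "RF R" "IF2 R" by (rule IF2_module)
 let ?p = "\<one>\<^sub>(RF R) +.\<^sub>(RF R) sq R (-. \<one>)"
 have p: "?p \<in> carrier (RF R)" by simp
 have inc: "?p *.\<^sub>(RF R) a \<in> carrier (IF2 R)" if "a \<in> IF R" for a using that
 proof (induction a rule: IF_induct)
  case zero
  then show ?case using M.zero_closed by (simp add: RF_mult_simps IF2_simps)
 next
  case (gen a)
  have d: "dsq R a *.\<^sub>(RF R) dsq R (-. a) \<in> carrier (IF2 R)" using gen by (auto simp: IF2_simps intro!: ideal_prod.prod dsq_IF)
  have "0 - dsq R a *.\<^sub>(RF R) dsq R (-. a) = \<zero>\<^sub>(IF2 R) -.\<^sub>(IF2 R) dsq R a *.\<^sub>(RF R) dsq R (-. a)"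
   using IF2_diff[OF M.zero_closed d] by (simp add: IF2_simps(3))
  then show ?case using minus_one_eq_IF2[OF gen] M.minus_closed[OF M.zero_closed d] by simp
 next
  case (diff a b)
  then show ?case using M.minus_closed[OF diff(3,4)] IF2_diff[OF diff(3,4)] by (simp add: RF_mult_simps)
 qed
 show ?thesis
 proof (rule RF_submodule[OF IF2_module])
  show "additive_subgroup (lambda1_sub R) (IF2 R)"
  proof (rule additive_subgroupI'[OF M.abelian_group_axioms])
   show "lambda1_sub R \<subseteq> carrier (IF2 R)" using inc by (auto simp: lambda1_sub_def)
   show "\<zero>\<^sub>(IF2 R) \<in> lambda1_sub R" unfolding lambda1_sub_def using IF_zero by (force simp: RF_mult_simps IF2_simps)
   show "s +.\<^sub>(IF2 R) t \<in> lambda1_sub R" if st: "s \<in> lambda1_sub R" "t \<in> lambda1_sub R" for s t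
   proof -
    obtain a b where "a \<in> IF R" "b \<in> IF R" "s = ?p *.\<^sub>(RF R) a" "t = ?p *.\<^sub>(RF R) b"
     using st unfolding lambda1_sub_def by blast
    then have "s +.\<^sub>(IF2 R) t = ?p *.\<^sub>(RF R) (a + b)" "a + b \<in> IF R" by (simp_all add: IF2_simps RF_mult_simps IF_add)
    then show ?thesis unfolding lambda1_sub_def by blast
   qed
   show "-.\<^sub>(IF2 R) s \<in> lambda1_sub R" if s: "s \<in> lambda1_sub R" for s
   proof -
    obtain a where a: "a \<in> IF R" "s = ?p *.\<^sub>(RF R) a" using s unfolding lambda1_sub_def by blast
    have "-.\<^sub>(IF2 R) s = 0 - s"
     using IF2_diff[OF M.zero_closed, of s] inc[OF a(1)] a(2) by (simp add: a_minus_def IF2_simps(3)) (simp add: IF2_simps)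
    then have "-.\<^sub>(IF2 R) s = ?p *.\<^sub>(RF R) (0 - a)" "0 - a \<in> IF R"
     using a IF_diff[OF IF_zero a(1)] by (simp_all only: RF_mult_simps)
    then show ?thesis unfolding lambda1_sub_def by blast
   qed
  qed
  show "sq R g \<odot>\<^sub>(IF2 R) s \<in> lambda1_sub R" if gs: "g \<in> nz R" "s \<in> lambda1_sub R" for g s
  proof -
   obtain a where a: "a \<in> IF R" "s = ?p *.\<^sub>(RF R) a" using gs(2) unfolding lambda1_sub_def by blast
   have "sq R g \<odot>\<^sub>(IF2 R) s = ?p *.\<^sub>(RF R) (sq R g *.\<^sub>(RF R) a)"
    unfolding IF2_simps(4) a(2) using p IF_closed[OF a(1)] gs(1) by (intro RF.m_lcomm) auto
   then show ?thesis unfolding lambda1_sub_def using IF_mult[OF sq_closed[OF gs(1)] a(1)] by blast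
  qed
 qed
qed

lemma lambda1_sub_I: "a \<in> IF R ==> (\<one>\<^sub>(RF R) +.\<^sub>(RF R) sq R (-. \<one>)) *.\<^sub>(RF R) a \<in> lambda1_sub R"
 by (auto simp: lambda1_sub_def)

lemma lambda1_psi1: "x \<in> nz R ==> lambda1 R (psi1 R x) \<in> lambda1_sub R"
proof -
 assume x: "x \<in> nz R"
 interpret RP: module "RF R" "RP R" by (rule RP_module)
 have d: "(if x = \<one> then 0 else dsq R x) \<in> IF R" using IF_zero dsq_IF[OF x] by simp
 have "lambda1 R (psi1 R x) = lam x + sq R (-. \<one>) *.\<^sub>(RF R) lam (inv x)"
  using x by (simp add: psi1_def mod_hom_add[OF lambda1_spec(1)] mod_hom_smult[OF lambda1_spec(1)] lambda1_spec(2) IF2_simps)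
 also have "\<dots> = (\<one>\<^sub>(RF R) +.\<^sub>(RF R) sq R (-. \<one>)) *.\<^sub>(RF R) (0 - (if x = \<one> then 0 else dsq R x))"
  unfolding lam_inv[OF x] by (simp only: RF_mult_simps)
 finally show ?thesis using lambda1_sub_I[OF IF_diff[OF IF_zero d]] by simp
qed

lemma lambda1t_spec:
 assumes "T \<in> carrier (RP R)"
 shows "lambda1t R (to_RPt R T) = lambda1_sub R +>\<^sub>(IF2 R) lambda1 R T"
proof -
 let ?Q = "quotient_module (IF2 R) (lambda1_sub R)"
 interpret RP: module "RF R" "RP R" by (rule RP_module)
 have Q: "module (RF R) ?Q" by (rule module_quotient_module[OF IF2_module lambda1_sub_submodule])
 let ?l = "restrict (\<lambda>T. restrict (\<lambda>c. lambda1_sub R +>\<^sub>(IF2 R) c) (carrier (IF2 R)) (lambda1 R T)) (carrier (RP R))"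
 have l: "?l \<in> mod_hom (RF R) (RP R) ?Q" by (rule mod_hom_comp[OF RP_module lambda1_spec(1) proj_mod_hom[OF IF2_module lambda1_sub_submodule]])
 note lc = mod_hom_closed[OF lambda1_spec(1)]
 have le: "?l T = lambda1_sub R +>\<^sub>(IF2 R) lambda1 R T" if "T \<in> carrier (RP R)" for T using that lc by simp
 have ps: "?l t = \<zero>\<^sub>?Q" if t: "t \<in> psi1 R ` nz R" for t
 proof -
  obtain x where x: "x \<in> nz R" "t = psi1 R x" using t by blast
  then show ?thesis using le[of t] lambda1_psi1[OF x(1)] lc[of t]
    proj_eq_zero_iff[OF module_abelian_group[OF IF2_module] submodule_additive[OF lambda1_sub_submodule]] by simp
 qed
 have "?l t = \<zero>\<^sub>?Q" if "t \<in> K1 R" for t by (rule mod_hom_kills_gen[OF RP_module Q l K1_gens(2) ps that[unfolded K1_def K1_gens(1)]])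
 from quotient_mod_lift[OF RP_module K1_submodule Q l this, folded RPt_def]
 obtain f where f: "f \<in> mod_hom (RF R) (RPt R) ?Q" "!!T. T \<in> carrier (RP R) ==> f (K1 R +>\<^sub>(RP R) T) = ?l T" by blast
 have f2: "f (to_RPt R T) = lambda1_sub R +>\<^sub>(IF2 R) lambda1 R T" if "T \<in> carrier (RP R)" for T
  using f(2)[OF that] le[OF that] by (simp add: to_RPt_def)
 have "\<exists>!f. f \<in> mod_hom (RF R) (RPt R) ?Q \<and>
  (\<forall>T\<in>carrier (RP R). f (to_RPt R T) = lambda1_sub R +>\<^sub>(IF2 R) lambda1 R T)"
 proof (rule ex1I[of _ f])
  fix f' assume f': "f' \<in> mod_hom (RF R) (RPt R) ?Q \<and>
   (\<forall>T\<in>carrier (RP R). f' (to_RPt R T) = lambda1_sub R +>\<^sub>(IF2 R) lambda1 R T)"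
  show "f' = f" by (rule mod_hom_eqI[OF conjunct1[OF f'] f(1)]) (use f' f2 in \<open>auto simp: RPt_carrier\<close>)
 qed (use f f2 in blast)
 from theI'[OF this, folded lambda1t_def] assms show ?thesis by blast
qed

lemma RPt1_carrier: "carrier (RPt1 R) = to_RPt R ` {T \<in> carrier (RP R). lambda1 R T \<in> lambda1_sub R}"
proof -
 have "lambda1t R (to_RPt R T) = \<zero>\<^sub>(quotient_module (IF2 R) (lambda1_sub R)) \<longleftrightarrow> lambda1 R T \<in> lambda1_sub R"
  if "T \<in> carrier (RP R)" for T using lambda1t_spec[OF that] mod_hom_closed[OF lambda1_spec(1) that]
   proj_eq_zero_iff[OF module_abelian_group[OF IF2_module] submodule_additive[OF lambda1_sub_submodule]] by simp
 then show ?thesis by (auto simp: RPt1_def RPt_carrier)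
qed

lemma RPb1_eq: "RPb1 R = (RPb R)\<lparr>carrier := to_RPb ` {T \<in> carrier (RP R). lambda1 R T \<in> lambda1_sub R}\<rparr>"
proof -
 have r: "a_r_coset (RPt1 R) = a_r_coset (RPt R)" by (simp add: a_r_coset_def r_coset_def RPt1_def fun_eq_iff)
 have s: "set_add (RPt1 R) = set_add (RPt R)" by (simp add: set_add_def set_mult_def RPt1_def fun_eq_iff)
 have c: "a_rcosets\<^bsub>RPt1 R\<^esub> (Dt_mod R) = to_RPb ` {T \<in> carrier (RP R). lambda1 R T \<in> lambda1_sub R}"
  unfolding A_RCOSETS_def' r RPt1_carrier to_RPb_def by auto
 have m: "smult (RPt1 R) = smult (RPt R)" by (simp add: RPt1_def)
 show ?thesis unfolding RPb1_def RPb_def quotient_module_def r s c m by simp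
qed

lemma RPb1_submodule: "submodule (carrier (RPb1 R)) (RF R) (RPb R)"
proof -
 let ?L = "{T \<in> carrier (RP R). lambda1 R T \<in> lambda1_sub R}"
 have L: "submodule ?L (RF R) (RP R)" by (rule submodule_preimage[OF RP_module IF2_module lambda1_spec(1) lambda1_sub_submodule])
 have "carrier (RPb1 R) = restrict to_RPb (carrier (RP R)) ` ?L" unfolding RPb1_eq by (auto simp: image_iff)
 then show ?thesis using submodule_image[OF RP_module RPb_module to_RPb_hom L] by simp
qed

lemma RPb1_as_submodule: "RPb1 R = (RPb R)\<lparr>carrier := carrier (RPb1 R)\<rparr>" by (subst RPb1_eq) (simp add: RPb1_eq)

lemma RPb1_module: "module (RF R) (RPb1 R)" by (subst RPb1_as_submodule) (rule submodule.submodule_is_module[OF RPb1_submodule RPb_module])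

lemma RPb1_simps: "ring.add (RPb1 R) = ring.add (RPb R)" "\<zero>\<^sub>(RPb1 R) = \<zero>\<^sub>(RPb R)" "smult (RPb1 R) = smult (RPb R)"
 by (simp_all add: RPb1_eq)

lemma RPb1_carrier_subset: "z \<in> carrier (RPb1 R) ==> z \<in> carrier (RPb R)" using module.submoduleE(1)[OF RPb_module RPb1_submodule] by blast

text \<open>\<open>lambda1\<close> takes (1 + <-1>)T to (1 + <-1>) times \<open>lambda1 R T\<close>,
  and the latter lies in \<open>IF\<close>.\<close>

lemma plus_part_RPb1:
 assumes "z \<in> carrier (RPb R)"
 shows "z +.\<^sub>(RPb R) sq R (-. \<one>) \<odot>\<^sub>(RPb R) z \<in> carrier (RPb1 R)"
proof -
 interpret RP: module "RF R" "RP R" by (rule RP_module)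
 obtain T where T: "T \<in> carrier (RP R)" "z = to_RPb T" using assms unfolding RPb_carrier by blast
 let ?T = "T +.\<^sub>(RP R) sq R (-. \<one>) \<odot>\<^sub>(RP R) T"
 interpret RF: cring "RF R" by (rule RF_cring)
 have c: "lambda1 R T \<in> carrier (IF2 R)" using mod_hom_closed[OF lambda1_spec(1) T(1)] .
 have "\<one>\<^sub>(RF R) *.\<^sub>(RF R) lambda1 R T = lambda1 R T" using IF2_carrier_RF[OF c] by simp
 then have "lambda1 R ?T = (\<one>\<^sub>(RF R) +.\<^sub>(RF R) sq R (-. \<one>)) *.\<^sub>(RF R) lambda1 R T"
  using T by (simp add: mod_hom_add[OF lambda1_spec(1)] mod_hom_smult[OF lambda1_spec(1)] IF2_simps RF_simps(1) RF_mult_simps)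
 then have "lambda1 R ?T \<in> lambda1_sub R" using lambda1_sub_I[OF IF2_IF[OF c]] by simp
 moreover have "to_RPb ?T = z +.\<^sub>(RPb R) sq R (-. \<one>) \<odot>\<^sub>(RPb R) z" using T by (simp add: to_RPb_simps)
 ultimately show ?thesis unfolding RPb1_eq using T(1) by force
qed

section \<open>Sign characters on modules over the ring of square classes\<close>

definition acts_trivially :: "('a sqr, 'x, 'n) module_scheme => 'x set => 'a => bool"
 where "acts_trivially M N g \<longleftrightarrow> (\<forall>x\<in>carrier M. sq R g \<odot>\<^sub>M x -.\<^sub>M x \<in> N)"

lemma sign_submodule:
 assumes "module (RF R) M" "z \<in> carrier M" "z \<notin> two_torsion M"
 obtains N where "submodule N (RF R) M" "saturated M N" "z \<notin> N"
  "!!g x. g \<in> nz R ==> x \<in> carrier M ==> \<not> acts_trivially M N g ==> sq R g \<odot>\<^sub>M x +.\<^sub>M x \<in> N"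
proof -
 obtain N where N: "submodule N (group_ring (sq_class_group R)) M" "saturated M N" "z \<notin> N"
  "!!g. g \<in> carrier (sq_class_group R) ==> (\<forall>x\<in>carrier M. frag_of g \<odot>\<^sub>M x -.\<^sub>M x \<in> N) \<or>
             (\<forall>x\<in>carrier M. frag_of g \<odot>\<^sub>M x +.\<^sub>M x \<in> N)"
  by (rule character_submodule[OF sq_class_group_comm sq_class_group_exp assms(1)[unfolded RF_def] assms(2,3)])
   (assumption, rule that, assumption, assumption, assumption, blast)
 have "sq R g \<odot>\<^sub>M x +.\<^sub>M x \<in> N" if "g \<in> nz R" "x \<in> carrier M" "\<not> acts_trivially M N g" for g x
  using N(4)[of "sq_class R g"] that by (auto simp: acts_trivially_def sq_def sq_class_group_carrier)
 then show thesis using that[of N] N(1-3) by (simp add: RF_def)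
qed

text \<open>The element z outside N keeps the two signs apart: if a class acted on M/N both as 1 and
  as -1, then 2z, and by saturation z, would be in N. This is what makes the character
  multiplicative.\<close>

lemma character_system_module:
 assumes M: "module (RF R) M" and e: "!!x. x \<in> nz R ==> e x \<in> carrier M"
  and h: "!!t. h t \<in> carrier M" "!!s t. h (s + t) = h s +.\<^sub>M h t" "!!s t. h (s - t) = h s -.\<^sub>M h t"
  "!!t. h (- t) = -.\<^sub>M h t" "h 0 = \<zero>\<^sub>M"
  "!!g x. g \<in> nz R ==> x \<in> nz R ==> h (bsym g x) = sq R g \<odot>\<^sub>M e x"
  and B: "bloch_system R bsym {t. h t \<in> N}"
  and N: "submodule N (RF R) M" "saturated M N" "z \<in> carrier M" "z \<notin> N"
  "!!g x. g \<in> nz R ==> x \<in> carrier M ==> \<not> acts_trivially M N g ==> sq R g \<odot>\<^sub>M x +.\<^sub>M x \<in> N"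
 shows "character_system R bsym {t. h t \<in> N} (acts_trivially M N)"
proof -
 interpret M: module "RF R" M by fact
 interpret B: bloch_system R bsym "{t. h t \<in> N}" by fact
 note E = M.submoduleE[OF N(1)]
 have Nd: "a -.\<^sub>M c \<in> N" if "a \<in> N" "c \<in> N" for a c using E(5)[OF that(1) E(3)[OF that(2)]] by (simp add: a_minus_def)
 have T: "acts_trivially M N g ==> x \<in> carrier M ==> sq R g \<odot>\<^sub>M x -.\<^sub>M x \<in> N" for g x by (simp add: acts_trivially_def)
 have sat: "x +.\<^sub>M x \<in> N ==> x \<in> N" if "x \<in> carrier M" for x using N(2) that unfolding saturated_def dbl_def by blast
 show ?thesis
 proof
  show "t \<in> {t. h t \<in> N}" if "t + t \<in> {t. h t \<in> N}" for t using sat[OF h(1), of t] that by (simp add: h(2))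
  show "bsym g x - bsym \<one> x \<in> {t. h t \<in> N}" if "g \<in> nz R" "x \<in> nz R" "acts_trivially M N g" for g x
   using that T[OF that(3), of "e x"] e by (simp add: h(3,6) sq_one_smult[OF M])
  show "bsym g x + bsym \<one> x \<in> {t. h t \<in> N}" if "g \<in> nz R" "x \<in> nz R" "\<not> acts_trivially M N g" for g x
   using that N(5)[OF that(1) _ that(3), of "e x"] e by (simp add: h(2,6) sq_one_smult[OF M])
  fix a c assume a: "a \<in> nz R" and c: "c \<in> nz R"
  have ac: "sq R (a *. c) \<odot>\<^sub>M x = sq R a \<odot>\<^sub>M (sq R c \<odot>\<^sub>M x)" if "x \<in> carrier M" for x
   using sq_smult_sq[OF M a c that] by simp
  have pp: "acts_trivially M N (a *. c)" if "acts_trivially M N a" "acts_trivially M N c" unfolding acts_trivially_def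
  proof
   fix x assume x: "x \<in> carrier M"
   have "(sq R a \<odot>\<^sub>M (sq R c \<odot>\<^sub>M x) -.\<^sub>M sq R c \<odot>\<^sub>M x) +.\<^sub>M (sq R c \<odot>\<^sub>M x -.\<^sub>M x) \<in> N"
    using E(5)[OF T[OF that(1)] T[OF that(2)]] a c x by simp
   moreover have "(sq R a \<odot>\<^sub>M (sq R c \<odot>\<^sub>M x) -.\<^sub>M sq R c \<odot>\<^sub>M x) +.\<^sub>M (sq R c \<odot>\<^sub>M x -.\<^sub>M x) = sq R a \<odot>\<^sub>M (sq R c \<odot>\<^sub>M x) -.\<^sub>M x"
    using a c x by (simp add: a_minus_def M.M.a_ac M.M.r_neg2)
   ultimately show "sq R (a *. c) \<odot>\<^sub>M x -.\<^sub>M x \<in> N" using ac[OF x] by simp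
  qed
  have mm: "acts_trivially M N (a *. c)" if "\<not> acts_trivially M N a" "\<not> acts_trivially M N c" unfolding acts_trivially_def
  proof
   fix x assume x: "x \<in> carrier M"
   have "(sq R a \<odot>\<^sub>M (sq R c \<odot>\<^sub>M x) +.\<^sub>M sq R c \<odot>\<^sub>M x) -.\<^sub>M (sq R c \<odot>\<^sub>M x +.\<^sub>M x) \<in> N"
    using Nd[OF N(5)[OF a _ that(1)] N(5)[OF c _ that(2)]] a c x by simp
   moreover have "(sq R a \<odot>\<^sub>M (sq R c \<odot>\<^sub>M x) +.\<^sub>M sq R c \<odot>\<^sub>M x) -.\<^sub>M (sq R c \<odot>\<^sub>M x +.\<^sub>M x) = sq R a \<odot>\<^sub>M (sq R c \<odot>\<^sub>M x) -.\<^sub>M x"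
    using a c x by (simp add: a_minus_def M.M.minus_add M.M.a_ac M.M.r_neg2 M.M.r_neg1)
   ultimately show "sq R (a *. c) \<odot>\<^sub>M x -.\<^sub>M x \<in> N" using ac[OF x] by simp
  qed
  have contra: False if "!!x. x \<in> carrier M ==> sq R (a *. c) \<odot>\<^sub>M x +.\<^sub>M x \<in> N" "acts_trivially M N (a *. c)"
  proof -
   have "(sq R (a *. c) \<odot>\<^sub>M z +.\<^sub>M z) -.\<^sub>M (sq R (a *. c) \<odot>\<^sub>M z -.\<^sub>M z) \<in> N"
    using Nd[OF that(1) T[OF that(2)]] N(3) by simp
   moreover have "(sq R (a *. c) \<odot>\<^sub>M z +.\<^sub>M z) -.\<^sub>M (sq R (a *. c) \<odot>\<^sub>M z -.\<^sub>M z) = z +.\<^sub>M z"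
    using a c N(3) by (simp add: a_minus_def M.M.minus_add M.M.a_ac M.M.r_neg2 M.M.r_neg1 M.M.r_neg)
   ultimately show False using sat[OF N(3)] N(4) by simp
  qed
  have pm: "\<not> acts_trivially M N (a *. c)" if "acts_trivially M N a" "\<not> acts_trivially M N c"
  proof
   assume t: "acts_trivially M N (a *. c)"
   show False
   proof (rule contra[OF _ t])
    fix x assume x: "x \<in> carrier M"
    have "(sq R a \<odot>\<^sub>M (sq R c \<odot>\<^sub>M x) -.\<^sub>M sq R c \<odot>\<^sub>M x) +.\<^sub>M (sq R c \<odot>\<^sub>M x +.\<^sub>M x) \<in> N"
     using E(5)[OF T[OF that(1)] N(5)[OF c _ that(2)]] a c x by simp
    moreover have "(sq R a \<odot>\<^sub>M (sq R c \<odot>\<^sub>M x) -.\<^sub>M sq R c \<odot>\<^sub>M x) +.\<^sub>M (sq R c \<odot>\<^sub>M x +.\<^sub>M x) = sq R a \<odot>\<^sub>M (sq R c \<odot>\<^sub>M x) +.\<^sub>M x"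
     using a c x by (simp add: a_minus_def M.M.a_ac M.M.r_neg2 M.M.r_neg1)
    ultimately show "sq R (a *. c) \<odot>\<^sub>M x +.\<^sub>M x \<in> N" using ac[OF x] by simp
   qed
  qed
  have mp: "\<not> acts_trivially M N (a *. c)" if "\<not> acts_trivially M N a" "acts_trivially M N c"
  proof
   assume t: "acts_trivially M N (a *. c)"
   show False
   proof (rule contra[OF _ t])
    fix x assume x: "x \<in> carrier M"
    have "(sq R a \<odot>\<^sub>M (sq R c \<odot>\<^sub>M x) +.\<^sub>M sq R c \<odot>\<^sub>M x) -.\<^sub>M (sq R c \<odot>\<^sub>M x -.\<^sub>M x) \<in> N"
     using Nd[OF N(5)[OF a _ that(1)] T[OF that(2)]] a c x by simp
    moreover have "(sq R a \<odot>\<^sub>M (sq R c \<odot>\<^sub>M x) +.\<^sub>M sq R c \<odot>\<^sub>M x) -.\<^sub>M (sq R c \<odot>\<^sub>M x -.\<^sub>M x) = sq R a \<odot>\<^sub>M (sq R c \<odot>\<^sub>M x) +.\<^sub>M x"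
     using a c x by (simp add: a_minus_def M.M.minus_add M.M.a_ac M.M.r_neg2 M.M.r_neg1)
    ultimately show "sq R (a *. c) \<odot>\<^sub>M x +.\<^sub>M x \<in> N" using ac[OF x] by simp
   qed
  qed
  show "acts_trivially M N (a *. c) = (acts_trivially M N a = acts_trivially M N c)" using pp mm pm mp by blast
 qed
qed

text \<open>Modulo a submodule on which every square class acts by a sign and \<open>\<langle>-1\<rangle>\<close> by \<open>-1\<close>, four times
 an element is its \<open>\<lambda>\<^sub>1\<close> times a constant, which vanishes on \<^term>\<open>RPb1 R\<close>.\<close>

lemma minus_part_RPb1:
 assumes "z \<in> carrier (RPb1 R)"
 shows "z -.\<^sub>(RPb R) sq R (-. \<one>) \<odot>\<^sub>(RPb R) z \<in> two_torsion (RPb R)"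
proof (rule ccontr)
 interpret M: module "RF R" "RPb R" by (rule RPb_module)
 interpret RP: module "RF R" "RP R" by (rule RP_module)
 interpret I: module "RF R" "IF2 R" by (rule IF2_module)
 have z: "z \<in> carrier (RPb R)" by (rule RPb1_carrier_subset[OF assms])
 let ?z = "z -.\<^sub>(RPb R) sq R (-. \<one>) \<odot>\<^sub>(RPb R) z"
 have zc: "?z \<in> carrier (RPb R)" using z by simp
 assume "?z \<notin> two_torsion (RPb R)"
 from sign_submodule[OF RPb_module zc this] obtain N where N: "submodule N (RF R) (RPb R)" "saturated (RPb R) N" "?z \<notin> N"
  "!!g x. g \<in> nz R ==> x \<in> carrier (RPb R) ==> \<not> acts_trivially (RPb R) N g ==> sq R g \<odot>\<^sub>(RPb R) x +.\<^sub>(RPb R) x \<in> N"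
  by this blast
 note E = M.submoduleE[OF N(1)]
 have Nd: "a -.\<^sub>(RPb R) c \<in> N" if "a \<in> N" "c \<in> N" for a c using E(5)[OF that(1) E(3)[OF that(2)]] by (simp add: a_minus_def)
 have NC: "a \<in> carrier (RPb R)" if "a \<in> N" for a using that E(1) by (rule subsetD[rotated])
 have N0: "\<zero>\<^sub>(RPb R) \<in> N" using additive_subgroup.zero_closed[OF submodule_additive[OF N(1)]] .
 obtain h where "sym_eval (RPb R) (symb R) h" using sym_eval_ex[of "RPb R" "symb R", OF RPb_module symb_closed] by blast
 note h = sym_evalD[OF this]
 interpret S: character_system R bsym "{t. h t \<in> N}" "acts_trivially (RPb R) N"
  by (rule character_system_module[OF RPb_module symb_closed h bloch_system_RPb[OF h submodule_additive[OF N(1)]] N(1,2) zc N(3,4)])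
 have m1: "\<not> acts_trivially (RPb R) N (-. \<one>)"
 proof
  assume "acts_trivially (RPb R) N (-. \<one>)"
  then have "sq R (-. \<one>) \<odot>\<^sub>(RPb R) z -.\<^sub>(RPb R) z \<in> N" using z by (simp add: acts_trivially_def)
  then have "-.\<^sub>(RPb R) (sq R (-. \<one>) \<odot>\<^sub>(RPb R) z -.\<^sub>(RPb R) z) \<in> N" by (rule E(3))
  moreover have "-.\<^sub>(RPb R) (sq R (-. \<one>) \<odot>\<^sub>(RPb R) z -.\<^sub>(RPb R) z) = ?z"
   using z by (simp add: a_minus_def M.M.minus_add M.M.a_comm)
  ultimately show False using N(3) by simp
 qed
 obtain \<kappa> where \<kappa>: "!!x. x \<in> nz R ==> bsym \<one> x - (if x ~= \<one> \<and> \<not> acts_trivially (RPb R) N x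
   \<and> \<not> acts_trivially (RPb R) N (\<one> -. x) then \<kappa> else 0) \<in> {t. h t \<in> N}" by (rule S.minus_part[OF m1]) blast
 define K where "K = h \<kappa>"
 have K: "K \<in> carrier (RPb R)" using h(1) by (simp add: K_def)
 have symK: "symb R x -.\<^sub>(RPb R) (if x ~= \<one> \<and> \<not> acts_trivially (RPb R) N x
   \<and> \<not> acts_trivially (RPb R) N (\<one> -. x) then K else \<zero>\<^sub>(RPb R)) \<in> N" if x: "x \<in> nz R" for x
  using \<kappa>[OF x] x by (auto simp: h(3,5,6) K_def sq_one_smult[OF RPb_module] split: if_splits)
 have dpos: "dsq R g \<odot>\<^sub>(RPb R) y \<in> N" if "g \<in> nz R" "y \<in> carrier (RPb R)" "acts_trivially (RPb R) N g" for g y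
  using that by (simp add: dsq_smult[OF RPb_module] acts_trivially_def)
 have dneg: "dsq R g \<odot>\<^sub>(RPb R) y +.\<^sub>(RPb R) (y +.\<^sub>(RPb R) y) \<in> N"
  if "g \<in> nz R" "y \<in> carrier (RPb R)" "\<not> acts_trivially (RPb R) N g" for g y
 proof -
  have "dsq R g \<odot>\<^sub>(RPb R) y +.\<^sub>(RPb R) (y +.\<^sub>(RPb R) y) = sq R g \<odot>\<^sub>(RPb R) y +.\<^sub>(RPb R) y"
   using that by (simp add: dsq_smult[OF RPb_module] a_minus_def M.M.a_ac M.M.r_neg2 M.M.r_neg1)
  then show ?thesis using N(4)[OF that] by simp
 qed
 have z0: "y -.\<^sub>(RPb R) \<zero>\<^sub>(RPb R) = y" if "y \<in> carrier (RPb R)" for y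
  using that M.M.minus_equality[of "\<zero>\<^sub>(RPb R)" "\<zero>\<^sub>(RPb R)"] unfolding a_minus_def by simp
 let ?four = "\<lambda>y. (y +.\<^sub>(RPb R) y) +.\<^sub>(RPb R) (y +.\<^sub>(RPb R) y)"
 have four: "?four y \<in> N" if "y \<in> N" for y using E(5) that by simp
 \<comment> \<open>\<open><<x>>\<close> acts modulo N as -2 or 0 according to the sign of x. So
   \<open><<1-x>><<x>>\<close> acts as 4 if x and 1-x both have character -1, and as 0 otherwise. In
   the same two cases [x] is congruent to K and to 0, so the difference of 4T and
   \<open>lambda1 R T\<close> applied to K lies in N.\<close>
 let ?f = "\<lambda>T. ?four (to_RPb T) -.\<^sub>(RPb R) lambda1 R T \<odot>\<^sub>(RPb R) K"
 note lR = IF2_carrier_RF[OF mod_hom_closed[OF lambda1_spec(1)]]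
 have gen: "?f (rp_class R g) \<in> N" if "g \<in> rp_gens R" for g using that
 proof (cases rule: rp_gens_cases)
  case (1 x)
  let ?s = "symb R x"
  have s: "?s \<in> carrier (RPb R)" using 1 by simp
  have eq: "?f (rp_class R g) = ?four ?s -.\<^sub>(RPb R) lam x \<odot>\<^sub>(RPb R) K"
   using 1 by (simp add: symb_eq lambda1_spec(2)[folded rp_sym_def] rp_sym_def[symmetric] lambda1_spec(2))
  have lc: "lam x \<in> carrier (RF R)" using IF2_carrier_RF[OF lam_closed] 1 by blast
  show ?thesis
  proof (cases "x ~= \<one> \<and> \<not> acts_trivially (RPb R) N x \<and> \<not> acts_trivially (RPb R) N (\<one> -. x)")
   case False
   then have "?s \<in> N" using symK[of x, unfolded if_not_P[OF False]] 1 s z0 by simp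
   moreover have "lam x \<odot>\<^sub>(RPb R) K \<in> N"
   proof (cases "x = \<one>")
    case True
    then show ?thesis using N0 K by (simp add: lam_def RF_simps(2)[symmetric] del: RF_simps(2))
   next
    case ne: False
    have l: "lam x \<odot>\<^sub>(RPb R) K = dsq R (\<one> -. x) \<odot>\<^sub>(RPb R) (dsq R x \<odot>\<^sub>(RPb R) K)"
     using ne 1 K by (simp add: lam_def M.smult_assoc1)
    show ?thesis
    proof (cases "acts_trivially (RPb R) N x")
     case True
     then show ?thesis unfolding l using 1 ne K by (intro E(4) dpos) auto
    next
     case F: False
     then show ?thesis unfolding l using 1 ne K False by (intro dpos) auto
    qed
   qed
   ultimately show ?thesis unfolding eq using Nd four by blast
  next
   case True
   let ?y = "dsq R x \<odot>\<^sub>(RPb R) K"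
   have y: "?y \<in> carrier (RPb R)" using 1 K by simp
   have l: "lam x \<odot>\<^sub>(RPb R) K = dsq R (\<one> -. x) \<odot>\<^sub>(RPb R) ?y" using True 1 K by (simp add: lam_def M.smult_assoc1)
   have a: "lam x \<odot>\<^sub>(RPb R) K +.\<^sub>(RPb R) (?y +.\<^sub>(RPb R) ?y) \<in> N" unfolding l using 1 True y by (intro dneg) auto
   have c: "?y +.\<^sub>(RPb R) (K +.\<^sub>(RPb R) K) \<in> N" using 1 True K by (intro dneg) auto
   have d: "?s -.\<^sub>(RPb R) K \<in> N" using symK[of x, unfolded if_P[OF True]] 1 by blast
   have n: "(?four (?s -.\<^sub>(RPb R) K) -.\<^sub>(RPb R) (lam x \<odot>\<^sub>(RPb R) K +.\<^sub>(RPb R) (?y +.\<^sub>(RPb R) ?y))) +.\<^sub>(RPb R)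
     ((?y +.\<^sub>(RPb R) (K +.\<^sub>(RPb R) K)) +.\<^sub>(RPb R) (?y +.\<^sub>(RPb R) (K +.\<^sub>(RPb R) K))) \<in> N"
    by (rule E(5)[OF Nd[OF four[OF d] a] E(5)[OF c c]])
   have *: "(?four (s -.\<^sub>(RPb R) K) -.\<^sub>(RPb R) (l +.\<^sub>(RPb R) (y +.\<^sub>(RPb R) y))) +.\<^sub>(RPb R)
     ((y +.\<^sub>(RPb R) (K +.\<^sub>(RPb R) K)) +.\<^sub>(RPb R) (y +.\<^sub>(RPb R) (K +.\<^sub>(RPb R) K))) = ?four s -.\<^sub>(RPb R) l"
    if "s \<in> carrier (RPb R)" "l \<in> carrier (RPb R)" "y \<in> carrier (RPb R)" for s l y
   proof -
    define Z where "Z = (y +.\<^sub>(RPb R) y) +.\<^sub>(RPb R) ?four K"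
    have Z: "Z \<in> carrier (RPb R)" using that K by (simp add: Z_def)
    have "?four (s -.\<^sub>(RPb R) K) -.\<^sub>(RPb R) (l +.\<^sub>(RPb R) (y +.\<^sub>(RPb R) y)) = (?four s -.\<^sub>(RPb R) l) -.\<^sub>(RPb R) Z"
     using that K by (simp add: Z_def a_minus_def M.M.minus_add M.M.a_ac)
    moreover have "(y +.\<^sub>(RPb R) (K +.\<^sub>(RPb R) K)) +.\<^sub>(RPb R) (y +.\<^sub>(RPb R) (K +.\<^sub>(RPb R) K)) = Z"
     using that K by (simp add: Z_def M.M.a_ac)
    ultimately show ?thesis using that Z by (simp add: a_minus_def M.M.a_assoc M.M.l_neg)
   qed
   show ?thesis unfolding eq using n *[OF s _ y, of "lam x \<odot>\<^sub>(RPb R) K"] lc K by simp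
  qed
 next
  case 2
  have "to_RPb (rp_class R CGen) = \<zero>\<^sub>(RPb R)" by (rule to_RPb_CGen[OF 2(1)])
  then show ?thesis using 2 N0 K by (simp add: lambda1_spec(3) RF_simps(2)[symmetric] z0 del: RF_simps(2))
 qed
 have sub: "rp_class R ` rp_gens R \<subseteq> carrier (RP R)" using rp_class_closed by blast
 have all: "T \<in> carrier (RP R) ==> ?f T \<in> N" for T
 proof -
  assume "T \<in> carrier (RP R)"
  then have "T \<in> submod_gen (RF R) (RP R) (rp_class R ` rp_gens R)" by (simp only: RP_gen)
  then show ?thesis
  proof (induct rule: submod_gen_induct[OF RP_module sub, consumes 1, case_names gen zero add smult])
   case (gen x)
   then show ?case using \<open>!!g. g \<in> rp_gens R ==> ?f (rp_class R g) \<in> N\<close> by blast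
  next
   case zero
   then show ?case using N0 K mod_hom_zero[OF RP_module IF2_module lambda1_spec(1)]
    by (simp add: to_RPb_zero IF2_simps RF_simps(2)[symmetric] z0 del: RF_simps(2))
  next
   case (add S T)
   have "lambda1 R (S +.\<^sub>(RP R) T) = lambda1 R S +.\<^sub>(RF R) lambda1 R T"
    using add by (simp add: mod_hom_add[OF lambda1_spec(1)] IF2_simps RF_simps)
   then have "?f (S +.\<^sub>(RP R) T) = ?f S +.\<^sub>(RPb R) ?f T" using add K lR[of S] lR[of T]
    by (simp add: to_RPb_simps M.smult_l_distr a_minus_def M.M.minus_add M.M.a_ac)
   then show ?case using add E(5) by simp
  next
   case (smult r T)
   have "?f (r \<odot>\<^sub>(RP R) T) = r \<odot>\<^sub>(RPb R) ?f T" using smult K lR[of T]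
    by (simp add: to_RPb_simps mod_hom_smult[OF lambda1_spec(1)] IF2_simps M.smult_assoc1 M.smult_r_distr M.smult_r_minus a_minus_def)
   then show ?case using smult E(4) by simp
  qed
 qed
 obtain T where T: "T \<in> carrier (RP R)" "lambda1 R T \<in> lambda1_sub R" "z = to_RPb T" using assms unfolding RPb1_eq by auto
 obtain a where a: "a \<in> IF R" "lambda1 R T = (\<one>\<^sub>(RF R) +.\<^sub>(RF R) sq R (-. \<one>)) *.\<^sub>(RF R) a"
  using T(2) unfolding lambda1_sub_def by blast
 have aK: "a \<odot>\<^sub>(RPb R) K \<in> carrier (RPb R)" using K IF_closed[OF a(1)] by simp
 \<comment> \<open>The factor 1 + <-1> of \<open>lambda1 R T\<close> acts as zero modulo N, because
   <-1> acts as -1.\<close>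
 have "lambda1 R T \<odot>\<^sub>(RPb R) K = sq R (-. \<one>) \<odot>\<^sub>(RPb R) (a \<odot>\<^sub>(RPb R) K) +.\<^sub>(RPb R) a \<odot>\<^sub>(RPb R) K"
  unfolding a(2) using K IF_closed[OF a(1)] aK by (simp add: M.smult_assoc1 M.smult_l_distr M.M.a_comm)
 then have "lambda1 R T \<odot>\<^sub>(RPb R) K \<in> N" using N(4)[OF m_one_nz aK m1] by simp
 from E(5)[OF all[OF T(1)] this] have "?four z \<in> N" using z aK K lR[OF T(1)] by (simp add: T(3)[symmetric] a_minus_def M.M.a_assoc M.M.l_neg)
 then have "z \<in> N" using saturatedD_pow[OF RPb_module N(2) z, of 2] by (simp add: numeral_2_eq_2 dbl_def)
 then have "?z \<in> N" using Nd E(4) by simp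
 then show False using N(3) by blast
qed

end

section \<open>The residue field\<close>

context valued_field
begin

abbreviation "k \<equiv> residue_field R v"

text \<open>With the convention v(0) = infinity built in, so that sums and products need no
  exception for zero.\<close>

definition ge :: "int => 'a => bool" where "ge n x \<longleftrightarrow> x \<in> carrier R \<and> (x = \<zero> \<or> n \<le> v x)"

lemma ge_zero: "ge n \<zero>" and ge_one: "ge 0 \<one>" by (simp_all add: ge_def v_one)

lemma ge_nz: "x \<in> nz R ==> ge n x \<longleftrightarrow> n \<le> v x" by (auto simp: ge_def nz_iff)

lemma ge_neg: "ge n x ==> ge n (-. x)" using v_neg[of x] by (auto simp: ge_def nz_iff)

lemma ge_add: "ge n x ==> ge n y ==> ge n (x +. y)" using v_add[of x y] by (cases "x = \<zero>"; cases "y = \<zero>") (auto simp: ge_def nz_iff)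

lemma ge_mult: "ge m x ==> ge n y ==> ge (m + n) (x *. y)"
 using v_mult[of x y] by (cases "x = \<zero>"; cases "y = \<zero>") (auto simp: ge_def nz_iff)

lemma val_ring_carrier: "x \<in> carrier (val_ring R v) \<longleftrightarrow> ge 0 x" by (auto simp: val_ring_def ge_def)

lemma val_ring_simps: "ring.add (val_ring R v) = ring.add R" "monoid.mult (val_ring R v) = monoid.mult R"
 "\<zero>\<^sub>(val_ring R v) = \<zero>" "\<one>\<^sub>(val_ring R v) = \<one>" by (simp_all add: val_ring_def)

lemma val_max_ideal_iff: "x \<in> val_max_ideal R v \<longleftrightarrow> ge 1 x" by (auto simp: val_max_ideal_def ge_def)

lemma val_ring_cring: "cring (val_ring R v)"
proof -
 let ?H = "{x \<in> carrier R. x = \<zero> \<or> 0 \<le> v x}"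
 have H: "x \<in> ?H \<longleftrightarrow> ge 0 x" for x by (auto simp: ge_def)
 have "subring ?H R"
 proof (rule subringI)
  show "?H \<subseteq> carrier R" by auto
 qed (use ge_one ge_neg ge_add ge_mult[of 0 _ 0] in \<open>simp_all only: H add_0\<close>)
 then show ?thesis using subcring_iff[of ?H] subcringI' by (auto simp: val_ring_def)
qed

lemma val_max_ideal_ideal: "ideal (val_max_ideal R v) (val_ring R v)"
proof -
 interpret V: cring "val_ring R v" by (rule val_ring_cring)
 have neg: "-.\<^sub>(val_ring R v) x = -. x" if "ge 0 x" for x
  by (rule V.minus_equality) (use that ge_neg[OF that] in \<open>auto simp: val_ring_simps val_ring_carrier l_neg ge_def\<close>)
 have sub: "ge 1 x ==> ge 0 x" for x by (auto simp: ge_def)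
 show ?thesis
 proof (rule idealI[OF V.ring_axioms])
  show "subgroup (val_max_ideal R v) (add_monoid (val_ring R v))"
  proof (rule V.add.subgroupI)
   show "val_max_ideal R v \<subseteq> carrier (val_ring R v)" using sub by (auto simp: val_max_ideal_iff val_ring_carrier)
   show "val_max_ideal R v ~= {}" using ge_zero[of 1] val_max_ideal_iff by blast
  qed (use neg[OF sub] ge_neg ge_add in \<open>simp_all only: val_max_ideal_iff val_ring_simps\<close>)
 next
  fix a x assume a: "a \<in> val_max_ideal R v" and x: "x \<in> carrier (val_ring R v)"
  then show "x *.\<^sub>(val_ring R v) a \<in> val_max_ideal R v"
   using ge_mult[of 0 x 1 a] by (simp add: val_max_ideal_iff val_ring_carrier val_ring_simps)
  show "a *.\<^sub>(val_ring R v) x \<in> val_max_ideal R v"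
   using a x ge_mult[of 1 a 0 x] by (simp add: val_max_ideal_iff val_ring_carrier val_ring_simps)
 qed
qed

lemma red_hom: "red R v \<in> ring_hom (val_ring R v) k"
proof -
 have "red R v = (\<lambda>a. val_max_ideal R v +>\<^sub>(val_ring R v) a)" by (rule ext) (simp add: red_def)
 then show ?thesis unfolding residue_field_def using ideal.rcos_ring_hom[OF val_max_ideal_ideal] by simp
qed

lemma red_closed: "ge 0 x ==> red R v x \<in> carrier k"
 and red_mult_ge: "ge 0 x ==> ge 0 y ==> red R v (x *. y) = red R v x *.\<^sub>k red R v y"
 and red_add: "ge 0 x ==> ge 0 y ==> red R v (x +. y) = red R v x +.\<^sub>k red R v y"
 and red_one: "red R v \<one> = \<one>\<^sub>k"
 using ring_hom_closed[OF red_hom, of x] ring_hom_mult[OF red_hom, of x y] ring_hom_add[OF red_hom, of x y]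
  ring_hom_one[OF red_hom] by (simp_all add: val_ring_carrier val_ring_simps)

lemma red_zero_iff: "ge 0 x ==> red R v x = \<zero>\<^sub>k \<longleftrightarrow> ge 1 x"
proof -
 assume x: "ge 0 x"
 interpret V: cring "val_ring R v" by (rule val_ring_cring)
 interpret S: abelian_subgroup "val_max_ideal R v" "val_ring R v"
  by (rule abelian_subgroupI3[OF ideal.axioms(1)[OF val_max_ideal_ideal] V.abelian_group_axioms])
 have "red R v x = val_max_ideal R v \<longleftrightarrow> x \<in> val_max_ideal R v"
  unfolding red_def using S.a_rcos_self[of x] S.a_rcos_const[of x] x by (auto simp: val_ring_carrier)
 then show ?thesis by (simp add: val_max_ideal_iff residue_field_def FactRing_def)
qed

lemma red_surj: "c \<in> carrier k ==> \<exists>x. ge 0 x \<and> c = red R v x"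
 by (auto simp: residue_field_def FactRing_def A_RCOSETS_def' red_def[abs_def] val_ring_carrier)

lemma units_iff: "u \<in> UU \<longleftrightarrow> u \<in> nz R \<and> v u = 0" by (auto simp: val_units_def nz_def)

lemma units_nz: "u \<in> UU ==> u \<in> nz R" and units_v: "u \<in> UU ==> v u = 0"
 and units_ge: "u \<in> UU ==> ge 0 u" using units_iff by (auto simp: ge_nz)

lemma units_one: "\<one> \<in> UU" and units_mult: "u \<in> UU ==> w \<in> UU ==> u *. w \<in> UU"
 and units_inv: "u \<in> UU ==> inv u \<in> UU" and units_neg: "u \<in> UU ==> -. u \<in> UU" by (simp_all add: units_iff v_one v_mult v_inv v_neg)

lemma ge_unit: "ge 0 x ==> \<not> ge 1 x ==> x \<in> UU" by (auto simp: ge_def units_iff nz_iff)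

lemma unit_not_ge: "u \<in> UU ==> \<not> ge 1 u" by (simp add: units_iff ge_nz)

lemma residue_field_field: "field k"
proof -
 interpret K: cring k unfolding residue_field_def by (rule ideal.quotient_is_cring[OF val_max_ideal_ideal val_ring_cring])
 show ?thesis
 proof (rule K.cring_fieldI2)
  show "\<zero>\<^sub>k ~= \<one>\<^sub>k" using red_zero_iff[OF ge_one] unit_not_ge[OF units_one] red_one by metis
  fix c assume c: "c \<in> carrier k" "c ~= \<zero>\<^sub>k"
  then obtain x where x: "ge 0 x" "c = red R v x" using red_surj by blast
  then have u: "x \<in> UU" using c red_zero_iff[OF x(1)] ge_unit by blast
  then have "x *. inv x = \<one>" using units_nz nz_r_inv by blast
  then have "red R v x *.\<^sub>k red R v (inv x) = \<one>\<^sub>k" using red_mult_ge[OF x(1) units_ge[OF units_inv[OF u]]] red_one by simp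
  then show "\<exists>b\<in>carrier k. c *.\<^sub>k b = \<one>\<^sub>k" using red_closed[OF units_ge[OF units_inv[OF u]]] x(2) by blast
 qed
qed

end

sublocale valued_field \<subseteq> K: field "residue_field R v" by (rule residue_field_field)

context valued_field
begin

lemma red_nz: "u \<in> UU ==> red R v u \<in> nz k" using red_zero_iff[OF units_ge] unit_not_ge red_closed[OF units_ge] by (auto simp: nz_iff)

lemma red_mult: "u \<in> UU ==> w \<in> UU ==> red R v (u *. w) = red R v u *.\<^sub>k red R v w" using red_mult_ge units_ge by blast

lemma red_inv: "u \<in> UU ==> red R v (inv u) = inv\<^bsub>k\<^esub> (red R v u)"
 using red_mult[of u "inv u"] units_inv[of u] red_nz[of u] red_nz[of "inv u"]
 by (intro K.nz_inv_unique[symmetric]) (auto simp: red_one nz_r_inv units_nz)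

lemma red_neg: "ge 0 x ==> red R v (-. x) = -.\<^sub>k (red R v x)"
proof -
 assume x: "ge 0 x"
 have c: "x \<in> carrier R" using x by (simp add: ge_def)
 have "red R v (-. x) +.\<^sub>k red R v x = \<zero>\<^sub>k"
  using red_add[OF ge_neg[OF x] x] red_zero_iff[OF ge_zero] ge_zero c by (simp add: l_neg)
 then show ?thesis using x ge_neg red_closed by (intro K.minus_equality[symmetric]) auto
qed

lemma red_compl: "ge 0 x ==> red R v (\<one> -. x) = \<one>\<^sub>k -.\<^sub>k red R v x"
 by (simp add: a_minus_def red_add red_neg ge_one ge_neg red_one)

lemma red_minus_one: "red R v (-. \<one>) = -.\<^sub>k \<one>\<^sub>k" by (simp add: red_neg ge_one red_one)

lemma red_eq_one_iff: "u \<in> UU ==> red R v u = \<one>\<^sub>k \<longleftrightarrow> u \<in> U1"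
proof -
 assume u: "u \<in> UU"
 have g: "ge 0 (\<one> -. u)" unfolding a_minus_def by (rule ge_add[OF ge_one ge_neg[OF units_ge[OF u]]])
 have "red R v u = \<one>\<^sub>k \<longleftrightarrow> \<one>\<^sub>k -.\<^sub>k red R v u = \<zero>\<^sub>k"
  using red_closed[OF units_ge[OF u]] K.r_right_minus_eq[of "\<one>\<^sub>k" "red R v u"] by auto
 also have "\<dots> \<longleftrightarrow> ge 1 (\<one> -. u)" using red_compl[OF units_ge[OF u]] red_zero_iff[OF g] by simp
 also have "\<dots> \<longleftrightarrow> u \<in> U1"
  using u one_minus_nz[of u] by (cases "u = \<one>") (auto simp: higher_units_iff units_iff ge_nz ge_zero a_minus_def r_neg)
 finally show ?thesis .
qed

lemma red_nz_surj: "c \<in> nz k ==> \<exists>u\<in>UU. c = red R v u" using red_surj[of c] red_zero_iff ge_unit by (auto simp: nz_iff)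

lemma higher_in_units: "u \<in> higher_units R v n ==> u \<in> UU" by (simp add: higher_units_def)

section \<open>Induced modules\<close>

definition usq :: "'a => 'a set"
 where "usq u = {w *. w | w. w \<in> UU} #>\<^sub>((mult_of R)\<lparr>carrier := UU\<rparr>) u"

lemma usq_iff: "w \<in> usq u \<longleftrightarrow> (\<exists>s\<in>UU. w = (s *. s) *. u)" by (auto simp: usq_def r_coset_def)

lemma unit_sq_group_carrier: "carrier (unit_sq_group R v) = usq ` UU" by (auto simp: unit_sq_group_def FactGroup_def RCOSETS_def usq_def)

lemma unit_sq_incl_frag: "u \<in> UU ==> unit_sq_incl R v (frag_of (usq u)) = sq R u"
proof -
 assume u: "u \<in> UU"
 have "sq_class R w = sq_class R u" if "w \<in> usq u" for w using that u sq_class_sq[of u] units_nz by (auto simp: usq_iff m_comm)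
 moreover have "u \<in> usq u" using u units_nz by (auto simp: usq_iff intro!: bexI[of _ \<one>] units_one)
 ultimately have "(\<Union>w\<in>usq u. sq_class R w) = sq_class R u" by blast
 then show ?thesis by (simp add: unit_sq_incl_def sq_def)
qed

lemma unit_sq_red_frag: "u \<in> UU ==> unit_sq_red R v (frag_of (usq u)) = sq k (red R v u)"
proof -
 assume u: "u \<in> UU"
 have "sq_class k (red R v w) = sq_class k (red R v u)" if "w \<in> usq u" for w
 proof -
  obtain s where s: "s \<in> UU" "w = (s *. s) *. u" using \<open>w \<in> usq u\<close> usq_iff by blast
  then have "red R v w = red R v u *.\<^sub>k (red R v s *.\<^sub>k red R v s)" using u red_nz by (simp add: red_mult units_mult K.m_comm)
  then show ?thesis using K.sq_class_sq[OF red_nz[OF u] red_nz[OF s(1)]] by simp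
 qed
 moreover have "u \<in> usq u" using u units_nz by (auto simp: usq_iff intro!: bexI[of _ \<one>] units_one)
 ultimately have "(\<Union>w\<in>usq u. sq_class k (red R v w)) = sq_class k (red R v u)" by blast
 then show ?thesis by (simp add: unit_sq_red_def sq_def)
qed

abbreviation "UR \<equiv> group_ring (unit_sq_group R v)"

lemma unit_ring_induct [consumes 1, case_names zero gen diff]:
 assumes "r \<in> carrier UR" "P 0" "!!u. u \<in> UU ==> P (frag_of (usq u))"
  "!!a b. a \<in> carrier UR ==> b \<in> carrier UR ==> P a ==> P b ==> P (a - b)"
 shows "P r" using assms(1,2) by (rule group_ring_induct) (use assms(3,4) in \<open>auto simp: unit_sq_group_carrier\<close>)

lemma unit_sq_maps_simps:
 "unit_sq_incl R v 0 = 0" "unit_sq_incl R v (a - b) = unit_sq_incl R v a - unit_sq_incl R v b"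
 "unit_sq_red R v 0 = 0" "unit_sq_red R v (a - b) = unit_sq_red R v a - unit_sq_red R v b"
 by (simp_all add: unit_sq_incl_def unit_sq_red_def frag_extend_diff)

lemma unit_sq_incl_closed: "r \<in> carrier UR ==> unit_sq_incl R v r \<in> carrier (RF R)"
proof (induction r rule: unit_ring_induct)
 case zero
 then show ?case using cring.cring_simprules(2)[OF RF_cring] by (simp add: unit_sq_maps_simps RF_simps)
next
 case (diff a b)
 then show ?case by (simp add: unit_sq_maps_simps RF_diff_closed)
qed (simp add: unit_sq_incl_frag units_nz)

lemma unit_sq_red_closed: "r \<in> carrier UR ==> unit_sq_red R v r \<in> carrier (RF k)"
proof (induction r rule: unit_ring_induct)
 case zero
 then show ?case using cring.cring_simprules(2)[OF K.RF_cring] by (simp add: unit_sq_maps_simps K.RF_simps)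
next
 case (diff a b)
 then show ?case by (simp add: unit_sq_maps_simps K.RF_diff_closed)
qed (simp add: unit_sq_red_frag red_nz)

lemma RF_regular_module: "module (RF R) (regular_module (RF R))"
proof -
 interpret RF: cring "RF R" by (rule RF_cring)
 show ?thesis by (rule moduleI)
    (use RF.l_neg in \<open>auto simp: regular_module_def RF.is_cring RF.m_assoc RF.l_distr RF.r_distr RF.a_ac
     intro!: abelian_groupI bexI[of _ "-.\<^sub>(RF R) _"]\<close>)
qed

lemma restrict_scalars_simps: "carrier (restrict_scalars f M) = carrier M" "ring.add (restrict_scalars f M) = ring.add M"
 "\<zero>\<^sub>(restrict_scalars f M) = \<zero>\<^sub>M" "s \<odot>\<^sub>(restrict_scalars f M) x = f s \<odot>\<^sub>M x"
 by (simp_all add: restrict_scalars_def)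

lemma regular_simps: "carrier (regular_module S) = carrier S" "ring.add (regular_module S) = ring.add S"
 "\<zero>\<^sub>(regular_module S) = \<zero>\<^sub>S" "s \<odot>\<^sub>(regular_module S) x = s *.\<^sub>S x" by (simp_all add: regular_module_def)

lemma restrict_scalars_abelian: "abelian_group M ==> abelian_group (restrict_scalars f M)"
proof -
 assume "abelian_group M"
 then interpret M: abelian_group M .
 show ?thesis by (rule abelian_groupI) (use M.l_neg M.a_inv_closed in \<open>auto simp: restrict_scalars_simps M.a_ac\<close>)
qed

lemma ind_tensor_product:
 assumes "module (RF k) M"
 shows "tensor_product UR (RF R) (regular_module (RF R)) (\<lambda>s r. s *.\<^sub>(RF R) unit_sq_incl R v r)
   (restrict_scalars (unit_sq_red R v) M)"
proof -
 interpret RF: cring "RF R" by (rule RF_cring)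
 interpret M: module "RF k" M by fact
 show ?thesis by (rule tensor_product.intro[OF RF_regular_module restrict_scalars_abelian[OF M.abelian_group_axioms]])
   (auto simp: regular_simps restrict_scalars_simps unit_sq_incl_closed unit_sq_red_closed RF.m_assoc)
qed

lemma ind_module: "module (RF k) M ==> module (RF R) (Ind R v M)" unfolding Ind_def by (rule tensor_product.tensor_module[OF ind_tensor_product])

text \<open>Every pure tensor \<open>s \<otimes> m\<close> is \<open>s (1 \<otimes> m)\<close>.\<close>

definition ind_one :: "('a set sqr, 'x) module => 'x => ('a, 'x) ind"
 where "ind_one M m = ind_tensor R v M \<one>\<^sub>(RF R) m"

lemma ind_tensor_eq:
 assumes "module (RF k) M" "s \<in> carrier (RF R)" "m \<in> carrier M"
 shows "ind_tensor R v M s m = s \<odot>\<^sub>(Ind R v M) ind_one M m"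
proof -
 interpret RF: cring "RF R" by (rule RF_cring)
 show ?thesis unfolding ind_one_def ind_tensor_def Ind_def
  using tensor_product.pt_smult[OF ind_tensor_product[OF assms(1)], of s "\<one>\<^sub>(RF R)" m] assms(2,3)
  by (simp add: regular_simps restrict_scalars_simps)
qed

lemma ind_one_add_map:
 assumes "module (RF k) M"
 shows "add_map M (Ind R v M) (ind_one M)"
proof -
 interpret RF: cring "RF R" by (rule RF_cring)
 have "add_map (restrict_scalars (unit_sq_red R v) M) (Ind R v M) (\<lambda>m. ind_tensor R v M \<one>\<^sub>(RF R) m)"
  unfolding ind_tensor_def Ind_def by (rule tensor_product.pt_add_maps(2)[OF ind_tensor_product[OF assms]]) (simp add: regular_simps)
 then show ?thesis by (simp add: add_map_def restrict_scalars_simps ind_one_def)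
qed

lemma ind_one_closed: "module (RF k) M ==> m \<in> carrier M ==> ind_one M m \<in> carrier (Ind R v M)" by (rule add_map_closed[OF ind_one_add_map])

lemma ind_one_sq:
 assumes "module (RF k) M" "u \<in> UU" "m \<in> carrier M"
 shows "ind_one M (sq k (red R v u) \<odot>\<^sub>M m) = sq R u \<odot>\<^sub>(Ind R v M) ind_one M m"
proof -
 interpret RF: cring "RF R" by (rule RF_cring)
 have f: "frag_of (usq u) \<in> carrier UR" using assms(2) by (intro frag_of_group_ring) (simp add: unit_sq_group_carrier)
 have "ind_tensor R v M (\<one>\<^sub>(RF R) *.\<^sub>(RF R) unit_sq_incl R v (frag_of (usq u))) m =
  ind_tensor R v M \<one>\<^sub>(RF R) (unit_sq_red R v (frag_of (usq u)) \<odot>\<^sub>M m)" unfolding ind_tensor_def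
  using tensor_product.pt_balanced[OF ind_tensor_product[OF assms(1)], of "\<one>\<^sub>(RF R)" "frag_of (usq u)" m] f assms(3)
  by (simp add: regular_simps restrict_scalars_simps)
 then show ?thesis using assms ind_tensor_eq[OF assms(1), of "sq R u" m] units_nz by (simp add: unit_sq_incl_frag unit_sq_red_frag ind_one_def)
qed

text \<open>Frobenius reciprocity. Compatibility of \<tau> with the classes of single units
  suffices, since these span the ring over which the tensor product is formed.\<close>

lemma ind_lift:
 assumes M: "module (RF k) M" and W: "module (RF R) W" and \<tau>: "add_map M W \<tau>"
  and eq: "!!u m. u \<in> UU ==> m \<in> carrier M ==> \<tau> (sq k (red R v u) \<odot>\<^sub>M m) = sq R u \<odot>\<^sub>W \<tau> m"
 obtains h where "h \<in> mod_hom (RF R) (Ind R v M) W" "!!m. m \<in> carrier M ==> h (ind_one M m) = \<tau> m"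
proof -
 interpret RF: cring "RF R" by (rule RF_cring)
 interpret M: module "RF k" M by fact
 interpret W: module "RF R" W by fact
 note \<tau>c = add_map_closed[OF \<tau>]
 have bal: "unit_sq_incl R v r \<odot>\<^sub>W \<tau> m = \<tau> (unit_sq_red R v r \<odot>\<^sub>M m)" if "r \<in> carrier UR" "m \<in> carrier M" for r m
  using that
 proof (induction r rule: unit_ring_induct)
  case zero
  then show ?case using add_map_zero[OF M.abelian_group_axioms W.abelian_group_axioms \<tau>] W.smult_l_null[OF \<tau>c] M.smult_l_null
   by (simp add: unit_sq_maps_simps RF_simps K.RF_simps)
 next
  case (gen u)
  then show ?case by (simp add: unit_sq_incl_frag unit_sq_red_frag eq)
 next
  case (diff a b)
  have "\<tau> (unit_sq_red R v a \<odot>\<^sub>M m -.\<^sub>M unit_sq_red R v b \<odot>\<^sub>M m) = \<tau> (unit_sq_red R v a \<odot>\<^sub>M m) -.\<^sub>W \<tau> (unit_sq_red R v b \<odot>\<^sub>M m)"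
   by (rule add_map_minus[OF M.abelian_group_axioms W.abelian_group_axioms \<tau>]) (use diff unit_sq_red_closed in simp_all)
  then show ?case
   using diff group_ring_diff_smult[OF W[unfolded RF_def], folded RF_def, OF unit_sq_incl_closed unit_sq_incl_closed \<tau>c, of a b m]
    group_ring_diff_smult[OF M[unfolded RF_def], folded RF_def, OF unit_sq_red_closed unit_sq_red_closed, of a b m]
   by (simp add: unit_sq_maps_simps)
 qed
 have "\<exists>h. h \<in> mod_hom (RF R) (Ind R v M) W \<and> (\<forall>s\<in>carrier (RF R). \<forall>m\<in>carrier M. h (ind_tensor R v M s m) = s \<odot>\<^sub>W \<tau> m)"
  unfolding Ind_def ind_tensor_def
 proof (rule tensor_product.tensor_mod_lift[OF ind_tensor_product[OF M] W, of "\<lambda>s m. s \<odot>\<^sub>W \<tau> m"], goal_cases)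
  case (1 y)
  then show ?case by (intro add_mapI) (auto simp: regular_simps restrict_scalars_simps \<tau>c W.smult_l_distr)
 next
  case (2 x)
  then show ?case by (intro add_mapI) (auto simp: regular_simps restrict_scalars_simps \<tau>c W.smult_r_distr add_map_add[OF \<tau>])
 next
  case (3 x r y)
  then show ?case using bal[of r y] by (simp add: regular_simps restrict_scalars_simps \<tau>c W.smult_assoc1 unit_sq_incl_closed)
 next
  case (4 s x y)
  then show ?case by (simp add: regular_simps restrict_scalars_simps \<tau>c W.smult_assoc1)
 next
  case (5 h)
  then show ?case by (intro exI[of _ h]) (auto simp: regular_simps restrict_scalars_simps)
 qed
 then obtain h where h: "h \<in> mod_hom (RF R) (Ind R v M) W"
  "!!s m. s \<in> carrier (RF R) ==> m \<in> carrier M ==> h (ind_tensor R v M s m) = s \<odot>\<^sub>W \<tau> m" by blast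
 show thesis by (rule that[OF h(1)]) (simp add: ind_one_def h(2) \<tau>c)
qed

lemma ind_hom_eq:
 assumes M: "module (RF k) M" and W: "module (RF R) W" and h: "h \<in> mod_hom (RF R) (Ind R v M) W" "h' \<in> mod_hom (RF R) (Ind R v M) W"
  and eq: "!!m. m \<in> carrier M ==> h (ind_one M m) = h' (ind_one M m)"
 shows "h = h'"
proof -
 have e: "h (ind_tensor R v M s m) = h' (ind_tensor R v M s m)" if "s \<in> carrier (RF R)" "m \<in> carrier M" for s m
  using that ind_one_closed[OF M that(2)] by (simp add: ind_tensor_eq[OF M] mod_hom_smult[OF h(1)] mod_hom_smult[OF h(2)] eq)
 show ?thesis by (rule tensor_product.tensor_mod_hom_eq[OF ind_tensor_product[OF M] W h[unfolded Ind_def]])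
   (use e in \<open>simp add: regular_simps restrict_scalars_simps ind_tensor_def\<close>)
qed

lemma ind_map_spec:
 assumes M: "module (RF k) M" and N: "module (RF k) N" and f: "add_map M N f"
  and lin: "!!r x. r \<in> carrier (RF k) ==> x \<in> carrier M ==> f (r \<odot>\<^sub>M x) = r \<odot>\<^sub>N f x"
 shows "ind_map R v M N f \<in> mod_hom (RF R) (Ind R v M) (Ind R v N)"
  and "!!m. m \<in> carrier M ==> ind_map R v M N f (ind_one M m) = ind_one N (f m)"
proof -
 interpret RF: cring "RF R" by (rule RF_cring)
 note fc = add_map_closed[OF f]
 have \<tau>: "add_map M (Ind R v N) (\<lambda>m. ind_one N (f m))" by (rule add_map_comp[OF f ind_one_add_map[OF N]])
 obtain h where h: "h \<in> mod_hom (RF R) (Ind R v M) (Ind R v N)" "!!m. m \<in> carrier M ==> h (ind_one M m) = ind_one N (f m)"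
  by (rule ind_lift[OF M ind_module[OF N] \<tau>]) (auto simp: lin red_nz fc ind_one_sq[OF N])
 have h2: "h (ind_tensor R v M s m) = ind_tensor R v N s (f m)" if "s \<in> carrier (RF R)" "m \<in> carrier M" for s m
  using that ind_one_closed[OF M] by (simp add: ind_tensor_eq[OF M] ind_tensor_eq[OF N] fc mod_hom_smult[OF h(1)] h(2))
 have "\<exists>!g. g \<in> mod_hom (RF R) (Ind R v M) (Ind R v N) \<and>
  (\<forall>s\<in>carrier (RF R). \<forall>m\<in>carrier M. g (ind_tensor R v M s m) = ind_tensor R v N s (f m))"
 proof (rule ex1I[of _ h])
  fix g assume g: "g \<in> mod_hom (RF R) (Ind R v M) (Ind R v N) \<and>
   (\<forall>s\<in>carrier (RF R). \<forall>m\<in>carrier M. g (ind_tensor R v M s m) = ind_tensor R v N s (f m))"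
  show "g = h" by (rule ind_hom_eq[OF M ind_module[OF N] conjunct1[OF g] h(1)])
    (use g h2 in \<open>simp add: ind_one_def\<close>)
 qed (use h h2 in blast)
 from theI'[OF this, folded ind_map_def] have s: "ind_map R v M N f \<in> mod_hom (RF R) (Ind R v M) (Ind R v N)"
  "!!s m. s \<in> carrier (RF R) ==> m \<in> carrier M ==> ind_map R v M N f (ind_tensor R v M s m) = ind_tensor R v N s (f m)" by blast+
 show "ind_map R v M N f \<in> mod_hom (RF R) (Ind R v M) (Ind R v N)" by (rule s(1))
 show "ind_map R v M N f (ind_one M m) = ind_one N (f m)" if "m \<in> carrier M" for m using s(2)[OF RF.one_closed that] by (simp add: ind_one_def)
qed

end

section \<open>The specialization map\<close>

text \<open>Modelled on \<open>spec_symb\<close>: symbols vanish off the units and on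
  \<open>U1\<close>, depend on a unit through its reduction, and obey the relations of the residue
  field. The five term relation is assumed only where x, y, 1-x and 1-y are units, so that it
  reduces to that of the residue field.\<close>

locale residue_symbols = valued_field R v for R (structure) and v +
 fixes b :: "'a => 'a => 't::ab_group_add" and N :: "'t set"
 assumes N0: "0 \<in> N" and Nadd: "!!s t. s \<in> N ==> t \<in> N ==> s + t \<in> N" and Nneg: "!!t. t \<in> N ==> - t \<in> N"
  and bsq: "!!g s x. g \<in> nz R ==> s \<in> nz R ==> b (g *. (s *. s)) x = b g x"
  and b_wild: "!!g a. g \<in> nz R ==> a \<in> nz R ==> v a ~= 0 ==> b g a \<in> N"
  and b_one_unit: "!!g u. g \<in> nz R ==> u \<in> U1 ==> b g u \<in> N"
  and b_unit_mult: "!!g x u. g \<in> nz R ==> x \<in> UU ==> u \<in> U1 ==> b g (x *. u) - b g x \<in> N"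
  and b_unit_smult: "!!g x u. g \<in> nz R ==> x \<in> nz R ==> u \<in> U1 ==> b (g *. u) x - b g x \<in> N"
  and bK: "!!g x. g \<in> nz R ==> x \<in> UU ==> b g x + b (-. g) (inv x) \<in> N"
  and bE: "!!g x. g \<in> nz R ==> x \<in> UU ==> x \<notin> U1 ==> b g x + b (-. g) (\<one> -. x) \<in> N"
  and bL: "!!g x. g \<in> nz R ==> x \<in> UU ==> b (g *. x) x - b (-. g) x \<in> N"
  and bft: "!!g x p q. g \<in> nz R ==> x \<in> UU ==> p \<in> UU ==> q \<in> UU ==>
   x \<notin> U1 ==> x *. p \<notin> U1 ==> \<one> -. x = q *. (\<one> -. x *. p) ==>
   b g x - b g (x *. p) + b (g *. x) p - b (g *. (x *. (\<one> -. x))) (p *. q) + b (g *. (\<one> -. x)) q \<in> N"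
begin

lemma Ndiff: "s \<in> N ==> t \<in> N ==> s - t \<in> N" using Nadd[of s "- t"] Nneg by simp

lemma N_eq: "s \<in> N ==> s = t ==> t \<in> N" by simp

lemma hu_nz: "u \<in> higher_units R v n ==> u \<in> nz R" and hu_v: "u \<in> higher_units R v n ==> v u = 0" by (simp_all add: higher_units_iff)

lemma b_unit_mult2:
 assumes "g \<in> nz R" "x \<in> UU" "u \<in> U1" "w \<in> U1"
 shows "b (g *. w) (x *. u) - b g x \<in> N"
proof -
 have "b (g *. w) (x *. u) - b g (x *. u) + (b g (x *. u) - b g x) \<in> N" using assms units_nz hu_nz by (intro Nadd b_unit_smult b_unit_mult) auto
 then show ?thesis by simp
qed

text \<open>The five term relation is inherited from the residue field.  The argument is by cases
 according to whether each of \<open>x\<close> and \<open>y = x p\<close> has positive or negative valuation, reduces to 1,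
 or is a unit with reduction different from 1.  Put \<open>A = 1 - x\<close>, \<open>B = 1 - y\<close>, so that \<open>q = A / B\<close>.\<close>

lemma five_term_residue:
 assumes g: "g \<in> nz R" and x: "x \<in> nz R" and p: "p \<in> nz R" and q: "q \<in> nz R"
  and x1: "x ~= \<one>" and y1: "x *. p ~= \<one>" and rel: "\<one> -. x = q *. (\<one> -. x *. p)"
 shows "b g x - b g (x *. p) + b (g *. x) p - b (g *. (x *. (\<one> -. x))) (p *. q) + b (g *. (\<one> -. x)) q \<in> N"
proof -
 define y A B C D where "y = x *. p" and "A = \<one> -. x" and "B = \<one> -. y" and "C = \<one> -. inv x" and "D = \<one> -. inv y"
 have y: "y \<in> nz R" "y ~= \<one>" using x p y1 by (simp_all add: y_def)
 have A: "A \<in> nz R" and B: "B \<in> nz R" using x x1 y by (simp_all add: A_def B_def)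
 have ix: "inv x \<in> nz R" "inv x ~= \<one>" and iy: "inv y \<in> nz R" "inv y ~= \<one>" using x x1 y inv_eq_one by auto
 have C: "C \<in> nz R" and D: "D \<in> nz R" using ix iy by (simp_all add: C_def D_def)
 have c: "x \<in> carrier R" "y \<in> carrier R" "p \<in> carrier R" "q \<in> carrier R" "A \<in> carrier R" "B \<in> carrier R" "C \<in> carrier R" "D \<in> carrier R"
  "g \<in> carrier R" "inv x \<in> carrier R" "inv y \<in> carrier R" "inv B \<in> carrier R" "inv D \<in> carrier R" "inv p \<in> carrier R"
  using g x y p q A B C D by simp_all
 \<comment> \<open>C and D, the complements of 1/x and 1/y, take over from A and B where x or y has
   negative valuation: p q = C/D, and x A is -C up to squares.\<close>
 have A_eq: "A = -. (x *. C)"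
 proof -
  have "x *. C = -. (A *. (x *. inv x))" unfolding C_def A_def one_minus_inv[OF x] using c by (simp add: r_minus m_ac)
  then show ?thesis using c x by (simp add: nz_r_inv)
 qed
 have B_eq: "B = -. (y *. D)"
 proof -
  have "y *. D = -. (B *. (y *. inv y))" unfolding D_def B_def one_minus_inv[OF y(1)] using c by (simp add: r_minus m_ac)
  then show ?thesis using c y by (simp add: nz_r_inv)
 qed
 have qB: "q *. B = A" using rel by (simp add: A_def B_def y_def)
 have cancel: "s = t" if "s \<in> carrier R" "t \<in> carrier R" "z \<in> nz R" "s *. z = t *. z" for s t z
 proof -
  have "s *. (z *. inv z) = t *. (z *. inv z)" using that(4) that(1-3) by (simp add: m_assoc[symmetric])
  then show ?thesis using that(1-3) by (simp add: nz_r_inv)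
 qed
 have q_eq: "q = s" if "s \<in> carrier R" "s *. B = A" for s by (rule cancel[OF c(4) that(1) B]) (simp only: qB that(2))
 have p_eq: "p = s" if "s \<in> carrier R" "s *. x = y" for s by (rule cancel[OF c(3) that(1) x]) (simp only: that(2), simp add: y_def m_comm c)
 have pq_eq: "p *. q = s" if "s \<in> carrier R" "s *. (B *. x) = y *. A" for s
 proof (rule cancel[of _ _ "B *. x"])
  have "p *. q *. (B *. x) = (x *. p) *. (q *. B)" using c by (simp add: m_ac)
  then show "p *. q *. (B *. x) = s *. (B *. x)" using that(2) qB by (simp add: y_def)
 qed (use that c B x in auto)
 have q_quot: "q = A *. inv B"
 proof (rule q_eq)
  have "A *. inv B *. B = A *. (inv B *. B)" using c by (simp add: m_ac)
  then show "A *. inv B *. B = A" using c B by (simp add: nz_l_inv)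
 qed (use c in simp)
 have p_quot: "p = y *. inv x"
 proof (rule p_eq)
  have "y *. inv x *. x = y *. (inv x *. x)" using c by (simp add: m_ac)
  then show "y *. inv x *. x = y" using c x by (simp add: nz_l_inv)
 qed (use c in simp)
 have pq_quot: "p *. q = C *. inv D"
 proof (rule pq_eq)
  have "C *. inv D *. (B *. x) = -. (y *. (x *. C)) *. (inv D *. D)" unfolding B_eq using c by (simp add: l_minus r_minus m_ac)
  then show "C *. inv D *. (B *. x) = y *. A" using c D by (simp add: nz_l_inv A_eq r_minus)
 qed (use c in simp)
 have gxA: "g *. (x *. A) = (-. g *. C) *. (x *. x)" unfolding A_eq using c by (simp add: l_minus r_minus m_ac)
 have vy: "v y = v x + v p" using x p by (simp add: y_def v_mult)
 have vq: "v A = v q + v B" using v_mult[OF q B] qB by simp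
 have vpq: "v (p *. q) = v p + v q" using p q by (simp add: v_mult)
 have vAx: "v A = v x + v C" using A_eq v_neg[of "x *. C"] v_mult[OF x C] x C by simp
 have vBy: "v B = v y + v D" using B_eq v_neg[of "y *. D"] v_mult[OF y(1) D] y D by simp
 have gg: "g *. x \<in> nz R" "g *. A \<in> nz R" "g *. (x *. A) \<in> nz R" "-. g \<in> nz R" "p *. q \<in> nz R" using g x A p q by simp_all
 let ?U = "U1"
 have five: ?thesis if "b g x - b g y + b (g *. x) p - b (g *. (x *. A)) (p *. q) + b (g *. A) q \<in> N" using that by (simp add: y_def A_def)
 have null5: ?thesis if "b g x \<in> N" "b g y \<in> N" "b (g *. x) p \<in> N" "b (g *. (x *. A)) (p *. q) \<in> N" "b (g *. A) q \<in> N"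
  by (rule five, rule Nadd[OF Ndiff[OF Nadd[OF Ndiff[OF that(1,2)] that(3)] that(4)] that(5)])
 have U_compl: "\<one> -. z \<in> ?U" if "z \<in> nz R" "v z > 0" for z using compl_higher[of z 1] that by simp
 have U_compl_inv: "\<one> -. inv z \<in> ?U" if "z \<in> nz R" "v z < 0" for z using U_compl[of "inv z"] that by (simp add: v_inv)
 have U_v: "v (\<one> -. z) > 0" if "z \<in> ?U" "z ~= \<one>" for z using that by (auto simp: higher_units_iff)
 have G_v: "v (\<one> -. z) = 0" if "z \<in> nz R" "v z = 0" "z \<notin> ?U" for z using not_higher_one that by blast
 have G_compl: "\<one> -. z \<notin> ?U" if "z \<in> nz R" "v z = 0" "z \<notin> ?U" for z
 proof -
  have "\<one> -. \<one> \<notin> nz R" by (simp add: a_minus_def r_neg nz_iff)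
  then show ?thesis using that one_minus_one_minus[of z] v_one by (auto simp: higher_units_iff)
 qed
 have G_inv: "inv z \<notin> ?U" if "z \<in> nz R" "z \<notin> ?U" for z using that higher_inv[of "inv z" 1] by (auto simp: nz_inv_inv)
 have un: "z \<in> UU" if "z \<in> nz R" "v z = 0" for z using that units_iff by blast
 consider (P) "v x > 0" | (M) "v x < 0" | (O) "x \<in> ?U" | (G) "v x = 0" "x \<notin> ?U" by linarith
 then show ?thesis
 proof cases
  case P
  note T1 = b_wild[OF g x less_imp_neq[OF P, symmetric]]
  have AU: "A \<in> ?U" and vA: "v A = 0" using U_compl[OF x P] v_compl_pos[OF x P] by (simp_all add: A_def)
  consider (P2) "v y > 0" | (M2) "v y < 0" | (O2) "y \<in> ?U" | (G2) "v y = 0" "y \<notin> ?U" by linarith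
  then show ?thesis
  proof cases
   case P2
   have BU: "B \<in> ?U" using U_compl[OF y(1) P2] by (simp add: B_def)
   have qU: "q \<in> ?U" unfolding q_quot by (rule higher_mult[OF AU higher_inv[OF BU]])
   show ?thesis
   proof (cases "v p = 0")
    case False
    then show ?thesis using T1 x P2 g y p q gg hu_v[OF qU] vpq by (intro null5[OF T1 b_wild b_wild b_wild b_one_unit[OF gg(2) qU]]) auto
   next
    case True
    \<comment> \<open>A and q lie in \<open>U1\<close>, so the third and fourth terms agree.\<close>
    have "b ((g *. x) *. A) (p *. q) - b (g *. x) p \<in> N" using gg p True qU AU by (intro b_unit_mult2 un) auto
    moreover have "g *. x *. A = g *. (x *. A)" using c by (simp add: m_assoc)
    ultimately have d: "b (g *. (x *. A)) (p *. q) - b (g *. x) p \<in> N" by simp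
    have T2: "b g y \<in> N" using P2 g y by (intro b_wild) auto
    show ?thesis by (rule five, rule N_eq[OF Nadd[OF Ndiff[OF Ndiff[OF T1 T2] d] b_one_unit[OF gg(2) qU]]]) (simp add: algebra_simps)
   qed
  next
   case M2
   have vB: "v B = v y" using v_compl_neg[OF y(1) M2] by (simp add: B_def)
   then show ?thesis using T1 M2 P g y p q gg vy vq vpq vA by (intro null5[OF T1 b_wild b_wild b_wild b_wild]) auto
  next
   case O2
   have vB: "v B > 0" using U_v[OF O2 y(2)] by (simp add: B_def)
   have "v y = 0" using hu_v[OF O2] .
   then show ?thesis using T1 O2 P g y p q gg vy vq vpq vA vB by (intro null5[OF T1 b_one_unit[OF g O2] b_wild b_wild b_wild]) auto
  next
   case G2
   have vB: "v B = 0" using G_v[OF y(1) G2] by (simp add: B_def)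
   have uB: "B \<in> UU" "inv B \<in> UU" using un[OF B vB] units_inv by auto
   have qe: "q = inv B *. A" using q_quot c by (simp add: m_comm)
   \<comment> \<open>A lies in \<open>U1\<close>, so the last term is [1/B]. By complement and
     inversion [y] is [1/B] as well, and the two cancel.\<close>
   have T5: "b (g *. A) q - b g (inv B) \<in> N" unfolding qe by (rule b_unit_mult2[OF g uB(2) AU AU])
   have T2: "b g y + b (-. g) B \<in> N" using bE[OF g un[OF y(1) G2(1)] G2(2)] by (simp add: B_def)
   have K: "b (-. g) B + b g (inv B) \<in> N" using bK[OF gg(4) uB(1)] c by simp
   have T3: "b (g *. x) p \<in> N" "b (g *. (x *. A)) (p *. q) \<in> N" using gg p q vy vpq vq vA vB P G2(1) by (auto intro!: b_wild)
   show ?thesis by (rule five, rule N_eq[OF Nadd[OF Nadd[OF Ndiff[OF Nadd[OF T1 T3(1)] T3(2)] T5] Ndiff[OF K T2]]])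
     (simp add: algebra_simps)
  qed
 next
  case M
  have T1: "b g x \<in> N" using M g x by (intro b_wild) auto
  have vA: "v A = v x" using v_compl_neg[OF x M] by (simp add: A_def)
  have CU: "C \<in> ?U" using U_compl_inv[OF x M] by (simp add: C_def)
  consider (P2) "v y > 0" | (M2) "v y < 0" | (O2) "y \<in> ?U" | (G2) "v y = 0" "y \<notin> ?U" by linarith
  then show ?thesis
  proof cases
   case P2
   have vB: "v B = 0" using v_compl_pos[OF y(1) P2] by (simp add: B_def)
   then show ?thesis using T1 x M P2 g y p q gg vy vq vpq vA by (intro null5[OF T1 b_wild b_wild b_wild b_wild]) auto
  next
   case M2
   have vB: "v B = v y" using v_compl_neg[OF y(1) M2] by (simp add: B_def)
   have DU: "D \<in> ?U" using U_compl_inv[OF y(1) M2] by (simp add: D_def)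
   have pqU: "p *. q \<in> ?U" unfolding pq_quot by (rule higher_mult[OF CU higher_inv[OF DU]])
   show ?thesis
   proof (cases "v p = 0")
    case False
    then show ?thesis using T1 M2 g y p q gg pqU vy vq vA vB by (intro null5[OF T1 b_wild b_wild b_one_unit[OF gg(3) pqU] b_wild]) auto
   next
    case True
    have ip: "inv p \<in> UU" using un[OF p True] units_inv by blast
    have "inv p *. (p *. q) = (inv p *. p) *. q" using c by (simp add: m_assoc)
    then have qe: "q = inv p *. (p *. q)" using c p by (simp add: nz_l_inv)
    \<comment> \<open>C and p q lie in \<open>U1\<close>, so the last term becomes <-x>[1/p], which
      cancels <x>[p] by inversion.\<close>
    have gA: "g *. A = -. (g *. x) *. C" unfolding A_eq using c by (simp add: l_minus r_minus m_ac)
    have "b (-. (g *. x) *. C) (inv p *. (p *. q)) - b (-. (g *. x)) (inv p) \<in> N" by (rule b_unit_mult2[OF _ ip pqU CU]) (use gg in simp)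
    then have T5: "b (g *. A) q - b (-. (g *. x)) (inv p) \<in> N" using gA qe by simp
    have T2: "b g y \<in> N" using M2 g y by (intro b_wild) auto
    show ?thesis by (rule five, rule N_eq[OF Nadd[OF Ndiff[OF Nadd[OF Ndiff[OF T1 T2] bK[OF gg(1) un[OF p True]]] b_one_unit[OF gg(3) pqU]] T5]])
      (simp add: algebra_simps)
   qed
  next
   case O2
   have vB: "v B > 0" using U_v[OF O2 y(2)] by (simp add: B_def)
   have "v y = 0" using hu_v[OF O2] .
   then show ?thesis using T1 M g y p q gg vy vq vpq vA vB by (intro null5[OF T1 b_one_unit[OF g O2] b_wild b_wild b_wild]) auto
  next
   case G2
   have vB: "v B = 0" using G_v[OF y(1) G2] by (simp add: B_def)
   have uy: "inv y \<in> UU" using un[OF y(1) G2(1)] units_inv by blast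
   have vD: "v D = 0" using vBy vB G2 by simp
   have uD: "D \<in> UU" "inv D \<in> UU" using un[OF D vD] units_inv by auto
   have T35: "b (g *. x) p \<in> N" "b (g *. A) q \<in> N" using gg p q vy vpq vq vA vB M G2(1) by (auto intro!: b_wild)
   \<comment> \<open>By inversion, complement and inversion again, [y] is -<-1>[1/D]; this cancels
     the fourth term.\<close>
   have "b (-. g *. C) (inv D *. C) - b (-. g) (inv D) \<in> N" by (rule b_unit_mult2[OF gg(4) uD(2) CU CU])
   moreover have "b (g *. (x *. A)) (p *. q) = b (-. g *. C) (inv D *. C)"
    unfolding gxA pq_quot using bsq[of "-. g *. C" x] gg(4) C x c by (simp add: m_comm)
   ultimately have T4: "b (g *. (x *. A)) (p *. q) - b (-. g) (inv D) \<in> N" by simp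
   have E: "b (-. g) (inv y) + b g D \<in> N" using bE[OF gg(4) uy G_inv[OF y(1) G2(2)]] c by (simp add: D_def)
   have K: "b g y + b (-. g) (inv y) \<in> N" "b g D + b (-. g) (inv D) \<in> N" using bK[OF g un[OF y(1) G2(1)]] bK[OF g uD(1)] by auto
   show ?thesis by (rule five, rule N_eq[OF Nadd[OF Ndiff[OF Ndiff[OF Nadd[OF T1 T35(1)] T4] Ndiff[OF K(1) Ndiff[OF E K(2)]]] T35(2)]])
     (simp add: algebra_simps)
  qed
 next
  case O
  have T1: "b g x \<in> N" by (rule b_one_unit[OF g O])
  have vx: "v x = 0" by (rule hu_v[OF O])
  have vA: "v A > 0" using U_v[OF O x1] by (simp add: A_def)
  consider (P2) "v y > 0" | (M2) "v y < 0" | (O2) "y \<in> ?U" | (G2) "v y = 0" "y \<notin> ?U" by linarith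
  then show ?thesis
  proof cases
   case P2
   have vB: "v B = 0" using v_compl_pos[OF y(1) P2] by (simp add: B_def)
   then show ?thesis using T1 P2 g y p q gg vx vy vq vpq vA by (intro null5[OF T1 b_wild b_wild b_wild b_wild]) auto
  next
   case M2
   have vB: "v B = v y" using v_compl_neg[OF y(1) M2] by (simp add: B_def)
   then show ?thesis using T1 M2 g y p q gg vx vy vq vpq vA by (intro null5[OF T1 b_wild b_wild b_wild b_wild]) auto
  next
   case O2
   have pU: "p \<in> ?U" unfolding p_quot by (rule higher_mult[OF O2 higher_inv[OF O]])
   have T2: "b g y \<in> N" by (rule b_one_unit[OF g O2])
   have T3: "b (g *. x) p \<in> N" by (rule b_one_unit[OF gg(1) pU])
   show ?thesis
   proof (cases "v q = 0")
    case False
    then show ?thesis using g y p q gg hu_v[OF pU] vpq by (intro null5[OF T1 T2 T3 b_wild b_wild]) auto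
   next
    case True
    have e: "g *. (x *. A) = (g *. A) *. x" "p *. q = q *. p" using c by (simp_all add: m_ac)
    \<comment> \<open>x and p lie in \<open>U1\<close>, so the fourth and fifth terms agree.\<close>
    have T4: "b (g *. (x *. A)) (p *. q) - b (g *. A) q \<in> N" unfolding e by (rule b_unit_mult2[OF gg(2) un[OF q True] pU O])
    show ?thesis by (rule five, rule N_eq[OF Ndiff[OF Nadd[OF Ndiff[OF T1 T2] T3] T4]]) (simp add: algebra_simps)
   qed
  next
   case G2
   have vB: "v B = 0" using G_v[OF y(1) G2] by (simp add: B_def)
   have T3: "b (g *. x) p - b g y \<in> N" unfolding p_quot by (rule b_unit_mult2[OF g un[OF y(1) G2(1)] higher_inv[OF O] O])
   have T45: "b (g *. (x *. A)) (p *. q) \<in> N" "b (g *. A) q \<in> N" using gg p q vx vy vpq vq vA vB G2(1) by (auto intro!: b_wild)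
   show ?thesis by (rule five, rule N_eq[OF Nadd[OF Ndiff[OF Nadd[OF T1 T3] T45(1)] T45(2)]]) (simp add: algebra_simps)
  qed
 next
  case G
  have ux: "x \<in> UU" "inv x \<in> UU" using un[OF x G(1)] units_inv by auto
  have vA: "v A = 0" using G_v[OF x G] by (simp add: A_def)
  have uA: "A \<in> UU" by (rule un[OF A vA])
  have E1: "b g x + b (-. g) A \<in> N" using bE[OF g ux(1) G(2)] by (simp add: A_def)
  have K1: "b g x + b (-. g) (inv x) \<in> N" by (rule bK[OF g ux(1)])
  consider (P2) "v y > 0" | (M2) "v y < 0" | (O2) "y \<in> ?U" | (G2) "v y = 0" "y \<notin> ?U" by linarith
  then show ?thesis
  proof cases
   case P2
   have BU: "B \<in> ?U" using U_compl[OF y(1) P2] by (simp add: B_def)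
   have vB: "v B = 0" by (rule hu_v[OF BU])
   have T: "b g y \<in> N" "b (g *. x) p \<in> N" "b (g *. (x *. A)) (p *. q) \<in> N"
    using g y gg p q G vy vpq vq vA vB P2 by (auto intro!: b_wild)
   \<comment> \<open>B lies in \<open>U1\<close>, so the last term is <A>[A]. The twist relation
     makes it <-1>[A], which is -[x] by the complement relation.\<close>
   have T5: "b (g *. A) q - b (g *. A) A \<in> N" unfolding q_quot by (rule b_unit_mult[OF gg(2) uA higher_inv[OF BU]])
   show ?thesis by (rule five, rule N_eq[OF Nadd[OF Nadd[OF Ndiff[OF Nadd[OF Ndiff[OF E1 T(1)] T(2)] T(3)] T5] bL[OF g uA]]])
     (simp add: algebra_simps)
  next
   case M2
   have vB: "v B = v y" using v_compl_neg[OF y(1) M2] by (simp add: B_def)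
   have DU: "D \<in> ?U" using U_compl_inv[OF y(1) M2] by (simp add: D_def)
   have vC: "v C = 0" using vAx vA G by simp
   have uC: "C \<in> UU" by (rule un[OF C vC])
   have T: "b g y \<in> N" "b (g *. x) p \<in> N" "b (g *. A) q \<in> N" using g y gg p q G vy vpq vq vA vB M2 by (auto intro!: b_wild)
   have "b (-. g *. C) (C *. inv D) - b (-. g *. C) C \<in> N" by (rule b_unit_mult[OF _ uC higher_inv[OF DU]]) (use gg(4) C in simp)
   moreover have "b (g *. (x *. A)) (p *. q) = b (-. g *. C) (C *. inv D)" unfolding gxA pq_quot using bsq[of "-. g *. C" x] gg(4) C x by simp
   ultimately have T4: "b (g *. (x *. A)) (p *. q) - b (-. g *. C) C \<in> N" by simp
   \<comment> \<open>The fourth term is [C] by the twist relation, and [x] is [C] by inversion and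
     complement.\<close>
   have L: "b (-. g *. C) C - b g C \<in> N" using bL[OF gg(4) uC] c by simp
   have E: "b (-. g) (inv x) + b g C \<in> N" using bE[OF gg(4) ux(2) G_inv[OF x G(2)]] c by (simp add: C_def)
   show ?thesis by (rule five, rule N_eq[OF Nadd[OF Ndiff[OF Ndiff[OF Nadd[OF Ndiff[OF Ndiff[OF K1 E] T(1)] T(2)] T4] L] T(3)]])
     (simp add: algebra_simps)
  next
   case O2
   have vB: "v B > 0" using U_v[OF O2 y(2)] by (simp add: B_def)
   have vp: "v p = 0" using vy hu_v[OF O2] G by simp
   have T2: "b g y \<in> N" by (rule b_one_unit[OF g O2])
   have T45: "b (g *. (x *. A)) (p *. q) \<in> N" "b (g *. A) q \<in> N" using gg p q vp vpq vq vA vB by (auto intro!: b_wild)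
   have pe: "p = inv x *. y" using p_quot c by (simp add: m_comm)
   \<comment> \<open>y lies in \<open>U1\<close>, so p is 1/x up to \<open>U1\<close>. The twist
     relation makes <x>[1/x] equal to <-1>[1/x], which is -[x].\<close>
   have T3: "b (g *. x) p - b (g *. x) (inv x) \<in> N" unfolding pe by (rule b_unit_mult[OF gg(1) ux(2) O2])
   have "b ((g *. (x *. x)) *. inv x) (inv x) - b (-. (g *. (x *. x))) (inv x) \<in> N" by (rule bL[OF _ ux(2)]) (use g x in simp)
   moreover have "(g *. (x *. x)) *. inv x = (g *. x) *. (x *. inv x)" "-. (g *. (x *. x)) = (-. g) *. (x *. x)"
    using c by (simp add: m_ac, simp add: l_minus)
   ultimately have L: "b (g *. x) (inv x) - b (-. g) (inv x) \<in> N" using c x gg(4) by (simp add: nz_r_inv bsq)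
   show ?thesis by (rule five, rule N_eq[OF Nadd[OF Ndiff[OF Nadd[OF Nadd[OF Ndiff[OF K1 T2] L] T3] T45(1)] T45(2)]])
     (simp add: algebra_simps)
  next
   case G2
   have vB: "v B = 0" using G_v[OF y(1) G2] by (simp add: B_def)
   have "v p = 0" "v q = 0" using vy vq vA vB G G2 by auto
   then show ?thesis using bft[OF g ux(1) un[OF p] un[OF q] G(2) _ rel] G2 by (simp add: y_def)
  qed
 qed
qed

end

context valued_field
begin

definition spec_symb :: "'a => ('a, 'a set rpb) ind"
 where "spec_symb a = (if v a = 0 then ind_one (RPb k) (symb k (red R v a)) else \<zero>\<^sub>(Ind R v (RPb k)))"

lemma spec_module: "module (RF R) (Ind R v (RPb k))" by (rule ind_module[OF K.RPb_module])

lemma spec_symb_unit: "u \<in> UU ==> spec_symb u = ind_one (RPb k) (symb k (red R v u))" by (simp add: spec_symb_def units_v)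

lemma spec_symb_closed: "a \<in> nz R ==> spec_symb a \<in> carrier (Ind R v (RPb k))"
proof -
 assume a: "a \<in> nz R"
 interpret W: module "RF R" "Ind R v (RPb k)" by (rule spec_module)
 show ?thesis using a ind_one_closed[OF K.RPb_module K.symb_closed[OF red_nz]] by (auto simp: spec_symb_def units_iff)
qed

lemma ind_one_zero: "module (RF k) M ==> ind_one M \<zero>\<^sub>M = \<zero>\<^sub>(Ind R v M)"
 by (rule add_map_zero[OF module_abelian_group module_abelian_group[OF ind_module] ind_one_add_map])

lemma spec_symb_one_unit:
 assumes u: "u \<in> U1"
 shows "spec_symb u = \<zero>\<^sub>(Ind R v (RPb k))"
proof -
 have "red R v u = \<one>\<^sub>k" using red_eq_one_iff[OF higher_in_units[OF u]] u by blast
 then show ?thesis using ind_one_zero[OF K.RPb_module] by (simp add: spec_symb_unit[OF higher_in_units[OF u]] K.symb_one)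
qed

lemma residue_symbols_spec:
 assumes h: "!!t. h t \<in> carrier (Ind R v (RPb k))" "!!s t. h (s + t) = h s +.\<^sub>(Ind R v (RPb k)) h t"
  "!!s t. h (s - t) = h s -.\<^sub>(Ind R v (RPb k)) h t" "!!t. h (- t) = -.\<^sub>(Ind R v (RPb k)) h t" "h 0 = \<zero>\<^sub>(Ind R v (RPb k))"
  "!!g x. g \<in> nz R ==> x \<in> nz R ==> h (bsym g x) = sq R g \<odot>\<^sub>(Ind R v (RPb k)) spec_symb x"
 shows "residue_symbols R v bsym {t. h t = \<zero>\<^sub>(Ind R v (RPb k))}"
proof -
 let ?M = "RPb k" and ?W = "Ind R v (RPb k)"
 interpret W: module "RF R" ?W by (rule spec_module)
 interpret M: module "RF k" ?M by (rule K.RPb_module)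
 note M = K.RPb_module
 note i1 = ind_one_closed[OF M] add_map_add[OF ind_one_add_map[OF M]]
  add_map_minus[OF M.abelian_group_axioms W.abelian_group_axioms ind_one_add_map[OF M]] ind_one_sq[OF M] ind_one_zero[OF M]
 have hu: "u \<in> U1 ==> u \<in> UU \<and> u \<in> nz R \<and> red R v u = \<one>\<^sub>k" for u
  using higher_in_units red_eq_one_iff units_nz by blast
 have sub: "s -.\<^sub>?W t = \<zero>\<^sub>?W" if "s = t" "t \<in> carrier ?W" for s t using that by (simp add: a_minus_def[of ?W] W.M.r_neg)
 \<comment> \<open>The class of a unit crosses the tensor sign and becomes the class of its
   reduction.\<close>
 have tw: "sq R (g *. u) \<odot>\<^sub>?W ind_one ?M m = sq R g \<odot>\<^sub>?W ind_one ?M (sq k (red R v u) \<odot>\<^sub>?M m)"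
  if "g \<in> nz R" "u \<in> UU" "m \<in> carrier ?M" for g u m
  using that sq_smult_sq[OF spec_module that(1) units_nz[OF that(2)], of "ind_one ?M m"] by (simp add: i1(1,4))
 have ng: "sq R (-. g) \<odot>\<^sub>?W ind_one ?M m = sq R g \<odot>\<^sub>?W ind_one ?M (sq k (-.\<^sub>k \<one>\<^sub>k) \<odot>\<^sub>?M m)"
  if "g \<in> nz R" "m \<in> carrier ?M" for g m using tw[OF that(1) units_neg[OF units_one] that(2)] that(1) by (simp add: r_minus red_minus_one)
 show ?thesis
 proof
  show "0 \<in> {t. h t = \<zero>\<^sub>?W}" by (simp add: h(5))
  show "s + t \<in> {t. h t = \<zero>\<^sub>?W}" if "s \<in> {t. h t = \<zero>\<^sub>?W}" "t \<in> {t. h t = \<zero>\<^sub>?W}" for s t using that by (simp add: h(2))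
  show "- t \<in> {t. h t = \<zero>\<^sub>?W}" if "t \<in> {t. h t = \<zero>\<^sub>?W}" for t
   using that W.M.minus_equality[of "\<zero>\<^sub>?W" "\<zero>\<^sub>?W"] by (simp add: h(4))
  show "bsym (g *. (s *. s)) x = bsym g x" if "g \<in> nz R" "s \<in> nz R" for g s x by (rule bsym_sq[OF that])
  show "bsym g a \<in> {t. h t = \<zero>\<^sub>?W}" if "g \<in> nz R" "a \<in> nz R" "v a ~= 0" for g a using that by (simp add: h(6) spec_symb_def)
  show "bsym g u \<in> {t. h t = \<zero>\<^sub>?W}" if "g \<in> nz R" "u \<in> U1" for g u using that hu by (simp add: h(6) spec_symb_one_unit)
  show "bsym g (x *. u) - bsym g x \<in> {t. h t = \<zero>\<^sub>?W}" if "g \<in> nz R" "x \<in> UU" "u \<in> U1" for g x u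
   using that hu[OF that(3)] units_nz[OF that(2)] red_nz[OF that(2)] units_mult[OF that(2), of u]
   by (simp add: h(3,6) spec_symb_unit red_mult sub spec_symb_closed i1(1))
  show "bsym (g *. u) x - bsym g x \<in> {t. h t = \<zero>\<^sub>?W}" if "g \<in> nz R" "x \<in> nz R" "u \<in> U1" for g x u
  proof (cases "v x = 0")
   case True
   then have x: "x \<in> UU" using that(2) units_iff by blast
   have "sq R (g *. u) \<odot>\<^sub>?W spec_symb x = sq R g \<odot>\<^sub>?W spec_symb x"
    using tw[OF that(1), of u "symb k (red R v x)"] hu[OF that(3)] red_nz[OF x] K.sq_one_smult[OF M] by (simp add: spec_symb_unit[OF x])
   then show ?thesis using that hu[OF that(3)] by (simp add: h(3,6) sub spec_symb_closed)
  next
   case False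
   then show ?thesis using that hu[OF that(3)] by (simp add: h(3,6) spec_symb_def sub)
  qed
  show "bsym g x + bsym (-. g) (inv x) \<in> {t. h t = \<zero>\<^sub>?W}" if "g \<in> nz R" "x \<in> UU" for g x
  proof -
   let ?m = "symb k (red R v x)" and ?n = "symb k (inv\<^bsub>k\<^esub> (red R v x))"
   have c: "?m \<in> carrier ?M" "?n \<in> carrier ?M" "sq k (-.\<^sub>k \<one>\<^sub>k) \<odot>\<^sub>?M ?n \<in> carrier ?M" using red_nz[OF that(2)] K.m_one_nz by simp_all
   have "h (bsym g x + bsym (-. g) (inv x)) = sq R g \<odot>\<^sub>?W ind_one ?M (?m +.\<^sub>?M sq k (-.\<^sub>k \<one>\<^sub>k) \<odot>\<^sub>?M ?n)"
    using that units_nz[OF that(2)] c by (simp add: h(2,6) spec_symb_unit units_inv red_inv ng i1(1,2) W.smult_r_distr)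
   then show ?thesis using K.symb_rel(1)[OF red_nz[OF that(2)]] that(1) by (simp add: i1(5))
  qed
  show "bsym g x + bsym (-. g) (\<one> -. x) \<in> {t. h t = \<zero>\<^sub>?W}" if "g \<in> nz R" "x \<in> UU" "x \<notin> U1" for g x
  proof -
   have A: "\<one> -. x \<in> UU" "x ~= \<one>" using that units_nz[OF that(2)] units_v[OF that(2)] not_higher_one[of x] by (auto simp: units_iff)
   have r: "red R v x ~= \<one>\<^sub>k" using that red_eq_one_iff by blast
   let ?m = "symb k (red R v x)" and ?n = "symb k (\<one>\<^sub>k -.\<^sub>k red R v x)"
   have c: "?m \<in> carrier ?M" "?n \<in> carrier ?M" "sq k (-.\<^sub>k \<one>\<^sub>k) \<odot>\<^sub>?M ?n \<in> carrier ?M" using r red_nz[OF that(2)] K.m_one_nz by simp_all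
   have "h (bsym g x + bsym (-. g) (\<one> -. x)) = sq R g \<odot>\<^sub>?W ind_one ?M (?m +.\<^sub>?M sq k (-.\<^sub>k \<one>\<^sub>k) \<odot>\<^sub>?M ?n)"
    using that(1) A units_nz[OF that(2)] c units_nz[OF A(1)] spec_symb_unit[OF A(1)] spec_symb_unit[OF that(2)] red_compl[OF units_ge[OF that(2)]]
    by (simp add: h(2,6) ng i1(1,2) W.smult_r_distr)
   then show ?thesis using K.symb_rel(2)[OF red_nz[OF that(2)] r] that(1) by (simp add: i1(5))
  qed
  show "bsym (g *. x) x - bsym (-. g) x \<in> {t. h t = \<zero>\<^sub>?W}" if "g \<in> nz R" "x \<in> UU" for g x
  proof -
   let ?m = "symb k (red R v x)"
   have c: "?m \<in> carrier ?M" using red_nz[OF that(2)] by simp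
   have "sq R (g *. x) \<odot>\<^sub>?W ind_one ?M ?m = sq R (-. g) \<odot>\<^sub>?W ind_one ?M ?m"
    using tw[OF that c] ng[OF that(1) c] K.symb_rel(3)[OF red_nz[OF that(2)]] by simp
   then show ?thesis using that(1) units_nz[OF that(2)] c by (simp add: h(3,6) spec_symb_unit[OF that(2)] sub i1(1))
  qed
  fix g x p q
  assume g: "g \<in> nz R" and u: "x \<in> UU" "p \<in> UU" "q \<in> UU"
   and ne: "x \<notin> U1" "x *. p \<notin> U1" and rel: "\<one> -. x = q *. (\<one> -. x *. p)"
  have nz: "x \<in> nz R" "p \<in> nz R" "q \<in> nz R" using u units_nz by auto
  have xp: "x *. p \<in> UU" by (rule units_mult[OF u(1,2)])
  have pq: "p *. q \<in> UU" by (rule units_mult[OF u(2,3)])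
  have A: "\<one> -. x \<in> UU" using nz units_v[OF u(1)] not_higher_one[of x] ne(1) by (auto simp: units_iff)
  have B: "\<one> -. x *. p \<in> UU" using nz units_v[OF xp] not_higher_one[of "x *. p"] ne(2) by (auto simp: units_iff)
  have xA: "x *. (\<one> -. x) \<in> UU" by (rule units_mult[OF u(1) A])
  let ?x = "red R v x" and ?p = "red R v p" and ?q = "red R v q"
  have r: "?x \<in> nz k" "?p \<in> nz k" "?q \<in> nz k" using u red_nz by auto
  have rx: "?x ~= \<one>\<^sub>k" "?x *.\<^sub>k ?p ~= \<one>\<^sub>k" using red_eq_one_iff[OF u(1)] red_eq_one_iff[OF xp] ne red_mult[OF u(1,2)] by auto
  have rA: "red R v (\<one> -. x) = \<one>\<^sub>k -.\<^sub>k ?x" using red_compl units_ge[OF u(1)] by blast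
  have rxA: "red R v (x *. (\<one> -. x)) = ?x *.\<^sub>k (\<one>\<^sub>k -.\<^sub>k ?x)" using red_mult[OF u(1) A] rA by simp
  have "\<one>\<^sub>k -.\<^sub>k ?x = ?q *.\<^sub>k (\<one>\<^sub>k -.\<^sub>k ?x *.\<^sub>k ?p)"
   using red_mult[OF u(3) B] rel rA red_compl[OF units_ge[OF xp]] red_mult[OF u(1,2)] by simp
  then have five: "symb k ?x -.\<^sub>?M symb k (?x *.\<^sub>k ?p) +.\<^sub>?M sq k ?x \<odot>\<^sub>?M symb k ?p
    -.\<^sub>?M sq k (?x *.\<^sub>k (\<one>\<^sub>k -.\<^sub>k ?x)) \<odot>\<^sub>?M symb k (?p *.\<^sub>k ?q) +.\<^sub>?M sq k (\<one>\<^sub>k -.\<^sub>k ?x) \<odot>\<^sub>?M symb k ?q = \<zero>\<^sub>?M" (is "?five = _")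
   using K.five_rel_RPb r rx unfolding K.five_rel_def by blast
  have cl: "symb k ?x \<in> carrier ?M" "symb k (?x *.\<^sub>k ?p) \<in> carrier ?M" "symb k ?p \<in> carrier ?M" "symb k (?p *.\<^sub>k ?q) \<in> carrier ?M"
   "symb k ?q \<in> carrier ?M" "sq k ?x \<in> carrier (RF k)" "sq k (?x *.\<^sub>k (\<one>\<^sub>k -.\<^sub>k ?x)) \<in> carrier (RF k)" "sq k (\<one>\<^sub>k -.\<^sub>k ?x) \<in> carrier (RF k)"
   using r rx by simp_all
  have "h (bsym g x - bsym g (x *. p) + bsym (g *. x) p - bsym (g *. (x *. (\<one> -. x))) (p *. q) + bsym (g *. (\<one> -. x)) q) =
   sq R g \<odot>\<^sub>?W ind_one ?M ?five" using g nz units_nz[OF A] units_nz[OF xA] units_nz[OF xp] units_nz[OF pq] cl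
    tw[OF g u(1) cl(3)] tw[OF g xA cl(4)] tw[OF g A cl(5)]
   by (simp add: h(2,3,6) spec_symb_unit u xp pq red_mult rA[symmetric] A i1(1-3) W.smult_r_distr W.smult_r_minus a_minus_def[of ?W])
  then show "bsym g x - bsym g (x *. p) + bsym (g *. x) p - bsym (g *. (x *. (\<one> -. x))) (p *. q) + bsym (g *. (\<one> -. x)) q \<in> {t. h t = \<zero>\<^sub>?W}"
   using five g by (simp add: i1(5))
 qed
qed

text \<open>The relations of \<open>spec_symb\<close> give existence through
  \<open>RPb_lift\<close>, and generation by symbols gives uniqueness, so the definite description
  in \<open>S_map\<close> is proper.\<close>

lemma S_map_spec:
 shows "S_map R v \<in> mod_hom (RF R) (RPb R) (Ind R v (RPb k))"
  and "!!a. a \<in> nz R ==> S_map R v (symb R a) = spec_symb a"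
proof -
 let ?W = "Ind R v (RPb k)"
 interpret W: module "RF R" ?W by (rule spec_module)
 obtain h where "sym_eval ?W spec_symb h" using sym_eval_ex[of ?W spec_symb, OF spec_module spec_symb_closed] by blast
 note h = sym_evalD[OF this]
 interpret S: residue_symbols R v bsym "{t. h t = \<zero>\<^sub>?W}" by (rule residue_symbols_spec[OF h])
 have one: "sq R \<one> \<odot>\<^sub>?W spec_symb x = spec_symb x" if "x \<in> nz R" for x
  using sq_one_smult[OF spec_module] that spec_symb_closed by simp
 have five: "five_rel ?W spec_symb" unfolding five_rel_def
 proof (intro ballI impI)
  fix x p q assume a: "x \<in> nz R" "p \<in> nz R" "q \<in> nz R" "x ~= \<one>" "x *. p ~= \<one>" "\<one> -. x = q *. (\<one> -. x *. p)"
  then show "spec_symb x -.\<^sub>?W spec_symb (x *. p) +.\<^sub>?W sq R x \<odot>\<^sub>?W spec_symb p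
    -.\<^sub>?W sq R (x *. (\<one> -. x)) \<odot>\<^sub>?W spec_symb (p *. q) +.\<^sub>?W sq R (\<one> -. x) \<odot>\<^sub>?W spec_symb q = \<zero>\<^sub>?W"
   using S.five_term_residue[OF nz_one a] by (simp add: h(2,3,6) one)
 qed
 have Kr: "spec_symb x +.\<^sub>?W sq R (-. \<one>) \<odot>\<^sub>?W spec_symb (inv x) = \<zero>\<^sub>?W" if x: "x \<in> nz R" for x
 proof (cases "v x = 0")
  case True
  then show ?thesis using S.bK[OF nz_one, of x] x by (simp add: units_iff h(2,6) one)
 next
  case False
  then show ?thesis using x by (simp add: spec_symb_def v_inv)
 qed
 \<comment> \<open>If x is not a unit or lies in \<open>U1\<close>, then both symbols vanish
   separately.\<close>
 have Er: "spec_symb x +.\<^sub>?W sq R (-. \<one>) \<odot>\<^sub>?W spec_symb (\<one> -. x) = \<zero>\<^sub>?W" if x: "x \<in> nz R" "x ~= \<one>" for x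
 proof -
  consider (P) "v x > 0" | (M) "v x < 0" | (O) "x \<in> U1" | (G) "v x = 0" "x \<notin> U1" by linarith
  then show ?thesis
  proof cases
   case P
   then show ?thesis using compl_higher[OF x(1), of 1] spec_symb_one_unit by (simp add: spec_symb_def[of x])
  next
   case M
   then show ?thesis using v_compl_neg[OF x(1)] by (simp add: spec_symb_def)
  next
   case O
   then have "v (\<one> -. x) > 0" using x by (auto simp: higher_units_iff)
   then show ?thesis using spec_symb_one_unit[OF O] by (simp add: spec_symb_def)
  next
   case G
   then show ?thesis using S.bE[OF nz_one, of x] x by (simp add: units_iff h(2,6) one)
  qed
 qed
 obtain f where f: "f \<in> mod_hom (RF R) (RPb R) ?W" "!!a. a \<in> nz R ==> f (symb R a) = spec_symb a"
  by (rule RPb_lift[OF spec_module spec_symb_closed spec_symb_one_unit[OF one_higher] five Kr Er])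
   (assumption+, rule that, assumption, blast)
 have eq: "(if v a = 0 then ind_tensor R v (RPb k) \<one>\<^sub>(RF R) (symb k (red R v a)) else \<zero>\<^sub>?W) = spec_symb a" for a
  by (simp add: spec_symb_def ind_one_def)
 have "\<exists>!f. f \<in> mod_hom (RF R) (RPb R) ?W \<and> (\<forall>a\<in>carrier R - {\<zero>}. f (symb R a) = spec_symb a)"
 proof (rule ex1I[of _ f])
  fix f' assume f': "f' \<in> mod_hom (RF R) (RPb R) ?W \<and> (\<forall>a\<in>carrier R - {\<zero>}. f' (symb R a) = spec_symb a)"
  show "f' = f" by (rule RPb_hom_eq[OF spec_module conjunct1[OF f'] f(1)]) (use f' f(2) in \<open>simp add: nz_def\<close>)
 qed (use f in \<open>simp add: nz_def\<close>)
 from theI'[OF this] have s: "S_map R v \<in> mod_hom (RF R) (RPb R) ?W \<and> (\<forall>a\<in>carrier R - {\<zero>}. S_map R v (symb R a) = spec_symb a)"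
  unfolding S_map_def Let_def eq .
 then show "S_map R v \<in> mod_hom (RF R) (RPb R) ?W" by blast
 show "S_map R v (symb R a) = spec_symb a" if "a \<in> nz R" for a using s that by (simp add: nz_def)
qed

end

section \<open>2-primary torsion and the action of the class of -1\<close>

lemma two_torsion_hom:
 assumes "module R M" "module R N" "f \<in> mod_hom R M N" "x \<in> two_torsion M"
 shows "f x \<in> two_torsion N"
proof -
 have fd: "f (dbl M y) = dbl N (f y)" if "y \<in> carrier M" for y using that by (simp add: dbl_def mod_hom_add[OF assms(3)])
 have p: "y \<in> carrier M ==> (dbl N ^^ n) (f y) = f ((dbl M ^^ n) y)" for n y
 proof (induction n arbitrary: y)
  case (Suc n)
  then show ?case using dbl_pow_facts(1)[OF assms(1), of y n] by (simp add: fd)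
 qed simp
 obtain n where "x \<in> carrier M" "(dbl M ^^ n) x = \<zero>\<^sub>M" using assms(4) by (auto simp: two_torsion_def)
 then show ?thesis using p[of x n] mod_hom_zero[OF assms(1-3)] mod_hom_closed[OF assms(3), of x] by (auto simp: two_torsion_def)
qed

lemma half_minus_eq:
 assumes "module R M" "x \<in> carrier M" "y \<in> carrier M" "x -.\<^sub>M y \<in> two_torsion M" "q \<in> carrier Z_half"
 shows "half_tensor M x q = half_tensor M y q"
proof -
 interpret H: module R "half M" by (rule half_module[OF assms(1)])
 have "half_tensor M x q -.\<^sub>(half M) half_tensor M y q = half_tensor M (x -.\<^sub>M y) q"
  using add_map_minus[OF module_abelian_group[OF assms(1)] H.abelian_group_axioms half_tensor_add_map(1)[OF assms(1,5)] assms(2,3)] by simp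
 then have "half_tensor M x q -.\<^sub>(half M) half_tensor M y q = \<zero>\<^sub>(half M)" by (simp add: half_tensor_two_torsion[OF assms(1,4,5)])
 then show ?thesis by (rule abelian_minus_eq_zero[OF H.abelian_group_axioms half_tensor_closed[OF assms(1,2,5)] half_tensor_closed[OF assms(1,3,5)]])
qed

context field
begin

lemma incl_add_map: "add_map (RPb1 R) (RPb R) (\<lambda>x. x)" by (rule add_mapI) (simp_all add: RPb1_carrier_subset RPb1_simps)

lemma minus_one_torsion:
 assumes "x \<in> carrier (RPb1 R)"
 shows "x -.\<^sub>(RPb1 R) sq R (-. \<one>) \<odot>\<^sub>(RPb1 R) x \<in> two_torsion (RPb1 R)"
proof -
 interpret M: module "RF R" "RPb1 R" by (rule RPb1_module)
 have d: "dbl (RPb1 R) = dbl (RPb R)" by (simp add: dbl_def[abs_def] RPb1_simps)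
 have c: "sq R (-. \<one>) \<odot>\<^sub>(RPb1 R) x \<in> carrier (RPb1 R)" using assms m_one_nz by simp
 have "x -.\<^sub>(RPb1 R) sq R (-. \<one>) \<odot>\<^sub>(RPb1 R) x = x -.\<^sub>(RPb R) sq R (-. \<one>) \<odot>\<^sub>(RPb R) x"
  using add_map_minus[OF M.abelian_group_axioms module_abelian_group[OF RPb_module] incl_add_map assms c] by (simp add: RPb1_simps)
 moreover have "x -.\<^sub>(RPb1 R) sq R (-. \<one>) \<odot>\<^sub>(RPb1 R) x \<in> carrier (RPb1 R)" using c assms by simp
 moreover obtain n where "(dbl (RPb R) ^^ n) (x -.\<^sub>(RPb R) sq R (-. \<one>) \<odot>\<^sub>(RPb R) x) = \<zero>\<^sub>(RPb R)"
  using minus_part_RPb1[OF assms] unfolding two_torsion_def by blast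
 ultimately show ?thesis unfolding two_torsion_def d RPb1_simps(2) by force
qed

lemma minus_one_half:
 assumes M: "module (RF R) M" and t: "!!x. x \<in> carrier M ==> x -.\<^sub>M sq R (-. \<one>) \<odot>\<^sub>M x \<in> two_torsion M"
  and z: "z \<in> carrier (half M)"
 shows "sq R (-. \<one>) \<odot>\<^sub>(half M) z = z"
proof -
 interpret M: module "RF R" M by fact
 interpret H: module "RF R" "half M" by (rule half_module[OF M])
 have s: "sq R (-. \<one>) \<in> carrier (RF R)" using m_one_nz by simp
 from M z show ?thesis
 proof (induction z rule: half_induct)
  case zero
  then show ?case using s by simp
 next
  case (tensor x q)
  then show ?case using half_minus_eq[OF M tensor(1) _ t[OF tensor(1)] tensor(2), symmetric] s by (simp add: half_tensor_smult[OF M])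
 next
  case (add a b)
  then show ?case using s by (simp add: H.smult_r_distr)
 qed
qed

text \<open>The operator 1 + <-1>. It maps \<open>RPb\<close> into \<open>RPb1\<close>, and on
  \<open>RPb1\<close> it is doubling up to 2-primary torsion.\<close>

definition plus_part :: "('a sqr, 'x, 'n) module_scheme => 'x => 'x"
 where "plus_part M z = z +.\<^sub>M sq R (-. \<one>) \<odot>\<^sub>M z"

lemma plus_part_closed: "module (RF R) M ==> z \<in> carrier M ==> plus_part M z \<in> carrier M"
proof -
 assume M: "module (RF R) M" and z: "z \<in> carrier M"
 interpret module "RF R" M by fact
 show ?thesis using z m_one_nz by (simp add: plus_part_def)
qed

lemma plus_part_hom: "f \<in> mod_hom (RF R) M N ==> module (RF R) M ==> z \<in> carrier M ==> f (plus_part M z) = plus_part N (f z)"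
 using m_one_nz module.smult_closed[of "RF R" M "sq R (-. \<one>)" z] by (simp add: plus_part_def mod_hom_add mod_hom_smult)

lemma plus_part_add:
 assumes "module (RF R) M" "x \<in> carrier M" "y \<in> carrier M"
 shows "plus_part M (x +.\<^sub>M y) = plus_part M x +.\<^sub>M plus_part M y"
proof -
 interpret module "RF R" M by fact
 have "sq R (-. \<one>) \<in> carrier (RF R)" using m_one_nz by simp
 then show ?thesis using assms(2,3) by (simp add: plus_part_def smult_r_distr M.a_ac)
qed

lemma plus_part_smult:
 assumes "module (RF R) M" "r \<in> carrier (RF R)" "x \<in> carrier M"
 shows "plus_part M (r \<odot>\<^sub>M x) = r \<odot>\<^sub>M plus_part M x"
proof -
 interpret module "RF R" M by fact
 have s: "sq R (-. \<one>) \<in> carrier (RF R)" using m_one_nz by simp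
 then have "sq R (-. \<one>) \<odot>\<^sub>M (r \<odot>\<^sub>M x) = r \<odot>\<^sub>M (sq R (-. \<one>) \<odot>\<^sub>M x)"
  using assms(2,3) by (simp add: smult_assoc1[symmetric] R.m_comm)
 then show ?thesis using assms(2,3) s by (simp add: plus_part_def smult_r_distr)
qed

lemma plus_part_RPb1_add_map: "add_map (RPb R) (RPb1 R) (plus_part (RPb R))" using plus_part_add[OF RPb_module] plus_part_RPb1
 by (intro add_mapI) (simp_all add: RPb1_simps plus_part_def)

lemma plus_part_half:
 assumes "module (RF R) M" "z \<in> carrier (half M)" "sq R (-. \<one>) \<odot>\<^sub>(half M) z = z"
 shows "plus_part (half M) z = dbl (half M) z" using assms(3) by (simp add: plus_part_def dbl_def)

lemma half_tensor_plus_part: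
 assumes M: "module (RF R) M" and t: "x \<in> carrier M" "x -.\<^sub>M sq R (-. \<one>) \<odot>\<^sub>M x \<in> two_torsion M" and q: "q \<in> carrier Z_half"
 shows "half_tensor M (plus_part M x) q = half_tensor M x (q + q)"
proof -
 interpret M: module "RF R" M by fact
 have s: "sq R (-. \<one>) \<odot>\<^sub>M x \<in> carrier M" using t m_one_nz by simp
 show ?thesis unfolding plus_part_def half_tensor_add_left[OF M t(1) s q] half_tensor_add_right[OF M t(1) q q]
  by (simp only: half_minus_eq[OF M t(1) s t(2) q])
qed

section \<open>Multiples by the augmentation ideal\<close>

abbreviation "ideal_span M \<equiv> submod_gen (RF R) M {a \<odot>\<^sub>M m | a m. a \<in> IF R \<and> m \<in> carrier M}"

lemma ideal_span_submodule:
 assumes "module (RF R) M"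
 shows "submodule (ideal_span M) (RF R) M"
proof -
 interpret module "RF R" M by fact
 show ?thesis by (rule submodule_submod_gen[OF assms]) (use IF_closed in auto)
qed

lemma ideal_span_incl: "a \<in> IF R ==> m \<in> carrier M ==> a \<odot>\<^sub>M m \<in> ideal_span M" by (rule subsetD[OF submod_gen_incl]) blast

lemma ideal_span_hom:
 assumes "module (RF R) M" "module (RF R) N" "f \<in> mod_hom (RF R) M N" "z \<in> ideal_span M"
 shows "f z \<in> ideal_span N"
proof -
 have "{a \<odot>\<^sub>M m | a m. a \<in> IF R \<and> m \<in> carrier M} \<subseteq> {x \<in> carrier M. f x \<in> ideal_span N}"
 proof
  fix x assume "x \<in> {a \<odot>\<^sub>M m | a m. a \<in> IF R \<and> m \<in> carrier M}"
  then obtain a m where x: "x = a \<odot>\<^sub>M m" "a \<in> IF R" "m \<in> carrier M" by blast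
  have "f x = a \<odot>\<^sub>N f m" using mod_hom_smult[OF assms(3) IF_closed[OF x(2)] x(3)] x(1) by simp
  then show "x \<in> {x \<in> carrier M. f x \<in> ideal_span N}"
   using x ideal_span_incl[OF x(2) mod_hom_closed[OF assms(3) x(3)]] module.smult_closed[OF assms(1) IF_closed[OF x(2)] x(3)] by simp
 qed
 from submod_gen_least[OF submodule_preimage[OF assms(1-3) ideal_span_submodule[OF assms(2)]] this] assms(4)
 show ?thesis by blast
qed

lemma ideal_smult_simps: "carrier (ideal_smult (RF R) (IF R) M) = ideal_span M"
 "ring.add (ideal_smult (RF R) (IF R) M) = ring.add M" "smult (ideal_smult (RF R) (IF R) M) = smult M" by (simp_all add: ideal_smult_def)

lemma dsq_dsq_smult:
 assumes "module (RF R) M" "g \<in> nz R" "x \<in> carrier M"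
 shows "dsq R g \<odot>\<^sub>M (dsq R g \<odot>\<^sub>M x) = -.\<^sub>M dbl M (dsq R g \<odot>\<^sub>M x)"
proof -
 interpret M: module "RF R" M by fact
 have "sq R g \<odot>\<^sub>M (sq R g \<odot>\<^sub>M x) = x"
  using sq_smult_sq[OF assms(1,2,2,3)] sq_sq[of \<one> g] assms sq_one_smult[OF assms(1,3)] by simp
 then show ?thesis using assms(2,3)
  by (simp add: dsq_smult[OF assms(1)] a_minus_def[of M] M.smult_r_distr M.smult_r_minus dbl_def M.M.minus_add M.M.a_ac)
qed

text \<open>An element killed by the augmentation ideal and lying in \<open>I M\<close> vanishes modulo every
 saturated submodule on which the square classes act by signs.\<close>

lemma ideal_span_annihilated:
 assumes A: "module (RF R) A" and z: "z \<in> ideal_span (half A)"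
  and ann: "!!g. g \<in> nz R ==> dsq R g \<odot>\<^sub>(half A) z = \<zero>\<^sub>(half A)"
 shows "z = \<zero>\<^sub>(half A)"
proof (rule ccontr)
 note H = half_module[OF A]
 interpret H: module "RF R" "half A" by (rule H)
 have zc: "z \<in> carrier (half A)" using z H.submoduleE(1)[OF ideal_span_submodule[OF H]] by blast
 assume "z ~= \<zero>\<^sub>(half A)"
 then have "z \<notin> two_torsion (half A)" using half_two_torsion[OF A] by simp
 from sign_submodule[OF H zc this] obtain N where N: "submodule N (RF R) (half A)" "saturated (half A) N" "z \<notin> N"
  "!!g x. g \<in> nz R ==> x \<in> carrier (half A) ==> \<not> acts_trivially (half A) N g ==> sq R g \<odot>\<^sub>(half A) x +.\<^sub>(half A) x \<in> N"
  by this blast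
 note E = H.submoduleE[OF N(1)]
 have N0: "\<zero>\<^sub>(half A) \<in> N" using additive_subgroup.zero_closed[OF submodule_additive[OF N(1)]] .
 show False
 proof (cases "\<forall>g\<in>nz R. acts_trivially (half A) N g")
  case True
  have "a \<odot>\<^sub>(half A) m \<in> N" if "a \<in> IF R" "m \<in> carrier (half A)" for a m using that
  proof (induction a rule: IF_induct)
   case zero
   then show ?case using N0 H.smult_l_null by (simp add: RF_simps)
  next
   case (gen g)
   then show ?case using True by (simp add: dsq_smult[OF H] acts_trivially_def)
  next
   case (diff a b)
   have "(a - b) \<odot>\<^sub>(half A) m = a \<odot>\<^sub>(half A) m +.\<^sub>(half A) (-.\<^sub>(half A) (b \<odot>\<^sub>(half A) m))"
    using group_ring_diff_smult[OF H[unfolded RF_def], folded RF_def, OF IF_closed[OF diff(1)] IF_closed[OF diff(2)], of m] diff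
    by (simp add: a_minus_def)
   then show ?case using E(5)[OF diff(3) E(3)[OF diff(4)]] diff by simp
  qed
  then have "{a \<odot>\<^sub>(half A) m | a m. a \<in> IF R \<and> m \<in> carrier (half A)} \<subseteq> N" by blast
  then show False using submod_gen_least[OF N(1)] z N(3) by blast
 next
  case False
  then obtain g where g: "g \<in> nz R" "\<not> acts_trivially (half A) N g" by blast
  \<comment> \<open>g fixes z but acts as -1 modulo N, so 2z lies in N.\<close>
  have "sq R g \<odot>\<^sub>(half A) z = z" by (rule abelian_minus_eq_zero[OF H.abelian_group_axioms])
    (use ann[OF g(1)] g(1) zc in \<open>simp_all add: dsq_smult[OF H]\<close>)
  then have "dbl (half A) z \<in> N" using N(4)[OF g(1) zc g(2)] by (simp add: dbl_def)
  then show False using N(2,3) zc unfolding saturated_def by blast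
 qed
qed

text \<open>Since \<open>\<langle>\<langle>g\<rangle>\<rangle>\<langle>\<langle>g\<rangle>\<rangle> = -2\<langle>\<langle>g\<rangle>\<rangle>\<close>, inverses up to \<open>2\<langle>\<langle>g\<rangle>\<rangle>\<close> for all \<open>g\<close> give an isomorphism
 after multiplication by the augmentation ideal.\<close>

lemma ideal_span_iso:
 assumes A: "module (RF R) A" and B: "module (RF R) B" and G: "G \<in> mod_hom (RF R) (half A) (half B)"
  and T: "!!g. g \<in> nz R ==> \<exists>T\<in>mod_hom (RF R) (half B) (half A).
   (\<forall>z\<in>carrier (half A). T (G z) = dbl (half A) (dsq R g \<odot>\<^sub>(half A) z)) \<and>
   (\<forall>y\<in>carrier (half B). G (T y) = dbl (half B) (dsq R g \<odot>\<^sub>(half B) y))"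
 shows "restrict G (carrier (ideal_smult (RF R) (IF R) (half A)))
  \<in> mod_iso (RF R) (ideal_smult (RF R) (IF R) (half A)) (ideal_smult (RF R) (IF R) (half B))"
proof -
 note HA = half_module[OF A] and HB = half_module[OF B]
 interpret HA: module "RF R" "half A" by (rule HA)
 interpret HB: module "RF R" "half B" by (rule HB)
 note SA = ideal_span_submodule[OF HA] and SB = ideal_span_submodule[OF HB]
 have cA: "z \<in> ideal_span (half A) ==> z \<in> carrier (half A)" for z using HA.submoduleE(1)[OF SA] by blast
 have GS: "z \<in> ideal_span (half A) ==> G z \<in> ideal_span (half B)" for z by (rule ideal_span_hom[OF HA HB G])
 have hom: "restrict G (ideal_span (half A)) \<in> mod_hom (RF R) (ideal_smult (RF R) (IF R) (half A)) (ideal_smult (RF R) (IF R) (half B))"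
 proof (rule mod_homI)
  show "add_map (ideal_smult (RF R) (IF R) (half A)) (ideal_smult (RF R) (IF R) (half B)) (restrict G (ideal_span (half A)))"
   by (rule add_mapI) (simp_all add: ideal_smult_simps GS HA.submoduleE(5)[OF SA] mod_hom_add[OF G] cA)
 qed (simp_all add: ideal_smult_simps HA.submoduleE(4)[OF SA] mod_hom_smult[OF G] cA)
 \<comment> \<open>G z = 0 gives \<open>2 <<g>> z = T (G z) = 0\<close> for every g, so z is killed
   by the whole augmentation ideal.\<close>
 have ker: "z = \<zero>\<^sub>(half A)" if z: "z \<in> ideal_span (half A)" "G z = \<zero>\<^sub>(half B)" for z
 proof (rule ideal_span_annihilated[OF A z(1)])
  fix g assume g: "g \<in> nz R"
  obtain T where T: "T \<in> mod_hom (RF R) (half B) (half A)" "\<forall>z\<in>carrier (half A). T (G z) = dbl (half A) (dsq R g \<odot>\<^sub>(half A) z)"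
   using T[OF g] by blast
  have w: "dsq R g \<odot>\<^sub>(half A) z \<in> carrier (half A)" using cA[OF z(1)] g by simp
  have "dbl (half A) (dsq R g \<odot>\<^sub>(half A) z) = \<zero>\<^sub>(half A)" using T(2) cA[OF z(1)] z(2) mod_hom_zero[OF HB HA T(1)] by metis
  then have "dbl (half A) (dsq R g \<odot>\<^sub>(half A) z) = dbl (half A) \<zero>\<^sub>(half A)" by (simp add: dbl_def)
  then show "dsq R g \<odot>\<^sub>(half A) z = \<zero>\<^sub>(half A)" by (rule half_dbl_inj[OF A w HA.zero_closed])
 qed
 have inj: "inj_on G (ideal_span (half A))"
 proof (rule inj_onI)
  fix y z assume y: "y \<in> ideal_span (half A)" and z: "z \<in> ideal_span (half A)" and eq: "G y = G z"
  have d: "y -.\<^sub>(half A) z \<in> ideal_span (half A)" using HA.submoduleE(5)[OF SA y HA.submoduleE(3)[OF SA z]] by (simp add: a_minus_def)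
  have "G (y -.\<^sub>(half A) z) = \<zero>\<^sub>(half B)" using mod_hom_minus[OF HA HB G cA[OF y] cA[OF z]] eq mod_hom_closed[OF G cA[OF z]]
   by (simp add: a_minus_def[of "half B"] HB.M.r_neg)
  from ker[OF d this] show "y = z" by (rule abelian_minus_eq_zero[OF HA.abelian_group_axioms, rotated -1]) (use cA y z in auto)
 qed
 have surj: "ideal_span (half B) \<subseteq> G ` ideal_span (half A)"
 proof (rule submod_gen_least)
  show GI: "submodule (G ` ideal_span (half A)) (RF R) (half B)" by (rule submodule_image[OF HA HB G SA])
  have "a \<odot>\<^sub>(half B) m \<in> G ` ideal_span (half A)" if "a \<in> IF R" "m \<in> carrier (half B)" for a m using that
  proof (induction a rule: IF_induct)
   case zero
   then show ?case using additive_subgroup.zero_closed[OF submodule_additive[OF GI]] HB.smult_l_null by (simp add: RF_simps)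
  next
   case (diff a b)
   have "(a - b) \<odot>\<^sub>(half B) m = a \<odot>\<^sub>(half B) m +.\<^sub>(half B) (-.\<^sub>(half B) (b \<odot>\<^sub>(half B) m))"
    using group_ring_diff_smult[OF HB[unfolded RF_def], folded RF_def, OF IF_closed[OF diff(1)] IF_closed[OF diff(2)], of m] diff
    by (simp add: a_minus_def)
   then show ?case using HB.submoduleE(5)[OF GI diff(3) HB.submoduleE(3)[OF GI diff(4)]] diff by simp
  next
   case (gen g)
   obtain T where T: "T \<in> mod_hom (RF R) (half B) (half A)" "\<forall>y\<in>carrier (half B). G (T y) = dbl (half B) (dsq R g \<odot>\<^sub>(half B) y)"
    using T[OF gen(1)] by blast
   obtain \<delta> where \<delta>0: "\<delta> \<in> mod_hom (RF R) (half B) (half B)"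
    "\<forall>z\<in>carrier (half B). dbl (half B) (\<delta> z) = z \<and> \<delta> (dbl (half B) z) = z" using half_halving[OF B] by (rule bexE)
   have \<delta>: "\<delta> \<in> mod_hom (RF R) (half B) (half B)" "z \<in> carrier (half B) ==> dbl (half B) (\<delta> z) = z" for z
    using \<delta>0 by simp_all
   have gc: "dsq R g \<in> carrier (RF R)" using gen by simp
   \<comment> \<open>n is -m/4: applying G after T multiplies by \<open>2 <<g>>\<close>, and
     \<open>2 <<g>><<g>> n\<close> is \<open>-4 <<g>> n\<close>.\<close>
   define n where "n = -.\<^sub>(half B) (\<delta> (\<delta> m))"
   have dm: "\<delta> m \<in> carrier (half B)" "\<delta> (\<delta> m) \<in> carrier (half B)" using mod_hom_closed[OF \<delta>(1)] gen by auto
   then have n: "n \<in> carrier (half B)" by (simp add: n_def)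
   have gn: "dsq R g \<odot>\<^sub>(half B) n \<in> carrier (half B)" using gc n by simp
   have "T (dsq R g \<odot>\<^sub>(half B) n) \<in> ideal_span (half A)"
    by (rule ideal_span_hom[OF HB HA T(1) ideal_span_incl[OF dsq_IF[OF gen(1)] n]])
   moreover have "G (T (dsq R g \<odot>\<^sub>(half B) n)) = dsq R g \<odot>\<^sub>(half B) m"
   proof -
    have d: "dbl (half B) (dsq R g \<odot>\<^sub>(half B) y) = dsq R g \<odot>\<^sub>(half B) dbl (half B) y" if "y \<in> carrier (half B)" for y
     using that gc by (simp add: dbl_def HB.smult_r_distr)
    have dn: "dbl (half B) (-.\<^sub>(half B) y) = -.\<^sub>(half B) (dbl (half B) y)" if "y \<in> carrier (half B)" for y
     using that by (simp add: dbl_def HB.M.minus_add)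
    have dc: "dbl (half B) y \<in> carrier (half B)" if "y \<in> carrier (half B)" for y using that by (simp add: dbl_def)
    have "G (T (dsq R g \<odot>\<^sub>(half B) n)) = dbl (half B) (-.\<^sub>(half B) dbl (half B) (dsq R g \<odot>\<^sub>(half B) n))"
     using T(2) gn dsq_dsq_smult[OF HB gen(1) n] by simp
    also have "\<dots> = dsq R g \<odot>\<^sub>(half B) (-.\<^sub>(half B) (dbl (half B) (dbl (half B) n)))"
     using n gc gn dc by (simp add: d dn HB.smult_r_minus)
    also have "-.\<^sub>(half B) (dbl (half B) (dbl (half B) n)) = m" using dm \<delta>(2) gen dc by (simp add: n_def dn)
    finally show ?thesis .
   qed
   ultimately show ?case by force
  qed
  then show "{a \<odot>\<^sub>(half B) m | a m. a \<in> IF R \<and> m \<in> carrier (half B)} \<subseteq> G ` ideal_span (half A)" by blast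
 qed
 have "bij_betw (restrict G (ideal_span (half A))) (ideal_span (half A)) (ideal_span (half B))"
  unfolding bij_betw_def inj_on_restrict_eq using inj surj GS by auto
 then show ?thesis using hom unfolding mod_iso_def ideal_smult_simps by blast
qed

end

context valued_field
begin

lemma ind_induct [consumes 2, case_names zero one add]:
 assumes M: "module (RF k) M" and z: "z \<in> carrier (Ind R v M)" and "P \<zero>\<^sub>(Ind R v M)"
  and "!!s m. s \<in> carrier (RF R) ==> m \<in> carrier M ==> P (s \<odot>\<^sub>(Ind R v M) ind_one M m)"
  and "!!a b. a \<in> carrier (Ind R v M) ==> b \<in> carrier (Ind R v M) ==> P a ==> P b ==> P (a +.\<^sub>(Ind R v M) b)"
 shows "P z"
proof -
 have t: "P (ind_tensor R v M s m)" if "s \<in> carrier (RF R)" "m \<in> carrier M" for s m using assms(4)[OF that] ind_tensor_eq[OF M that] by simp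
 show ?thesis
 proof (rule tensor_product.tensor_induct[OF ind_tensor_product[OF M] z[unfolded Ind_def], of P], goal_cases)
  case 1
  show ?case by (rule assms(3)[unfolded Ind_def])
 next
  case (2 x y)
  then show ?case by (intro t[unfolded ind_tensor_def]) (simp_all add: regular_simps restrict_scalars_simps)
 next
  case (3 a b)
  then show ?case by (rule assms(5)[unfolded Ind_def])
 qed
qed

text \<open>-1 is a unit of F with reduction -1, so on \<open>ind_one M m\<close> its class acts
  through M, where the hypothesis applies.\<close>

lemma ind_minus_one_torsion:
 assumes M: "module (RF k) M" and t: "!!m. m \<in> carrier M ==> m -.\<^sub>M sq k (-.\<^sub>k \<one>\<^sub>k) \<odot>\<^sub>M m \<in> two_torsion M"
  and z: "z \<in> carrier (Ind R v M)"
 shows "z -.\<^sub>(Ind R v M) sq R (-. \<one>) \<odot>\<^sub>(Ind R v M) z \<in> two_torsion (Ind R v M)"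
proof -
 note W = ind_module[OF M]
 interpret M: module "RF k" M by fact
 interpret W: module "RF R" "Ind R v M" by (rule W)
 note E = W.submoduleE[OF submodule_two_torsion(1)[OF W]]
 have s: "sq R (-. \<one>) \<in> carrier (RF R)" using m_one_nz by simp
 have m1: "sq k (-.\<^sub>k \<one>\<^sub>k) \<in> carrier (RF k)" using K.m_one_nz by simp
 have tw: "ind_one M y \<in> two_torsion (Ind R v M)" if "y \<in> two_torsion M" for y
 proof -
  have fd: "ind_one M (dbl M y) = dbl (Ind R v M) (ind_one M y)" if "y \<in> carrier M" for y
   using that by (simp add: dbl_def add_map_add[OF ind_one_add_map[OF M]])
  have p: "y \<in> carrier M ==> (dbl (Ind R v M) ^^ n) (ind_one M y) = ind_one M ((dbl M ^^ n) y)" for n y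
  proof (induction n arbitrary: y)
   case (Suc n)
   then show ?case using dbl_pow_facts(1)[OF M, of y n] by (simp add: fd)
  qed simp
  obtain n where "y \<in> carrier M" "(dbl M ^^ n) y = \<zero>\<^sub>M" using \<open>y \<in> two_torsion M\<close> by (auto simp: two_torsion_def)
  then show ?thesis using p[of y n] ind_one_zero[OF M] ind_one_closed[OF M, of y] by (auto simp: two_torsion_def)
 qed
 from M z show ?thesis
 proof (induction z rule: ind_induct)
  case zero
  then show ?case using s E(3)[OF additive_subgroup.zero_closed[OF submodule_additive[OF submodule_two_torsion(1)[OF W]]]]
   by (simp add: a_minus_def[of "Ind R v M"])
 next
  case (one r m)
  have i: "ind_one M m \<in> carrier (Ind R v M)" by (rule ind_one_closed[OF M one(2)])
  have c: "sq k (-.\<^sub>k \<one>\<^sub>k) \<odot>\<^sub>M m \<in> carrier M" using m1 one by simp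
  have "ind_one M (m -.\<^sub>M sq k (-.\<^sub>k \<one>\<^sub>k) \<odot>\<^sub>M m) = ind_one M m -.\<^sub>(Ind R v M) sq R (-. \<one>) \<odot>\<^sub>(Ind R v M) ind_one M m"
   using add_map_minus[OF M.abelian_group_axioms W.abelian_group_axioms ind_one_add_map[OF M] one(2) c]
    ind_one_sq[OF M units_neg[OF units_one] one(2)] by (simp add: red_minus_one)
  moreover have "sq R (-. \<one>) \<odot>\<^sub>(Ind R v M) (r \<odot>\<^sub>(Ind R v M) ind_one M m) = r \<odot>\<^sub>(Ind R v M) (sq R (-. \<one>) \<odot>\<^sub>(Ind R v M) ind_one M m)"
   using s one i by (simp add: W.smult_assoc1[symmetric] W.R.m_comm)
  ultimately have "r \<odot>\<^sub>(Ind R v M) ind_one M (m -.\<^sub>M sq k (-.\<^sub>k \<one>\<^sub>k) \<odot>\<^sub>M m) =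
   r \<odot>\<^sub>(Ind R v M) ind_one M m -.\<^sub>(Ind R v M) sq R (-. \<one>) \<odot>\<^sub>(Ind R v M) (r \<odot>\<^sub>(Ind R v M) ind_one M m)"
   using one i s by (simp add: a_minus_def[of "Ind R v M"] W.smult_r_distr W.smult_r_minus)
  then show ?case using E(4)[OF one(1) tw[OF t[OF one(2)]]] by simp
 next
  case (add a b)
  have "a +.\<^sub>(Ind R v M) b -.\<^sub>(Ind R v M) sq R (-. \<one>) \<odot>\<^sub>(Ind R v M) (a +.\<^sub>(Ind R v M) b) =
   (a -.\<^sub>(Ind R v M) sq R (-. \<one>) \<odot>\<^sub>(Ind R v M) a) +.\<^sub>(Ind R v M) (b -.\<^sub>(Ind R v M) sq R (-. \<one>) \<odot>\<^sub>(Ind R v M) b)"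
   using add(1,2) s by (simp add: a_minus_def[of "Ind R v M"] W.smult_r_distr W.M.minus_add W.M.a_ac)
  then show ?case using E(5)[OF add(3,4)] by simp
 qed
qed

end

section \<open>Moving symbols into \<open>RPb1\<close> with 2 inverted\<close>

context field
begin

lemma plus_part_mod_hom:
 assumes "module (RF R) M"
 shows "restrict (plus_part M) (carrier M) \<in> mod_hom (RF R) M M"
 using plus_part_closed[OF assms] plus_part_add[OF assms] plus_part_smult[OF assms] by (intro mod_hom_restrictI[OF assms] add_mapI) auto

text \<open>Symbols need not lie in \<open>RPb1\<close>, and 1 + <-1> moves them there. On
  \<open>RPb1\<close> itself the result is twice the canonical map, by \<open>eps_RPb1\<close>, so
  nothing is lost once 2 is inverted.\<close>

definition eps :: "'a rpb => 'a rpb half"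
 where "eps m = half_tensor (RPb1 R) (plus_part (RPb R) m) 1"

lemma half_RPb1_module: "module (RF R) (half (RPb1 R))" by (rule half_module[OF RPb1_module])

lemma half_RPb1_minus_one: "z \<in> carrier (half (RPb1 R)) ==> sq R (-. \<one>) \<odot>\<^sub>(half (RPb1 R)) z = z"
 by (rule minus_one_half[OF RPb1_module minus_one_torsion])

lemma eps_add_map: "add_map (RPb R) (half (RPb1 R)) eps" unfolding eps_def[abs_def]
 by (rule add_map_comp[OF plus_part_RPb1_add_map half_tensor_add_map(1)[OF RPb1_module Z_half_one]])

lemma eps_closed [simp]: "m \<in> carrier (RPb R) ==> eps m \<in> carrier (half (RPb1 R))" by (rule add_map_closed[OF eps_add_map])

lemma eps_smult: "r \<in> carrier (RF R) ==> m \<in> carrier (RPb R) ==> eps (r \<odot>\<^sub>(RPb R) m) = r \<odot>\<^sub>(half (RPb1 R)) eps m"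
 using half_tensor_smult[OF RPb1_module _ add_map_closed[OF plus_part_RPb1_add_map] Z_half_one, of r m]
 by (simp add: eps_def plus_part_smult[OF RPb_module] RPb1_simps)

lemma eps_RPb1:
 assumes "x \<in> carrier (RPb1 R)"
 shows "eps x = dbl (half (RPb1 R)) (half_tensor (RPb1 R) x 1)"
proof -
 have "plus_part (RPb R) x = plus_part (RPb1 R) x" by (simp add: plus_part_def RPb1_simps)
 then show ?thesis using half_tensor_plus_part[OF RPb1_module assms minus_one_torsion[OF assms] Z_half_one]
   half_tensor_add_right[OF RPb1_module assms Z_half_one Z_half_one] by (simp add: eps_def dbl_def)
qed

lemma eps_plus_part: "m \<in> carrier (RPb R) ==> eps (plus_part (RPb R) m) = dbl (half (RPb1 R)) (eps m)"
proof -
 assume m: "m \<in> carrier (RPb R)"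
 interpret M: module "RF R" "RPb R" by (rule RPb_module)
 have s: "sq R (-. \<one>) \<in> carrier (RF R)" using m_one_nz by simp
 then show ?thesis using m half_RPb1_minus_one[OF eps_closed[OF m]] by (simp add: plus_part_def add_map_add[OF eps_add_map] eps_smult dbl_def)
qed

end

section \<open>The restricted specialization \<open>S1_map\<close>\<close>

context valued_field
begin

abbreviation "IM \<equiv> Ind R v (RPb k)"
abbreviation "IM1 \<equiv> Ind R v (RPb1 k)"
abbreviation "HF \<equiv> half (RPb1 R)"
abbreviation "HI \<equiv> half IM1"

definition ind_incl :: "('a, 'a set rpb) ind => ('a, 'a set rpb) ind"
 where "ind_incl = ind_map R v (RPb1 k) (RPb k) (\<lambda>x. x)"

text \<open>Once 2 is inverted, this is an inverse of \<open>ind_incl\<close> up to the factor 2. It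
  yields the injectivity of the inclusion without an appeal to flatness.\<close>

definition ind_plus :: "('a, 'a set rpb) ind => ('a, 'a set rpb) ind"
 where "ind_plus = ind_map R v (RPb k) (RPb1 k) (K.plus_part (RPb k))"

lemma IM1_module: "module (RF R) IM1" by (rule ind_module[OF K.RPb1_module])

lemma HI_module: "module (RF R) HI" by (rule half_module[OF IM1_module])

lemma ind_incl_spec:
 "ind_incl \<in> mod_hom (RF R) IM1 IM"
 "m \<in> carrier (RPb1 k) ==> ind_incl (ind_one (RPb1 k) m) = ind_one (RPb k) m" unfolding ind_incl_def
 using ind_map_spec[OF K.RPb1_module K.RPb_module K.incl_add_map] by (simp_all add: K.RPb1_simps)

lemma ind_plus_spec:
 "ind_plus \<in> mod_hom (RF R) IM IM1"
 "m \<in> carrier (RPb k) ==> ind_plus (ind_one (RPb k) m) = ind_one (RPb1 k) (K.plus_part (RPb k) m)" unfolding ind_plus_def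
 using ind_map_spec[OF K.RPb_module K.RPb1_module K.plus_part_RPb1_add_map] by (simp_all add: K.plus_part_smult[OF K.RPb_module] K.RPb1_simps)

lemma ind_one_plus_part:
 assumes M: "module (RF k) M" and m: "m \<in> carrier M"
 shows "ind_one M (K.plus_part M m) = plus_part (Ind R v M) (ind_one M m)"
proof -
 interpret M: module "RF k" M by fact
 have "sq k (-.\<^sub>k \<one>\<^sub>k) \<odot>\<^sub>M m \<in> carrier M" using K.m_one_nz m by simp
 then show ?thesis using m ind_one_sq[OF M units_neg[OF units_one] m]
  by (simp add: K.plus_part_def plus_part_def add_map_add[OF ind_one_add_map[OF M]] red_minus_one)
qed

lemma ind_incl_plus: "w \<in> carrier IM ==> ind_incl (ind_plus w) = plus_part IM w"
proof -
 assume w: "w \<in> carrier IM"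
 note c = mod_hom_comp[OF spec_module ind_plus_spec(1) ind_incl_spec(1)]
 have "restrict (\<lambda>w. ind_incl (ind_plus w)) (carrier IM) = restrict (plus_part IM) (carrier IM)"
 proof (rule ind_hom_eq[OF K.RPb_module spec_module c plus_part_mod_hom[OF spec_module]])
  fix m assume m: "m \<in> carrier (RPb k)"
  then show "restrict (\<lambda>w. ind_incl (ind_plus w)) (carrier IM) (ind_one (RPb k) m) = restrict (plus_part IM) (carrier IM) (ind_one (RPb k) m)"
   using ind_one_closed[OF K.RPb_module m] add_map_closed[OF K.plus_part_RPb1_add_map m]
   by (simp add: ind_plus_spec(2) ind_incl_spec(2) ind_one_plus_part[OF K.RPb_module])
 qed
 from fun_cong[OF this, of w] w show ?thesis by simp
qed

lemma ind_plus_incl: "w \<in> carrier IM1 ==> ind_plus (ind_incl w) = plus_part IM1 w"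
proof -
 assume w: "w \<in> carrier IM1"
 note c = mod_hom_comp[OF IM1_module ind_incl_spec(1) ind_plus_spec(1)]
 have "restrict (\<lambda>w. ind_plus (ind_incl w)) (carrier IM1) = restrict (plus_part IM1) (carrier IM1)"
 proof (rule ind_hom_eq[OF K.RPb1_module IM1_module c plus_part_mod_hom[OF IM1_module]])
  fix m assume m: "m \<in> carrier (RPb1 k)"
  have "K.plus_part (RPb k) m = K.plus_part (RPb1 k) m" by (simp add: K.plus_part_def K.RPb1_simps)
  then show "restrict (\<lambda>w. ind_plus (ind_incl w)) (carrier IM1) (ind_one (RPb1 k) m) = restrict (plus_part IM1) (carrier IM1) (ind_one (RPb1 k) m)"
   using ind_one_closed[OF K.RPb1_module m] m K.RPb1_carrier_subset[OF m]
   by (simp add: ind_plus_spec(2) ind_incl_spec(2) ind_one_plus_part[OF K.RPb1_module])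
 qed
 from fun_cong[OF this, of w] w show ?thesis by simp
qed

lemma IM1_minus_one: "w \<in> carrier IM1 ==> w -.\<^sub>IM1 sq R (-. \<one>) \<odot>\<^sub>IM1 w \<in> two_torsion IM1"
 by (rule ind_minus_one_torsion[OF K.RPb1_module K.minus_one_torsion])

lemma HI_minus_one: "y \<in> carrier HI ==> sq R (-. \<one>) \<odot>\<^sub>HI y = y" by (rule minus_one_half[OF IM1_module IM1_minus_one])

text \<open>The factor 1/2 undoes the doubling by 1 + <-1>: since <-1> fixes S(x) up to 2-primary
  torsion, (1 + <-1>)S(x) (x) 1/2 equals S(x) (x) 1. The formula defines a map that makes the square
  commute, and injectivity of the inclusion makes it the only one.\<close>

lemma S1_map_spec:
 shows "S1_map R v \<in> mod_hom (RF R) HF HI"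
  and "!!x. x \<in> carrier (RPb1 R) ==> S1_map R v (half_tensor (RPb1 R) x 1) = half_tensor IM1 (ind_plus (S_map R v x)) (1 / 2)"
proof -
 let ?S = "S_map R v"
 note S = S_map_spec(1) and M1 = RPb1_module
 let ?jk = "half_map (RF R) IM1 IM ind_incl" and ?Sh = "half_map (RF R) (RPb R) IM ?S"
  and ?jF = "half_map (RF R) (RPb1 R) (RPb R) (\<lambda>x. x)" and ?r = "half_map (RF R) IM IM1 ind_plus"
 have jk: "?jk \<in> mod_hom (RF R) HI (half IM)"
  "!!x q. x \<in> carrier IM1 ==> q \<in> carrier Z_half ==> ?jk (half_tensor IM1 x q) = half_tensor IM (ind_incl x) q"
  using half_map_spec[OF IM1_module spec_module mod_hom_add_map[OF ind_incl_spec(1)] mod_hom_smult[OF ind_incl_spec(1)]] by blast+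
 have r: "?r \<in> mod_hom (RF R) (half IM) HI"
  "!!x q. x \<in> carrier IM ==> q \<in> carrier Z_half ==> ?r (half_tensor IM x q) = half_tensor IM1 (ind_plus x) q"
  using half_map_spec[OF spec_module IM1_module mod_hom_add_map[OF ind_plus_spec(1)] mod_hom_smult[OF ind_plus_spec(1)]] by blast+
 have Sh: "?Sh \<in> mod_hom (RF R) (half (RPb R)) (half IM)"
  "!!x q. x \<in> carrier (RPb R) ==> q \<in> carrier Z_half ==> ?Sh (half_tensor (RPb R) x q) = half_tensor IM (?S x) q"
  using half_map_spec[OF RPb_module spec_module mod_hom_add_map[OF S] mod_hom_smult[OF S]] by blast+
 have jF: "?jF \<in> mod_hom (RF R) HF (half (RPb R))"
  "!!x q. x \<in> carrier (RPb1 R) ==> q \<in> carrier Z_half ==> ?jF (half_tensor (RPb1 R) x q) = half_tensor (RPb R) x q"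
  using half_map_spec[OF M1 RPb_module incl_add_map] by (simp_all add: RPb1_simps)
 have Sc: "?S x \<in> carrier IM" if "x \<in> carrier (RPb1 R)" for x by (rule mod_hom_closed[OF S RPb1_carrier_subset[OF that]])
 have "add_map (RPb1 R) IM ?S" by (rule add_mapI) (simp_all add: Sc RPb1_simps mod_hom_add[OF S] RPb1_carrier_subset)
 then have \<theta>: "add_map (RPb1 R) HI (\<lambda>x. half_tensor IM1 (ind_plus (?S x)) (1 / 2))"
  by (intro add_map_comp[OF _ half_tensor_add_map(1)[OF IM1_module Z_half_half], where f = "\<lambda>x. ind_plus (?S x)"]
    add_map_comp[OF _ mod_hom_add_map[OF ind_plus_spec(1)]])
 obtain G where G: "G \<in> mod_hom (RF R) HF HI"
  "!!x. x \<in> carrier (RPb1 R) ==> G (half_tensor (RPb1 R) x 1) = half_tensor IM1 (ind_plus (?S x)) (1 / 2)"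
 proof (rule half_extend[OF M1 IM1_module \<theta>])
  fix s x assume s: "s \<in> carrier (RF R)" and x: "x \<in> carrier (RPb1 R)"
  show "half_tensor IM1 (ind_plus (?S (s \<odot>\<^sub>(RPb1 R) x))) (1 / 2) = s \<odot>\<^sub>HI half_tensor IM1 (ind_plus (?S x)) (1 / 2)"
   using s x Sc[OF x] mod_hom_closed[OF ind_plus_spec(1) Sc[OF x]]
   by (simp add: RPb1_simps mod_hom_smult[OF S] RPb1_carrier_subset mod_hom_smult[OF ind_plus_spec(1)]
     half_tensor_smult[OF IM1_module _ _ Z_half_half])
 qed (rule that, assumption, blast)
 have sq1: "?jk (G z) = ?Sh (?jF z)" if z: "z \<in> carrier HF" for z
 proof -
  have "restrict (\<lambda>z. ?jk (G z)) (carrier HF) = restrict (\<lambda>z. ?Sh (?jF z)) (carrier HF)"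
  proof (rule half_mod_hom_eq1[OF M1 spec_module mod_hom_comp[OF half_module[OF M1] G(1) jk(1)] mod_hom_comp[OF half_module[OF M1] jF(1) Sh(1)]])
   fix x assume x: "x \<in> carrier (RPb1 R)"
   note xc = RPb1_carrier_subset[OF x]
   interpret M: module "RF R" "RPb R" by (rule RPb_module)
   interpret I: module "RF R" IM by (rule spec_module)
   have s: "sq R (-. \<one>) \<in> carrier (RF R)" using m_one_nz by simp
   have "?S (x -.\<^sub>(RPb R) sq R (-. \<one>) \<odot>\<^sub>(RPb R) x) = ?S x -.\<^sub>IM sq R (-. \<one>) \<odot>\<^sub>IM ?S x"
    using mod_hom_minus[OF RPb_module spec_module S xc M.smult_closed[OF s xc]] mod_hom_smult[OF S s xc] by simp
   then have t: "?S x -.\<^sub>IM sq R (-. \<one>) \<odot>\<^sub>IM ?S x \<in> two_torsion IM"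
    using two_torsion_hom[OF RPb_module spec_module S minus_part_RPb1[OF x]] by simp
   have "half_tensor IM (ind_incl (ind_plus (?S x))) (1 / 2) = half_tensor IM (?S x) 1"
    using half_tensor_plus_part[OF spec_module Sc[OF x] t Z_half_half] ind_incl_plus[OF Sc[OF x]] by simp
   then show "restrict (\<lambda>z. ?jk (G z)) (carrier HF) (half_tensor (RPb1 R) x 1) = restrict (\<lambda>z. ?Sh (?jF z)) (carrier HF) (half_tensor (RPb1 R) x 1)"
    using half_tensor_closed[OF M1 x Z_half_one] x xc mod_hom_closed[OF ind_plus_spec(1) Sc[OF x]]
    by (simp add: G(2) jk(2) jF(2) Sh(2) Z_half_one Z_half_half)
  qed
  from fun_cong[OF this, of z] z show ?thesis by simp
 qed
 \<comment> \<open>A left inverse of the inclusion up to the factor 2. As doubling is injective, the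
   map sought by \<open>S1_map\<close> is unique.\<close>
 have rjk: "?r (?jk y) = dbl HI y" if y: "y \<in> carrier HI" for y
 proof -
  have "restrict (\<lambda>y. ?r (?jk y)) (carrier HI) = restrict (plus_part HI) (carrier HI)"
  proof (rule half_mod_hom_eq1[OF IM1_module IM1_module mod_hom_comp[OF HI_module jk(1) r(1)] plus_part_mod_hom[OF HI_module]])
   fix w assume w: "w \<in> carrier IM1"
   interpret I1: module "RF R" IM1 by (rule IM1_module)
   have s: "sq R (-. \<one>) \<in> carrier (RF R)" using m_one_nz by simp
   have "half_tensor IM1 (plus_part IM1 w) 1 = plus_part HI (half_tensor IM1 w 1)"
    using w s by (simp add: plus_part_def half_tensor_add_left[OF IM1_module _ _ Z_half_one] half_tensor_smult[OF IM1_module _ _ Z_half_one])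
   then show "restrict (\<lambda>y. ?r (?jk y)) (carrier HI) (half_tensor IM1 w 1) = restrict (plus_part HI) (carrier HI) (half_tensor IM1 w 1)"
    using w half_tensor_closed[OF IM1_module w Z_half_one] mod_hom_closed[OF ind_incl_spec(1) w]
    by (simp add: jk(2) r(2) Z_half_one ind_plus_incl)
  qed
  from fun_cong[OF this, of y] y have "?r (?jk y) = plus_part HI y" by simp
  then show ?thesis using plus_part_half[OF IM1_module y HI_minus_one[OF y]] by simp
 qed
 have "S1_map R v = G" unfolding S1_map_def Let_def
 proof (rule the_equality, unfold ind_incl_def[symmetric])
  show "G \<in> mod_hom (RF R) HF HI \<and> (\<forall>z\<in>carrier HF. ?jk (G z) = ?Sh (?jF z))" using G(1) sq1 by blast
  fix G' assume G': "G' \<in> mod_hom (RF R) HF HI \<and> (\<forall>z\<in>carrier HF. ?jk (G' z) = ?Sh (?jF z))"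
  show "G' = G"
  proof (rule mod_hom_eqI[OF conjunct1[OF G'] G(1)])
   fix z assume z: "z \<in> carrier HF"
   have c: "G' z \<in> carrier HI" "G z \<in> carrier HI" using mod_hom_closed[OF conjunct1[OF G'] z] mod_hom_closed[OF G(1) z] by auto
   have "?jk (G' z) = ?jk (G z)" using G' sq1 z by simp
   then have "dbl HI (G' z) = dbl HI (G z)" using rjk c by metis
   then show "G' z = G z" by (rule half_dbl_inj[OF IM1_module c])
  qed
 qed
 then show "S1_map R v \<in> mod_hom (RF R) HF HI"
  "!!x. x \<in> carrier (RPb1 R) ==> S1_map R v (half_tensor (RPb1 R) x 1) = half_tensor IM1 (ind_plus (?S x)) (1 / 2)" using G by auto
qed

text \<open>Symbols of the residue field lift to symbols of units, and its square classes act on the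
  image as classes of units do.\<close>

lemma S_map_surj: "S_map R v ` carrier (RPb R) = carrier IM"
proof
 note S = S_map_spec(1)
 let ?H = "S_map R v ` carrier (RPb R)"
 interpret M: module "RF R" "RPb R" by (rule RPb_module)
 interpret Mk: module "RF k" "RPb k" by (rule K.RPb_module)
 interpret I: module "RF R" IM by (rule spec_module)
 show "?H \<subseteq> carrier IM" using mod_hom_closed[OF S] by blast
 have H: "submodule ?H (RF R) IM" by (rule submodule_image[OF RPb_module spec_module S M.carrier_is_submodule])
 note E = I.submoduleE[OF H]
 have H0: "\<zero>\<^sub>IM \<in> ?H" using additive_subgroup.zero_closed[OF submodule_additive[OF H]] .
 have sm: "ind_one (RPb k) (r \<odot>\<^sub>(RPb k) m) \<in> ?H" if "r \<in> carrier (RF k)" "m \<in> carrier (RPb k)" "ind_one (RPb k) m \<in> ?H" for r m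
  using that
 proof (induction r rule: K.RF_induct)
  case zero
  then show ?case using H0 Mk.smult_l_null ind_one_zero[OF K.RPb_module] by (simp add: K.RF_simps)
 next
  case (gen c)
  obtain u where u: "u \<in> UU" "c = red R v u" using red_nz_surj[OF gen(1)] by blast
  then show ?case using ind_one_sq[OF K.RPb_module u(1) gen(2)] E(4)[OF sq_closed[OF units_nz[OF u(1)]] gen(3)] by simp
 next
  case (diff a b)
  have "(a - b) \<odot>\<^sub>(RPb k) m = a \<odot>\<^sub>(RPb k) m -.\<^sub>(RPb k) b \<odot>\<^sub>(RPb k) m"
   using group_ring_diff_smult[OF K.RPb_module[unfolded RF_def], folded RF_def, OF diff(1,2), of m] diff by simp
  then have "ind_one (RPb k) ((a - b) \<odot>\<^sub>(RPb k) m) = ind_one (RPb k) (a \<odot>\<^sub>(RPb k) m) +.\<^sub>IM (-.\<^sub>IM ind_one (RPb k) (b \<odot>\<^sub>(RPb k) m))"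
   using add_map_minus[OF Mk.abelian_group_axioms I.abelian_group_axioms ind_one_add_map[OF K.RPb_module],
     of "a \<odot>\<^sub>(RPb k) m" "b \<odot>\<^sub>(RPb k) m"] diff by (simp add: a_minus_def[of IM])
  then show ?case using E(5)[OF diff(3) E(3)[OF diff(4)]] diff by simp
 qed
 have img: "ind_one (RPb k) m \<in> ?H" if "m \<in> carrier (RPb k)" for m using that
 proof (induction m rule: K.RPb_induct)
  case (gen c)
  obtain u where u: "u \<in> UU" "c = red R v u" using red_nz_surj[OF gen(1)] by blast
  then have "ind_one (RPb k) (symb k c) = S_map R v (symb R u)" using S_map_spec(2)[OF units_nz[OF u(1)]] spec_symb_unit[OF u(1)] by simp
  then show ?case using symb_closed[OF units_nz[OF u(1)]] by blast
 next
  case zero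
  then show ?case using H0 ind_one_zero[OF K.RPb_module] by simp
 next
  case (add x y)
  then show ?case using E(5)[OF add(3,4)] by (simp add: add_map_add[OF ind_one_add_map[OF K.RPb_module]])
 next
  case (smult r x)
  show ?case by (rule sm[OF smult])
 qed
 show "carrier IM \<subseteq> ?H"
 proof
  fix z assume "z \<in> carrier IM"
  with K.RPb_module show "z \<in> ?H"
  proof (induction z rule: ind_induct)
   case zero
   show ?case by (rule H0)
  next
   case (one s m)
   then show ?case using E(4)[OF one(1) img[OF one(2)]] by simp
  next
   case (add a b)
   show ?case by (rule E(5)[OF add(3,4)])
  qed
 qed
qed

end

section \<open>Symbols with 2 inverted, and inverses of specialization up to
  \<open>2 <<g>>\<close>\<close>

locale tame_valued_field = valued_field +
 fixes n :: nat
 assumes n_pos: "n \<ge> 1" and higher_squares: "!!u. u \<in> higher_units R v n ==> \<exists>w\<in>U1. u = w *. w"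
begin

text \<open>The character \<chi> given by N is even, since <-1> is the identity on
  \<open>HF\<close>, and nontrivial at g. If it is nontrivial on \<open>U1\<close>, it has a
  conductor because the elements of \<open>U_n\<close> are squares, and \<open>c_zero_wild\<close>
  applies. Otherwise the lemmas for characters trivial on \<open>U1\<close> apply.\<close>

lemma sign_dichotomy:
 assumes N: "submodule N (RF R) HF" "saturated HF N" "z \<in> carrier HF" "z \<notin> N"
  "!!g x. g \<in> nz R ==> x \<in> carrier HF ==> \<not> acts_trivially HF N g ==> sq R g \<odot>\<^sub>HF x +.\<^sub>HF x \<in> N"
  and g: "g \<in> nz R" "\<not> acts_trivially HF N g"
 shows "(\<forall>a\<in>nz R. eps (symb R a) \<in> N) \<or>
  ((\<forall>u\<in>U1. acts_trivially HF N u) \<and>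
   (\<forall>a\<in>nz R. v a ~= 0 --> eps (symb R a) \<in> N) \<and>
   (\<forall>a\<in>UU. \<forall>u\<in>U1. eps (symb R (a *. u)) -.\<^sub>HF eps (symb R a) \<in> N))"
proof -
 interpret M: module "RF R" "RPb R" by (rule RPb_module)
 interpret H: module "RF R" HF by (rule half_RPb1_module)
 note E = H.submoduleE[OF N(1)]
 have N0: "\<zero>\<^sub>HF \<in> N" using additive_subgroup.zero_closed[OF submodule_additive[OF N(1)]] .
 obtain h where h0: "sym_eval (RPb R) (symb R) h" using sym_eval_ex[of "RPb R" "symb R", OF RPb_module symb_closed] by blast
 note h = sym_evalD[OF h0]
 define h' where "h' t = eps (h t)" for t
 note ea = add_map_add[OF eps_add_map] add_map_minus[OF M.abelian_group_axioms H.abelian_group_axioms eps_add_map]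
  add_map_neg[OF M.abelian_group_axioms H.abelian_group_axioms eps_add_map] add_map_zero[OF M.abelian_group_axioms H.abelian_group_axioms eps_add_map]
 have h': "h' t \<in> carrier HF" "h' (s + t) = h' s +.\<^sub>HF h' t" "h' (s - t) = h' s -.\<^sub>HF h' t" "h' (- t) = -.\<^sub>HF h' t" "h' 0 = \<zero>\<^sub>HF"
  "g \<in> nz R ==> x \<in> nz R ==> h' (bsym g x) = sq R g \<odot>\<^sub>HF eps (symb R x)" for s t g x by (simp_all add: h'_def h ea eps_smult)
 have "submodule {m \<in> carrier (RPb R). eps m \<in> N} (RF R) (RPb R)"
 proof -
  have "restrict eps (carrier (RPb R)) \<in> mod_hom (RF R) (RPb R) HF" by (rule mod_hom_restrictI[OF RPb_module eps_add_map eps_smult])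
  from submodule_preimage[OF RPb_module half_RPb1_module this N(1)] show ?thesis
   by (rule back_subst[of "\<lambda>H. submodule H (RF R) (RPb R)"]) auto
 qed
 from bloch_system_RPb[OF h submodule_additive[OF this]]
 have B: "bloch_system R bsym {t. h' t \<in> N}" by (simp add: h'_def h(1))
 interpret S: character_system R bsym "{t. h' t \<in> N}" "acts_trivially HF N"
  by (rule character_system_module[OF half_RPb1_module _ h' B N]) simp_all
 have m1: "acts_trivially HF N (-. \<one>)" using half_RPb1_minus_one N0 by (simp add: acts_trivially_def a_minus_def[of HF] H.M.r_neg)
 interpret V: valued_character_system R v bsym "{t. h' t \<in> N}" "acts_trivially HF N" by unfold_locales (use m1 g in auto)
 have c: "bsym \<one> a \<in> {t. h' t \<in> N} \<longleftrightarrow> eps (symb R a) \<in> N" if "a \<in> nz R" for a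
  using that by (simp add: h'(6) sq_one_smult[OF half_RPb1_module])
 have Pn: "acts_trivially HF N u" if u: "u \<in> higher_units R v n" for u
 proof -
  obtain w where w: "w \<in> U1" "u = w *. w" using higher_squares[OF u] by blast
  have wn: "w \<in> nz R" using w(1) by (simp add: higher_units_iff)
  then have "sq R u = sq R \<one>" using sq_sq[of \<one> w] w(2) by simp
  then show ?thesis using N0 by (simp add: acts_trivially_def sq_one_smult[OF half_RPb1_module] a_minus_def[of HF] H.M.r_neg)
 qed
 show ?thesis
 proof (cases "\<exists>u\<in>U1. \<not> acts_trivially HF N u")
  case True
  then obtain u where u: "u \<in> U1" "\<not> acts_trivially HF N u" by blast
  have "eps (symb R a) \<in> N" if "a \<in> nz R" for a using V.c_zero_wild[OF u n_pos Pn that] c[OF that] by blast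
  then show ?thesis by blast
 next
  case False
  then have U: "u \<in> U1 ==> acts_trivially HF N u" for u by blast
  have pos: "bsym \<one> a \<in> {t. h' t \<in> N}" if "a \<in> nz R" "v a > 0" for a by (rule V.c_valuation_pos[OF U that])
  have v0: "eps (symb R a) \<in> N" if "a \<in> nz R" "v a ~= 0" for a using V.c_valuation_sym(1)[OF pos that] c[OF that(1)] by blast
  have u1: "bsym \<one> u \<in> {t. h' t \<in> N}" if "u \<in> U1" for u by (rule V.c_valuation_sym(2)[OF pos that])
  have "eps (symb R (a *. u)) -.\<^sub>HF eps (symb R a) \<in> N" if a: "a \<in> UU" and u: "u \<in> U1" for a u
  proof -
   have "bsym \<one> (a *. u) - bsym \<one> a \<in> {t. h' t \<in> N}" by (rule V.c_unit_mult[OF u1 units_nz[OF a] units_v[OF a] u])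
   then show ?thesis using units_nz[OF a] units_nz[OF units_mult[OF a higher_in_units[OF u]]]
    by (simp add: h'(3,6) sq_one_smult[OF half_RPb1_module])
  qed
  then show ?thesis using U v0 by blast
 qed
qed

text \<open>An element of \<open>HF\<close> is zero once it lies in every saturated submodule on
  which the classes act by signs. The factor \<open><<g>>\<close> puts it into all those with
  \<chi>(g) = 1, and \<open>sign_dichotomy\<close> handles the others.\<close>

lemma eps_symb_facts:
 assumes g: "g \<in> nz R"
 shows "a \<in> nz R ==> u \<in> U1 ==> dsq R u \<odot>\<^sub>HF (dsq R g \<odot>\<^sub>HF eps (symb R a)) = \<zero>\<^sub>HF"
  and "a \<in> nz R ==> v a ~= 0 ==> dsq R g \<odot>\<^sub>HF eps (symb R a) = \<zero>\<^sub>HF"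
  and "a \<in> UU ==> u \<in> U1 ==> dsq R g \<odot>\<^sub>HF eps (symb R (a *. u)) = dsq R g \<odot>\<^sub>HF eps (symb R a)"
proof -
 interpret H: module "RF R" HF by (rule half_RPb1_module)
 have gc: "dsq R g \<in> carrier (RF R)" using g by simp
 have vanish: "dsq R g \<odot>\<^sub>HF z = \<zero>\<^sub>HF"
  if z: "z \<in> carrier HF" and P: "!!N. submodule N (RF R) HF ==> \<forall>a\<in>nz R. eps (symb R a) \<in> N ==> dsq R g \<odot>\<^sub>HF z \<in> N"
   "!!N. submodule N (RF R) HF ==> \<forall>u\<in>U1. acts_trivially HF N u ==>
    \<forall>a\<in>nz R. v a ~= 0 --> eps (symb R a) \<in> N ==>
    \<forall>a\<in>UU. \<forall>u\<in>U1. eps (symb R (a *. u)) -.\<^sub>HF eps (symb R a) \<in> N ==> dsq R g \<odot>\<^sub>HF z \<in> N" for z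
 proof (rule ccontr)
  let ?z = "dsq R g \<odot>\<^sub>HF z"
  have zc: "?z \<in> carrier HF" using z gc by simp
  assume "?z ~= \<zero>\<^sub>HF"
  then have "?z \<notin> two_torsion HF" using half_two_torsion[OF RPb1_module] by simp
  from sign_submodule[OF half_RPb1_module zc this] obtain N where N: "submodule N (RF R) HF" "saturated HF N" "?z \<notin> N"
   "!!g x. g \<in> nz R ==> x \<in> carrier HF ==> \<not> acts_trivially HF N g ==> sq R g \<odot>\<^sub>HF x +.\<^sub>HF x \<in> N" by this blast
  have "\<not> acts_trivially HF N g" using N(3) z g by (auto simp: acts_trivially_def dsq_smult[OF half_RPb1_module])
  from sign_dichotomy[OF N(1,2) zc N(3,4) g this] show False using P(1)[OF N(1)] P(2)[OF N(1)] N(3) by blast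
 qed
 have smN: "r \<odot>\<^sub>HF x \<in> N" if "submodule N (RF R) HF" "r \<in> carrier (RF R)" "x \<in> N" for N r x
  by (rule H.submoduleE(4)[OF that])
 have e: "eps (symb R a) \<in> carrier HF" if "a \<in> nz R" for a using that by simp
 show "dsq R u \<odot>\<^sub>HF (dsq R g \<odot>\<^sub>HF eps (symb R a)) = \<zero>\<^sub>HF" if a: "a \<in> nz R" and u: "u \<in> U1"
 proof -
  have un: "u \<in> nz R" using u by (simp add: higher_units_iff)
  have uc: "dsq R u \<in> carrier (RF R)" using un by simp
  have "dsq R u \<odot>\<^sub>HF (dsq R g \<odot>\<^sub>HF eps (symb R a)) = dsq R g \<odot>\<^sub>HF (dsq R u \<odot>\<^sub>HF eps (symb R a))"
   using uc gc e[OF a] by (simp add: H.smult_assoc1[symmetric] H.R.m_comm)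
  also have "\<dots> = \<zero>\<^sub>HF"
  proof (rule vanish)
   show "dsq R u \<odot>\<^sub>HF eps (symb R a) \<in> carrier HF" using uc e[OF a] by simp
  next
   fix N assume N: "submodule N (RF R) HF" "\<forall>a\<in>nz R. eps (symb R a) \<in> N"
   then show "dsq R g \<odot>\<^sub>HF (dsq R u \<odot>\<^sub>HF eps (symb R a)) \<in> N" using smN[OF N(1) gc smN[OF N(1) uc]] a by blast
  next
   fix N assume N: "submodule N (RF R) HF" "\<forall>u\<in>U1. acts_trivially HF N u"
   then have "dsq R u \<odot>\<^sub>HF eps (symb R a) \<in> N" using u e[OF a] un by (simp add: acts_trivially_def dsq_smult[OF half_RPb1_module])
   then show "dsq R g \<odot>\<^sub>HF (dsq R u \<odot>\<^sub>HF eps (symb R a)) \<in> N" by (rule smN[OF N(1) gc])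
  qed
  finally show ?thesis .
 qed
 show "dsq R g \<odot>\<^sub>HF eps (symb R a) = \<zero>\<^sub>HF" if a: "a \<in> nz R" "v a ~= 0"
  by (rule vanish[OF e[OF a(1)]]) (use smN gc a in blast)+
 show "dsq R g \<odot>\<^sub>HF eps (symb R (a *. u)) = dsq R g \<odot>\<^sub>HF eps (symb R a)" if a: "a \<in> UU" and u: "u \<in> U1"
 proof -
  have c: "eps (symb R (a *. u)) \<in> carrier HF" "eps (symb R a) \<in> carrier HF"
   using e units_nz[OF a] units_nz[OF units_mult[OF a higher_in_units[OF u]]] by auto
  have nz: "a \<in> nz R" "a *. u \<in> nz R" using units_nz[OF a] units_nz[OF units_mult[OF a higher_in_units[OF u]]] by auto
  have "dsq R g \<odot>\<^sub>HF (eps (symb R (a *. u)) -.\<^sub>HF eps (symb R a)) = \<zero>\<^sub>HF"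
  proof (rule vanish)
   show "eps (symb R (a *. u)) -.\<^sub>HF eps (symb R a) \<in> carrier HF" using c by simp
  next
   fix N assume N: "submodule N (RF R) HF" "\<forall>a\<in>nz R. eps (symb R a) \<in> N"
   have "eps (symb R (a *. u)) -.\<^sub>HF eps (symb R a) \<in> N" unfolding a_minus_def using N(2) nz H.submoduleE(3,5)[OF N(1)] by blast
   then show "dsq R g \<odot>\<^sub>HF (eps (symb R (a *. u)) -.\<^sub>HF eps (symb R a)) \<in> N" by (rule smN[OF N(1) gc])
  next
   fix N assume N: "submodule N (RF R) HF"
    "\<forall>a\<in>UU. \<forall>u\<in>U1. eps (symb R (a *. u)) -.\<^sub>HF eps (symb R a) \<in> N"
   then have "eps (symb R (a *. u)) -.\<^sub>HF eps (symb R a) \<in> N" using a u by blast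
   then show "dsq R g \<odot>\<^sub>HF (eps (symb R (a *. u)) -.\<^sub>HF eps (symb R a)) \<in> N" by (rule smN[OF N(1) gc])
  qed
  then have "dsq R g \<odot>\<^sub>HF eps (symb R (a *. u)) -.\<^sub>HF dsq R g \<odot>\<^sub>HF eps (symb R a) = \<zero>\<^sub>HF"
   using c gc by (simp add: a_minus_def[of HF] H.smult_r_distr H.smult_r_minus)
  then show ?thesis by (rule abelian_minus_eq_zero[OF H.abelian_group_axioms H.smult_closed[OF gc c(1)] H.smult_closed[OF gc c(2)]])
 qed
qed

end

context tame_valued_field
begin

text \<open>The elements fixed by all \<open>\<langle>u\<rangle>\<close>, \<open>u \<in> U\<^sub>1\<close>, form a module over \<open>R\<^sub>k\<close>, in which the class of the reduction of \<open>u\<close> acts as \<open>\<langle>u\<rangle>\<close>.\<close>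

lemma residue_module:
 defines "W \<equiv> {x \<in> carrier HF. \<forall>u\<in>U1. sq R u \<odot>\<^sub>HF x = x}"
 obtains sm where "module (RF k) (mk_module W (ring.add HF) \<zero>\<^sub>HF sm)"
  and "!!u x. u \<in> UU ==> x \<in> W ==> sm (sq k (red R v u)) x = sq R u \<odot>\<^sub>HF x"
proof -
 interpret H: module "RF R" HF by (rule half_RPb1_module)
 have hu: "u \<in> U1 ==> sq R u \<in> carrier (RF R)" for u by (simp add: higher_units_iff)
 have Wc: "x \<in> carrier HF" and Wf: "u \<in> U1 ==> sq R u \<odot>\<^sub>HF x = x" if "x \<in> W" for x u using that by (simp_all add: W_def)
 have WI: "x \<in> W" if "x \<in> carrier HF" "!!u. u \<in> U1 ==> sq R u \<odot>\<^sub>HF x = x" for x using that by (simp add: W_def)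
 have Wadd: "x +.\<^sub>HF y \<in> W" if "x \<in> W" "y \<in> W" for x y by (rule WI) (simp_all add: Wc Wf that H.smult_r_distr hu)
 have Wneg: "-.\<^sub>HF x \<in> W" if "x \<in> W" for x by (rule WI) (simp_all add: Wc Wf that H.smult_r_minus hu)
 have W0: "\<zero>\<^sub>HF \<in> W" by (rule WI) (simp_all add: hu)
 have Wsm: "sq R g \<odot>\<^sub>HF x \<in> W" if g: "g \<in> nz R" and x: "x \<in> W" for g x
 proof (rule WI)
  fix u assume u: "u \<in> U1"
  then have un: "u \<in> nz R" by (simp add: higher_units_iff)
  have "sq R u \<odot>\<^sub>HF (sq R g \<odot>\<^sub>HF x) = sq R g \<odot>\<^sub>HF (sq R u \<odot>\<^sub>HF x)"
   using sq_smult_sq[OF half_RPb1_module] g un Wc[OF x] by (simp add: m_comm)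
  then show "sq R u \<odot>\<^sub>HF (sq R g \<odot>\<^sub>HF x) = sq R g \<odot>\<^sub>HF x" using Wf[OF x u] by simp
 qed (use g Wc[OF x] in simp)
 have A: "abelian_group (HF\<lparr>carrier := W\<rparr>)"
 proof (rule abelian_groupI)
  fix x assume "x \<in> carrier (HF\<lparr>carrier := W\<rparr>)"
  then have x: "x \<in> W" by simp
  then show "\<exists>y\<in>carrier (HF\<lparr>carrier := W\<rparr>). y +.\<^sub>(HF\<lparr>carrier := W\<rparr>) x = \<zero>\<^sub>(HF\<lparr>carrier := W\<rparr>)"
   using Wneg[OF x] H.M.l_neg[OF Wc[OF x]] by (intro bexI[of _ "-.\<^sub>HF x"]) simp_all
 qed (use Wadd W0 Wc in \<open>simp_all add: H.M.a_ac\<close>)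
 define rep where "rep c = (SOME u. u \<in> UU \<and> sq_class k (red R v u) = c)" for c
 have rep: "rep (sq_class k (red R v u)) \<in> UU \<and> sq_class k (red R v (rep (sq_class k (red R v u)))) = sq_class k (red R v u)"
  if "u \<in> UU" for u unfolding rep_def by (rule someI[of _ u]) (use that in simp)
 define act where "act c x = sq R (rep c) \<odot>\<^sub>HF x" for c x
 have act: "act (sq_class k (red R v u)) x = sq R u \<odot>\<^sub>HF x" if u: "u \<in> UU" and x: "x \<in> W" for u x
 proof -
  define w where "w = rep (sq_class k (red R v u))"
  have w: "w \<in> UU" "sq_class k (red R v w) = sq_class k (red R v u)" using rep[OF u] by (simp_all add: w_def)
  obtain s where s: "s \<in> nz k" "red R v w = red R v u *.\<^sub>k (s *.\<^sub>k s)"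
   using w(2) K.sq_class_eq_iff[OF red_nz[OF w(1)] red_nz[OF u]] by blast
  obtain t where t: "t \<in> UU" "s = red R v t" using red_nz_surj[OF s(1)] by blast
  \<comment> \<open>Two units lifting the same square class of the residue field differ by the
    square of a unit and an element of \<open>U1\<close>. Both act trivially on W, so the choice
    made by \<open>rep\<close> is immaterial.\<close>
  define a where "a = u *. (t *. t)"
  have a: "a \<in> UU" unfolding a_def using units_mult[OF u units_mult[OF t(1) t(1)]] .
  have ra: "red R v a = red R v w" unfolding a_def s(2) t(2) using red_mult[OF u units_mult[OF t(1) t(1)]] red_mult[OF t(1) t(1)] by simp
  define y where "y = w *. inv a"
  have y: "y \<in> UU" unfolding y_def by (rule units_mult[OF w(1) units_inv[OF a]])
  have "red R v y = red R v a *.\<^sub>k inv\<^bsub>k\<^esub> red R v a"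
   unfolding y_def using red_mult[OF w(1) units_inv[OF a]] red_inv[OF a] ra by simp
  then have y1: "y \<in> U1" using red_eq_one_iff[OF y] K.nz_r_inv[OF red_nz[OF a]] by simp
  have wa: "w = a *. y" unfolding y_def using quot_mult(2)[OF units_nz[OF w(1)] units_nz[OF a]] by simp
  have "sq R w \<odot>\<^sub>HF x = sq R a \<odot>\<^sub>HF (sq R y \<odot>\<^sub>HF x)"
   using sq_smult_sq[OF half_RPb1_module units_nz[OF a] units_nz[OF y] Wc[OF x]] wa by simp
  also have "\<dots> = sq R u \<odot>\<^sub>HF x" using Wf[OF x y1] sq_sq[OF units_nz[OF u] units_nz[OF t(1)]] by (simp add: a_def)
  finally show ?thesis by (simp add: act_def w_def)
 qed
 have cls: "\<exists>u\<in>UU. c = sq_class k (red R v u)" if "c \<in> carrier (sq_class_group k)" for c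
 proof -
  obtain d where d: "d \<in> nz k" "c = sq_class k d" using \<open>c \<in> carrier (sq_class_group k)\<close> unfolding K.sq_class_group_carrier by blast
  then show ?thesis using red_nz_surj[OF d(1)] by blast
 qed
 have am: "add_map (HF\<lparr>carrier := W\<rparr>) (HF\<lparr>carrier := W\<rparr>) (act c)" if c: "c \<in> carrier (sq_class_group k)" for c
 proof -
  obtain u where u: "u \<in> UU" "c = sq_class k (red R v u)" using cls[OF c] by blast
  have s: "sq R u \<in> carrier (RF R)" using units_nz[OF u(1)] by simp
  show ?thesis unfolding u(2)
   by (rule add_mapI) (use Wadd in \<open>simp_all add: act[OF u(1)] Wsm[OF units_nz[OF u(1)]] Wc H.smult_r_distr[OF s]\<close>)
 qed
 obtain sm where sm: "module (group_ring (sq_class_group k)) (mk_module (carrier (HF\<lparr>carrier := W\<rparr>)) (ring.add (HF\<lparr>carrier := W\<rparr>)) \<zero>\<^sub>(HF\<lparr>carrier := W\<rparr>) sm)"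
  "!!c x. c \<in> carrier (sq_class_group k) ==> x \<in> carrier (HF\<lparr>carrier := W\<rparr>) ==> sm (frag_of c) x = act c x"
 proof (rule group_action_module[OF K.sq_class_group_comm A am])
  fix x assume x: "x \<in> carrier (HF\<lparr>carrier := W\<rparr>)"
  have "\<one>\<^sub>(sq_class_group k) = sq_class k (red R v \<one>)" by (simp add: K.sq_class_group_one red_one)
  then show "act \<one>\<^sub>(sq_class_group k) x = x" using act[OF units_one, of x] x Wc sq_one_smult[OF half_RPb1_module, of x] by simp
 next
  fix c d x assume c: "c \<in> carrier (sq_class_group k)" and d: "d \<in> carrier (sq_class_group k)" and x: "x \<in> carrier (HF\<lparr>carrier := W\<rparr>)"
  obtain u where u: "u \<in> UU" "c = sq_class k (red R v u)" using cls[OF c] by blast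
  obtain w where w: "w \<in> UU" "d = sq_class k (red R v w)" using cls[OF d] by blast
  have xW: "x \<in> W" using x by simp
  have "c *.\<^sub>(sq_class_group k) d = sq_class k (red R v (u *. w))"
   unfolding u(2) w(2) using K.sq_class_group_mult[OF red_nz[OF u(1)] red_nz[OF w(1)]] red_mult[OF u(1) w(1)] by simp
  then have "act (c *.\<^sub>(sq_class_group k) d) x = sq R (u *. w) \<odot>\<^sub>HF x" using act[OF units_mult[OF u(1) w(1)] xW] by simp
  also have "\<dots> = sq R u \<odot>\<^sub>HF (sq R w \<odot>\<^sub>HF x)"
   using sq_smult_sq[OF half_RPb1_module units_nz[OF u(1)] units_nz[OF w(1)] Wc[OF xW]] by simp
  also have "\<dots> = act c (act d x)" using act[OF w(1) xW] act[OF u(1) Wsm[OF units_nz[OF w(1)] xW]] u(2) w(2) by simp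
  finally show "act (c *.\<^sub>(sq_class_group k) d) x = act c (act d x)" .
 qed (assumption | rule that | blast)+
 show thesis
 proof (rule that[of sm])
  show "module (RF k) (mk_module W (ring.add HF) \<zero>\<^sub>HF sm)" using sm(1) by (simp add: RF_def)
  fix u x assume u: "u \<in> UU" and x: "x \<in> W"
  have "sq_class k (red R v u) \<in> carrier (sq_class_group k)" using red_nz[OF u] unfolding K.sq_class_group_carrier by blast
  then show "sm (sq k (red R v u)) x = sq R u \<odot>\<^sub>HF x" using sm(2)[of "sq_class k (red R v u)" x] act[OF u x] x by (simp add: sq_def)
 qed
qed

text \<open>The elements \<open><<g>> eps [a]\<close> are fixed by \<open>U1\<close>, so they lie in
  a module over the square classes of the residue field. The universal property of
  \<open>RPb\<close> over the residue field, applied to that module, produces \<tau>.\<close>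

lemma cospecialization:
 assumes g: "g \<in> nz R"
 obtains \<tau> where "add_map (RPb k) HF \<tau>"
  and "!!u m. u \<in> UU ==> m \<in> carrier (RPb k) ==> \<tau> (sq k (red R v u) \<odot>\<^sub>(RPb k) m) = sq R u \<odot>\<^sub>HF \<tau> m"
  and "!!a. a \<in> UU ==> \<tau> (symb k (red R v a)) = dsq R g \<odot>\<^sub>HF eps (symb R a)"
proof -
 let ?W = "{x \<in> carrier HF. \<forall>u\<in>U1. sq R u \<odot>\<^sub>HF x = x}"
 interpret H: module "RF R" HF by (rule half_RPb1_module)
 obtain sm where sm: "module (RF k) (mk_module ?W (ring.add HF) \<zero>\<^sub>HF sm)"
  "!!u x. u \<in> UU ==> x \<in> ?W ==> sm (sq k (red R v u)) x = sq R u \<odot>\<^sub>HF x" by (rule residue_module) (rule that)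
 define Q where "Q = mk_module ?W (ring.add HF) \<zero>\<^sub>HF sm"
 have Q: "module (RF k) Q" using sm(1) by (simp add: Q_def)
 then interpret Q: module "RF k" Q .
 have Qs: "carrier Q = ?W" "ring.add Q = ring.add HF" "\<zero>\<^sub>Q = \<zero>\<^sub>HF" by (simp_all add: Q_def)
 have Qsq: "sq k (red R v u) \<odot>\<^sub>Q x = sq R u \<odot>\<^sub>HF x" if "u \<in> UU" "x \<in> carrier Q" for u x
  using sm(2)[OF that(1)] that(2) by (simp add: Q_def)
 have Qc: "x \<in> carrier Q ==> x \<in> carrier HF" for x by (simp add: Qs)
 have incl: "add_map Q HF (\<lambda>x. x)" by (rule add_mapI) (simp_all add: Qc Qs(2))
 have Qm: "x -.\<^sub>Q y = x -.\<^sub>HF y" if "x \<in> carrier Q" "y \<in> carrier Q" for x y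
  by (rule add_map_minus[OF Q.abelian_group_axioms H.abelian_group_axioms incl that])
 define f where "f m = dsq R g \<odot>\<^sub>HF eps m" for m
 have gc: "dsq R g \<in> carrier (RF R)" using g by simp
 have fa: "add_map (RPb R) HF f" unfolding f_def[abs_def] by (rule add_map_comp[OF eps_add_map add_map_smult[OF half_RPb1_module gc]])
 have fs: "f (r \<odot>\<^sub>(RPb R) m) = r \<odot>\<^sub>HF f m" if "r \<in> carrier (RF R)" "m \<in> carrier (RPb R)" for r m
  using that gc by (simp add: f_def eps_smult H.smult_assoc1[symmetric] H.R.m_comm)
 have fh: "restrict f (carrier (RPb R)) \<in> mod_hom (RF R) (RPb R) HF" by (rule mod_hom_restrictI[OF RPb_module fa fs])
 have fc: "f (symb R a) \<in> carrier Q" if a: "a \<in> nz R" for a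
 proof -
  have c: "f (symb R a) \<in> carrier HF" using add_map_closed[OF fa] a by simp
  have "sq R u \<odot>\<^sub>HF f (symb R a) = f (symb R a)" if u: "u \<in> U1" for u
  proof -
   have un: "u \<in> nz R" using u by (simp add: higher_units_iff)
   have "sq R u \<odot>\<^sub>HF f (symb R a) -.\<^sub>HF f (symb R a) = \<zero>\<^sub>HF"
    using eps_symb_facts(1)[OF g a u] dsq_smult[OF half_RPb1_module un c] by (simp add: f_def)
   then show ?thesis by (rule abelian_minus_eq_zero[OF H.abelian_group_axioms H.smult_closed[OF sq_closed[OF un] c] c])
  qed
  then show ?thesis using c by (simp add: Qs)
 qed
 define lift where "lift c = (SOME a. a \<in> UU \<and> red R v a = c)" for c
 define m where "m c = f (symb R (lift c))" for c
 have lift: "lift c \<in> UU" "red R v (lift c) = c" if "c \<in> nz k" for c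
 proof -
  have "\<exists>a. a \<in> UU \<and> red R v a = c" using red_nz_surj[OF that] by blast
  from someI_ex[OF this] show "lift c \<in> UU" "red R v (lift c) = c" by (simp_all add: lift_def)
 qed
 \<comment> \<open>Two units with the same residue differ by an element of \<open>U1\<close>, so the
   choice made by \<open>lift\<close> does not matter.\<close>
 have m_red: "m (red R v a) = f (symb R a)" if a: "a \<in> UU" for a
 proof -
  define b where "b = lift (red R v a)"
  have b: "b \<in> UU" "red R v b = red R v a" using lift[OF red_nz[OF a]] by (simp_all add: b_def)
  define u where "u = b *. inv a"
  have u: "u \<in> UU" unfolding u_def by (rule units_mult[OF b(1) units_inv[OF a]])
  have "red R v u = red R v a *.\<^sub>k inv\<^bsub>k\<^esub> red R v a"
   unfolding u_def using red_mult[OF b(1) units_inv[OF a]] red_inv[OF a] b by simp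
  then have u1: "u \<in> U1" using red_eq_one_iff[OF u] K.nz_r_inv[OF red_nz[OF a]] by simp
  have "b = a *. u" unfolding u_def using quot_mult(2)[OF units_nz[OF b(1)] units_nz[OF a]] by simp
  then show ?thesis using eps_symb_facts(3)[OF g a u1] by (simp add: m_def f_def b_def[symmetric])
 qed
 have mc: "m c \<in> carrier Q" if "c \<in> nz k" for c using fc[OF units_nz[OF lift(1)[OF that]]] by (simp add: m_def)
 have f0: "f \<zero>\<^sub>(RPb R) = \<zero>\<^sub>HF" by (rule add_map_zero[OF module_abelian_group[OF RPb_module] H.abelian_group_axioms fa])
 have m1: "m \<one>\<^sub>k = \<zero>\<^sub>Q" using m_red[OF units_one] by (simp add: red_one symb_one f0 Qs)
 interpret RM: module "RF R" "RPb R" by (rule RPb_module)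
 have s1: "sq R (-. \<one>) \<in> carrier (RF R)" using m_one_nz by simp
 have neg: "sq k (-.\<^sub>k \<one>\<^sub>k) \<odot>\<^sub>Q x = sq R (-. \<one>) \<odot>\<^sub>HF x" if "x \<in> carrier Q" for x
  using Qsq[OF units_neg[OF units_one] that] by (simp add: red_minus_one)
 have Kr: "m c +.\<^sub>Q sq k (-.\<^sub>k \<one>\<^sub>k) \<odot>\<^sub>Q m (inv\<^bsub>k\<^esub> c) = \<zero>\<^sub>Q" if c: "c \<in> nz k" for c
 proof -
  obtain a where a: "a \<in> UU" "c = red R v a" using red_nz_surj[OF c] by blast
  have ia: "inv a \<in> nz R" using units_nz[OF a(1)] by simp
  have "f (symb R a +.\<^sub>(RPb R) sq R (-. \<one>) \<odot>\<^sub>(RPb R) symb R (inv a)) = \<zero>\<^sub>HF"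
   using symb_rel(1)[OF units_nz[OF a(1)]] f0 by simp
  then have "f (symb R a) +.\<^sub>HF sq R (-. \<one>) \<odot>\<^sub>HF f (symb R (inv a)) = \<zero>\<^sub>HF"
   using units_nz[OF a(1)] ia s1 by (simp add: add_map_add[OF fa] fs)
  then show ?thesis using m_red[OF a(1)] m_red[OF units_inv[OF a(1)]] red_inv[OF a(1)] a(2) neg[OF fc[OF ia]] by (simp add: Qs(2,3))
 qed
 have Er: "m c +.\<^sub>Q sq k (-.\<^sub>k \<one>\<^sub>k) \<odot>\<^sub>Q m (\<one>\<^sub>k -.\<^sub>k c) = \<zero>\<^sub>Q" if c: "c \<in> nz k" "c ~= \<one>\<^sub>k" for c
 proof -
  obtain a where a: "a \<in> UU" "c = red R v a" using red_nz_surj[OF c(1)] by blast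
  have na: "a \<notin> U1" using red_eq_one_iff[OF a(1)] a(2) c(2) by simp
  have A: "a ~= \<one>" "\<one> -. a \<in> UU"
   using not_higher_one[OF units_nz[OF a(1)] units_v[OF a(1)]] na units_nz[OF a(1)] by (auto simp: units_iff)
  have nA: "\<one> -. a \<in> nz R" by (rule units_nz[OF A(2)])
  have rA: "red R v (\<one> -. a) = \<one>\<^sub>k -.\<^sub>k c" using red_compl[OF units_ge[OF a(1)]] a(2) by simp
  have "f (symb R a +.\<^sub>(RPb R) sq R (-. \<one>) \<odot>\<^sub>(RPb R) symb R (\<one> -. a)) = \<zero>\<^sub>HF"
   using symb_rel(2)[OF units_nz[OF a(1)] A(1)] f0 by simp
  then have "f (symb R a) +.\<^sub>HF sq R (-. \<one>) \<odot>\<^sub>HF f (symb R (\<one> -. a)) = \<zero>\<^sub>HF"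
   using units_nz[OF a(1)] nA s1 by (simp add: add_map_add[OF fa] fs)
  then show ?thesis using m_red[OF a(1)] m_red[OF A(2)] rA a(2) neg[OF fc[OF nA]] by (simp add: Qs(2,3))
 qed
 have five: "K.five_rel Q m" unfolding K.five_rel_def
 proof (intro ballI impI)
  fix x' p' q' assume c: "x' \<in> nz k" "p' \<in> nz k" "q' \<in> nz k" "x' ~= \<one>\<^sub>k" "x' *.\<^sub>k p' ~= \<one>\<^sub>k"
   and rel: "\<one>\<^sub>k -.\<^sub>k x' = q' *.\<^sub>k (\<one>\<^sub>k -.\<^sub>k x' *.\<^sub>k p')"
  obtain x where x: "x \<in> UU" "x' = red R v x" using red_nz_surj[OF c(1)] by blast
  obtain p where p: "p \<in> UU" "p' = red R v p" using red_nz_surj[OF c(2)] by blast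
  have xp: "x *. p \<in> UU" "red R v (x *. p) = x' *.\<^sub>k p'" using units_mult[OF x(1) p(1)] red_mult[OF x(1) p(1)] x(2) p(2) by auto
  have nx: "x \<notin> U1" "x *. p \<notin> U1" using red_eq_one_iff[OF x(1)] red_eq_one_iff[OF xp(1)] xp(2) x(2) c(4,5) by auto
  have A: "x ~= \<one>" "\<one> -. x \<in> UU"
   using not_higher_one[OF units_nz[OF x(1)] units_v[OF x(1)]] nx(1) units_nz[OF x(1)] by (auto simp: units_iff)
  have B: "x *. p ~= \<one>" "\<one> -. x *. p \<in> UU"
   using not_higher_one[OF units_nz[OF xp(1)] units_v[OF xp(1)]] nx(2) units_nz[OF xp(1)] by (auto simp: units_iff)
  have rA: "red R v (\<one> -. x) = \<one>\<^sub>k -.\<^sub>k x'" using red_compl[OF units_ge[OF x(1)]] x(2) by simp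
  have rB: "red R v (\<one> -. x *. p) = \<one>\<^sub>k -.\<^sub>k x' *.\<^sub>k p'" using red_compl[OF units_ge[OF xp(1)]] xp(2) by simp
  \<comment> \<open>Computed from the lifts x and p instead of being lifted from q', so that the
    relation holds exactly over F; the reduction of q is still q'.\<close>
  define q where "q = (\<one> -. x) *. inv (\<one> -. x *. p)"
  have q: "q \<in> UU" unfolding q_def by (rule units_mult[OF A(2) units_inv[OF B(2)]])
  have qB: "\<one> -. x = q *. (\<one> -. x *. p)" unfolding q_def using quot_mult(1)[OF units_nz[OF A(2)] units_nz[OF B(2)]] by simp
  have "red R v q = q'"
  proof -
   have "red R v q = (\<one>\<^sub>k -.\<^sub>k x') *.\<^sub>k inv\<^bsub>k\<^esub> (\<one>\<^sub>k -.\<^sub>k x' *.\<^sub>k p')"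
    unfolding q_def using red_mult[OF A(2) units_inv[OF B(2)]] red_inv[OF B(2)] rA rB by simp
   also have "\<dots> = q' *.\<^sub>k ((\<one>\<^sub>k -.\<^sub>k x' *.\<^sub>k p') *.\<^sub>k inv\<^bsub>k\<^esub> (\<one>\<^sub>k -.\<^sub>k x' *.\<^sub>k p'))"
    unfolding rel using c(1-3,5) by (intro K.m_assoc) simp_all
   also have "\<dots> = q'" using K.nz_r_inv[of "\<one>\<^sub>k -.\<^sub>k x' *.\<^sub>k p'"] c by simp
   finally show ?thesis .
  qed
  then have rq: "q' = red R v q" by simp
  have pq: "p *. q \<in> UU" "red R v (p *. q) = p' *.\<^sub>k q'" using units_mult[OF p(1) q] red_mult[OF p(1) q] p(2) rq by auto
  have xA: "x *. (\<one> -. x) \<in> UU" "red R v (x *. (\<one> -. x)) = x' *.\<^sub>k (\<one>\<^sub>k -.\<^sub>k x')"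
   using units_mult[OF x(1) A(2)] red_mult[OF x(1) A(2)] x(2) rA by auto
  have mm: "m x' = f (symb R x)" "m (x' *.\<^sub>k p') = f (symb R (x *. p))" "m p' = f (symb R p)" "m (p' *.\<^sub>k q') = f (symb R (p *. q))"
   "m q' = f (symb R q)" using m_red[OF x(1)] m_red[OF xp(1)] m_red[OF p(1)] m_red[OF pq(1)] m_red[OF q] x(2) xp(2) p(2) pq(2) rq by simp_all
  have cl: "f (symb R x) \<in> carrier Q" "f (symb R (x *. p)) \<in> carrier Q" "f (symb R p) \<in> carrier Q" "f (symb R (p *. q)) \<in> carrier Q" "f (symb R q) \<in> carrier Q"
   using fc units_nz x(1) xp(1) p(1) pq(1) q by blast+
  have sc: "sq k x' \<odot>\<^sub>Q f (symb R p) = sq R x \<odot>\<^sub>HF f (symb R p)"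
   "sq k (x' *.\<^sub>k (\<one>\<^sub>k -.\<^sub>k x')) \<odot>\<^sub>Q f (symb R (p *. q)) = sq R (x *. (\<one> -. x)) \<odot>\<^sub>HF f (symb R (p *. q))"
   "sq k (\<one>\<^sub>k -.\<^sub>k x') \<odot>\<^sub>Q f (symb R q) = sq R (\<one> -. x) \<odot>\<^sub>HF f (symb R q)"
   using Qsq[OF x(1) cl(3)] Qsq[OF xA(1) cl(4)] Qsq[OF A(2) cl(5)] x(2) xA(2) rA by simp_all
  have "five_rel HF (\<lambda>x. restrict f (carrier (RPb R)) (symb R x))"
   by (rule five_rel_hom[OF RPb_module half_RPb1_module fh symb_closed five_rel_RPb])
  then have "five_rel HF (\<lambda>x. f (symb R x))" by (simp add: five_rel_def)
  then have E: "f (symb R x) -.\<^sub>HF f (symb R (x *. p)) +.\<^sub>HF sq R x \<odot>\<^sub>HF f (symb R p)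
    -.\<^sub>HF sq R (x *. (\<one> -. x)) \<odot>\<^sub>HF f (symb R (p *. q)) +.\<^sub>HF sq R (\<one> -. x) \<odot>\<^sub>HF f (symb R q) = \<zero>\<^sub>HF"
   unfolding five_rel_def using units_nz[OF x(1)] units_nz[OF p(1)] units_nz[OF q] A(1) B(1) qB by blast
  have kc: "sq k x' \<in> carrier (RF k)" "sq k (x' *.\<^sub>k (\<one>\<^sub>k -.\<^sub>k x')) \<in> carrier (RF k)" using c by simp_all
  have m12: "f (symb R x) -.\<^sub>Q f (symb R (x *. p)) = f (symb R x) -.\<^sub>HF f (symb R (x *. p))" by (rule Qm[OF cl(1,2)])
  have c123: "f (symb R x) -.\<^sub>Q f (symb R (x *. p)) +.\<^sub>Q sq k x' \<odot>\<^sub>Q f (symb R p) \<in> carrier Q" using cl kc by simp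
  note m4 = Qm[OF c123 Q.smult_closed[OF kc(2) cl(4)]]
  show "m x' -.\<^sub>Q m (x' *.\<^sub>k p') +.\<^sub>Q sq k x' \<odot>\<^sub>Q m p'
    -.\<^sub>Q sq k (x' *.\<^sub>k (\<one>\<^sub>k -.\<^sub>k x')) \<odot>\<^sub>Q m (p' *.\<^sub>k q') +.\<^sub>Q sq k (\<one>\<^sub>k -.\<^sub>k x') \<odot>\<^sub>Q m q' = \<zero>\<^sub>Q"
   unfolding mm unfolding m4 unfolding m12 sc Qs(2,3) by (rule E)
 qed
 obtain \<tau> where \<tau>: "\<tau> \<in> mod_hom (RF k) (RPb k) Q" "!!c. c \<in> nz k ==> \<tau> (symb k c) = m c"
  by (rule K.RPb_lift[OF Q mc m1 five Kr Er]) (assumption+, rule that, assumption, blast)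
 show thesis
 proof (rule that[of \<tau>])
  show "add_map (RPb k) HF \<tau>" by (rule add_map_comp[OF mod_hom_add_map[OF \<tau>(1)] incl])
  show "\<tau> (sq k (red R v u) \<odot>\<^sub>(RPb k) y) = sq R u \<odot>\<^sub>HF \<tau> y" if "u \<in> UU" "y \<in> carrier (RPb k)" for u y
   using mod_hom_smult[OF \<tau>(1) K.sq_closed[OF red_nz[OF that(1)]] that(2)] Qsq[OF that(1) mod_hom_closed[OF \<tau>(1) that(2)]] by simp
  show "\<tau> (symb k (red R v a)) = dsq R g \<odot>\<^sub>HF eps (symb R a)" if "a \<in> UU" for a
   using \<tau>(2)[OF red_nz[OF that]] m_red[OF that] by (simp add: f_def)
 qed
qed

lemma half_tensor_ind_plus_incl: "w \<in> carrier IM1 ==> half_tensor IM1 (ind_plus (ind_incl w)) 1 = dbl HI (half_tensor IM1 w 1)"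
 using half_tensor_plus_part[OF IM1_module _ IM1_minus_one Z_half_one, of w] half_tensor_add_right[OF IM1_module _ Z_half_one Z_half_one, of w]
 by (simp add: ind_plus_incl dbl_def)

lemma dbl_S1: "x \<in> carrier (RPb1 R) ==> dbl HI (S1_map R v (half_tensor (RPb1 R) x 1)) = half_tensor IM1 (ind_plus (S_map R v x)) 1"
 using S1_map_spec(2)[of x] half_tensor_add_right[OF IM1_module _ Z_half_half Z_half_half, of "ind_plus (S_map R v x)"]
  mod_hom_closed[OF ind_plus_spec(1) mod_hom_closed[OF S_map_spec(1) RPb1_carrier_subset, of x]] by (simp add: dbl_def)

text \<open>The doubling contained in \<open>eps\<close> cancels the factor 1/2 of
  \<open>S1_map_spec\<close>.\<close>

lemma S1_eps: "m \<in> carrier (RPb R) ==> S1_map R v (eps m) = half_tensor IM1 (ind_plus (S_map R v m)) 1"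
proof -
 assume m: "m \<in> carrier (RPb R)"
 have p: "plus_part (RPb R) m \<in> carrier (RPb1 R)" by (rule add_map_closed[OF plus_part_RPb1_add_map m])
 have Sm: "S_map R v m \<in> carrier IM" by (rule mod_hom_closed[OF S_map_spec(1) m])
 have im: "ind_plus (S_map R v m) \<in> carrier IM1" by (rule mod_hom_closed[OF ind_plus_spec(1) Sm])
 have "S1_map R v (eps m) = half_tensor IM1 (plus_part IM1 (ind_plus (S_map R v m))) (1 / 2)"
  using S1_map_spec(2)[OF p] plus_part_hom[OF S_map_spec(1) RPb_module m] plus_part_hom[OF ind_plus_spec(1) spec_module Sm] by (simp add: eps_def)
 also have "\<dots> = half_tensor IM1 (ind_plus (S_map R v m)) 1"
  using half_tensor_plus_part[OF IM1_module im IM1_minus_one[OF im] Z_half_half] by simp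
 finally show ?thesis .
qed

theorem S1_inverse_up_to:
 assumes g: "g \<in> nz R"
 shows "\<exists>T\<in>mod_hom (RF R) HI HF. (\<forall>z\<in>carrier HF. T (S1_map R v z) = dbl HF (dsq R g \<odot>\<^sub>HF z)) \<and>
  (\<forall>y\<in>carrier HI. S1_map R v (T y) = dbl HI (dsq R g \<odot>\<^sub>HI y))"
proof -
 let ?G = "S1_map R v" and ?S = "S_map R v"
 note G = S1_map_spec(1) and S = S_map_spec(1)
 interpret H: module "RF R" HF by (rule half_RPb1_module)
 interpret I: module "RF R" HI by (rule HI_module)
 have gc: "dsq R g \<in> carrier (RF R)" using g by simp
 obtain \<tau> where \<tau>: "add_map (RPb k) HF \<tau>"
  "!!u m. u \<in> UU ==> m \<in> carrier (RPb k) ==> \<tau> (sq k (red R v u) \<odot>\<^sub>(RPb k) m) = sq R u \<odot>\<^sub>HF \<tau> m"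
  "!!a. a \<in> UU ==> \<tau> (symb k (red R v a)) = dsq R g \<odot>\<^sub>HF eps (symb R a)"
  by (rule cospecialization[OF g]) (rule that, assumption, blast, blast)
 obtain \<Theta> where \<Theta>: "\<Theta> \<in> mod_hom (RF R) IM HF" "!!m. m \<in> carrier (RPb k) ==> \<Theta> (ind_one (RPb k) m) = \<tau> m"
  by (rule ind_lift[OF K.RPb_module half_RPb1_module \<tau>(1,2)]) (assumption+, rule that, assumption, blast)
 have fh: "restrict (\<lambda>m. dsq R g \<odot>\<^sub>HF eps m) (carrier (RPb R)) \<in> mod_hom (RF R) (RPb R) HF"
 proof (rule mod_hom_restrictI[OF RPb_module add_map_comp[OF eps_add_map add_map_smult[OF half_RPb1_module gc]]])
  show "dsq R g \<odot>\<^sub>HF eps (r \<odot>\<^sub>(RPb R) m) = r \<odot>\<^sub>HF (dsq R g \<odot>\<^sub>HF eps m)" if "r \<in> carrier (RF R)" "m \<in> carrier (RPb R)" for r m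
   using that gc by (simp add: eps_smult H.smult_assoc1[symmetric] H.R.m_comm)
 qed
 \<comment> \<open>Both sides are linear in m, so symbols suffice: for units they agree by the
   choice of \<tau>, and otherwise both are zero.\<close>
 have \<Theta>S: "\<Theta> (?S m) = dsq R g \<odot>\<^sub>HF eps m" if m: "m \<in> carrier (RPb R)" for m
 proof -
  have "restrict (\<lambda>m. \<Theta> (?S m)) (carrier (RPb R)) = restrict (\<lambda>m. dsq R g \<odot>\<^sub>HF eps m) (carrier (RPb R))"
  proof (rule RPb_hom_eq[OF half_RPb1_module mod_hom_comp[OF RPb_module S \<Theta>(1)] fh])
   fix a assume a: "a \<in> nz R"
   have "\<Theta> (?S (symb R a)) = dsq R g \<odot>\<^sub>HF eps (symb R a)"
   proof (cases "v a = 0")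
    case True
    then have u: "a \<in> UU" using a units_iff by blast
    then show ?thesis using S_map_spec(2)[OF a] spec_symb_unit[OF u] \<Theta>(2)[OF K.symb_closed[OF red_nz[OF u]]] \<tau>(3)[OF u] by simp
   next
    case False
    then show ?thesis
     using S_map_spec(2)[OF a] mod_hom_zero[OF spec_module half_RPb1_module \<Theta>(1)] eps_symb_facts(2)[OF g a] by (simp add: spec_symb_def)
   qed
   then show "restrict (\<lambda>m. \<Theta> (?S m)) (carrier (RPb R)) (symb R a) = restrict (\<lambda>m. dsq R g \<odot>\<^sub>HF eps m) (carrier (RPb R)) (symb R a)"
    using a by simp
  qed
  from fun_cong[OF this, of m] m show ?thesis by simp
 qed
 \<comment> \<open>By surjectivity of \<open>S_map\<close> the element w is the image of some m, and
   then \<open>S1_eps\<close> computes the left side.\<close>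
 have G\<Theta>: "?G (\<Theta> w) = dsq R g \<odot>\<^sub>HI half_tensor IM1 (ind_plus w) 1" if w: "w \<in> carrier IM" for w
 proof -
  obtain m where m: "m \<in> carrier (RPb R)" "w = ?S m" using w S_map_surj by blast
  then show ?thesis using \<Theta>S[OF m(1)] mod_hom_smult[OF G gc eps_closed[OF m(1)]] S1_eps[OF m(1)] by simp
 qed
 have \<theta>: "add_map IM1 HF (\<lambda>w. \<Theta> (ind_incl w))"
  by (rule add_map_comp[OF mod_hom_add_map[OF ind_incl_spec(1)] mod_hom_add_map[OF \<Theta>(1)]])
 have lin: "\<Theta> (ind_incl (r \<odot>\<^sub>IM1 w)) = r \<odot>\<^sub>HF \<Theta> (ind_incl w)" if "r \<in> carrier (RF R)" "w \<in> carrier IM1" for r w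
  using that mod_hom_closed[OF ind_incl_spec(1)] by (simp add: mod_hom_smult[OF ind_incl_spec(1)] mod_hom_smult[OF \<Theta>(1)])
 obtain T where T: "T \<in> mod_hom (RF R) HI HF" "!!w. w \<in> carrier IM1 ==> T (half_tensor IM1 w 1) = \<Theta> (ind_incl w)"
  by (rule half_extend[OF IM1_module RPb1_module \<theta> lin]) (assumption+, rule that, assumption, blast)
 have dw: "restrict (\<lambda>z. dbl M (dsq R g \<odot>\<^sub>M z)) (carrier M) \<in> mod_hom (RF R) M M" if M: "module (RF R) M"
  for M :: "('a sqr, 'z) module"
 proof -
  interpret M: module "RF R" M by fact
  show ?thesis using gc by (intro mod_hom_restrictI[OF M] add_mapI)
    (simp_all add: dbl_def M.smult_r_distr M.M.a_ac M.smult_assoc1[symmetric] H.R.m_comm)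
 qed
 have TG: "T (?G z) = dbl HF (dsq R g \<odot>\<^sub>HF z)" if z: "z \<in> carrier HF" for z
 proof -
  have "restrict (\<lambda>z. T (?G z)) (carrier HF) = restrict (\<lambda>z. dbl HF (dsq R g \<odot>\<^sub>HF z)) (carrier HF)"
  proof (rule half_mod_hom_eq1[OF RPb1_module RPb1_module mod_hom_comp[OF half_RPb1_module G T(1)] dw[OF half_RPb1_module]])
   fix x assume x: "x \<in> carrier (RPb1 R)"
   let ?x = "half_tensor (RPb1 R) x 1"
   have xc: "?x \<in> carrier HF" by (rule half_tensor_closed[OF RPb1_module x Z_half_one])
   have xM: "x \<in> carrier (RPb R)" by (rule RPb1_carrier_subset[OF x])
   have Sx: "?S x \<in> carrier IM" by (rule mod_hom_closed[OF S xM])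
   have ipx: "ind_plus (?S x) \<in> carrier IM1" by (rule mod_hom_closed[OF ind_plus_spec(1) Sx])
   have Gx: "?G ?x \<in> carrier HI" by (rule mod_hom_closed[OF G xc])
   \<comment> \<open>After doubling, \<open>dbl_S1\<close> removes the factor 1/2, and 1 + <-1> can
     be pulled through \<open>S_map\<close>. The value of \<open>eps\<close> at (1 + <-1>)x is four
     times x (x) 1; cancelling one factor 2 leaves the claim.\<close>
   have d: "dbl HF (T (?G ?x)) = T (dbl HI (?G ?x))" using mod_hom_add[OF T(1) Gx Gx] by (simp add: dbl_def)
   also have "\<dots> = \<Theta> (plus_part IM (?S x))" using dbl_S1[OF x] T(2)[OF ipx] ind_incl_plus[OF Sx] by simp
   also have "\<dots> = \<Theta> (?S (plus_part (RPb R) x))" using plus_part_hom[OF S RPb_module xM] by simp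
   also have "\<dots> = dsq R g \<odot>\<^sub>HF eps (plus_part (RPb R) x)" by (rule \<Theta>S[OF plus_part_closed[OF RPb_module xM]])
   also have "\<dots> = dsq R g \<odot>\<^sub>HF dbl HF (dbl HF ?x)" using eps_plus_part[OF xM] eps_RPb1[OF x] by simp
   also have "\<dots> = dbl HF (dbl HF (dsq R g \<odot>\<^sub>HF ?x))" using gc xc by (simp add: dbl_def H.smult_r_distr)
   finally have "dbl HF (T (?G ?x)) = dbl HF (dbl HF (dsq R g \<odot>\<^sub>HF ?x))" .
   then have "T (?G ?x) = dbl HF (dsq R g \<odot>\<^sub>HF ?x)"
    by (rule half_dbl_inj[OF RPb1_module mod_hom_closed[OF T(1) Gx], rotated]) (use gc xc in \<open>simp add: dbl_def\<close>)
   then show "restrict (\<lambda>z. T (?G z)) (carrier HF) ?x = restrict (\<lambda>z. dbl HF (dsq R g \<odot>\<^sub>HF z)) (carrier HF) ?x"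
    using xc by simp
  qed
  from fun_cong[OF this, of z] z show ?thesis by simp
 qed
 have GT: "?G (T y) = dbl HI (dsq R g \<odot>\<^sub>HI y)" if y: "y \<in> carrier HI" for y
 proof -
  have "restrict (\<lambda>y. ?G (T y)) (carrier HI) = restrict (\<lambda>z. dbl HI (dsq R g \<odot>\<^sub>HI z)) (carrier HI)"
  proof (rule half_mod_hom_eq1[OF IM1_module IM1_module mod_hom_comp[OF HI_module T(1) G] dw[OF HI_module]])
   fix w assume w: "w \<in> carrier IM1"
   let ?w = "half_tensor IM1 w 1"
   have wc: "?w \<in> carrier HI" by (rule half_tensor_closed[OF IM1_module w Z_half_one])
   have "?G (T ?w) = dsq R g \<odot>\<^sub>HI dbl HI ?w"
    using T(2)[OF w] G\<Theta>[OF mod_hom_closed[OF ind_incl_spec(1) w]] half_tensor_ind_plus_incl[OF w] by simp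
   also have "\<dots> = dbl HI (dsq R g \<odot>\<^sub>HI ?w)" using gc wc by (simp add: dbl_def I.smult_r_distr)
   finally show "restrict (\<lambda>y. ?G (T y)) (carrier HI) ?w = restrict (\<lambda>z. dbl HI (dsq R g \<odot>\<^sub>HI z)) (carrier HI) ?w"
    using wc by simp
  qed
  from fun_cong[OF this, of y] y show ?thesis by simp
 qed
 show ?thesis by (intro bexI[OF _ T(1)]) (use TG GT in blast)
qed

lemma S1_ideal_iso:
 "restrict (S1_map R v) (carrier (ideal_smult (RF R) (IF R) HF))
  \<in> mod_iso (RF R) (ideal_smult (RF R) (IF R) HF) (ideal_smult (RF R) (IF R) HI)"
 by (rule ideal_span_iso[OF RPb1_module IM1_module S1_map_spec(1) S1_inverse_up_to])

end

theorem theorem6p1: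
  fixes F :: "('a, 'm) ring_scheme" and v :: "'a \<Rightarrow> int"
  assumes "field F"
    and "discrete_valuation F v"
    and "\<exists>n\<ge>1. higher_units F v n \<subseteq> {u \<otimes>\<^bsub>F\<^esub> u | u. u \<in> higher_units F v 1}"
  shows "restrict (S1_map F v) (carrier (ideal_smult (RF F) (IF F) (half (RPb1 F))))
    \<in> mod_iso (RF F)
        (ideal_smult (RF F) (IF F) (half (RPb1 F)))
        (ideal_smult (RF F) (IF F) (half (Ind F v (RPb1 (residue_field F v)))))"
proof -
  interpret field F by fact
  obtain n where n: "n \<ge> 1" "higher_units F v n \<subseteq> {u \<otimes>\<^bsub>F\<^esub> u | u. u \<in> higher_units F v 1}"
    using assms(3) by blast
  interpret tame_valued_field F v n
    by unfold_locales (use assms(2) n in auto)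
  show ?thesis by (rule S1_ideal_iso)
qed

end
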